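(* Let $d\ge1$, $n\ge 1$, $\ell\ge 2$, let $\Lambda=A^{(d+1)}_{n,\ell-1}$, and let $\Phi:\Lambda\to\Lambda$ be the algebra automorphism induced by $(x_1,\dots,x_{d+1})\mapsto(x_{d+1}-\ell-d+1,x_1,\dots,x_d)$. Then $\Lambda$ is twisted $(d+2)$-periodic, that is, $\Omega_\Lambda^{d+2}\cong(-)_\Phi$ as functors on $\underline{\mathrm{mod}}\,\Lambda$.
   Context: $k$ is an arbitrary field; modules are finite dimensional right modules; $\underline{\mathrm{mod}}\,\Lambda$ is the projectively stable module category and $\Omega_\Lambda$ the syzygy functor on it (kernel of a projective cover). The self-injective $(d+1)$-Nakayama algebra $\Lambda=A^{(d+1)}_{n,\ell-1}$ is given as follows. Put $os=\{x=(x_1,\dots,x_{d+1})\in\mathbb Z^{d+1}\mid x_1<\dots<x_{d+1},\ x_{d+1}-x_1+1\le (\ell-1)+d\}$. Let $Q$ be the quiver with vertex set $os$ and an arrow $a_i(x):x\to x+e_i$ ($1\le i\le d+1$, $e_i$ the standard basis vector) whenever $x+e_i\in os$. Let $\mathcal A$ be the path category $kQ$ modulo the ideal generated by all $a_i(x+e_j)a_j(x)-a_j(x+e_i)a_i(x)$, with the convention $a_i(x)=0$ if $x$ or $x+e_i$ is not in $os$. The infinite cyclic group $G$ generated by the translation $x\mapsto x-n(1,\dots,1)$ acts on $\mathcal A$, and $\Lambda=\mathcal A/G$ is the orbit category, viewed as a finite dimensional algebra. Its Gabriel quiver $Q_\Lambda$ is $Q/G$; vertices are written as representatives $x\in os$.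 Put $f(i)=i-\ell-d+1$ for $i\in\mathbb Z$. The automorphism $\Phi$ of $Q_\Lambda$ is given on vertices by $\Phi(x_1,\dots,x_{d+1})=(f(x_{d+1}),x_1,\dots,x_d)$ and on arrows by $\Phi(a_i(x):x\to x+e_i)=(a_{i+1}(\Phi(x)):\Phi(x)\to\Phi(x)+e_{i+1})$, where $a_{d+2}=a_1$ and $e_{d+2}=e_1$. It preserves the relations and extends linearly to an algebra automorphism $\Phi:\Lambda\to\Lambda$. $(-)_\Phi:\mathrm{mod}\,\Lambda\to\mathrm{mod}\,\Lambda$ denotes the auto-equivalence induced by $\Phi$, normalized so that it sends the indecomposable projective at a vertex $x$ to the indecomposable projective at $\Phi(x)$ and acts on morphisms between projectives through $\Phi$; it induces a functor on $\underline{\mathrm{mod}}\,\Lambda$. *)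

theory Defs
  imports Complex_Main "HOL-Algebra.QuotRing" "HOL-Algebra.Module" "HOL-Library.Function_Algebras"
begin

section \<open>Categories, functors, natural isomorphisms\<close>

text \<open>Hom-sets need not be disjoint, so composition and the morphism part of a functor take the
  objects as arguments; \<open>cmp C X Y Z g f\<close> is the composite of \<open>f : X \<rightarrow> Y\<close> and \<open>g : Y \<rightarrow> Z\<close>.\<close>

record ('o, 'm) cat =
  obj :: "'o set"
  arr :: "'o \<Rightarrow> 'o \<Rightarrow> 'm set"
  cmp :: "'o \<Rightarrow> 'o \<Rightarrow> 'o \<Rightarrow> 'm \<Rightarrow> 'm \<Rightarrow> 'm"
  idt :: "'o \<Rightarrow> 'm"

definition category :: "('o, 'm) cat \<Rightarrow> bool" where
  "category C \<longleftrightarrow>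
     (\<forall>X\<in>obj C. idt C X \<in> arr C X X) \<and>
     (\<forall>X\<in>obj C. \<forall>Y\<in>obj C. \<forall>Z\<in>obj C. \<forall>f\<in>arr C X Y. \<forall>g\<in>arr C Y Z. cmp C X Y Z g f \<in> arr C X Z) \<and>
     (\<forall>X\<in>obj C. \<forall>Y\<in>obj C. \<forall>f\<in>arr C X Y.
        cmp C X X Y f (idt C X) = f \<and> cmp C X Y Y (idt C Y) f = f) \<and>
     (\<forall>W\<in>obj C. \<forall>X\<in>obj C. \<forall>Y\<in>obj C. \<forall>Z\<in>obj C.
        \<forall>f\<in>arr C W X. \<forall>g\<in>arr C X Y. \<forall>h\<in>arr C Y Z.
        cmp C W X Z (cmp C X Y Z h g) f = cmp C W Y Z h (cmp C W X Y g f))"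

record ('o, 'm, 'p, 'q) func =
  on_obj :: "'o \<Rightarrow> 'p"
  on_arr :: "'o \<Rightarrow> 'o \<Rightarrow> 'm \<Rightarrow> 'q"

definition is_functor ::
  "('o, 'm) cat \<Rightarrow> ('p, 'q) cat \<Rightarrow> ('o, 'm, 'p, 'q) func \<Rightarrow> bool" where
  "is_functor C D F \<longleftrightarrow> category C \<and> category D \<and>
     (\<forall>X\<in>obj C. on_obj F X \<in> obj D) \<and>
     (\<forall>X\<in>obj C. \<forall>Y\<in>obj C. \<forall>f\<in>arr C X Y. on_arr F X Y f \<in> arr D (on_obj F X) (on_obj F Y)) \<and>
     (\<forall>X\<in>obj C. on_arr F X X (idt C X) = idt D (on_obj F X)) \<and>
     (\<forall>X\<in>obj C. \<forall>Y\<in>obj C. \<forall>Z\<in>obj C. \<forall>f\<in>arr C X Y. \<forall>g\<in>arr C Y Z.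
        on_arr F X Z (cmp C X Y Z g f) =
          cmp D (on_obj F X) (on_obj F Y) (on_obj F Z) (on_arr F Y Z g) (on_arr F X Y f))"

definition is_iso :: "('o, 'm) cat \<Rightarrow> 'o \<Rightarrow> 'o \<Rightarrow> 'm \<Rightarrow> bool" where
  "is_iso C X Y f \<longleftrightarrow> f \<in> arr C X Y \<and>
     (\<exists>g\<in>arr C Y X. cmp C X Y X g f = idt C X \<and> cmp C Y X Y f g = idt C Y)"

definition naturally_isomorphic ::
  "('o, 'm) cat \<Rightarrow> ('p, 'q) cat \<Rightarrow> ('o, 'm, 'p, 'q) func \<Rightarrow> ('o, 'm, 'p, 'q) func \<Rightarrow> bool" where
  "naturally_isomorphic C D F G \<longleftrightarrow> is_functor C D F \<and> is_functor C D G \<and>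
     (\<exists>\<eta>. (\<forall>X\<in>obj C. is_iso D (on_obj F X) (on_obj G X) (\<eta> X)) \<and>
          (\<forall>X\<in>obj C. \<forall>Y\<in>obj C. \<forall>f\<in>arr C X Y.
             cmp D (on_obj F X) (on_obj F Y) (on_obj G Y) (\<eta> Y) (on_arr F X Y f) =
             cmp D (on_obj F X) (on_obj G X) (on_obj G Y) (on_arr G X Y f) (\<eta> X)))"

primrec func_pow :: "('o, 'm, 'o, 'm) func \<Rightarrow> nat \<Rightarrow> ('o, 'm, 'o, 'm) func" where
  "func_pow F 0 = \<lparr>on_obj = (\<lambda>X. X), on_arr = (\<lambda>X Y f. f)\<rparr>"
| "func_pow F (Suc m) =
     \<lparr>on_obj = (\<lambda>X. on_obj F (on_obj (func_pow F m) X)),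
      on_arr = (\<lambda>X Y f. on_arr F (on_obj (func_pow F m) X) (on_obj (func_pow F m) Y)
                          (on_arr (func_pow F m) X Y f))\<rparr>"


section \<open>Finite dimensional right modules over a \<open>k\<close>-algebra\<close>

text \<open>A \<open>k\<close>-algebra is given by a record of type \<open>('k, 'a) module\<close> of \<open>HOL-Algebra\<close> (ring
  operations together with the scalar multiplication by \<open>k\<close>).

  The underlying space of a finite dimensional module is taken to be a finite dimensional subspace
  of the fixed infinite dimensional space \<open>nat \<Rightarrow> 'k\<close>. Every finite dimensional module is isomorphic
  to one of this form, and submodules and kernels are again of this form.\<close>

type_synonym 'k vec = "nat \<Rightarrow> 'k"

definition vscale :: "'k::field \<Rightarrow> 'k vec \<Rightarrow> 'k vec" where
  "vscale c v = (\<lambda>i. c * v i)"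

interpretation kvec: vector_space vscale
  by unfold_locales (auto simp: vscale_def algebra_simps)

record ('k, 'a) rmod =
  space :: "'k vec set"
  act :: "'k vec \<Rightarrow> 'a \<Rightarrow> 'k vec"

definition rmodule :: "('k::field, 'a) module \<Rightarrow> ('k, 'a) rmod \<Rightarrow> bool" where
  "rmodule L M \<longleftrightarrow>
     kvec.subspace (space M) \<and> (\<exists>B. finite B \<and> space M = kvec.span B) \<and>
     (\<forall>v\<in>space M. \<forall>a\<in>carrier L. act M v a \<in> space M) \<and>
     (\<forall>v\<in>space M. \<forall>w\<in>space M. \<forall>a\<in>carrier L. act M (v + w) a = act M v a + act M w a) \<and>
     (\<forall>v\<in>space M. \<forall>a\<in>carrier L. \<forall>b\<in>carrier L. act M v (a \<oplus>\<^bsub>L\<^esub> b) = act M v a + act M v b) \<and>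
     (\<forall>c. \<forall>v\<in>space M. \<forall>a\<in>carrier L. act M (vscale c v) a = vscale c (act M v a)) \<and>
     (\<forall>c. \<forall>v\<in>space M. \<forall>a\<in>carrier L. act M v (c \<odot>\<^bsub>L\<^esub> a) = vscale c (act M v a)) \<and>
     (\<forall>v\<in>space M. \<forall>a\<in>carrier L. \<forall>b\<in>carrier L. act M v (a \<otimes>\<^bsub>L\<^esub> b) = act M (act M v a) b) \<and>
     (\<forall>v\<in>space M. act M v \<one>\<^bsub>L\<^esub> = v)"

text \<open>Only the values on \<open>space M\<close> of a homomorphism from \<open>M\<close> matter. Two functions that agree there
  are identified by \<open>stable_rel\<close> below.\<close>

definition rhom :: "('k::field, 'a) module \<Rightarrow> ('k, 'a) rmod \<Rightarrow> ('k, 'a) rmod \<Rightarrow> ('k vec \<Rightarrow> 'k vec) set"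
  where
  "rhom L M N = {f.
     (\<forall>v\<in>space M. f v \<in> space N) \<and>
     (\<forall>v\<in>space M. \<forall>w\<in>space M. f (v + w) = f v + f w) \<and>
     (\<forall>c. \<forall>v\<in>space M. f (vscale c v) = vscale c (f v)) \<and>
     (\<forall>v\<in>space M. \<forall>a\<in>carrier L. f (act M v a) = act N (f v) a)}"

definition projective :: "('k::field, 'a) module \<Rightarrow> ('k, 'a) rmod \<Rightarrow> bool" where
  "projective L P \<longleftrightarrow> rmodule L P \<and>
     (\<forall>M N f g. rmodule L M \<and> rmodule L N \<and> g \<in> rhom L M N \<and> g ` space M = space N \<and> f \<in> rhom L P N
        \<longrightarrow> (\<exists>h\<in>rhom L P M. \<forall>v\<in>space P. g (h v) = f v))"

definition submodule :: "('k::field, 'a) module \<Rightarrow> 'k vec set \<Rightarrow> ('k, 'a) rmod \<Rightarrow> bool" where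
  "submodule L U M \<longleftrightarrow> kvec.subspace U \<and> U \<subseteq> space M \<and> (\<forall>v\<in>U. \<forall>a\<in>carrier L. act M v a \<in> U)"

definition ker_mod :: "('k::field, 'a) rmod \<Rightarrow> ('k vec \<Rightarrow> 'k vec) \<Rightarrow> ('k, 'a) rmod" where
  "ker_mod P \<pi> = P\<lparr>space := {v \<in> space P. \<pi> v = 0}\<rparr>"

text \<open>A projective cover is an epimorphism from a projective module with superfluous kernel.\<close>

definition projective_cover ::
  "('k::field, 'a) module \<Rightarrow> ('k, 'a) rmod \<Rightarrow> ('k, 'a) rmod \<Rightarrow> ('k vec \<Rightarrow> 'k vec) \<Rightarrow> bool" where
  "projective_cover L M P \<pi> \<longleftrightarrow>
     projective L P \<and> \<pi> \<in> rhom L P M \<and> \<pi> ` space P = space M \<and>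
     (\<forall>U. submodule L U P \<and> (\<forall>v\<in>space P. \<exists>u\<in>U. \<exists>w\<in>space (ker_mod P \<pi>). v = u + w)
        \<longrightarrow> U = space P)"


section \<open>The projectively stable category and its endofunctors\<close>

definition stable_rel ::
  "('k::field, 'a) module \<Rightarrow> ('k, 'a) rmod \<Rightarrow> ('k, 'a) rmod \<Rightarrow> (('k vec \<Rightarrow> 'k vec) \<times> ('k vec \<Rightarrow> 'k vec)) set"
  where
  "stable_rel L M N = {(f, g). f \<in> rhom L M N \<and> g \<in> rhom L M N \<and>
     (\<exists>P. projective L P \<and> (\<exists>u\<in>rhom L M P. \<exists>w\<in>rhom L P N. \<forall>v\<in>space M. f v - g v = w (u v)))}"

abbreviation stable_class ::
  "('k::field, 'a) module \<Rightarrow> ('k, 'a) rmod \<Rightarrow> ('k, 'a) rmod \<Rightarrow> ('k vec \<Rightarrow> 'k vec) \<Rightarrow> ('k vec \<Rightarrow> 'k vec) set"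
  where "stable_class L M N f \<equiv> stable_rel L M N `` {f}"

text \<open>Here and in the two functors below, the value on a stable class is written as the union of the
  stable classes obtained from all representatives (and, for the syzygy, all lifts). These classes
  all coincide, so the union is a single class.\<close>

definition stmod :: "('k::field, 'a) module \<Rightarrow> (('k, 'a) rmod, ('k vec \<Rightarrow> 'k vec) set) cat" where
  "stmod L = \<lparr>
     obj = {M. rmodule L M},
     arr = (\<lambda>M N. rhom L M N // stable_rel L M N),
     cmp = (\<lambda>M N K D C. \<Union>g\<in>D. \<Union>f\<in>C. stable_class L M K (g \<circ> f)),
     idt = (\<lambda>M. stable_class L M M id)\<rparr>"

definition pcover :: "('k::field, 'a) module \<Rightarrow> ('k, 'a) rmod \<Rightarrow> ('k, 'a) rmod \<times> ('k vec \<Rightarrow> 'k vec)" where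
  "pcover L M = (SOME (P, \<pi>). projective_cover L M P \<pi>)"

definition syz :: "('k::field, 'a) module \<Rightarrow> ('k, 'a) rmod \<Rightarrow> ('k, 'a) rmod" where
  "syz L M = (case pcover L M of (P, \<pi>) \<Rightarrow> ker_mod P \<pi>)"

definition cover_lifts ::
  "('k::field, 'a) module \<Rightarrow> ('k, 'a) rmod \<Rightarrow> ('k, 'a) rmod \<Rightarrow> ('k vec \<Rightarrow> 'k vec) \<Rightarrow> ('k vec \<Rightarrow> 'k vec) set"
  where
  "cover_lifts L M N f = (case pcover L M of (P, \<pi>) \<Rightarrow> case pcover L N of (P', \<pi>') \<Rightarrow>
     {h \<in> rhom L P P'. \<forall>v\<in>space P. \<pi>' (h v) = f (\<pi> v)})"

definition syzygy_functor ::
  "('k::field, 'a) module \<Rightarrow>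
     (('k, 'a) rmod, ('k vec \<Rightarrow> 'k vec) set, ('k, 'a) rmod, ('k vec \<Rightarrow> 'k vec) set) func" where
  "syzygy_functor L = \<lparr>
     on_obj = syz L,
     on_arr = (\<lambda>M N C. \<Union>f\<in>C. \<Union>h\<in>cover_lifts L M N f. stable_class L (syz L M) (syz L N) h)\<rparr>"

text \<open>The functor \<open>(-)\<^sub>\<phi>\<close> for an automorphism \<open>\<phi>\<close> keeps spaces and maps and lets \<open>a\<close> act as
  \<open>\<phi>\<inverse>(a)\<close>. The inverse is what the normalization requires: for an idempotent \<open>e\<close>, the map \<open>\<phi>\<close> is an
  isomorphism from \<open>eL\<close> with this action onto the projective module \<open>\<phi>(e)L\<close>, and it turns left
  multiplication by \<open>b\<close> into left multiplication by \<open>\<phi>(b)\<close>.\<close>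

definition twist :: "('k::field, 'a) module \<Rightarrow> ('a \<Rightarrow> 'a) \<Rightarrow> ('k, 'a) rmod \<Rightarrow> ('k, 'a) rmod" where
  "twist L \<phi> M = M\<lparr>act := (\<lambda>v a. act M v (inv_into (carrier L) \<phi> a))\<rparr>"

definition twist_functor ::
  "('k::field, 'a) module \<Rightarrow> ('a \<Rightarrow> 'a) \<Rightarrow>
     (('k, 'a) rmod, ('k vec \<Rightarrow> 'k vec) set, ('k, 'a) rmod, ('k vec \<Rightarrow> 'k vec) set) func" where
  "twist_functor L \<phi> = \<lparr>
     on_obj = twist L \<phi>,
     on_arr = (\<lambda>M N C. \<Union>f\<in>C. stable_class L (twist L \<phi> M) (twist L \<phi> N) f)\<rparr>"


section \<open>The path category of \<open>Q\<close>\<close>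

text \<open>Vertices are lists \<open>x\<close> of length \<open>d + 1\<close>, with positions counted from \<open>0\<close>; \<open>l\<close> is the
  parameter \<open>\<ell>\<close> of \<open>A\<^bsup>(d+1)\<^esup>\<^bsub>n,\<ell>-1\<^esub>\<close>.\<close>

type_synonym vertex = "int list"

definition os :: "nat \<Rightarrow> nat \<Rightarrow> vertex set" where
  "os d l = {x. length x = d + 1 \<and> sorted_wrt (<) x \<and> last x - hd x + 1 \<le> (int l - 1) + int d}"

definition bump :: "nat \<Rightarrow> vertex \<Rightarrow> vertex" where
  "bump i x = x[i := x ! i + 1]"

text \<open>A path is given by its source and the directions of its successive arrows, the arrow
  traversed first coming first; so \<open>(x, [j, i])\<close> is the path \<open>a\<^sub>i(x + e\<^sub>j) a\<^sub>j(x)\<close>.\<close>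

type_synonym path = "vertex \<times> nat list"

fun target :: "path \<Rightarrow> vertex" where
  "target (x, []) = x"
| "target (x, i # is) = target (bump i x, is)"

fun is_path :: "nat \<Rightarrow> nat \<Rightarrow> path \<Rightarrow> bool" where
  "is_path d l (x, []) \<longleftrightarrow> x \<in> os d l"
| "is_path d l (x, i # is) \<longleftrightarrow> x \<in> os d l \<and> i < d + 1 \<and> is_path d l (bump i x, is)"

definition kQ :: "nat \<Rightarrow> nat \<Rightarrow> vertex \<Rightarrow> vertex \<Rightarrow> (path \<Rightarrow> 'k::field) set" where
  "kQ d l x y = {c. finite {p. c p \<noteq> 0} \<and>
     (\<forall>p. c p \<noteq> 0 \<longrightarrow> is_path d l p \<and> fst p = x \<and> target p = y)}"

text \<open>\<open>path_comp c c'\<close> is the composite in which \<open>c'\<close> comes first. A path has finitely many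
  factorizations, so this makes sense for infinite linear combinations of paths as well.\<close>

definition path_comp :: "(path \<Rightarrow> 'k::field) \<Rightarrow> (path \<Rightarrow> 'k) \<Rightarrow> path \<Rightarrow> 'k" where
  "path_comp c c' = (\<lambda>(x, is). \<Sum>m\<le>length is.
     c (target (x, take m is), drop m is) * c' (x, take m is))"

definition path_elt :: "nat \<Rightarrow> nat \<Rightarrow> path \<Rightarrow> path \<Rightarrow> 'k::field" where
  "path_elt d l p = (\<lambda>q. if q = p \<and> is_path d l p then 1 else 0)"

text \<open>\<open>rel_ideal d l x y\<close> is the part in \<open>kQ(x, y)\<close> of the ideal of the category \<open>kQ\<close> generated by the
  relations. Since \<open>path_elt\<close> vanishes on words that are not paths, \<open>gen\<close> covers the zero relations.\<close>

inductive rel_ideal :: "nat \<Rightarrow> nat \<Rightarrow> vertex \<Rightarrow> vertex \<Rightarrow> (path \<Rightarrow> 'k::field) \<Rightarrow> bool" for d l where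
  zero: "rel_ideal d l x y 0"
| gen: "\<lbrakk>x \<in> os d l; i < d + 1; j < d + 1\<rbrakk> \<Longrightarrow>
    rel_ideal d l x (bump i (bump j x)) (path_elt d l (x, [j, i]) - path_elt d l (x, [i, j]))"
| add: "\<lbrakk>rel_ideal d l x y c; rel_ideal d l x y c'\<rbrakk> \<Longrightarrow> rel_ideal d l x y (c + c')"
| comp_left: "\<lbrakk>b \<in> kQ d l y z; rel_ideal d l x y c\<rbrakk> \<Longrightarrow> rel_ideal d l x z (path_comp b c)"
| comp_right: "\<lbrakk>rel_ideal d l y z c; b \<in> kQ d l x y\<rbrakk> \<Longrightarrow> rel_ideal d l x z (path_comp c b)"


section \<open>The orbit algebra \<open>\<Lambda> = A\<^bsup>(d+1)\<^esup>\<^bsub>n,\<ell>-1\<^esub>\<close>\<close>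

text \<open>A function \<open>c\<close> on paths encodes the family of its parts in the spaces \<open>kQ(x, y)\<close>. Thus
  \<open>path_matrices\<close> is the ring of all families in \<open>\<Prod>\<^sub>x\<^sub>,\<^sub>y kQ(x, y)\<close> with matrix multiplication,
  \<open>rel_matrices\<close> is the ideal of families with all entries in the ideal of relations, and the
  quotient ring consists of the families in \<open>\<Prod>\<^sub>x\<^sub>,\<^sub>y \<A>(x, y)\<close>.\<close>

definition part :: "vertex \<Rightarrow> vertex \<Rightarrow> (path \<Rightarrow> 'k::field) \<Rightarrow> path \<Rightarrow> 'k" where
  "part x y c = (\<lambda>p. if fst p = x \<and> target p = y then c p else 0)"

definition path_matrices :: "nat \<Rightarrow> nat \<Rightarrow> (path \<Rightarrow> 'k::field) ring" where
  "path_matrices d l = \<lparr>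
     carrier = {c. \<forall>x y. part x y c \<in> kQ d l x y},
     mult = path_comp,
     one = (\<lambda>p. if snd p = [] \<and> fst p \<in> os d l then 1 else 0),
     zero = 0,
     add = (+)\<rparr>"

definition rel_matrices :: "nat \<Rightarrow> nat \<Rightarrow> (path \<Rightarrow> 'k::field) set" where
  "rel_matrices d l = {c \<in> carrier (path_matrices d l). \<forall>x y. rel_ideal d l x y (part x y c)}"

text \<open>The linear map induced by a permutation \<open>\<sigma>\<close> of the set of paths.\<close>

definition push :: "nat \<Rightarrow> nat \<Rightarrow> (path \<Rightarrow> path) \<Rightarrow> (path \<Rightarrow> 'k::field) \<Rightarrow> path \<Rightarrow> 'k" where
  "push d l \<sigma> c = (\<lambda>q. if is_path d l q then c (inv_into {p. is_path d l p} \<sigma> q) else 0)"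

definition translate :: "nat \<Rightarrow> path \<Rightarrow> path" where
  "translate n = (\<lambda>(x, is). (map (\<lambda>z. z - int n) x, is))"

text \<open>A morphism \<open>Gx \<rightarrow> Gy\<close> of the orbit category is a \<open>G\<close>-invariant family of morphisms of \<open>\<A>\<close>
  between the points of the two orbits that has finitely many nonzero entries in each row and
  column; composition is matrix multiplication. There are finitely many orbits, so the associated
  algebra \<open>\<Oplus> Hom(Gx, Gy)\<close> consists of all such families indexed by all pairs of vertices. The
  product \<open>b \<otimes> a\<close> is the composite with \<open>a\<close> first, so \<open>e\<^sub>x\<Lambda>\<close>, the projective right module at \<open>x\<close>,
  consists of the morphisms ending at \<open>x\<close>.\<close>

definition nakayama_algebra :: "nat \<Rightarrow> nat \<Rightarrow> nat \<Rightarrow> ('k::field, (path \<Rightarrow> 'k) set) module" where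
  "nakayama_algebra d n l =
    (let R = path_matrices d l; J = rel_matrices d l; A = R Quot J in \<lparr>
       carrier = {C \<in> carrier A. push d l (translate n) ` C = C \<and>
         (\<forall>c\<in>C. (\<forall>x. finite {y. \<not> rel_ideal d l x y (part x y c)}) \<and>
                 (\<forall>y. finite {x. \<not> rel_ideal d l x y (part x y c)}))},
       mult = mult A,
       one = \<one>\<^bsub>A\<^esub>,
       zero = \<zero>\<^bsub>A\<^esub>,
       add = add A,
       smult = (\<lambda>s C. \<Union>c\<in>C. J +>\<^bsub>R\<^esub> (\<lambda>p. s * c p))\<rparr>)"

definition Phi_vertex :: "nat \<Rightarrow> nat \<Rightarrow> vertex \<Rightarrow> vertex" where
  "Phi_vertex d l x = (last x - int l - int d + 1) # butlast x"

definition Phi_path :: "nat \<Rightarrow> nat \<Rightarrow> path \<Rightarrow> path" where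
  "Phi_path d l = (\<lambda>(x, is). (Phi_vertex d l x, map (\<lambda>i. (i + 1) mod (d + 1)) is))"

definition nakayama_Phi :: "nat \<Rightarrow> nat \<Rightarrow> (path \<Rightarrow> 'k::field) set \<Rightarrow> (path \<Rightarrow> 'k) set" where
  "nakayama_Phi d l C = push d l (Phi_path d l) ` C"

end

theory Submission
  imports Defs "HOL-Library.Nat_Bijection" "HOL-Library.Countable" "HOL-Library.Multiset"
begin

text \<open>Why the theorem holds. Count coordinates from \<open>0\<close> and put \<open>z\<^sub>d\<^sub>+\<^sub>1 = z\<^sub>0 + \<ell> + d - 1\<close> for a
  vertex \<open>z\<close>, so that \<open>\<Phi>\<inverse>(z) = (z\<^sub>1, \<dots>, z\<^sub>d\<^sub>+\<^sub>1)\<close>. In the path category modulo relations the space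
  \<open>Hom(z, w)\<close> is one dimensional if \<open>z\<^sub>i \<le> w\<^sub>i < z\<^sub>i\<^sub>+\<^sub>1\<close> for all \<open>i\<close> (the vertices \<^emph>\<open>interlace\<close>), and zero
  otherwise; all paths from \<open>z\<close> to \<open>w\<close> are equal in it (\<open>rel_ideal_iff\<close>). Hence \<open>\<Lambda>\<close> is the algebra of
  translation invariant functions on pairs of interlacing vertices, under convolution
  (\<open>orbit_twist_L\<close>). This description is all that the homological part uses.

  For a right module \<open>M\<close> there is a Koszul complex. Let \<open>e\<^sub>I\<close> be the sum of the standard basis vectors
  with index in \<open>I\<close>, and put \<open>K\<^sub>m(M) = \<Oplus> M\<^sub>y \<otimes> e(y - e\<^sub>I)\<Lambda>\<close>, the sum being over \<open>\<bar>I\<bar> = m\<close> and the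
  vertices \<open>y\<close> up to translation. The differential is the signed sum over \<open>i \<in> I\<close> of the operators
  \<open>v \<otimes> \<lambda> \<mapsto> v a\<^sub>i \<otimes> \<lambda> - v \<otimes> a\<^sub>i \<lambda>\<close>, and the action \<open>M \<otimes> \<Lambda> \<rightarrow> M\<close> augments the complex. Every \<open>K\<^sub>m(M)\<close> is projective
  (\<open>projective_koszul\<close>), and everything is natural in \<open>M\<close>.

  The part of \<open>K\<^sub>m(M)\<close> at a vertex \<open>z\<close> is the sum of the \<open>M\<^sub>y\<close> over all \<open>(I, y)\<close> for which \<open>z\<close> and \<open>y - e\<^sub>I\<close>
  interlace. Filter by \<open>\<Sum>\<^sub>i (y\<^sub>i - z\<^sub>i)\<close>. In the associated graded complex \<open>y\<close> and \<open>z\<close> are fixed, only the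
  second term of the differential survives, and the complex is the tensor product of \<open>M\<^sub>y\<close> with one
  complex for each coordinate: \<open>k \<rightarrow> k\<close> if \<open>z\<^sub>i < y\<^sub>i < z\<^sub>i\<^sub>+\<^sub>1\<close>, and a single \<open>k\<close> if \<open>y\<^sub>i = z\<^sub>i\<close> or
  \<open>y\<^sub>i = z\<^sub>i\<^sub>+\<^sub>1\<close>. One free coordinate makes it acyclic (\<open>homotopy_step\<close>). Without free coordinates,
  strict monotonicity of \<open>y\<close> leaves only \<open>y = z\<close>, \<open>I = \<emptyset>\<close> and \<open>y = \<Phi>\<inverse>(z)\<close>, \<open>I = {0, \<dots>, d}\<close>
  (\<open>no_free_coordinate\<close>). The first position is accounted for by the augmentation. The second
  contributes the homology \<open>M\<^sub>y\<close> with \<open>y = \<Phi>\<inverse>(z)\<close> in degree \<open>d + 1\<close>, and these spaces form the twisted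
  module \<open>M\<^sub>\<Phi>\<close> (\<open>omega\<close>). So there is a natural exact sequence
  \<open>0 \<rightarrow> M\<^sub>\<Phi> \<rightarrow> K\<^sub>d\<^sub>+\<^sub>1(M) \<rightarrow> \<dots> \<rightarrow> K\<^sub>0(M) \<rightarrow> M \<rightarrow> 0\<close> with \<open>d + 2\<close> projective terms.

  The syzygy of a module is stably isomorphic, naturally, to the kernel of any epimorphism onto it from
  a projective module (\<open>compare_iso\<close>, \<open>compare_natural\<close>). Dimension shifting along the exact
  sequence gives the isomorphism of \<open>\<Omega>\<^sup>d\<^sup>+\<^sup>2\<close> with the twist (\<open>syzygy_power_iso\<close>,
  \<open>twisted_periodic\<close>).\<close>

section \<open>Subspaces of the ambient vector space\<close>

interpretation kvec2: vector_space_pair vscale vscale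
  by unfold_locales

text \<open>Maps between modules matter only on the underlying subspace, so linearity is required only there.\<close>

definition lin_on :: "'k::field vec set \<Rightarrow> ('k vec \<Rightarrow> 'k vec) \<Rightarrow> bool" where
  "lin_on S f \<longleftrightarrow> (\<forall>v\<in>S. \<forall>w\<in>S. f (v + w) = f v + f w) \<and> (\<forall>c. \<forall>v\<in>S. f (vscale c v) = vscale c (f v))"

lemma vscale_minus: "vscale (-1) v = - v"
  by (auto simp: vscale_def)

lemma fd_subspace:
  assumes "kvec.subspace U" "U \<subseteq> kvec.span B" "finite B"
  shows "\<exists>C. finite C \<and> U = kvec.span C"
proof -
  obtain C where C: "C \<subseteq> U" "kvec.independent C" "U \<subseteq> kvec.span C"
    by (rule kvec.maximal_independent_subset)
  have "finite C"
    using kvec.independent_span_bound[OF assms(3) C(2)] C(1) assms(2) by blast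
  moreover have "kvec.span C \<subseteq> U"
    by (rule kvec.span_minimal[OF C(1) assms(1)])
  ultimately show ?thesis using C(3) by blast
qed

lemma dim_eq_fd:
  assumes "kvec.subspace A" "A \<subseteq> B" "B \<subseteq> kvec.span F" "finite F" "kvec.dim B \<le> kvec.dim A"
  shows "A = B"
proof -
  obtain a where a: "a \<subseteq> A" "kvec.independent a" "A \<subseteq> kvec.span a" "card a = kvec.dim A"
    by (rule kvec.basis_exists)
  obtain b where b: "a \<subseteq> b" "b \<subseteq> B" "kvec.independent b" "B \<subseteq> kvec.span b"
    using kvec.maximal_independent_subset_extend[of a B] a assms(2) by (metis subset_trans)
  have fb: "finite b" using kvec.independent_span_bound[OF assms(4) b(3)] b(2) assms(3) by blast
  have "card b = kvec.dim B" using kvec.basis_card_eq_dim[OF b(2,4,3)] .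
  hence "card b \<le> card a" using a(4) assms(5) by simp
  hence "a = b" using fb b(1) by (meson card_seteq)
  hence "B \<subseteq> kvec.span a" using b(4) by simp
  also have "\<dots> \<subseteq> A" by (rule kvec.span_minimal[OF a(1) assms(1)])
  finally show ?thesis using assms(2) by blast
qed

lemma lin_on_sum:
  assumes "lin_on S f" "kvec.subspace S" "\<And>i. i \<in> I \<Longrightarrow> v i \<in> S"
  shows "f (\<Sum>i\<in>I. v i) = (\<Sum>i\<in>I. f (v i))"
proof -
  have f0: "f 0 = 0"
  proof -
    have "f (vscale 0 0) = vscale 0 (f 0)"
      using assms(1,2) kvec.subspace_0 unfolding lin_on_def by blast
    thus ?thesis by (simp only: kvec.scale_zero_left)
  qed
  show ?thesis
  proof (cases "finite I")
    case True
    thus ?thesis using assms(3)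
    proof (induction I rule: finite_induct)
      case empty thus ?case by (simp only: sum.empty f0)
    next
      case (insert x F)
      have "(\<Sum>i\<in>F. v i) \<in> S" using insert.prems by (intro kvec.subspace_sum[OF assms(2)]) auto
      hence "f (v x + (\<Sum>i\<in>F. v i)) = f (v x) + f (\<Sum>i\<in>F. v i)"
        using insert.prems assms(1) unfolding lin_on_def by blast
      moreover have "f (\<Sum>i\<in>F. v i) = (\<Sum>i\<in>F. f (v i))" using insert by blast
      ultimately show ?case by (simp only: sum.insert[OF insert.hyps])
    qed
  qed (simp add: f0)
qed

text \<open>Choose preimages of a basis of \<open>Y\<close>; a vector space has no obstruction to splitting, and projectivity
  of the Koszul modules will be reduced to this.\<close>

lemma lin_on_section:
  assumes g: "lin_on X g" and X: "kvec.subspace X" and Y: "kvec.subspace Y" and s: "g ` X = Y"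
  shows "\<exists>t. lin_on Y t \<and> (\<forall>y\<in>Y. t y \<in> X \<and> g (t y) = y)"
proof -
  obtain b where b: "b \<subseteq> Y" "kvec.independent b" "Y \<subseteq> kvec.span b"
    by (rule kvec.maximal_independent_subset)
  have "\<forall>y\<in>b. \<exists>x\<in>X. g x = y" using b(1) s by blast
  then obtain t0 where t0: "\<And>y. y \<in> b \<Longrightarrow> t0 y \<in> X \<and> g (t0 y) = y" by metis
  obtain t where t: "Vector_Spaces.linear vscale vscale t" "\<And>y. y \<in> b \<Longrightarrow> t y = t0 y"
    using kvec2.linear_independent_extend[OF b(2), of t0] by blast
  have lin: "t (v + w) = t v + t w" "t (vscale c v) = vscale c (t v)" for v w c
    by (rule kvec2.linear_add[OF t(1)], rule kvec2.linear_scale[OF t(1)])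
  have g0: "g 0 = 0" using lin_on_sum[OF g X, of "{}"] by simp
  have t0': "t 0 = 0" using lin(2)[of 0 0] by simp
  have sub: "kvec.subspace {y. t y \<in> X \<and> g (t y) = y}"
    using g X unfolding lin_on_def kvec.subspace_def by (auto simp: lin g0 t0')
  have "t y \<in> X \<and> g (t y) = y" if "y \<in> Y" for y
    using kvec.span_induct[OF _ sub, of y b] that b(3) t(2) t0 by auto
  thus ?thesis using lin unfolding lin_on_def by blast
qed

text \<open>A section of \<open>T\<close> is injective, hence surjective by dimension, and so is a two-sided inverse.\<close>

lemma lin_on_endo_inj:
  assumes T: "lin_on V T" and V: "kvec.subspace V" "V \<subseteq> kvec.span F" "finite F" and s: "T ` V = V"
  shows "inj_on T V"
proof -
  obtain t where t: "lin_on V t" "\<And>y. y \<in> V \<Longrightarrow> t y \<in> V \<and> T (t y) = y"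
    using lin_on_section[OF T V(1) V(1) s] by blast
  obtain b where b: "b \<subseteq> V" "kvec.independent b" "V \<subseteq> kvec.span b" "card b = kvec.dim V"
    by (rule kvec.basis_exists)
  have spb: "kvec.span b = V" using b(3) kvec.span_minimal[OF b(1) V(1)] by blast
  obtain t' where t': "Vector_Spaces.linear vscale vscale t'" "\<And>y. y \<in> b \<Longrightarrow> t' y = t y"
    using kvec2.linear_independent_extend[OF b(2), of t] by blast
  have lin: "t' (v + w) = t' v + t' w" "t' (vscale c v) = vscale c (t' v)" for v w c
    by (rule kvec2.linear_add[OF t'(1)], rule kvec2.linear_scale[OF t'(1)])
  have z: "t' 0 = 0" "t 0 = 0" using lin(2)[of 0 0] lin_on_sum[OF t(1) V(1), of "{}"] by simp_all
  have sub: "kvec.subspace {y. y \<in> V \<and> t' y = t y}"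
    using t(1) V(1) unfolding lin_on_def kvec.subspace_def by (auto simp: lin z)
  have eq: "t' y = t y" if "y \<in> V" for y
    using kvec.span_induct[OF _ sub, of y b] that b(1,3) t'(2) by auto
  have inj: "inj_on t' V" by (rule inj_onI) (metis eq t(2))
  have "kvec.independent (t' ` b)"
    using kvec2.linear_independent_injective_image[OF t'(1) b(2)] inj spb by metis
  moreover have "card (t' ` b) = card b" using inj_on_subset[OF inj b(1)] by (rule card_image)
  moreover have "kvec.span (t' ` b) = t' ` V"
    using kvec2.linear_span_image[OF t'(1)] spb by metis
  ultimately have "kvec.dim (t' ` V) = kvec.dim V"
    using b(4) by (metis kvec.dim_span_eq_card_independent)
  moreover have tV: "t' ` V = t ` V" using eq by auto
  moreover have "kvec.subspace (t' ` V)" using kvec2.linear_subspace_image[OF t'(1) V(1)] .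
  ultimately have "t ` V = V"
    using dim_eq_fd[of "t ` V" V F] t(2) V(2,3) by fastforce
  thus ?thesis using t(2) by (metis (no_types, lifting) image_iff inj_onI)
qed

section \<open>Modules and homomorphisms\<close>

lemma rmoduleD:
  assumes "rmodule L M"
  shows rmod_subspace: "kvec.subspace (space M)"
    and rmod_fd: "\<exists>B. finite B \<and> space M = kvec.span B"
    and rmod_act: "\<And>v a. v \<in> space M \<Longrightarrow> a \<in> carrier L \<Longrightarrow> act M v a \<in> space M"
    and rmod_act_add: "\<And>v w a. v \<in> space M \<Longrightarrow> w \<in> space M \<Longrightarrow> a \<in> carrier L \<Longrightarrow> act M (v + w) a = act M v a + act M w a"
    and rmod_act_ladd: "\<And>v a b. v \<in> space M \<Longrightarrow> a \<in> carrier L \<Longrightarrow> b \<in> carrier L \<Longrightarrow> act M v (a \<oplus>\<^bsub>L\<^esub> b) = act M v a + act M v b"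
    and rmod_act_scale: "\<And>c v a. v \<in> space M \<Longrightarrow> a \<in> carrier L \<Longrightarrow> act M (vscale c v) a = vscale c (act M v a)"
    and rmod_act_lscale: "\<And>c v a. v \<in> space M \<Longrightarrow> a \<in> carrier L \<Longrightarrow> act M v (c \<odot>\<^bsub>L\<^esub> a) = vscale c (act M v a)"
    and rmod_act_mult: "\<And>v a b. v \<in> space M \<Longrightarrow> a \<in> carrier L \<Longrightarrow> b \<in> carrier L \<Longrightarrow> act M v (a \<otimes>\<^bsub>L\<^esub> b) = act M (act M v a) b"
    and rmod_act_one: "\<And>v. v \<in> space M \<Longrightarrow> act M v \<one>\<^bsub>L\<^esub> = v"
  using assms unfolding rmodule_def by blast+

lemma rmod_closed:
  assumes "rmodule L M"
  shows rmod_0: "0 \<in> space M"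
    and rmod_add: "\<And>v w. v \<in> space M \<Longrightarrow> w \<in> space M \<Longrightarrow> v + w \<in> space M"
    and rmod_scale: "\<And>c v. v \<in> space M \<Longrightarrow> vscale c v \<in> space M"
    and rmod_minus: "\<And>v. v \<in> space M \<Longrightarrow> - v \<in> space M"
    and rmod_diff: "\<And>v w. v \<in> space M \<Longrightarrow> w \<in> space M \<Longrightarrow> v - w \<in> space M"
  using rmod_subspace[OF assms]
  by (auto intro: kvec.subspace_0 kvec.subspace_add kvec.subspace_scale kvec.subspace_neg kvec.subspace_diff)

lemma rmod_act_lin: "rmodule L M \<Longrightarrow> a \<in> carrier L \<Longrightarrow> lin_on (space M) (\<lambda>v. act M v a)"
  by (auto simp: lin_on_def rmod_act_add rmod_act_scale)

lemma rmod_act_diff: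
  assumes "rmodule (L :: ('k::field, 'a) module) M" "v \<in> space M" "w \<in> space M" "a \<in> carrier L"
  shows "act M (v - w) a = act M v a - act M w a"
proof -
  have e: "x - y = x + vscale (-1) y" for x y :: "'k vec"
    by (simp only: vscale_minus diff_conv_add_uminus)
  show ?thesis
    unfolding e by (simp only: rmod_act_add[OF assms(1)] rmod_act_scale[OF assms(1)] rmod_scale[OF assms(1)] assms)
qed

lemma rmod_act_0: assumes "rmodule L M" "a \<in> carrier L" shows "act M 0 a = 0"
  using rmod_act_diff[OF assms(1) rmod_0[OF assms(1)] rmod_0[OF assms(1)] assms(2)] by simp

lemma rmodule_submodule:
  assumes M: "rmodule L M" and U: "submodule L U M"
  shows "rmodule L (M\<lparr>space := U\<rparr>)"
proof -
  have sub: "U \<subseteq> space M" "kvec.subspace U" "\<And>v a. v \<in> U \<Longrightarrow> a \<in> carrier L \<Longrightarrow> act M v a \<in> U"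
    using U unfolding submodule_def by auto
  have "\<exists>B. finite B \<and> U = kvec.span B"
    using rmod_fd[OF M] fd_subspace[OF sub(2)] sub(1) by metis
  thus ?thesis using M sub unfolding rmodule_def by (simp add: subset_iff)
qed

lemma rhomI:
  assumes "\<And>v. v \<in> space M \<Longrightarrow> f v \<in> space N"
    "\<And>v w. v \<in> space M \<Longrightarrow> w \<in> space M \<Longrightarrow> f (v + w) = f v + f w"
    "\<And>c v. v \<in> space M \<Longrightarrow> f (vscale c v) = vscale c (f v)"
    "\<And>v a. v \<in> space M \<Longrightarrow> a \<in> carrier L \<Longrightarrow> f (act M v a) = act N (f v) a"
  shows "f \<in> rhom L M N"
  using assms unfolding rhom_def by blast

lemma rhomD:
  assumes "f \<in> rhom L M N"
  shows rhom_in: "\<And>v. v \<in> space M \<Longrightarrow> f v \<in> space N"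
    and rhom_add: "\<And>v w. v \<in> space M \<Longrightarrow> w \<in> space M \<Longrightarrow> f (v + w) = f v + f w"
    and rhom_scale: "\<And>c v. v \<in> space M \<Longrightarrow> f (vscale c v) = vscale c (f v)"
    and rhom_act: "\<And>v a. v \<in> space M \<Longrightarrow> a \<in> carrier L \<Longrightarrow> f (act M v a) = act N (f v) a"
  using assms unfolding rhom_def by auto

lemma rhom_lin: "f \<in> rhom L M N \<Longrightarrow> lin_on (space M) f"
  unfolding rhom_def lin_on_def by auto

lemma rhom_0: "rmodule L M \<Longrightarrow> f \<in> rhom L M N \<Longrightarrow> f 0 = 0"
  using lin_on_sum[of "space M" f "{}"] rhom_lin rmod_subspace by fastforce

lemma rhom_minus_val:
  assumes "rmodule (L :: ('k::field, 'a) module) M" "f \<in> rhom L M N" "v \<in> space M" "w \<in> space M"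
  shows "f (v - w) = f v - f w"
proof -
  have e: "x - y = x + vscale (-1) y" for x y :: "'k vec"
    by (simp only: vscale_minus diff_conv_add_uminus)
  show ?thesis
    unfolding e by (simp only: rhom_add[OF assms(2)] rhom_scale[OF assms(2)] rmod_scale[OF assms(1)] assms)
qed

lemma rhom_id: "id \<in> rhom L M M"
  unfolding rhom_def by simp

lemma rhom_comp: "f \<in> rhom L M N \<Longrightarrow> g \<in> rhom L N K \<Longrightarrow> g \<circ> f \<in> rhom L M K"
  unfolding rhom_def by simp

lemma rhom_comp': "f \<in> rhom L M N \<Longrightarrow> g \<in> rhom L N K \<Longrightarrow> (\<lambda>v. g (f v)) \<in> rhom L M K"
  using rhom_comp[of f L M N g K] by (simp add: comp_def)

lemma rhom_zero: "rmodule L N \<Longrightarrow> (\<lambda>v. 0) \<in> rhom L M N"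
  using rmod_0 rmod_act_0 by (intro rhomI) fastforce+

lemma rhom_plus:
  assumes "rmodule L N" "f \<in> rhom L M N" "g \<in> rhom L M N"
  shows "(\<lambda>v. f v + g v) \<in> rhom L M N"
  by (rule rhomI)
    (auto simp: rhomD[OF assms(2)] rhomD[OF assms(3)] rmod_add[OF assms(1)] kvec.scale_right_distrib
      rmod_act_add[OF assms(1)])

lemma rhom_diff:
  assumes "rmodule L N" "f \<in> rhom L M N" "g \<in> rhom L M N"
  shows "(\<lambda>v. f v - g v) \<in> rhom L M N"
  by (rule rhomI)
    (auto simp: rhomD[OF assms(2)] rhomD[OF assms(3)] rmod_diff[OF assms(1)] kvec.scale_right_diff_distrib
      rmod_act_diff[OF assms(1)])

lemma rhom_sub_source: "f \<in> rhom L M N \<Longrightarrow> U \<subseteq> space M \<Longrightarrow> f \<in> rhom L (M\<lparr>space := U\<rparr>) N"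
  unfolding rhom_def by (auto simp: subset_iff)

lemma space_ker_mod [simp]: "space (ker_mod P p) = {v \<in> space P. p v = 0}"
  by (simp add: ker_mod_def)

lemma act_ker_mod [simp]: "act (ker_mod P p) = act P"
  by (simp add: ker_mod_def)

lemma submodule_ker:
  assumes "rmodule L P" "rmodule L M" "p \<in> rhom L P M"
  shows "submodule L {v \<in> space P. p v = 0} P"
  unfolding submodule_def kvec.subspace_def
  using rhom_0[OF assms(1,3)]
  by (auto simp: rmod_closed[OF assms(1)] rhomD[OF assms(3)] rmod_act[OF assms(1)] rmod_act_0[OF assms(2)])

lemma rmodule_ker: "rmodule L P \<Longrightarrow> rmodule L M \<Longrightarrow> p \<in> rhom L P M \<Longrightarrow> rmodule L (ker_mod P p)"
  unfolding ker_mod_def by (rule rmodule_submodule[OF _ submodule_ker])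

lemma rhom_to_ker: "f \<in> rhom L M P \<Longrightarrow> (\<And>v. v \<in> space M \<Longrightarrow> p (f v) = 0) \<Longrightarrow> f \<in> rhom L M (ker_mod P p)"
  unfolding rhom_def by auto

lemma rhom_from_ker: "f \<in> rhom L P M \<Longrightarrow> f \<in> rhom L (ker_mod P p) M"
  unfolding rhom_def by auto

lemma projectiveD: "projective L P \<Longrightarrow> rmodule L P"
  unfolding projective_def by simp

lemma projective_lift:
  assumes "projective L P" "rmodule L M" "rmodule L N" "g \<in> rhom L M N" "g ` space M = space N" "f \<in> rhom L P N"
  obtains h where "h \<in> rhom L P M" "\<And>v. v \<in> space P \<Longrightarrow> g (h v) = f v"
proof -
  have "\<exists>h\<in>rhom L P M. \<forall>v\<in>space P. g (h v) = f v"
    using assms(1)[unfolded projective_def, THEN conjunct2, rule_format, of M N g f] assms(2-6) by simp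
  thus thesis using that by blast
qed

lemma submodule_image:
  assumes "rmodule L M" "rmodule L N" "f \<in> rhom L M N"
  shows "submodule L (f ` space M) N"
  unfolding submodule_def kvec.subspace_def
proof (intro conjI allI ballI)
  have "f 0 \<in> f ` space M" by (rule imageI[OF rmod_0[OF assms(1)]])
  thus "0 \<in> f ` space M" by (simp only: rhom_0[OF assms(1,3)])
next
  fix v w assume "v \<in> f ` space M" "w \<in> f ` space M"
  thus "v + w \<in> f ` space M"
    by (metis (no_types, lifting) imageE imageI rhom_add[OF assms(3)] rmod_add[OF assms(1)])
next
  fix c v assume "v \<in> f ` space M"
  thus "vscale c v \<in> f ` space M"
    by (metis (no_types, lifting) imageE imageI rhom_scale[OF assms(3)] rmod_scale[OF assms(1)])
next
  fix v a assume "v \<in> f ` space M" "a \<in> carrier L"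
  thus "act N v a \<in> f ` space M"
    by (metis (no_types, lifting) imageE imageI rhom_act[OF assms(3)] rmod_act[OF assms(1)])
qed (use rhom_in[OF assms(3)] in auto)

section \<open>Projective covers\<close>

lemma rhom_funpow: "h \<in> rhom L P P \<Longrightarrow> (h ^^ k) \<in> rhom L P P"
  by (induction k) (auto intro: rhom_id rhom_comp)

text \<open>To lift a map out of a direct summand, precompose it with the retraction.\<close>

lemma projective_retract:
  assumes P: "projective L P" and V: "submodule L V P" and r: "r \<in> rhom L P (P\<lparr>space := V\<rparr>)"
    and rV: "\<And>v. v \<in> V \<Longrightarrow> r v = v"
  shows "projective L (P\<lparr>space := V\<rparr>)"
  unfolding projective_def
proof (intro conjI allI impI)
  show "rmodule L (P\<lparr>space := V\<rparr>)" by (rule rmodule_submodule[OF projectiveD[OF P] V])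
next
  fix M N f g
  assume a: "rmodule L M \<and> rmodule L N \<and> g \<in> rhom L M N \<and> g ` space M = space N \<and> f \<in> rhom L (P\<lparr>space := V\<rparr>) N"
  hence "f \<circ> r \<in> rhom L P N" using r by (blast intro: rhom_comp)
  then obtain h where h: "h \<in> rhom L P M" "\<And>v. v \<in> space P \<Longrightarrow> g (h v) = (f \<circ> r) v"
    using a projective_lift[OF P] by metis
  have "V \<subseteq> space P" using V unfolding submodule_def by blast
  thus "\<exists>h\<in>rhom L (P\<lparr>space := V\<rparr>) M. \<forall>v\<in>space (P\<lparr>space := V\<rparr>). g (h v) = f v"
    using h rV by (intro bexI[of _ h]) (auto intro: rhom_sub_source)
qed

text \<open>Fitting's lemma. When the decreasing images have reached minimal dimension, the power \<open>h\<^sup>m\<close> maps its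
  image \<open>W\<close> bijectively to itself, and \<open>h\<^sup>m\<close> followed by the inverse of this bijection
  retracts \<open>P\<close> onto \<open>W\<close>.\<close>

lemma fitting_retract:
  assumes P: "rmodule L P" and h: "h \<in> rhom L P P"
  obtains m r where "m \<ge> 1" "submodule L ((h ^^ m) ` space P) P"
    "r \<in> rhom L P (P\<lparr>space := (h ^^ m) ` space P\<rparr>)" "\<And>v. v \<in> (h ^^ m) ` space P \<Longrightarrow> r v = v"
proof -
  obtain F where F: "finite F" "space P = kvec.span F" using rmod_fd[OF P] by blast
  \<comment> \<open>The images start with the first power: only then do they lie in the image of \<open>h\<close> itself.\<close>
  define V where "V k = (h ^^ Suc k) ` space P" for k
  have hk: "(h ^^ k) \<in> rhom L P P" for k using rhom_funpow[OF h] .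
  have subV: "submodule L (V k) P" for k unfolding V_def by (rule submodule_image[OF P P hk])
  obtain m0 where m0: "\<And>k. kvec.dim (V m0) \<le> kvec.dim (V k)"
    using exists_least_iff[of "\<lambda>x. \<exists>k. x = kvec.dim (V k)"] by (metis linorder_not_le)
  define m where "m = Suc m0"
  define T where "T = h ^^ m"
  have T: "T \<in> rhom L P P" unfolding T_def by (rule hk)
  define W where "W = V m0"
  have W: "W = T ` space P" unfolding W_def V_def T_def m_def by simp
  have subW: "submodule L W P" "kvec.subspace W" "W \<subseteq> space P"
    using subV[of m0] unfolding W_def submodule_def by auto
  have TW: "T ` W = V (m + m0)"
    unfolding W T_def V_def m_def by (simp add: image_comp funpow_add [symmetric] del: funpow.simps) 
  have "T ` W \<subseteq> W" using subW(3) W by blast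
  moreover have "kvec.subspace (T ` W)" using subV[of "m + m0"] unfolding TW submodule_def by blast
  ultimately have eq: "T ` W = W"
    using dim_eq_fd[of "T ` W" W F] F subW m0[of "m + m0"] unfolding W_def[symmetric] TW[symmetric] by auto
  have linT: "lin_on W T" using rhom_lin[OF T] subW(3) unfolding lin_on_def by blast
  have inj: "inj_on T W" using lin_on_endo_inj[OF linT subW(2) _ F(1) eq] subW(3) F(2) by blast
  define r where "r v = inv_into W T (T v)" for v
  have TP: "T v \<in> W" if "v \<in> space P" for v using that W by blast
  have rW: "r v \<in> W" "T (r v) = T v" if "v \<in> space P" for v
    using TP[OF that] eq unfolding r_def by (metis inv_into_into, metis f_inv_into_f)
  have runiq: "r v = w" if "v \<in> space P" "w \<in> W" "T w = T v" for v w
    using inj rW[OF that(1)] that by (metis inj_onD)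
  have WP: "v \<in> space P" if "v \<in> W" for v using that subW(3) by blast
  have rh: "r \<in> rhom L P (P\<lparr>space := W\<rparr>)"
  proof (rule rhomI)
    fix v w assume vw: "v \<in> space P" "w \<in> space P"
    show "r v \<in> space (P\<lparr>space := W\<rparr>)" using rW vw by simp
    show "r (v + w) = r v + r w"
      using vw rW WP kvec.subspace_add[OF subW(2)]
      by (intro runiq) (auto simp: rmod_add[OF P] rhom_add[OF T])
    fix c show "r (vscale c v) = vscale c (r v)"
      using vw rW WP kvec.subspace_scale[OF subW(2)]
      by (intro runiq) (auto simp: rmod_scale[OF P] rhom_scale[OF T])
  next
    fix v a assume va: "v \<in> space P" "a \<in> carrier L"
    have "act P (r v) a \<in> W" using subW(1) rW va unfolding submodule_def by blast
    thus "r (act P v a) = act (P\<lparr>space := W\<rparr>) (r v) a"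
      using va rW WP by (auto intro!: runiq simp: rmod_act[OF P] rhom_act[OF T])
  qed
  have "r v = v" if "v \<in> W" for v using runiq WP that by blast
  thus thesis using that[of m r] rh subW(1) unfolding W T_def m_def by simp
qed

text \<open>Among the projective modules mapping onto \<open>M\<close> take one, \<open>p : P \<rightarrow> M\<close>, of minimal dimension. If \<open>U\<close> and
  the kernel of \<open>p\<close> span \<open>P\<close>, then \<open>p\<close> lifts through its restriction to \<open>U\<close>, giving an endomorphism \<open>h\<close>
  of \<open>P\<close> over \<open>M\<close> with image in \<open>U\<close>. Fitting's lemma produces from \<open>h\<close> a projective summand that lies in
  \<open>U\<close> and still maps onto \<open>M\<close>; by minimality it is \<open>P\<close>.\<close>

theorem projective_cover_exists:
  assumes M: "rmodule L M" and P0: "projective L P0" "p0 \<in> rhom L P0 M" "p0 ` space P0 = space M"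
  shows "\<exists>P p. projective_cover L M P p"
proof -
  let ?E = "\<lambda>P p. projective L P \<and> p \<in> rhom L P M \<and> p ` space P = space M"
  obtain P p where E: "?E P p" and min: "\<And>Q q. ?E Q q \<Longrightarrow> kvec.dim (space P) \<le> kvec.dim (space Q)"
    using exists_least_iff[of "\<lambda>x. \<exists>P p. ?E P p \<and> x = kvec.dim (space P)"] P0
    by (metis (no_types, lifting) linorder_not_le)
  have P: "projective L P" "rmodule L P" and p: "p \<in> rhom L P M" "p ` space P = space M"
    using E projectiveD by auto
  obtain F where F: "finite F" "space P = kvec.span F" using rmod_fd[OF P(2)] by blast
  have "projective_cover L M P p"
    unfolding projective_cover_def
  proof (intro conjI allI impI)
    fix U assume U: "submodule L U P \<and> (\<forall>v\<in>space P. \<exists>u\<in>U. \<exists>w\<in>space (ker_mod P p). v = u + w)"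
    let ?U = "P\<lparr>space := U\<rparr>"
    have UP: "U \<subseteq> space P" using U unfolding submodule_def by blast
    have "p ` U = space M"
    proof
      show "p ` U \<subseteq> space M" using UP p by blast
      show "space M \<subseteq> p ` U"
      proof
        fix x assume "x \<in> space M"
        then obtain v where v: "v \<in> space P" "x = p v" using p(2) by blast
        then obtain u w where uw: "u \<in> U" "w \<in> space P" "p w = 0" "v = u + w" using U by auto
        have "p v = p u" using rhom_add[OF p(1), of u w] uw UP by auto
        thus "x \<in> p ` U" using v uw by blast
      qed
    qed
    then obtain h where h: "h \<in> rhom L P ?U" "\<And>v. v \<in> space P \<Longrightarrow> p (h v) = p v"
      using projective_lift[OF P(1) rmodule_submodule[OF P(2)] M rhom_sub_source[OF p(1) UP] _ p(1)] U
      by auto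
    have hU: "h v \<in> U" if "v \<in> space P" for v using rhom_in[OF h(1) that] by simp
    have hP: "h \<in> rhom L P P" using h(1) UP unfolding rhom_def by auto
    obtain m r where r: "m \<ge> 1" "submodule L ((h ^^ m) ` space P) P"
      "r \<in> rhom L P (P\<lparr>space := (h ^^ m) ` space P\<rparr>)" "\<And>v. v \<in> (h ^^ m) ` space P \<Longrightarrow> r v = v"
      using fitting_retract[OF P(2) hP] by metis
    define V where "V = (h ^^ m) ` space P"
    have projV: "projective L (P\<lparr>space := V\<rparr>)"
      unfolding V_def by (rule projective_retract[OF P(1) r(2,3,4)])
    have VP: "V \<subseteq> space P" "kvec.subspace V" using r(2) unfolding V_def submodule_def by auto
    have ph: "p ((h ^^ k) v) = p v \<and> (h ^^ k) v \<in> space P" if "v \<in> space P" for k v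
      using that by (induction k) (auto simp: h(2) rhom_in[OF hP])
    have "p ` V = space M" using ph p(2) unfolding V_def by (force simp: image_image)
    hence "kvec.dim (space P) \<le> kvec.dim V"
      using min[of "P\<lparr>space := V\<rparr>" p] projV rhom_sub_source[OF p(1) VP(1)] by simp
    hence "V = space P" using dim_eq_fd[OF VP(2,1) _ F(1)] F(2) by simp
    moreover have "V \<subseteq> U"
    proof -
      obtain k where "m = Suc k" using r(1) by (cases m) auto
      thus ?thesis unfolding V_def using hU ph by auto
    qed
    ultimately show "U = space P" using UP by blast
  qed (use P p in auto)
  thus ?thesis by blast
qed

section \<open>The stable category and its syzygy functor\<close>

lemma cat_simps_stmod [simp]:
  "obj (stmod L) = {M. rmodule L M}"
  "arr (stmod L) M N = rhom L M N // stable_rel L M N"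
  "idt (stmod L) M = stable_class L M M id"
  by (simp_all add: stmod_def)

lemma stable_relI:
  assumes "f \<in> rhom L M N" "g \<in> rhom L M N" "projective L P" "u \<in> rhom L M P" "w \<in> rhom L P N"
    "\<And>v. v \<in> space M \<Longrightarrow> f v - g v = w (u v)"
  shows "(f, g) \<in> stable_rel L M N"
  using assms unfolding stable_rel_def by blast

lemma stable_rel_rhom: "(f, g) \<in> stable_rel L M N \<Longrightarrow> f \<in> rhom L M N \<and> g \<in> rhom L M N"
  unfolding stable_rel_def by blast

locale enough_projectives =
  fixes L :: "('k::field, 'a) module"
  assumes enough: "rmodule L M \<Longrightarrow> \<exists>P p. projective L P \<and> p \<in> rhom L P M \<and> p ` space P = space M"
begin

text \<open>A map through some projective module factors through every epimorphism from a projective module to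
  the target. So two maps can be taken to factor through the same projective module, and sums of such
  maps do not call for direct sums.\<close>

lemma stable_rel_factor:
  assumes M: "rmodule L M" and N: "rmodule L N"
    and P: "projective L P" "p \<in> rhom L P N" "p ` space P = space N"
    and fg: "(f, g) \<in> stable_rel L M N"
  obtains u where "u \<in> rhom L M P" "\<And>v. v \<in> space M \<Longrightarrow> f v - g v = p (u v)"
proof -
  obtain Q u w where Q: "projective L Q" "u \<in> rhom L M Q" "w \<in> rhom L Q N"
    "\<And>v. v \<in> space M \<Longrightarrow> f v - g v = w (u v)"
    using fg unfolding stable_rel_def by blast
  obtain h where h: "h \<in> rhom L Q P" "\<And>v. v \<in> space Q \<Longrightarrow> p (h v) = w v"
    using projective_lift[OF Q(1) projectiveD[OF P(1)] N P(2,3) Q(3)] by metis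
  show thesis
  proof (rule that)
    show "h \<circ> u \<in> rhom L M P" using rhom_comp[OF Q(2) h(1)] .
    fix v assume "v \<in> space M"
    thus "f v - g v = p ((h \<circ> u) v)" using Q(4) h(2) rhom_in[OF Q(2)] by simp
  qed
qed

lemma stable_rel_refl:
  assumes M: "rmodule L M" and N: "rmodule L N" and f: "f \<in> rhom L M N"
  shows "(f, f) \<in> stable_rel L M N"
proof -
  obtain P p where P: "projective L P" "p \<in> rhom L P N" using enough[OF N] by blast
  show ?thesis
    by (rule stable_relI[OF f f P(1) rhom_zero[OF projectiveD[OF P(1)]] P(2)])
      (simp only: rhom_0[OF projectiveD[OF P(1)] P(2)] diff_self)
qed

lemma stable_rel_sym:
  assumes M: "rmodule L M" and N: "rmodule L N" and fg: "(f, g) \<in> stable_rel L M N"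
  shows "(g, f) \<in> stable_rel L M N"
proof -
  obtain P p where P: "projective L P" "p \<in> rhom L P N" "p ` space P = space N"
    using enough[OF N] by blast
  have Pm: "rmodule L P" using projectiveD P(1) .
  obtain u where u: "u \<in> rhom L M P" "\<And>v. v \<in> space M \<Longrightarrow> f v - g v = p (u v)"
    using stable_rel_factor[OF M N P fg] by blast
  have fgh: "g \<in> rhom L M N" "f \<in> rhom L M N" using stable_rel_rhom[OF fg] by auto
  show ?thesis
  proof (rule stable_relI[OF fgh P(1) rhom_diff[OF Pm rhom_zero[OF Pm] u(1)] P(2)])
    fix v assume v: "v \<in> space M"
    have "p (0 - u v) = 0 - p (u v)"
      by (simp only: rhom_minus_val[OF Pm P(2) rmod_0[OF Pm] rhom_in[OF u(1) v]] rhom_0[OF Pm P(2)])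
    thus "g v - f v = p (0 - u v)" by (simp only: u(2)[OF v, symmetric] minus_diff_eq diff_0)
  qed
qed

lemma stable_rel_trans:
  assumes M: "rmodule L M" and N: "rmodule L N"
    and fg: "(f, g) \<in> stable_rel L M N" and gh: "(g, h) \<in> stable_rel L M N"
  shows "(f, h) \<in> stable_rel L M N"
proof -
  obtain P p where P: "projective L P" "p \<in> rhom L P N" "p ` space P = space N"
    using enough[OF N] by blast
  have Pm: "rmodule L P" using projectiveD P(1) .
  obtain u where u: "u \<in> rhom L M P" "\<And>v. v \<in> space M \<Longrightarrow> f v - g v = p (u v)"
    using stable_rel_factor[OF M N P fg] by blast
  obtain w where w: "w \<in> rhom L M P" "\<And>v. v \<in> space M \<Longrightarrow> g v - h v = p (w v)"
    using stable_rel_factor[OF M N P gh] by blast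
  have fh: "f \<in> rhom L M N" "h \<in> rhom L M N" using stable_rel_rhom[OF fg] stable_rel_rhom[OF gh] by auto
  show ?thesis
  proof (rule stable_relI[OF fh P(1) rhom_plus[OF Pm u(1) w(1)] P(2)])
    fix v assume v: "v \<in> space M"
    have "f v - h v = (f v - g v) + (g v - h v)" by (simp only: add_diff_eq diff_add_cancel)
    thus "f v - h v = p (u v + w v)"
      by (simp only: u(2)[OF v] w(2)[OF v] rhom_add[OF P(2) rhom_in[OF u(1) v] rhom_in[OF w(1) v]])
  qed
qed

lemma stable_rel_equiv:
  assumes "rmodule L M" "rmodule L N"
  shows "equiv (rhom L M N) (stable_rel L M N)"
proof (rule equivI)
  show "stable_rel L M N \<subseteq> rhom L M N \<times> rhom L M N"
    unfolding stable_rel_def by auto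
  show "refl_on (rhom L M N) (stable_rel L M N)"
    using stable_rel_refl[OF assms] stable_rel_rhom by (auto simp: refl_on_def)
  show "sym (stable_rel L M N)" by (rule symI) (rule stable_rel_sym[OF assms])
  show "trans (stable_rel L M N)" by (rule transI) (rule stable_rel_trans[OF assms])
qed

lemma stable_rel_comp:
  assumes M: "rmodule L M" and N: "rmodule L N" and K: "rmodule L K"
    and f: "(f, f') \<in> stable_rel L M N" and g: "(g, g') \<in> stable_rel L N K"
  shows "(g \<circ> f, g' \<circ> f') \<in> stable_rel L M K"
proof -
  have r: "f \<in> rhom L M N" "f' \<in> rhom L M N" "g \<in> rhom L N K" "g' \<in> rhom L N K"
    using stable_rel_rhom[OF f] stable_rel_rhom[OF g] by auto
  obtain P u w where P: "projective L P" "u \<in> rhom L M P" "w \<in> rhom L P N"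
    "\<And>v. v \<in> space M \<Longrightarrow> f v - f' v = w (u v)"
    using f unfolding stable_rel_def by blast
  obtain Q s t where Q: "projective L Q" "s \<in> rhom L N Q" "t \<in> rhom L Q K"
    "\<And>v. v \<in> space N \<Longrightarrow> g v - g' v = t (s v)"
    using g unfolding stable_rel_def by blast
  have "(g \<circ> f, g \<circ> f') \<in> stable_rel L M K"
  proof (rule stable_relI[OF rhom_comp[OF r(1,3)] rhom_comp[OF r(2,3)] P(1,2) rhom_comp[OF P(3) r(3)]])
    fix v assume v: "v \<in> space M"
    show "(g \<circ> f) v - (g \<circ> f') v = (g \<circ> w) (u v)"
      by (simp only: o_apply P(4)[OF v, symmetric]
        rhom_minus_val[OF N r(3) rhom_in[OF r(1) v] rhom_in[OF r(2) v]])
  qed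
  moreover have "(g \<circ> f', g' \<circ> f') \<in> stable_rel L M K"
    by (rule stable_relI[OF rhom_comp[OF r(2,3)] rhom_comp[OF r(2,4)] Q(1) rhom_comp[OF r(2) Q(2)] Q(3)])
      (simp only: o_apply Q(4)[OF rhom_in[OF r(2)]])
  ultimately show ?thesis by (rule stable_rel_trans[OF M K])
qed

lemma stable_classI:
  assumes "rmodule L M" "rmodule L N" "(f, g) \<in> stable_rel L M N"
  shows "stable_class L M N f = stable_class L M N g"
  using equiv_class_eq[OF stable_rel_equiv[OF assms(1,2)] assms(3)] .

lemma stable_class_arr: "f \<in> rhom L M N \<Longrightarrow> stable_class L M N f \<in> arr (stmod L) M N"
  by (simp add: quotientI)

lemma arr_stmodE:
  assumes "C \<in> arr (stmod L) M N"
  obtains f where "f \<in> rhom L M N" "C = stable_class L M N f"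
  using assms by (auto elim: quotientE)

lemma stable_class_mem:
  assumes "rmodule L M" "rmodule L N" "f \<in> rhom L M N"
  shows "f \<in> stable_class L M N f"
  using stable_rel_refl[OF assms] by blast

lemma cmp_stmod:
  assumes M: "rmodule L M" and N: "rmodule L N" and K: "rmodule L K"
    and f: "f \<in> rhom L M N" and g: "g \<in> rhom L N K"
  shows "cmp (stmod L) M N K (stable_class L N K g) (stable_class L M N f) = stable_class L M K (g \<circ> f)"
proof -
  have "stable_class L M K (g' \<circ> f') = stable_class L M K (g \<circ> f)"
    if "g' \<in> stable_class L N K g" "f' \<in> stable_class L M N f" for g' f'
  proof -
    have "(g \<circ> f, g' \<circ> f') \<in> stable_rel L M K"
      using that by (intro stable_rel_comp[OF M N K]) auto
    thus ?thesis using stable_classI[OF M K] by blast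
  qed
  hence "(\<Union>g'\<in>stable_class L N K g. \<Union>f'\<in>stable_class L M N f. stable_class L M K (g' \<circ> f'))
       = (\<Union>g'\<in>stable_class L N K g. \<Union>f'\<in>stable_class L M N f. stable_class L M K (g \<circ> f))"
    by (intro SUP_cong refl) simp
  also have "\<dots> = stable_class L M K (g \<circ> f)"
    using stable_class_mem[OF M N f] stable_class_mem[OF N K g] by blast
  finally show ?thesis by (simp add: stmod_def)
qed

lemma category_stmod: "category (stmod L)"
  unfolding category_def
proof (intro conjI ballI)
  fix X assume "X \<in> obj (stmod L)"
  show "idt (stmod L) X \<in> arr (stmod L) X X"
    using stable_class_arr[OF rhom_id] by simp
next
  fix X Y Z f g
  assume o: "X \<in> obj (stmod L)" "Y \<in> obj (stmod L)" "Z \<in> obj (stmod L)"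
    and f: "f \<in> arr (stmod L) X Y" and g: "g \<in> arr (stmod L) Y Z"
  obtain f' where f': "f' \<in> rhom L X Y" "f = stable_class L X Y f'" using arr_stmodE[OF f] .
  obtain g' where g': "g' \<in> rhom L Y Z" "g = stable_class L Y Z g'" using arr_stmodE[OF g] .
  show "cmp (stmod L) X Y Z g f \<in> arr (stmod L) X Z"
    unfolding f' g' using o cmp_stmod[OF _ _ _ f'(1) g'(1)] stable_class_arr[OF rhom_comp[OF f'(1) g'(1)]] by simp
next
  fix X Y f assume o: "X \<in> obj (stmod L)" "Y \<in> obj (stmod L)" and f: "f \<in> arr (stmod L) X Y"
  obtain f' where f': "f' \<in> rhom L X Y" "f = stable_class L X Y f'" using arr_stmodE[OF f] .
  show "cmp (stmod L) X X Y f (idt (stmod L) X) = f"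
    unfolding f' using o cmp_stmod[OF _ _ _ rhom_id f'(1)] by simp
  show "cmp (stmod L) X Y Y (idt (stmod L) Y) f = f"
    unfolding f' using o cmp_stmod[OF _ _ _ f'(1) rhom_id] by simp
next
  fix W X Y Z f g h
  assume o: "W \<in> obj (stmod L)" "X \<in> obj (stmod L)" "Y \<in> obj (stmod L)" "Z \<in> obj (stmod L)"
    and f: "f \<in> arr (stmod L) W X" and g: "g \<in> arr (stmod L) X Y" and h: "h \<in> arr (stmod L) Y Z"
  obtain f' where f': "f' \<in> rhom L W X" "f = stable_class L W X f'" using arr_stmodE[OF f] .
  obtain g' where g': "g' \<in> rhom L X Y" "g = stable_class L X Y g'" using arr_stmodE[OF g] .
  obtain h' where h': "h' \<in> rhom L Y Z" "h = stable_class L Y Z h'" using arr_stmodE[OF h] .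
  have o': "rmodule L W" "rmodule L X" "rmodule L Y" "rmodule L Z" using o by auto
  show "cmp (stmod L) W X Z (cmp (stmod L) X Y Z h g) f = cmp (stmod L) W Y Z h (cmp (stmod L) W X Y g f)"
    unfolding f' g' h'
    by (simp only: cmp_stmod[OF o'(2-4) g'(1) h'(1)] cmp_stmod[OF o'(1-3) f'(1) g'(1)]
      cmp_stmod[OF o'(1,2,4) f'(1) rhom_comp[OF g'(1) h'(1)]]
      cmp_stmod[OF o'(1,3,4) rhom_comp[OF f'(1) g'(1)] h'(1)] comp_assoc)
qed

text \<open>Two maps of presentations that induce stably equal maps on the cokernels induce stably equal
  maps on the kernels: their difference, corrected by a map that vanishes on the kernel, extends to
  the projective module presenting the source.\<close>

lemma ker_lift_stable:
  assumes M: "rmodule L M" and N: "rmodule L N"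
    and P: "projective L P" "p \<in> rhom L P M"
    and Q: "projective L Q" "q \<in> rhom L Q N" "q ` space Q = space N"
    and f: "(f, f') \<in> stable_rel L M N"
    and h: "h \<in> rhom L P Q" "\<And>v. v \<in> space P \<Longrightarrow> q (h v) = f (p v)"
    and h': "h' \<in> rhom L P Q" "\<And>v. v \<in> space P \<Longrightarrow> q (h' v) = f' (p v)"
  shows "(h, h') \<in> stable_rel L (ker_mod P p) (ker_mod Q q)"
proof -
  have Pm: "rmodule L P" and Qm: "rmodule L Q" using P Q projectiveD by auto
  have ff: "f \<in> rhom L M N" "f' \<in> rhom L M N" using stable_rel_rhom[OF f] by auto
  obtain u where u: "u \<in> rhom L M Q" "\<And>v. v \<in> space M \<Longrightarrow> f v - f' v = q (u v)"
    using stable_rel_factor[OF M N Q f] by blast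
  define k where "k = (\<lambda>v. (h v - h' v) - u (p v))"
  have kQ: "k \<in> rhom L P Q"
    unfolding k_def by (rule rhom_diff[OF Qm rhom_diff[OF Qm h(1) h'(1)] rhom_comp'[OF P(2) u(1)]])
  have k: "k \<in> rhom L P (ker_mod Q q)"
  proof (rule rhom_to_ker[OF kQ])
    fix v assume v: "v \<in> space P"
    have i: "h v \<in> space Q" "h' v \<in> space Q" "u (p v) \<in> space Q" "p v \<in> space M"
      using v rhom_in h(1) h'(1) u(1) P(2) by metis+
    have "q (k v) = (f (p v) - f' (p v)) - q (u (p v))"
      unfolding k_def
      by (simp only: rhom_minus_val[OF Qm Q(2)] rmod_diff[OF Qm] i h(2)[OF v] h'(2)[OF v])
    thus "q (k v) = 0" by (simp only: u(2)[OF i(4)] diff_self)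
  qed
  have restr: "g \<in> rhom L (ker_mod P p) (ker_mod Q q)"
    if g: "g \<in> rhom L P Q" "\<And>v. v \<in> space P \<Longrightarrow> q (g v) = F (p v)" and F: "F \<in> rhom L M N" for g F
    using rhom_0[OF M F] g(2) by (intro rhom_to_ker[OF rhom_from_ker[OF g(1)]]) auto
  have incl: "id \<in> rhom L (ker_mod P p) P" by (rule rhom_from_ker[OF rhom_id])
  show ?thesis
  proof (rule stable_relI[OF restr[OF h ff(1)] restr[OF h' ff(2)] P(1) incl k])
    fix v assume "v \<in> space (ker_mod P p)"
    hence v: "v \<in> space P" "p v = 0" by auto
    show "h v - h' v = k (id v)"
      by (simp only: k_def id_apply v(2) rhom_0[OF M u(1)] diff_zero)
  qed
qed

definition PC where "PC M = fst (pcover L M)"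
definition pc where "pc M = snd (pcover L M)"

lemma pcover_props:
  assumes "rmodule L M"
  shows "projective L (PC M)" "pc M \<in> rhom L (PC M) M" "pc M ` space (PC M) = space M"
proof -
  obtain P0 p0 where "projective L P0" "p0 \<in> rhom L P0 M" "p0 ` space P0 = space M"
    using enough[OF assms] by auto
  from projective_cover_exists[OF assms this] obtain P p where "projective_cover L M P p" by auto
  hence "case pcover L M of (P, p) \<Rightarrow> projective_cover L M P p"
    unfolding pcover_def by (intro someI[of "\<lambda>(P, p). projective_cover L M P p" "(P, p)"]) simp
  hence "projective_cover L M (PC M) (pc M)" unfolding PC_def pc_def by (simp add: case_prod_beta)
  thus "projective L (PC M)" "pc M \<in> rhom L (PC M) M" "pc M ` space (PC M) = space M"
    unfolding projective_cover_def by auto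
qed

lemma syz_eq: "syz L M = ker_mod (PC M) (pc M)"
  unfolding syz_def PC_def pc_def by (simp add: case_prod_beta)

lemma rmodule_syz: assumes "rmodule L M" shows "rmodule L (syz L M)"
  unfolding syz_eq
  by (rule rmodule_ker[OF projectiveD[OF pcover_props(1)[OF assms]] assms pcover_props(2)[OF assms]])

lemma cover_lifts_eq:
  "cover_lifts L M N f = {h \<in> rhom L (PC M) (PC N). \<forall>v\<in>space (PC M). pc N (h v) = f (pc M v)}"
  unfolding cover_lifts_def PC_def pc_def by (simp add: case_prod_beta)

lemma cover_lift_exists:
  assumes "rmodule L M" "rmodule L N" "f \<in> rhom L M N"
  obtains h where "h \<in> cover_lifts L M N f"
proof -
  obtain h where "h \<in> rhom L (PC M) (PC N)" "\<And>v. v \<in> space (PC M) \<Longrightarrow> pc N (h v) = f (pc M v)"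
    using projective_lift[OF pcover_props(1)[OF assms(1)] projectiveD[OF pcover_props(1)[OF assms(2)]] assms(2)
        pcover_props(2,3)[OF assms(2)] rhom_comp'[OF pcover_props(2)[OF assms(1)] assms(3)]] by metis
  thus thesis using that unfolding cover_lifts_eq by blast
qed

lemma cover_lifts_stable:
  assumes "rmodule L M" "rmodule L N" "(f, f') \<in> stable_rel L M N"
    "h \<in> cover_lifts L M N f" "h' \<in> cover_lifts L M N f'"
  shows "(h, h') \<in> stable_rel L (syz L M) (syz L N)"
  unfolding syz_eq
  using assms(4,5) unfolding cover_lifts_eq
  by (intro ker_lift_stable[OF assms(1,2) pcover_props(1,2)[OF assms(1)] pcover_props[OF assms(2)] assms(3)]) auto

lemma cover_lifts_rhom:
  assumes "rmodule L M" "rmodule L N" "f \<in> rhom L M N" "h \<in> cover_lifts L M N f"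
  shows "h \<in> rhom L (syz L M) (syz L N)"
  using cover_lifts_stable[OF assms(1,2) stable_rel_refl[OF assms(1-3)] assms(4,4)] stable_rel_rhom by blast

lemma syzygy_on_class:
  assumes M: "rmodule L M" and N: "rmodule L N" and f: "f \<in> rhom L M N" and h: "h \<in> cover_lifts L M N f"
  shows "on_arr (syzygy_functor L) M N (stable_class L M N f) = stable_class L (syz L M) (syz L N) h"
proof -
  have eq: "stable_class L (syz L M) (syz L N) h' = stable_class L (syz L M) (syz L N) h"
    if "f' \<in> stable_class L M N f" "h' \<in> cover_lifts L M N f'" for f' h'
    using cover_lifts_stable[OF M N _ h that(2)] that(1) stable_classI[OF rmodule_syz[OF M] rmodule_syz[OF N]]
    by (metis Image_singleton_iff)
  have ne: "\<exists>h'. h' \<in> cover_lifts L M N f'" if "f' \<in> stable_class L M N f" for f'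
    using cover_lift_exists[OF M N] that stable_rel_rhom by (metis Image_singleton_iff)
  have "(\<Union>h'\<in>cover_lifts L M N f'. stable_class L (syz L M) (syz L N) h') = stable_class L (syz L M) (syz L N) h"
    if "f' \<in> stable_class L M N f" for f'
    using eq[OF that] ne[OF that] by blast
  hence "(\<Union>f'\<in>stable_class L M N f. \<Union>h'\<in>cover_lifts L M N f'. stable_class L (syz L M) (syz L N) h')
      = (\<Union>f'\<in>stable_class L M N f. stable_class L (syz L M) (syz L N) h)"
    by (intro SUP_cong refl) simp
  also have "\<dots> = stable_class L (syz L M) (syz L N) h"
    using stable_class_mem[OF M N f] by blast
  finally show ?thesis by (simp add: syzygy_functor_def)
qed

lemma on_obj_syzygy [simp]: "on_obj (syzygy_functor L) M = syz L M"
  by (simp add: syzygy_functor_def)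

lemma is_functor_syzygy: "is_functor (stmod L) (stmod L) (syzygy_functor L)"
  unfolding is_functor_def
proof (intro conjI ballI category_stmod)
  fix X assume X: "X \<in> obj (stmod L)"
  show "on_obj (syzygy_functor L) X \<in> obj (stmod L)" using X rmodule_syz by simp
  have X': "rmodule L X" using X by simp
  have id: "id \<in> cover_lifts L X X id" unfolding cover_lifts_eq using rhom_id by auto
  show "on_arr (syzygy_functor L) X X (idt (stmod L) X) = idt (stmod L) (on_obj (syzygy_functor L) X)"
    using syzygy_on_class[OF X' X' rhom_id id] by simp
next
  fix X Y C assume o: "X \<in> obj (stmod L)" "Y \<in> obj (stmod L)" and C: "C \<in> arr (stmod L) X Y"
  have X: "rmodule L X" and Y: "rmodule L Y" using o by auto
  obtain f where f: "f \<in> rhom L X Y" "C = stable_class L X Y f" using arr_stmodE[OF C] .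
  obtain h where h: "h \<in> cover_lifts L X Y f" using cover_lift_exists[OF X Y f(1)] .
  show "on_arr (syzygy_functor L) X Y C \<in> arr (stmod L) (on_obj (syzygy_functor L) X) (on_obj (syzygy_functor L) Y)"
    unfolding f(2) syzygy_on_class[OF X Y f(1) h] on_obj_syzygy
    by (rule stable_class_arr[OF cover_lifts_rhom[OF X Y f(1) h]])
next
  fix X Y Z C D assume o: "X \<in> obj (stmod L)" "Y \<in> obj (stmod L)" "Z \<in> obj (stmod L)"
    and C: "C \<in> arr (stmod L) X Y" and D: "D \<in> arr (stmod L) Y Z"
  have X: "rmodule L X" and Y: "rmodule L Y" and Z: "rmodule L Z" using o by auto
  obtain f where f: "f \<in> rhom L X Y" "C = stable_class L X Y f" using arr_stmodE[OF C] .
  obtain h where h: "h \<in> cover_lifts L X Y f" using cover_lift_exists[OF X Y f(1)] .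
  obtain g where g: "g \<in> rhom L Y Z" "D = stable_class L Y Z g" using arr_stmodE[OF D] .
  obtain k where k: "k \<in> cover_lifts L Y Z g" using cover_lift_exists[OF Y Z g(1)] .
  have h': "h \<in> rhom L (PC X) (PC Y)" "\<And>v. v \<in> space (PC X) \<Longrightarrow> pc Y (h v) = f (pc X v)"
    and k': "k \<in> rhom L (PC Y) (PC Z)" "\<And>v. v \<in> space (PC Y) \<Longrightarrow> pc Z (k v) = g (pc Y v)"
    using h k unfolding cover_lifts_eq by auto
  have kh: "k \<circ> h \<in> cover_lifts L X Z (g \<circ> f)"
    unfolding cover_lifts_eq using h'(2) k'(2) rhom_in[OF h'(1)] rhom_comp[OF h'(1) k'(1)] by auto
  show "on_arr (syzygy_functor L) X Z (cmp (stmod L) X Y Z D C) =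
          cmp (stmod L) (on_obj (syzygy_functor L) X) (on_obj (syzygy_functor L) Y) (on_obj (syzygy_functor L) Z)
            (on_arr (syzygy_functor L) Y Z D) (on_arr (syzygy_functor L) X Y C)"
    unfolding f(2) g(2) cmp_stmod[OF X Y Z f(1) g(1)] syzygy_on_class[OF X Y f(1) h]
      syzygy_on_class[OF Y Z g(1) k] syzygy_on_class[OF X Z rhom_comp[OF f(1) g(1)] kh] on_obj_syzygy
    by (rule cmp_stmod[OF rmodule_syz[OF X] rmodule_syz[OF Y] rmodule_syz[OF Z]
          cover_lifts_rhom[OF X Y f(1) h] cover_lifts_rhom[OF Y Z g(1) k], symmetric])
qed

text \<open>Two presentations of \<open>M\<close> are compared by lifting the identity of \<open>M\<close> in both directions. The lifts
  are not unique, but by \<open>ker_lift_stable\<close> they agree stably on the kernels; so any choice gives a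
  stable isomorphism from the syzygy to the other kernel, and the choice does not affect naturality.\<close>

definition compare where
  "compare M Q q = (SOME c. c \<in> rhom L (PC M) Q \<and> (\<forall>v\<in>space (PC M). q (c v) = pc M v))"

lemma compare_props:
  assumes M: "rmodule L M" and Q: "projective L Q" "q \<in> rhom L Q M" "q ` space Q = space M"
  shows "compare M Q q \<in> rhom L (PC M) Q" "\<And>v. v \<in> space (PC M) \<Longrightarrow> q (compare M Q q v) = pc M v"
proof -
  obtain c where "c \<in> rhom L (PC M) Q" "\<And>v. v \<in> space (PC M) \<Longrightarrow> q (c v) = pc M v"
    using projective_lift[OF pcover_props(1)[OF M] projectiveD[OF Q(1)] M Q(2,3) pcover_props(2)[OF M]] by metis
  hence "\<exists>c. c \<in> rhom L (PC M) Q \<and> (\<forall>v\<in>space (PC M). q (c v) = pc M v)" by blast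
  from someI_ex[OF this]
  show "compare M Q q \<in> rhom L (PC M) Q" "\<And>v. v \<in> space (PC M) \<Longrightarrow> q (compare M Q q v) = pc M v"
    unfolding compare_def by auto
qed

lemma compare_iso:
  assumes M: "rmodule L M" and Q: "projective L Q" "q \<in> rhom L Q M" "q ` space Q = space M"
  shows "compare M Q q \<in> rhom L (syz L M) (ker_mod Q q)"
    and "is_iso (stmod L) (syz L M) (ker_mod Q q) (stable_class L (syz L M) (ker_mod Q q) (compare M Q q))"
proof -
  let ?c = "compare M Q q"
  note P = pcover_props[OF M]
  note c = compare_props[OF M Q]
  note idst = stable_rel_refl[OF M M rhom_id]
  obtain b where b: "b \<in> rhom L Q (PC M)" "\<And>v. v \<in> space Q \<Longrightarrow> pc M (b v) = q v"
    using projective_lift[OF Q(1) projectiveD[OF P(1)] M P(2,3) Q(2)] by metis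
  have S: "rmodule L (syz L M)" "rmodule L (ker_mod Q q)"
    using rmodule_syz[OF M] rmodule_ker[OF projectiveD[OF Q(1)] M Q(2)] by auto
  have "(?c, ?c) \<in> stable_rel L (syz L M) (ker_mod Q q)"
    unfolding syz_eq using c by (intro ker_lift_stable[OF M M P(1,2) Q idst]) auto
  thus c': "?c \<in> rhom L (syz L M) (ker_mod Q q)" using stable_rel_rhom by blast
  have "(b, b) \<in> stable_rel L (ker_mod Q q) (syz L M)"
    unfolding syz_eq using b by (intro ker_lift_stable[OF M M Q(1,2) P idst]) auto
  hence b': "b \<in> rhom L (ker_mod Q q) (syz L M)" using stable_rel_rhom by blast
  have bc: "(b \<circ> ?c, id) \<in> stable_rel L (syz L M) (syz L M)"
    unfolding syz_eq using b c rhom_in[OF c(1)]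
    by (intro ker_lift_stable[OF M M P(1,2) P idst]) (auto intro: rhom_id rhom_comp)
  have cb: "(?c \<circ> b, id) \<in> stable_rel L (ker_mod Q q) (ker_mod Q q)"
    using b c rhom_in[OF b(1)]
    by (intro ker_lift_stable[OF M M Q(1,2) Q idst]) (auto intro: rhom_id rhom_comp)
  show "is_iso (stmod L) (syz L M) (ker_mod Q q) (stable_class L (syz L M) (ker_mod Q q) ?c)"
    unfolding is_iso_def
  proof (intro conjI bexI)
    show "stable_class L (ker_mod Q q) (syz L M) b \<in> arr (stmod L) (ker_mod Q q) (syz L M)"
      by (rule stable_class_arr[OF b'])
    show "stable_class L (syz L M) (ker_mod Q q) ?c \<in> arr (stmod L) (syz L M) (ker_mod Q q)"
      by (rule stable_class_arr[OF c'])
    show "cmp (stmod L) (syz L M) (ker_mod Q q) (syz L M) (stable_class L (ker_mod Q q) (syz L M) b)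
            (stable_class L (syz L M) (ker_mod Q q) ?c) = idt (stmod L) (syz L M)"
      using cmp_stmod[OF S(1,2,1) c' b'] stable_classI[OF S(1,1) bc] by simp
    show "cmp (stmod L) (ker_mod Q q) (syz L M) (ker_mod Q q) (stable_class L (syz L M) (ker_mod Q q) ?c)
            (stable_class L (ker_mod Q q) (syz L M) b) = idt (stmod L) (ker_mod Q q)"
      using cmp_stmod[OF S(2,1,2) b' c'] stable_classI[OF S(2,2) cb] by simp
  qed
qed

lemma compare_natural:
  assumes M: "rmodule L M" and Q: "projective L Q" "q \<in> rhom L Q M" "q ` space Q = space M"
    and M': "rmodule L M'" and Q': "projective L Q'" "q' \<in> rhom L Q' M'" "q' ` space Q' = space M'"
    and f: "f \<in> rhom L M M'" and F: "F \<in> rhom L Q Q'" "\<And>v. v \<in> space Q \<Longrightarrow> q' (F v) = f (q v)"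
  shows "F \<in> rhom L (ker_mod Q q) (ker_mod Q' q')"
    and "cmp (stmod L) (syz L M) (syz L M') (ker_mod Q' q')
      (stable_class L (syz L M') (ker_mod Q' q') (compare M' Q' q'))
      (on_arr (syzygy_functor L) M M' (stable_class L M M' f)) =
     cmp (stmod L) (syz L M) (ker_mod Q q) (ker_mod Q' q')
      (stable_class L (ker_mod Q q) (ker_mod Q' q') F)
      (stable_class L (syz L M) (ker_mod Q q) (compare M Q q))"
proof -
  note P = pcover_props[OF M]
  note c = compare_props[OF M Q]
  note c' = compare_props[OF M' Q']
  note fst = stable_rel_refl[OF M M' f]
  obtain h where h: "h \<in> cover_lifts L M M' f" using cover_lift_exists[OF M M' f] .
  have h': "h \<in> rhom L (PC M) (PC M')" "\<And>v. v \<in> space (PC M) \<Longrightarrow> pc M' (h v) = f (pc M v)"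
    using h unfolding cover_lifts_eq by auto
  have S: "rmodule L (syz L M)" "rmodule L (syz L M')" "rmodule L (ker_mod Q q)" "rmodule L (ker_mod Q' q')"
    using rmodule_syz M M' rmodule_ker[OF projectiveD] Q Q' by auto
  have "(F, F) \<in> stable_rel L (ker_mod Q q) (ker_mod Q' q')"
    using F by (intro ker_lift_stable[OF M M' Q(1,2) Q' fst]) auto
  thus F': "F \<in> rhom L (ker_mod Q q) (ker_mod Q' q')" using stable_rel_rhom by blast
  have "(compare M' Q' q' \<circ> h, F \<circ> compare M Q q) \<in> stable_rel L (syz L M) (ker_mod Q' q')"
    unfolding syz_eq using F c c' h' rhom_in[OF c(1)] rhom_in[OF h'(1)]
    by (intro ker_lift_stable[OF M M' P(1,2) Q' fst]) (auto intro: rhom_comp)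
  thus "cmp (stmod L) (syz L M) (syz L M') (ker_mod Q' q')
      (stable_class L (syz L M') (ker_mod Q' q') (compare M' Q' q'))
      (on_arr (syzygy_functor L) M M' (stable_class L M M' f)) =
     cmp (stmod L) (syz L M) (ker_mod Q q) (ker_mod Q' q')
      (stable_class L (ker_mod Q q) (ker_mod Q' q') F)
      (stable_class L (syz L M) (ker_mod Q q) (compare M Q q))"
    unfolding syzygy_on_class[OF M M' f h]
    by (simp only: cmp_stmod[OF S(1,2,4) cover_lifts_rhom[OF M M' f h] compare_iso(1)[OF M' Q']]
      cmp_stmod[OF S(1,3,4) compare_iso(1)[OF M Q] F'] stable_classI[OF S(1,4)])
qed

end

section \<open>Iterated syzygies\<close>

lemma is_iso_comp:
  assumes C: "category C" and X: "X \<in> obj C" and Y: "Y \<in> obj C" and Z: "Z \<in> obj C"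
    and f: "is_iso C X Y f" and g: "is_iso C Y Z g"
  shows "is_iso C X Z (cmp C X Y Z g f)"
proof -
  have assoc: "cmp C W A D (cmp C A B D h k) m = cmp C W B D h (cmp C W A B k m)"
    if "W \<in> obj C" "A \<in> obj C" "B \<in> obj C" "D \<in> obj C" "m \<in> arr C W A" "k \<in> arr C A B" "h \<in> arr C B D"
    for W A B D m k h using C that unfolding category_def by blast
  have cl: "cmp C A B D k m \<in> arr C A D"
    if "A \<in> obj C" "B \<in> obj C" "D \<in> obj C" "m \<in> arr C A B" "k \<in> arr C B D" for A B D m k
    using C that unfolding category_def by blast
  have idl: "cmp C A B B (idt C B) m = m" if "A \<in> obj C" "B \<in> obj C" "m \<in> arr C A B" for A B m
    using C that unfolding category_def by blast
  obtain f' where f': "f \<in> arr C X Y" "f' \<in> arr C Y X" "cmp C X Y X f' f = idt C X" "cmp C Y X Y f f' = idt C Y"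
    using f unfolding is_iso_def by blast
  obtain g' where g': "g \<in> arr C Y Z" "g' \<in> arr C Z Y" "cmp C Y Z Y g' g = idt C Y" "cmp C Z Y Z g g' = idt C Z"
    using g unfolding is_iso_def by blast
  let ?h = "cmp C X Y Z g f" and ?h' = "cmp C Z Y X f' g'"
  have "cmp C X Z X ?h' ?h = cmp C X Y X f' (cmp C X Z Y g' ?h)"
    by (rule assoc[OF X Z Y X cl[OF X Y Z f'(1) g'(1)] g'(2) f'(2)])
  also have "cmp C X Z Y g' ?h = cmp C X Y Y (cmp C Y Z Y g' g) f"
    by (rule assoc[OF X Y Z Y f'(1) g'(1) g'(2), symmetric])
  finally have 1: "cmp C X Z X ?h' ?h = idt C X" using f'(3) g'(3) idl[OF X Y f'(1)] by simp
  have "cmp C Z X Z ?h ?h' = cmp C Z Y Z g (cmp C Z X Y f ?h')"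
    by (rule assoc[OF Z X Y Z cl[OF Z Y X g'(2) f'(2)] f'(1) g'(1)])
  also have "cmp C Z X Y f ?h' = cmp C Z Y Y (cmp C Y X Y f f') g'"
    by (rule assoc[OF Z Y X Y g'(2) f'(2) f'(1), symmetric])
  finally have 2: "cmp C Z X Z ?h ?h' = idt C Z" using f'(4) g'(4) idl[OF Z Y g'(2)] by simp
  show ?thesis
    unfolding is_iso_def using 1 2 cl[OF X Y Z f'(1) g'(1)] cl[OF Z Y X g'(2) f'(2)] by blast
qed

lemma functor_iso:
  assumes F: "is_functor C D F" and X: "X \<in> obj C" and Y: "Y \<in> obj C" and f: "is_iso C X Y f"
  shows "is_iso D (on_obj F X) (on_obj F Y) (on_arr F X Y f)"
proof -
  obtain f' where f': "f \<in> arr C X Y" "f' \<in> arr C Y X" "cmp C X Y X f' f = idt C X" "cmp C Y X Y f f' = idt C Y"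
    using f unfolding is_iso_def by blast
  have "on_arr F X Y f \<in> arr D (on_obj F X) (on_obj F Y)" "on_arr F Y X f' \<in> arr D (on_obj F Y) (on_obj F X)"
    using F X Y f' unfolding is_functor_def by blast+
  moreover have "cmp D (on_obj F X) (on_obj F Y) (on_obj F X) (on_arr F Y X f') (on_arr F X Y f)
      = on_arr F X X (cmp C X Y X f' f)" "cmp D (on_obj F Y) (on_obj F X) (on_obj F Y) (on_arr F X Y f) (on_arr F Y X f')
      = on_arr F Y Y (cmp C Y X Y f f')"
    using F X Y f'(1,2) unfolding is_functor_def by metis+
  moreover have "on_arr F X X (idt C X) = idt D (on_obj F X)" "on_arr F Y Y (idt C Y) = idt D (on_obj F Y)"
    using F X Y unfolding is_functor_def by blast+
  ultimately show ?thesis unfolding is_iso_def using f'(3,4) by metis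
qed

lemma is_functor_func_pow:
  assumes F: "is_functor C C F"
  shows "is_functor C C (func_pow F m)"
proof (induction m)
  case 0
  show ?case using F unfolding is_functor_def by simp
next
  case (Suc m)
  let ?G = "func_pow F m"
  have C: "category C" using F unfolding is_functor_def by blast
  have G1: "\<And>X. X \<in> obj C \<Longrightarrow> on_obj ?G X \<in> obj C"
    and G2: "\<And>X Y f. X \<in> obj C \<Longrightarrow> Y \<in> obj C \<Longrightarrow> f \<in> arr C X Y \<Longrightarrow> on_arr ?G X Y f \<in> arr C (on_obj ?G X) (on_obj ?G Y)"
    and G3: "\<And>X. X \<in> obj C \<Longrightarrow> on_arr ?G X X (idt C X) = idt C (on_obj ?G X)"
    and G4: "\<And>X Y Z f g. X \<in> obj C \<Longrightarrow> Y \<in> obj C \<Longrightarrow> Z \<in> obj C \<Longrightarrow> f \<in> arr C X Y \<Longrightarrow> g \<in> arr C Y Z \<Longrightarrow>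
      on_arr ?G X Z (cmp C X Y Z g f) = cmp C (on_obj ?G X) (on_obj ?G Y) (on_obj ?G Z) (on_arr ?G Y Z g) (on_arr ?G X Y f)"
    using Suc unfolding is_functor_def by blast+
  have F1: "\<And>X. X \<in> obj C \<Longrightarrow> on_obj F X \<in> obj C"
    and F2: "\<And>X Y f. X \<in> obj C \<Longrightarrow> Y \<in> obj C \<Longrightarrow> f \<in> arr C X Y \<Longrightarrow> on_arr F X Y f \<in> arr C (on_obj F X) (on_obj F Y)"
    and F3: "\<And>X. X \<in> obj C \<Longrightarrow> on_arr F X X (idt C X) = idt C (on_obj F X)"
    and F4: "\<And>X Y Z f g. X \<in> obj C \<Longrightarrow> Y \<in> obj C \<Longrightarrow> Z \<in> obj C \<Longrightarrow> f \<in> arr C X Y \<Longrightarrow> g \<in> arr C Y Z \<Longrightarrow>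
      on_arr F X Z (cmp C X Y Z g f) = cmp C (on_obj F X) (on_obj F Y) (on_obj F Z) (on_arr F Y Z g) (on_arr F X Y f)"
    using F unfolding is_functor_def by blast+
  show ?case
    unfolding is_functor_def by (simp add: C G1 G2 G3 G4 F1 F2 F3 F4)
qed

context enough_projectives
begin

text \<open>A sequence of natural short exact sequences \<open>0 \<rightarrow> Z (m+1) M \<rightarrow> K m M \<rightarrow> Z m M \<rightarrow> 0\<close> with
  projective middle terms, starting from \<open>Z 0 M = M\<close>.\<close>

definition resolves where
  "resolves r Z K del Kmap \<longleftrightarrow>
    (\<forall>M. rmodule L M \<longrightarrow> Z 0 M = M \<and>
      (\<forall>m<r. projective L (K m M) \<and> del m M \<in> rhom L (K m M) (Z m M) \<and>
         del m M ` space (K m M) = space (Z m M) \<and> Z (Suc m) M = ker_mod (K m M) (del m M))) \<and>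
    (\<forall>M N f. rmodule L M \<longrightarrow> rmodule L N \<longrightarrow> f \<in> rhom L M N \<longrightarrow>
      (\<forall>m<r. Kmap m f \<in> rhom L (K m M) (K m N) \<and>
         (\<forall>v\<in>space (K m M). del m N (Kmap m f v) = (case m of 0 \<Rightarrow> f | Suc i \<Rightarrow> Kmap i f) (del m M v))))"

text \<open>Dimension shifting: apply \<open>\<Omega>\<close> to the isomorphism from \<open>\<Omega>\<^sup>m M\<close> to \<open>Z m M\<close> and compose it with the
  comparison from \<open>\<Omega> (Z m M)\<close> to \<open>Z (m+1) M\<close>. The map induced on \<open>Z (m+1)\<close> by a homomorphism \<open>f\<close> is
  the map on \<open>K m\<close>, restricted to the kernel; on \<open>Z 0\<close> it is \<open>f\<close> itself, whence the case distinction.\<close>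

lemma iterated_syzygy:
  assumes R: "resolves r Z K del Kmap" and m: "m \<le> r"
  shows "(\<forall>M. rmodule L M \<longrightarrow> rmodule L (Z m M)) \<and>
    (\<forall>M N f. rmodule L M \<longrightarrow> rmodule L N \<longrightarrow> f \<in> rhom L M N \<longrightarrow>
       (case m of 0 \<Rightarrow> f | Suc i \<Rightarrow> Kmap i f) \<in> rhom L (Z m M) (Z m N)) \<and>
    (\<exists>\<eta>. (\<forall>M. rmodule L M \<longrightarrow> is_iso (stmod L) (on_obj (func_pow (syzygy_functor L) m) M) (Z m M) (\<eta> M)) \<and>
      (\<forall>M N f. rmodule L M \<longrightarrow> rmodule L N \<longrightarrow> f \<in> rhom L M N \<longrightarrow>
        cmp (stmod L) (on_obj (func_pow (syzygy_functor L) m) M) (on_obj (func_pow (syzygy_functor L) m) N) (Z m N)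
          (\<eta> N) (on_arr (func_pow (syzygy_functor L) m) M N (stable_class L M N f)) =
        cmp (stmod L) (on_obj (func_pow (syzygy_functor L) m) M) (Z m M) (Z m N)
          (stable_class L (Z m M) (Z m N) (case m of 0 \<Rightarrow> f | Suc i \<Rightarrow> Kmap i f)) (\<eta> M)))"
  using m
proof (induction m)
  case 0
  have Z0: "Z 0 M = M" if "rmodule L M" for M using R that unfolding resolves_def by blast
  let ?\<eta> = "\<lambda>M. stable_class L M M id"
  have "is_iso (stmod L) M M (?\<eta> M)" if M: "rmodule L M" for M
    unfolding is_iso_def using cmp_stmod[OF M M M rhom_id rhom_id] stable_class_arr[OF rhom_id]
    by (auto intro!: bexI[of _ "stable_class L M M id"])
  moreover have "cmp (stmod L) M N N (?\<eta> N) (stable_class L M N f) = cmp (stmod L) M M N (stable_class L M N f) (?\<eta> M)"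
    if M: "rmodule L M" and N: "rmodule L N" and f: "f \<in> rhom L M N" for M N f
    using cmp_stmod[OF M N N f rhom_id] cmp_stmod[OF M M N rhom_id f] by simp
  ultimately show ?case using Z0 by (intro conjI exI[of _ ?\<eta>]) simp_all
next
  case (Suc m)
  let ?S = "stmod L" and ?O = "syzygy_functor L"
  let ?E = "\<lambda>M. on_obj (func_pow ?O m) M"
  let ?zf = "\<lambda>f. (case m of 0 \<Rightarrow> f | Suc i \<Rightarrow> Kmap i f)"
  have mr: "m < r" "m \<le> r" using Suc.prems by auto
  note IH = Suc.IH[OF mr(2)]
  have Zm: "rmodule L (Z m M)" if "rmodule L M" for M using IH that by blast
  have zf: "?zf f \<in> rhom L (Z m M) (Z m N)" if "rmodule L M" "rmodule L N" "f \<in> rhom L M N" for M N f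
    using IH that by blast
  obtain \<eta> where \<eta>: "\<And>M. rmodule L M \<Longrightarrow> is_iso ?S (?E M) (Z m M) (\<eta> M)"
    and nat: "\<And>M N f. rmodule L M \<Longrightarrow> rmodule L N \<Longrightarrow> f \<in> rhom L M N \<Longrightarrow>
        cmp ?S (?E M) (?E N) (Z m N) (\<eta> N) (on_arr (func_pow ?O m) M N (stable_class L M N f)) =
        cmp ?S (?E M) (Z m M) (Z m N) (stable_class L (Z m M) (Z m N) (?zf f)) (\<eta> M)"
    using IH by blast
  have K: "projective L (K m M)" "del m M \<in> rhom L (K m M) (Z m M)" "del m M ` space (K m M) = space (Z m M)"
    "Z (Suc m) M = ker_mod (K m M) (del m M)" if "rmodule L M" for M
    using R mr(1) that unfolding resolves_def by blast+
  have Kf: "Kmap m f \<in> rhom L (K m M) (K m N)"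
    "\<And>v. v \<in> space (K m M) \<Longrightarrow> del m N (Kmap m f v) = ?zf f (del m M v)"
    if "rmodule L M" "rmodule L N" "f \<in> rhom L M N" for M N f
    using R mr(1) that unfolding resolves_def by blast+
  have Zs: "rmodule L (Z (Suc m) M)" if M: "rmodule L M" for M
    unfolding K(4)[OF M] by (rule rmodule_ker[OF projectiveD[OF K(1)[OF M]] Zm[OF M] K(2)[OF M]])
  have Em: "rmodule L (?E M)" if "rmodule L M" for M
    using is_functor_func_pow[OF is_functor_syzygy, of m] that unfolding is_functor_def by simp
  have Ef: "on_arr (func_pow ?O m) M N (stable_class L M N f) \<in> arr ?S (?E M) (?E N)"
    if "rmodule L M" "rmodule L N" "f \<in> rhom L M N" for M N f
    using is_functor_func_pow[OF is_functor_syzygy, of m] that stable_class_arr[OF that(3)]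
    unfolding is_functor_def cat_simps_stmod(1) by blast
  define c where "c M = stable_class L (syz L (Z m M)) (Z (Suc m) M) (compare (Z m M) (K m M) (del m M))" for M
  have ciso: "is_iso ?S (syz L (Z m M)) (Z (Suc m) M) (c M)" if M: "rmodule L M" for M
    unfolding c_def K(4)[OF M] by (rule compare_iso(2)[OF Zm[OF M] K(1-3)[OF M]])
  have zfS: "Kmap m f \<in> rhom L (Z (Suc m) M) (Z (Suc m) N)" 
    if M: "rmodule L M" and N: "rmodule L N" and f: "f \<in> rhom L M N" for M N f
    unfolding K(4)[OF M] K(4)[OF N]
    by (rule compare_natural(1)[OF Zm[OF M] K(1-3)[OF M] Zm[OF N] K(1-3)[OF N] zf[OF M N f] Kf[OF M N f]])
  have cnat: "cmp ?S (syz L (Z m M)) (syz L (Z m N)) (Z (Suc m) N) (c N)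
      (on_arr ?O (Z m M) (Z m N) (stable_class L (Z m M) (Z m N) (?zf f))) =
     cmp ?S (syz L (Z m M)) (Z (Suc m) M) (Z (Suc m) N)
      (stable_class L (Z (Suc m) M) (Z (Suc m) N) (Kmap m f)) (c M)"
    if M: "rmodule L M" and N: "rmodule L N" and f: "f \<in> rhom L M N" for M N f
    unfolding c_def K(4)[OF M] K(4)[OF N]
    by (rule compare_natural(2)[OF Zm[OF M] K(1-3)[OF M] Zm[OF N] K(1-3)[OF N] zf[OF M N f] Kf[OF M N f]])
  define \<theta> where "\<theta> M = cmp ?S (syz L (?E M)) (syz L (Z m M)) (Z (Suc m) M) (c M) (on_arr ?O (?E M) (Z m M) (\<eta> M))" for M
  have O\<eta>: "is_iso ?S (syz L (?E M)) (syz L (Z m M)) (on_arr ?O (?E M) (Z m M) (\<eta> M))" if M: "rmodule L M" for M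
    using functor_iso[OF is_functor_syzygy _ _ \<eta>[OF M]] Em[OF M] Zm[OF M] by simp
  have \<theta>iso: "is_iso ?S (syz L (?E M)) (Z (Suc m) M) (\<theta> M)" if M: "rmodule L M" for M
    unfolding \<theta>_def
    using is_iso_comp[OF category_stmod _ _ _ O\<eta>[OF M] ciso[OF M]] rmodule_syz Em[OF M] Zm[OF M] Zs[OF M] by simp
  have assoc: "cmp ?S W A D (cmp ?S A B D h k) j = cmp ?S W B D h (cmp ?S W A B k j)"
    if "rmodule L W" "rmodule L A" "rmodule L B" "rmodule L D" "j \<in> arr ?S W A" "k \<in> arr ?S A B" "h \<in> arr ?S B D"
    for W A B D j k h
    using category_stmod[unfolded category_def, THEN conjunct2, THEN conjunct2, THEN conjunct2,
        rule_format, of W A B D j k h] that by simp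
  have Ocmp: "on_arr ?O A D (cmp ?S A B D k j) = cmp ?S (syz L A) (syz L B) (syz L D) (on_arr ?O B D k) (on_arr ?O A B j)"
    if "rmodule L A" "rmodule L B" "rmodule L D" "j \<in> arr ?S A B" "k \<in> arr ?S B D" for A B D j k
    using is_functor_syzygy[unfolded is_functor_def, THEN conjunct2, THEN conjunct2, THEN conjunct2,
        THEN conjunct2, THEN conjunct2, rule_format, of A B D j k] that by simp
  have Oarr: "on_arr ?O A B j \<in> arr ?S (syz L A) (syz L B)" if "rmodule L A" "rmodule L B" "j \<in> arr ?S A B" for A B j
    using is_functor_syzygy that unfolding is_functor_def cat_simps_stmod(1) on_obj_syzygy by blast
  have \<theta>nat: "cmp ?S (syz L (?E M)) (syz L (?E N)) (Z (Suc m) N) (\<theta> N)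
      (on_arr ?O (?E M) (?E N) (on_arr (func_pow ?O m) M N (stable_class L M N f))) =
     cmp ?S (syz L (?E M)) (Z (Suc m) M) (Z (Suc m) N) (stable_class L (Z (Suc m) M) (Z (Suc m) N) (Kmap m f)) (\<theta> M)"
    if M: "rmodule L M" and N: "rmodule L N" and f: "f \<in> rhom L M N" for M N f
  proof -
    note sy = rmodule_syz
    have ar: "\<eta> M \<in> arr ?S (?E M) (Z m M)" "\<eta> N \<in> arr ?S (?E N) (Z m N)"
      "c M \<in> arr ?S (syz L (Z m M)) (Z (Suc m) M)" "c N \<in> arr ?S (syz L (Z m N)) (Z (Suc m) N)"
      using \<eta>[OF M] \<eta>[OF N] ciso[OF M] ciso[OF N] unfolding is_iso_def by auto
    note zfa = stable_class_arr[OF zf[OF M N f]] and zfSa = stable_class_arr[OF zfS[OF M N f]]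
    note e = Em[OF M] Em[OF N] Zm[OF M] Zm[OF N] Zs[OF M] Zs[OF N]
    have "cmp ?S (syz L (?E M)) (syz L (?E N)) (Z (Suc m) N) (\<theta> N)
      (on_arr ?O (?E M) (?E N) (on_arr (func_pow ?O m) M N (stable_class L M N f)))
      = cmp ?S (syz L (?E M)) (syz L (Z m N)) (Z (Suc m) N) (c N)
          (on_arr ?O (?E M) (Z m N) (cmp ?S (?E M) (?E N) (Z m N) (\<eta> N) (on_arr (func_pow ?O m) M N (stable_class L M N f))))"
      unfolding \<theta>_def
      by (simp only: assoc[OF sy[OF e(1)] sy[OF e(2)] sy[OF e(4)] e(6) Oarr[OF e(1,2) Ef[OF M N f]] Oarr[OF e(2,4) ar(2)] ar(4)]
          Ocmp[OF e(1,2,4) Ef[OF M N f] ar(2)])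
    also have "\<dots> = cmp ?S (syz L (?E M)) (syz L (Z m M)) (Z (Suc m) N)
          (cmp ?S (syz L (Z m M)) (syz L (Z m N)) (Z (Suc m) N) (c N)
            (on_arr ?O (Z m M) (Z m N) (stable_class L (Z m M) (Z m N) (?zf f))))
          (on_arr ?O (?E M) (Z m M) (\<eta> M))"
      by (simp only: nat[OF M N f] Ocmp[OF e(1,3,4) ar(1) zfa]
          assoc[OF sy[OF e(1)] sy[OF e(3)] sy[OF e(4)] e(6) Oarr[OF e(1,3) ar(1)] Oarr[OF e(3,4) zfa] ar(4)])
    also have "\<dots> = cmp ?S (syz L (?E M)) (Z (Suc m) M) (Z (Suc m) N)
        (stable_class L (Z (Suc m) M) (Z (Suc m) N) (Kmap m f)) (\<theta> M)"
      unfolding \<theta>_def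
      by (simp only: cnat[OF M N f]
          assoc[OF sy[OF e(1)] sy[OF e(3)] e(5,6) Oarr[OF e(1,3) ar(1)] ar(3) zfSa])
    finally show ?thesis .
  qed
  show ?case
    using Zs zfS \<theta>iso \<theta>nat by (intro conjI exI[of _ \<theta>]) simp_all
qed

text \<open>The comparison with the last kernel, followed by an isomorphism \<open>\<tau>\<close> of honest modules from that kernel
  to the values of \<open>F\<close>. On homomorphisms \<open>F\<close> does not change the underlying map, as is the case for a
  twist.\<close>

theorem syzygy_power_iso:
  assumes R: "resolves r Z K del Kmap"
    and F: "is_functor (stmod L) (stmod L) F"
    and \<tau>: "\<And>M. rmodule L M \<Longrightarrow> \<tau> M \<in> rhom L (Z r M) (on_obj F M)"
    and \<sigma>: "\<And>M. rmodule L M \<Longrightarrow> \<sigma> M \<in> rhom L (on_obj F M) (Z r M)"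
    and \<sigma>\<tau>: "\<And>M v. rmodule L M \<Longrightarrow> v \<in> space (Z r M) \<Longrightarrow> \<sigma> M (\<tau> M v) = v"
    and \<tau>\<sigma>: "\<And>M v. rmodule L M \<Longrightarrow> v \<in> space (on_obj F M) \<Longrightarrow> \<tau> M (\<sigma> M v) = v"
    and Fhom: "\<And>M N f. rmodule L M \<Longrightarrow> rmodule L N \<Longrightarrow> f \<in> rhom L M N \<Longrightarrow> f \<in> rhom L (on_obj F M) (on_obj F N) \<and>
       on_arr F M N (stable_class L M N f) = stable_class L (on_obj F M) (on_obj F N) f"
    and \<tau>nat: "\<And>M N f v. rmodule L M \<Longrightarrow> rmodule L N \<Longrightarrow> f \<in> rhom L M N \<Longrightarrow> v \<in> space (Z r M) \<Longrightarrow>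
       \<tau> N ((case r of 0 \<Rightarrow> f | Suc i \<Rightarrow> Kmap i f) v) = f (\<tau> M v)"
  shows "naturally_isomorphic (stmod L) (stmod L) (func_pow (syzygy_functor L) r) F"
proof -
  let ?S = "stmod L" and ?G = "func_pow (syzygy_functor L) r"
  let ?E = "\<lambda>M. on_obj ?G M"
  let ?zf = "\<lambda>f. (case r of 0 \<Rightarrow> f | Suc i \<Rightarrow> Kmap i f)"
  note I = iterated_syzygy[OF R order_refl]
  have Zr: "rmodule L (Z r M)" if "rmodule L M" for M using I that by blast
  have zf: "?zf f \<in> rhom L (Z r M) (Z r N)" if "rmodule L M" "rmodule L N" "f \<in> rhom L M N" for M N f
    using I that by blast
  obtain \<eta> where \<eta>: "\<And>M. rmodule L M \<Longrightarrow> is_iso ?S (?E M) (Z r M) (\<eta> M)"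
    and nat: "\<And>M N f. rmodule L M \<Longrightarrow> rmodule L N \<Longrightarrow> f \<in> rhom L M N \<Longrightarrow>
        cmp ?S (?E M) (?E N) (Z r N) (\<eta> N) (on_arr ?G M N (stable_class L M N f)) =
        cmp ?S (?E M) (Z r M) (Z r N) (stable_class L (Z r M) (Z r N) (?zf f)) (\<eta> M)"
    using I by blast
  have G: "is_functor ?S ?S ?G" by (rule is_functor_func_pow[OF is_functor_syzygy])
  have Er: "rmodule L (?E M)" if "rmodule L M" for M using G that unfolding is_functor_def by simp
  have Ef: "on_arr ?G M N C \<in> arr ?S (?E M) (?E N)"
    if "rmodule L M" "rmodule L N" "C \<in> arr ?S M N" for M N C
    using G that unfolding is_functor_def cat_simps_stmod(1) by blast
  have Fr: "rmodule L (on_obj F M)" if "rmodule L M" for M using F that unfolding is_functor_def by simp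
  define t where "t M = stable_class L (Z r M) (on_obj F M) (\<tau> M)" for M
  have stable_eq: "stable_class L A B f = stable_class L A B g"
    if "rmodule L A" "rmodule L B" "f \<in> rhom L A B" "g \<in> rhom L A B" "\<And>v. v \<in> space A \<Longrightarrow> f v = g v" for A B f g
  proof -
    note th = that
    obtain P p where P: "projective L P" "p \<in> rhom L P B" using enough[OF th(2)] by blast
    have "(f, g) \<in> stable_rel L A B"
      by (rule stable_relI[OF that(3,4) P(1) rhom_zero[OF projectiveD[OF P(1)]] P(2)])
        (simp only: rhom_0[OF projectiveD[OF P(1)] P(2)] that(5) diff_self)
    thus ?thesis by (rule stable_classI[OF that(1,2)])
  qed
  have tiso: "is_iso ?S (Z r M) (on_obj F M) (t M)" if M: "rmodule L M" for M
    unfolding is_iso_def t_def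
  proof (intro conjI bexI)
    show "stable_class L (Z r M) (on_obj F M) (\<tau> M) \<in> arr ?S (Z r M) (on_obj F M)"
      by (rule stable_class_arr[OF \<tau>[OF M]])
    show "stable_class L (on_obj F M) (Z r M) (\<sigma> M) \<in> arr ?S (on_obj F M) (Z r M)"
      by (rule stable_class_arr[OF \<sigma>[OF M]])
    show "cmp ?S (Z r M) (on_obj F M) (Z r M) (stable_class L (on_obj F M) (Z r M) (\<sigma> M))
        (stable_class L (Z r M) (on_obj F M) (\<tau> M)) = idt ?S (Z r M)"
      unfolding cmp_stmod[OF Zr[OF M] Fr[OF M] Zr[OF M] \<tau>[OF M] \<sigma>[OF M]] cat_simps_stmod(3)
      by (rule stable_eq[OF Zr[OF M] Zr[OF M] rhom_comp[OF \<tau>[OF M] \<sigma>[OF M]] rhom_id]) (simp add: \<sigma>\<tau>[OF M])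
    show "cmp ?S (on_obj F M) (Z r M) (on_obj F M) (stable_class L (Z r M) (on_obj F M) (\<tau> M))
        (stable_class L (on_obj F M) (Z r M) (\<sigma> M)) = idt ?S (on_obj F M)"
      unfolding cmp_stmod[OF Fr[OF M] Zr[OF M] Fr[OF M] \<sigma>[OF M] \<tau>[OF M]] cat_simps_stmod(3)
      by (rule stable_eq[OF Fr[OF M] Fr[OF M] rhom_comp[OF \<sigma>[OF M] \<tau>[OF M]] rhom_id]) (simp add: \<tau>\<sigma>[OF M])
  qed
  have assoc: "cmp ?S W A D (cmp ?S A B D h k) j = cmp ?S W B D h (cmp ?S W A B k j)"
    if "rmodule L W" "rmodule L A" "rmodule L B" "rmodule L D" "j \<in> arr ?S W A" "k \<in> arr ?S A B" "h \<in> arr ?S B D"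
    for W A B D j k h
    using category_stmod[unfolded category_def, THEN conjunct2, THEN conjunct2, THEN conjunct2,
        rule_format, of W A B D j k h] that by simp
  define \<theta> where "\<theta> M = cmp ?S (?E M) (Z r M) (on_obj F M) (t M) (\<eta> M)" for M
  have \<theta>iso: "is_iso ?S (?E M) (on_obj F M) (\<theta> M)" if M: "rmodule L M" for M
    unfolding \<theta>_def using is_iso_comp[OF category_stmod _ _ _ \<eta>[OF M] tiso[OF M]] Er[OF M] Zr[OF M] Fr[OF M] by simp
  have \<theta>nat: "cmp ?S (?E M) (?E N) (on_obj F N) (\<theta> N) (on_arr ?G M N C) =
      cmp ?S (?E M) (on_obj F M) (on_obj F N) (on_arr F M N C) (\<theta> M)"
    if M: "rmodule L M" and N: "rmodule L N" and C: "C \<in> arr ?S M N" for M N C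
  proof -
    obtain f where f: "f \<in> rhom L M N" "C = stable_class L M N f" using arr_stmodE[OF C] .
    have ar: "\<eta> M \<in> arr ?S (?E M) (Z r M)" "\<eta> N \<in> arr ?S (?E N) (Z r N)"
      "t M \<in> arr ?S (Z r M) (on_obj F M)" "t N \<in> arr ?S (Z r N) (on_obj F N)"
      using \<eta>[OF M] \<eta>[OF N] tiso[OF M] tiso[OF N] unfolding is_iso_def by auto
    note zfa = stable_class_arr[OF zf[OF M N f(1)]]
    note Fh = Fhom[OF M N f(1)]
    have Fa: "on_arr F M N C \<in> arr ?S (on_obj F M) (on_obj F N)"
      unfolding f(2) using Fh stable_class_arr by metis
    have sq: "cmp ?S (Z r M) (Z r N) (on_obj F N) (t N) (stable_class L (Z r M) (Z r N) (?zf f)) =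
        cmp ?S (Z r M) (on_obj F M) (on_obj F N) (on_arr F M N C) (t M)"
      unfolding f(2) t_def Fh[THEN conjunct2]
        cmp_stmod[OF Zr[OF M] Zr[OF N] Fr[OF N] zf[OF M N f(1)] \<tau>[OF N]]
        cmp_stmod[OF Zr[OF M] Fr[OF M] Fr[OF N] \<tau>[OF M] Fh[THEN conjunct1]]
      by (rule stable_eq[OF Zr[OF M] Fr[OF N] rhom_comp[OF zf[OF M N f(1)] \<tau>[OF N]] rhom_comp[OF \<tau>[OF M] Fh[THEN conjunct1]]])
        (simp add: \<tau>nat[OF M N f(1)])
    note e = Er[OF M] Er[OF N] Zr[OF M] Zr[OF N] Fr[OF M] Fr[OF N]
    show ?thesis
      unfolding \<theta>_def
      by (simp only: assoc[OF e(1,2,4,6) Ef[OF M N C] ar(2,4)] nat[OF M N f(1), folded f(2)]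
          assoc[OF e(1,3,4,6) ar(1) zfa ar(4), symmetric] sq assoc[OF e(1,3,5,6) ar(1,3) Fa])
  qed
  show ?thesis
    unfolding naturally_isomorphic_def using G F \<theta>iso \<theta>nat by (intro conjI exI[of _ \<theta>]) auto
qed

end

section \<open>Twisting by an automorphism\<close>

locale twisting = enough_projectives L for L :: "('k::field, 'a) module" +
  fixes \<phi> :: "'a \<Rightarrow> 'a"
  assumes bij: "bij_betw \<phi> (carrier L) (carrier L)"
    and \<phi>_add: "a \<in> carrier L \<Longrightarrow> b \<in> carrier L \<Longrightarrow> \<phi> (a \<oplus>\<^bsub>L\<^esub> b) = \<phi> a \<oplus>\<^bsub>L\<^esub> \<phi> b"
    and \<phi>_mult: "a \<in> carrier L \<Longrightarrow> b \<in> carrier L \<Longrightarrow> \<phi> (a \<otimes>\<^bsub>L\<^esub> b) = \<phi> a \<otimes>\<^bsub>L\<^esub> \<phi> b"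
    and \<phi>_smult: "a \<in> carrier L \<Longrightarrow> \<phi> (c \<odot>\<^bsub>L\<^esub> a) = c \<odot>\<^bsub>L\<^esub> \<phi> a"
    and \<phi>_one: "\<phi> \<one>\<^bsub>L\<^esub> = \<one>\<^bsub>L\<^esub>"
    and closed: "a \<in> carrier L \<Longrightarrow> b \<in> carrier L \<Longrightarrow> a \<oplus>\<^bsub>L\<^esub> b \<in> carrier L"
      "a \<in> carrier L \<Longrightarrow> b \<in> carrier L \<Longrightarrow> a \<otimes>\<^bsub>L\<^esub> b \<in> carrier L"
      "a \<in> carrier L \<Longrightarrow> c \<odot>\<^bsub>L\<^esub> a \<in> carrier L" "\<one>\<^bsub>L\<^esub> \<in> carrier L"
begin

abbreviation \<psi> where "\<psi> \<equiv> inv_into (carrier L) \<phi>"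

lemma \<phi>\<psi>: "a \<in> carrier L \<Longrightarrow> \<psi> a \<in> carrier L" "a \<in> carrier L \<Longrightarrow> \<phi> (\<psi> a) = a"
  "a \<in> carrier L \<Longrightarrow> \<psi> (\<phi> a) = a" "a \<in> carrier L \<Longrightarrow> \<phi> a \<in> carrier L"
  using bij unfolding bij_betw_def by (auto simp: inv_into_into f_inv_into_f)

lemma \<psi>_hom: "a \<in> carrier L \<Longrightarrow> b \<in> carrier L \<Longrightarrow> \<psi> (a \<oplus>\<^bsub>L\<^esub> b) = \<psi> a \<oplus>\<^bsub>L\<^esub> \<psi> b"
  "a \<in> carrier L \<Longrightarrow> b \<in> carrier L \<Longrightarrow> \<psi> (a \<otimes>\<^bsub>L\<^esub> b) = \<psi> a \<otimes>\<^bsub>L\<^esub> \<psi> b"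
  "a \<in> carrier L \<Longrightarrow> \<psi> (c \<odot>\<^bsub>L\<^esub> a) = c \<odot>\<^bsub>L\<^esub> \<psi> a"
  "\<psi> \<one>\<^bsub>L\<^esub> = \<one>\<^bsub>L\<^esub>"
proof -
  have u: "\<psi> x = y" if "y \<in> carrier L" "\<phi> y = x" for x y using \<phi>\<psi>(3)[OF that(1)] that(2) by simp
  show "a \<in> carrier L \<Longrightarrow> b \<in> carrier L \<Longrightarrow> \<psi> (a \<oplus>\<^bsub>L\<^esub> b) = \<psi> a \<oplus>\<^bsub>L\<^esub> \<psi> b"
    by (rule u) (simp_all add: \<phi>\<psi>(1,2) \<phi>_add closed)
  show "a \<in> carrier L \<Longrightarrow> b \<in> carrier L \<Longrightarrow> \<psi> (a \<otimes>\<^bsub>L\<^esub> b) = \<psi> a \<otimes>\<^bsub>L\<^esub> \<psi> b"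
    by (rule u) (simp_all add: \<phi>\<psi>(1,2) \<phi>_mult closed)
  show "a \<in> carrier L \<Longrightarrow> \<psi> (c \<odot>\<^bsub>L\<^esub> a) = c \<odot>\<^bsub>L\<^esub> \<psi> a"
    by (rule u) (simp_all add: \<phi>\<psi>(1,2) \<phi>_smult closed)
  show "\<psi> \<one>\<^bsub>L\<^esub> = \<one>\<^bsub>L\<^esub>" by (rule u) (simp_all add: \<phi>_one closed)
qed

lemma space_twist [simp]: "space (twist L \<phi> M) = space M" by (simp add: twist_def)
lemma act_twist [simp]: "act (twist L \<phi> M) v a = act M v (\<psi> a)" by (simp add: twist_def)

lemma rmodule_twist: "rmodule L M \<Longrightarrow> rmodule L (twist L \<phi> M)"
  unfolding rmodule_def by (simp add: \<phi>\<psi> \<psi>_hom closed)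

lemma rhom_twist: "f \<in> rhom L M N \<Longrightarrow> f \<in> rhom L (twist L \<phi> M) (twist L \<phi> N)"
  unfolding rhom_def by (simp add: \<phi>\<psi>)

text \<open>A lifting problem for the twisted module is one for \<open>P\<close> after untwisting the two other modules; here
  \<open>U\<close> is the twist by the inverse automorphism.\<close>

lemma projective_twist:
  assumes P: "projective L P"
  shows "projective L (twist L \<phi> P)"
  unfolding projective_def
proof (intro conjI allI impI)
  show "rmodule L (twist L \<phi> P)" by (rule rmodule_twist[OF projectiveD[OF P]])
  fix M N f g
  assume a: "rmodule L M \<and> rmodule L N \<and> g \<in> rhom L M N \<and> g ` space M = space N \<and> f \<in> rhom L (twist L \<phi> P) N"
  define U where "U X = X\<lparr>act := (\<lambda>v a. act X v (\<phi> a))\<rparr>" for X :: "('k, 'a) rmod"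
  have [simp]: "space (U X) = space X" "act (U X) v a = act X v (\<phi> a)" for X v a by (simp_all add: U_def)
  have U: "rmodule L (U X)" if "rmodule L X" for X
    using that unfolding rmodule_def by (simp add: \<phi>\<psi> \<phi>_add \<phi>_mult \<phi>_smult \<phi>_one closed)
  have gU: "g \<in> rhom L (U M) (U N)" using a unfolding rhom_def by (simp add: \<phi>\<psi>)
  have fU: "f \<in> rhom L P (U N)"
  proof (rule rhomI)
    fix v a' assume "v \<in> space P" "a' \<in> carrier L"
    thus "f (act P v a') = act (U N) (f v) a'"
      using a rhom_act[of f L "twist L \<phi> P" N v "\<phi> a'"] by (simp add: \<phi>\<psi>)
  qed (use a in \<open>auto simp: rhom_def\<close>)
  obtain h where h: "h \<in> rhom L P (U M)" "\<And>v. v \<in> space P \<Longrightarrow> g (h v) = f v"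
    using projective_lift[OF P U U gU _ fU] a by auto
  have "h \<in> rhom L (twist L \<phi> P) M"
    using h(1) unfolding rhom_def by (simp add: \<phi>\<psi>)
  thus "\<exists>h\<in>rhom L (twist L \<phi> P) M. \<forall>v\<in>space (twist L \<phi> P). g (h v) = f v" using h(2) by auto
qed

lemma stable_rel_twist:
  assumes "(f, g) \<in> stable_rel L M N"
  shows "(f, g) \<in> stable_rel L (twist L \<phi> M) (twist L \<phi> N)"
proof -
  obtain P u w where "projective L P" "u \<in> rhom L M P" "w \<in> rhom L P N" "\<And>v. v \<in> space M \<Longrightarrow> f v - g v = w (u v)"
    "f \<in> rhom L M N" "g \<in> rhom L M N"
    using assms unfolding stable_rel_def by blast
  thus ?thesis
    by (intro stable_relI[where P = "twist L \<phi> P" and u = u and w = w] rhom_twist projective_twist) simp_all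
qed

lemma twist_on_class:
  assumes M: "rmodule L M" and N: "rmodule L N" and f: "f \<in> rhom L M N"
  shows "on_arr (twist_functor L \<phi>) M N (stable_class L M N f) = stable_class L (twist L \<phi> M) (twist L \<phi> N) f"
proof -
  have "stable_class L (twist L \<phi> M) (twist L \<phi> N) g = stable_class L (twist L \<phi> M) (twist L \<phi> N) f"
    if "g \<in> stable_class L M N f" for g
    using stable_classI[OF rmodule_twist[OF M] rmodule_twist[OF N] stable_rel_twist] that by blast
  hence "(\<Union>g\<in>stable_class L M N f. stable_class L (twist L \<phi> M) (twist L \<phi> N) g)
      = (\<Union>g\<in>stable_class L M N f. stable_class L (twist L \<phi> M) (twist L \<phi> N) f)"
    by (intro SUP_cong refl) simp
  also have "\<dots> = stable_class L (twist L \<phi> M) (twist L \<phi> N) f" using stable_class_mem[OF M N f] by blast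
  finally show ?thesis by (simp add: twist_functor_def)
qed

lemma on_obj_twist [simp]: "on_obj (twist_functor L \<phi>) M = twist L \<phi> M"
  by (simp add: twist_functor_def)

lemma is_functor_twist: "is_functor (stmod L) (stmod L) (twist_functor L \<phi>)"
  unfolding is_functor_def
proof (intro conjI ballI category_stmod)
  fix X assume X: "X \<in> obj (stmod L)"
  show "on_obj (twist_functor L \<phi>) X \<in> obj (stmod L)" using X rmodule_twist by simp
  show "on_arr (twist_functor L \<phi>) X X (idt (stmod L) X) = idt (stmod L) (on_obj (twist_functor L \<phi>) X)"
    using X twist_on_class[OF _ _ rhom_id] by simp
next
  fix X Y C assume o: "X \<in> obj (stmod L)" "Y \<in> obj (stmod L)" and C: "C \<in> arr (stmod L) X Y"
  have X: "rmodule L X" and Y: "rmodule L Y" using o by auto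
  obtain f where f: "f \<in> rhom L X Y" "C = stable_class L X Y f" using arr_stmodE[OF C] .
  show "on_arr (twist_functor L \<phi>) X Y C \<in> arr (stmod L) (on_obj (twist_functor L \<phi>) X) (on_obj (twist_functor L \<phi>) Y)"
    unfolding f(2) twist_on_class[OF X Y f(1)] on_obj_twist by (rule stable_class_arr[OF rhom_twist[OF f(1)]])
next
  fix X Y Z C D assume o: "X \<in> obj (stmod L)" "Y \<in> obj (stmod L)" "Z \<in> obj (stmod L)"
    and C: "C \<in> arr (stmod L) X Y" and D: "D \<in> arr (stmod L) Y Z"
  have X: "rmodule L X" and Y: "rmodule L Y" and Z: "rmodule L Z" using o by auto
  obtain f where f: "f \<in> rhom L X Y" "C = stable_class L X Y f" using arr_stmodE[OF C] .
  obtain g where g: "g \<in> rhom L Y Z" "D = stable_class L Y Z g" using arr_stmodE[OF D] .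
  show "on_arr (twist_functor L \<phi>) X Z (cmp (stmod L) X Y Z D C) =
          cmp (stmod L) (on_obj (twist_functor L \<phi>) X) (on_obj (twist_functor L \<phi>) Y) (on_obj (twist_functor L \<phi>) Z)
            (on_arr (twist_functor L \<phi>) Y Z D) (on_arr (twist_functor L \<phi>) X Y C)"
    unfolding f(2) g(2) cmp_stmod[OF X Y Z f(1) g(1)] twist_on_class[OF X Y f(1)]
      twist_on_class[OF Y Z g(1)] twist_on_class[OF X Z rhom_comp[OF f(1) g(1)]] on_obj_twist
    by (rule cmp_stmod[OF rmodule_twist[OF X] rmodule_twist[OF Y] rmodule_twist[OF Z]
          rhom_twist[OF f(1)] rhom_twist[OF g(1)], symmetric])
qed

end

section \<open>Interlacing vertices\<close>

text \<open>The Hom-spaces of the path category modulo its relations, described combinatorially. The convention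
  \<open>next_entry z d = z\<^sub>0 + width\<close> continues a vertex to a periodic increasing sequence; it turns the bound
  on \<open>x\<^sub>d - x\<^sub>0\<close> in the definition of a vertex into one more strict inequality between neighbours.\<close>

locale interlacing =
  fixes d n l :: nat
  assumes d1: "1 \<le> d" and n1: "1 \<le> n"
begin

abbreviation width where "width \<equiv> int l + int d - 1"

definition next_entry :: "vertex \<Rightarrow> nat \<Rightarrow> int" where
  "next_entry z i = (if i = d then z ! 0 + width else z ! Suc i)"

text \<open>The condition for \<open>Hom(z, w)\<close> to be nonzero.\<close>

definition interlace :: "vertex \<Rightarrow> vertex \<Rightarrow> bool" where
  "interlace z w \<longleftrightarrow> length z = d + 1 \<and> length w = d + 1 \<and> (\<forall>i\<le>d. z ! i \<le> w ! i \<and> w ! i < next_entry z i)"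

definition below :: "vertex \<Rightarrow> vertex \<Rightarrow> bool" where
  "below z w \<longleftrightarrow> length z = d + 1 \<and> length w = d + 1 \<and> (\<forall>i\<le>d. z ! i \<le> w ! i)"

definition shift :: "int \<Rightarrow> vertex \<Rightarrow> vertex" where
  "shift k x = map (\<lambda>t. t + k * int n) x"

lemma os_iff: "x \<in> os d l \<longleftrightarrow> length x = d + 1 \<and> (\<forall>i\<le>d. x ! i < next_entry x i)"
proof (cases "length x = d + 1")
  case True
  have ne: "x \<noteq> []" using True by auto
  have lh: "last x = x ! d" "hd x = x ! 0" using True ne by (auto simp: last_conv_nth hd_conv_nth)
  have "sorted_wrt (<) x \<longleftrightarrow> (\<forall>i<d. x ! i < x ! Suc i)"
    using sorted_wrt_iff_nth_Suc_transp[of "(<)" x] True by auto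
  moreover have "(\<forall>i\<le>d. x ! i < next_entry x i) \<longleftrightarrow> (\<forall>i<d. x ! i < x ! Suc i) \<and> x ! d < x ! 0 + width"
    by (auto simp: next_entry_def le_less)
  ultimately show ?thesis using True lh unfolding os_def by auto
qed (auto simp: os_def)

lemma os_length: "x \<in> os d l \<Longrightarrow> length x = d + 1"
  by (simp add: os_def)

lemma next_entry_mono: "below x y \<Longrightarrow> i \<le> d \<Longrightarrow> next_entry x i \<le> next_entry y i"
  unfolding below_def next_entry_def by auto

lemma below_trans: "below x y \<Longrightarrow> below y z \<Longrightarrow> below x z"
  unfolding below_def by force

lemma interlace_below: "interlace x y \<Longrightarrow> below x y"
  unfolding interlace_def below_def by blast

lemma interlace_os: assumes "interlace x y" shows "x \<in> os d l" "y \<in> os d l"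
proof -
  show "x \<in> os d l" using assms unfolding os_iff interlace_def by force
  have "y ! i < next_entry y i" if "i \<le> d" for i
    using assms next_entry_mono[OF interlace_below[OF assms] that] that unfolding interlace_def by force
  thus "y \<in> os d l" using assms unfolding os_iff interlace_def by blast
qed

lemma interlace_refl: "x \<in> os d l \<Longrightarrow> interlace x x"
  unfolding os_iff interlace_def by blast

text \<open>If a composite of two coordinatewise increasing steps is nonzero, then so are both steps. This is
  why no path between interlacing vertices leaves the vertex set, and why coefficients of composites can
  be computed termwise.\<close>

lemma interlace_convex:
  assumes "interlace a c" "below a b" "below b c"
  shows "interlace a b" "interlace b c"
proof -
  show "interlace a b" using assms unfolding interlace_def below_def by force
  have "c ! i < next_entry b i" if "i \<le> d" for i
    using assms(1) next_entry_mono[OF assms(2) that] that unfolding interlace_def by force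
  thus "interlace b c" using assms unfolding interlace_def below_def by blast
qed

lemma length_shift [simp]: "length (shift k x) = length x"
  by (simp add: shift_def)

lemma nth_shift [simp]: "i < length x \<Longrightarrow> shift k x ! i = x ! i + k * int n"
  by (simp add: shift_def)

lemma shift_shift [simp]: "shift k (shift m x) = shift (k + m) x"
  by (simp add: shift_def algebra_simps)

lemma shift_0 [simp]: "shift 0 x = x"
  by (simp add: shift_def)

lemma shift_eq_iff: "shift k x = shift k y \<longleftrightarrow> x = y"
  by (metis add.right_inverse add.commute shift_0 shift_shift)

lemma shift_eq_swap: "shift k x = y \<longleftrightarrow> x = shift (- k) y"
  by (metis add.left_inverse add.right_inverse shift_0 shift_shift)

lemma next_entry_shift [simp]: "length x = d + 1 \<Longrightarrow> i \<le> d \<Longrightarrow> next_entry (shift k x) i = next_entry x i + k * int n"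
  by (auto simp: next_entry_def)

lemma interlace_shift [simp]: "interlace (shift k x) (shift k y) \<longleftrightarrow> interlace x y"
  unfolding interlace_def by (auto simp: less_Suc_eq_le)

lemma os_shift [simp]: "shift k x \<in> os d l \<longleftrightarrow> x \<in> os d l"
  unfolding os_iff by (auto simp: less_Suc_eq_le)

lemma shift_fix: assumes "x \<in> os d l" "shift k x = shift m x" shows "k = m"
proof -
  have "shift k x ! 0 = shift m x ! 0" using assms(2) by simp
  hence "k * int n = m * int n" using os_length[OF assms(1)] by simp
  thus ?thesis using n1 by simp
qed

definition reps where "reps = {x \<in> os d l. 0 \<le> x ! 0 \<and> x ! 0 < int n}"

lemma reps_os: "x \<in> reps \<Longrightarrow> x \<in> os d l" by (simp add: reps_def)

lemma reps_ex: assumes "x \<in> os d l" shows "\<exists>k. shift k x \<in> reps"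
proof
  have "shift (- (x ! 0 div int n)) x ! 0 = x ! 0 mod int n"
    using os_length[OF assms] by (simp add: minus_div_mult_eq_mod[symmetric])
  thus "shift (- (x ! 0 div int n)) x \<in> reps" using assms n1 unfolding reps_def by simp
qed

lemma reps_shift: assumes "x \<in> reps" "shift k x \<in> reps" shows "k = 0"
proof -
  have len: "length x = d + 1" using assms(1) os_length reps_os by blast
  have a: "0 \<le> x ! 0" "x ! 0 < int n" "0 \<le> x ! 0 + k * int n" "x ! 0 + k * int n < int n"
    using assms len unfolding reps_def by auto
  have "(x ! 0 + k * int n) div int n = 0" using a(3,4) by simp
  moreover have "(x ! 0 + k * int n) div int n = k + x ! 0 div int n" using n1 by simp
  ultimately show ?thesis using a(1,2) by simp
qed

lemma reps_unique: "x \<in> reps \<Longrightarrow> y \<in> reps \<Longrightarrow> shift k x = shift m y \<Longrightarrow> x = y \<and> k = m"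
proof -
  assume a: "x \<in> reps" "y \<in> reps" "shift k x = shift m y"
  have "y = shift (k - m) x" using a(3) by (metis add.commute diff_conv_add_uminus shift_eq_swap shift_shift)
  hence "k - m = 0" using reps_shift a(1,2) by metis
  thus "x = y \<and> k = m" using a(3) by (simp add: shift_eq_iff)
qed

lemma finite_box:
  assumes "\<And>w. w \<in> W \<Longrightarrow> length w = d + 1 \<and> (\<forall>i\<le>d. A i \<le> w ! i \<and> w ! i \<le> (B i :: int))"
  shows "finite W"
proof (rule finite_subset)
  show "finite {w. set w \<subseteq> (\<Union>i\<le>d. {A i..B i}) \<and> length w = d + 1}"
    by (intro finite_lists_length_eq) simp
  show "W \<subseteq> {w. set w \<subseteq> (\<Union>i\<le>d. {A i..B i}) \<and> length w = d + 1}"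
    using assms by (force simp: in_set_conv_nth less_Suc_eq_le)
qed

lemma os_nth_mono: assumes "x \<in> os d l" "i \<le> d" shows "x ! 0 \<le> x ! i" "x ! i \<le> x ! d"
proof -
  have s: "sorted_wrt (<) x" "length x = d + 1" using assms(1) unfolding os_def by auto
  have m: "x ! i \<le> x ! j" if "i \<le> j" "j \<le> d" for i j
    using sorted_wrt_nth_less[OF s(1), of i j] that s(2) by (cases "i = j") auto
  show "x ! 0 \<le> x ! i" "x ! i \<le> x ! d" using m assms(2) by auto
qed

lemma os_span: "x \<in> os d l \<Longrightarrow> x ! d < x ! 0 + width"
  unfolding os_iff next_entry_def by auto

definition above where "above z = {w. interlace z w}"
definition beneath where "beneath w = {z. interlace z w}"

lemma finite_above: "finite (above z)"
  by (rule finite_box[of _ "\<lambda>i. z ! i" "\<lambda>i. next_entry z i"]) (auto simp: above_def interlace_def intro: less_imp_le)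

lemma finite_beneath: "finite (beneath w)"
proof (rule finite_box[of _ "\<lambda>i. w ! d - width" "\<lambda>i. w ! i"])
  fix z assume "z \<in> beneath w"
  hence z: "interlace z w" by (simp add: beneath_def)
  have "w ! d - width \<le> z ! i" if "i \<le> d" for i
    using z os_nth_mono(1)[OF interlace_os(1)[OF z] that] unfolding interlace_def next_entry_def by force
  thus "length z = d + 1 \<and> (\<forall>i\<le>d. w ! d - width \<le> z ! i \<and> z ! i \<le> w ! i)"
    using z unfolding interlace_def by blast
qed

lemma finite_reps: "finite reps"
proof (rule finite_box[of _ "\<lambda>i. 0" "\<lambda>i. int n + width"])
  fix x assume x: "x \<in> reps"
  have "0 \<le> x ! i \<and> x ! i \<le> int n + width" if "i \<le> d" for i
    using os_nth_mono[OF reps_os[OF x] that] os_span[OF reps_os[OF x]] x unfolding reps_def by auto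
  thus "length x = d + 1 \<and> (\<forall>i\<le>d. 0 \<le> x ! i \<and> x ! i \<le> int n + width)"
    using os_length[OF reps_os[OF x]] by blast
qed

lemma finite_between: "finite {y. interlace x y \<and> interlace y z}"
  by (rule finite_subset[OF _ finite_above[of x]]) (auto simp: above_def)

section \<open>Coefficient functions\<close>

text \<open>An element of the orbit algebra is a translation invariant choice of a scalar for every one
  dimensional space \<open>Hom(x, y)\<close>.\<close>

definition Coeffs :: "(vertex \<Rightarrow> vertex \<Rightarrow> 'k::field) set" where
  "Coeffs = {\<gamma>. (\<forall>x y. \<gamma> x y \<noteq> 0 \<longrightarrow> interlace x y) \<and> (\<forall>k x y. \<gamma> (shift k x) (shift k y) = \<gamma> x y)}"

text \<open>The product \<open>\<gamma> \<cdot> \<delta>\<close> composes with \<open>\<delta>\<close> first. Intermediate vertices of a nonzero composite interlace with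
  both ends, and there are finitely many of them.\<close>

definition conv :: "(vertex \<Rightarrow> vertex \<Rightarrow> 'k::field) \<Rightarrow> (vertex \<Rightarrow> vertex \<Rightarrow> 'k) \<Rightarrow> vertex \<Rightarrow> vertex \<Rightarrow> 'k" where
  "conv \<gamma> \<delta> x z = (if interlace x z then \<Sum>y | interlace x y \<and> interlace y z. \<delta> x y * \<gamma> y z else 0)"

definition unit_coeff :: "vertex \<Rightarrow> vertex \<Rightarrow> 'k::field" where
  "unit_coeff x y = (if x = y \<and> x \<in> os d l then 1 else 0)"

text \<open>The morphism \<open>x \<rightarrow> y\<close> of the orbit category: the sum over the translates of the basis vector of
  \<open>Hom(x, y)\<close>. It is zero if that space is.\<close>

definition basis :: "vertex \<Rightarrow> vertex \<Rightarrow> vertex \<Rightarrow> vertex \<Rightarrow> 'k::field" where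
  "basis x y x' y' = (if interlace x y \<and> (\<exists>k. x' = shift k x \<and> y' = shift k y) then 1 else 0)"

lemma CoeffsD: "\<gamma> \<in> Coeffs \<Longrightarrow> \<not> interlace x y \<Longrightarrow> \<gamma> x y = 0" "\<gamma> \<in> Coeffs \<Longrightarrow> \<gamma> (shift k x) (shift k y) = \<gamma> x y"
  unfolding Coeffs_def by blast+

lemma CoeffsI: "(\<And>x y. \<not> interlace x y \<Longrightarrow> \<gamma> x y = 0) \<Longrightarrow> (\<And>k x y. \<gamma> (shift k x) (shift k y) = \<gamma> x y) \<Longrightarrow> \<gamma> \<in> Coeffs"
  unfolding Coeffs_def by blast

lemma Coeffs_shift: "\<gamma> \<in> Coeffs \<Longrightarrow> \<gamma> (shift k x) y = \<gamma> x (shift (- k) y)"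
  using CoeffsD(2)[of \<gamma> k x "shift (- k) y"] by simp

lemma Coeffs_zero: "(\<lambda>x y. 0) \<in> Coeffs" by (rule CoeffsI) auto
lemma Coeffs_add: "\<gamma> \<in> Coeffs \<Longrightarrow> \<delta> \<in> Coeffs \<Longrightarrow> (\<lambda>x y. \<gamma> x y + \<delta> x y) \<in> Coeffs"
  by (rule CoeffsI) (auto simp: CoeffsD)
lemma Coeffs_scale: "\<gamma> \<in> Coeffs \<Longrightarrow> (\<lambda>x y. c * \<gamma> x y) \<in> Coeffs"
  by (rule CoeffsI) (auto simp: CoeffsD)
lemma Coeffs_sum: "(\<And>i. i \<in> F \<Longrightarrow> \<gamma> i \<in> Coeffs) \<Longrightarrow> (\<lambda>x y. \<Sum>i\<in>F. \<gamma> i x y) \<in> Coeffs"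
  by (rule CoeffsI) (auto simp: CoeffsD intro!: sum.neutral sum.cong)
lemma Coeffs_unit: "unit_coeff \<in> Coeffs"
  by (rule CoeffsI) (auto simp: unit_coeff_def shift_eq_iff dest: interlace_refl)

lemma Coeffs_basis: "basis x y \<in> Coeffs"
proof (rule CoeffsI)
  fix a b assume "\<not> interlace a b" thus "basis x y a b = 0" by (auto simp: basis_def)
next
  fix k a b
  have "(\<exists>j. shift k a = shift j x \<and> shift k b = shift j y) \<longleftrightarrow> (\<exists>j. a = shift j x \<and> b = shift j y)"
  proof
    assume "\<exists>j. shift k a = shift j x \<and> shift k b = shift j y"
    then obtain j where "shift k a = shift j x" "shift k b = shift j y" by blast
    hence "a = shift (j - k) x" "b = shift (j - k) y" by (simp_all add: shift_eq_swap)
    thus "\<exists>j. a = shift j x \<and> b = shift j y" by blast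
  next
    assume "\<exists>j. a = shift j x \<and> b = shift j y"
    then obtain j where "a = shift j x" "b = shift j y" by blast
    thus "\<exists>j. shift k a = shift j x \<and> shift k b = shift j y" by (intro exI[of _ "k + j"]) simp
  qed
  thus "basis x y (shift k a) (shift k b) = basis x y a b" by (simp add: basis_def)
qed

lemma Coeffs_conv:
  assumes "\<gamma> \<in> Coeffs" "\<delta> \<in> Coeffs" shows "conv \<gamma> \<delta> \<in> Coeffs"
proof (rule CoeffsI)
  fix k x z
  have "(\<Sum>y | interlace (shift k x) y \<and> interlace y (shift k z). \<delta> (shift k x) y * \<gamma> y (shift k z))
      = (\<Sum>y | interlace x y \<and> interlace y z. \<delta> x y * \<gamma> y z)"
    by (rule sum.reindex_bij_witness[of _ "shift k" "shift (- k)"])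
      (use CoeffsD(2)[OF assms(1)] CoeffsD(2)[OF assms(2)] in \<open>auto simp: Coeffs_shift[OF assms(2)] shift_eq_swap\<close>,
       (metis add.right_inverse interlace_shift shift_0 shift_shift add.left_inverse CoeffsD(2)[OF assms(1)])+)
  thus "conv \<gamma> \<delta> (shift k x) (shift k z) = conv \<gamma> \<delta> x z" by (simp add: conv_def)
qed (simp add: conv_def)

lemma basis_shift: "basis (shift k x) (shift k y) = basis x y"
proof (intro ext)
  fix a b
  have "(\<exists>j. a = shift (j + k) x \<and> b = shift (j + k) y) \<longleftrightarrow> (\<exists>j. a = shift j x \<and> b = shift j y)"
    by (metis diff_add_cancel)
  thus "basis (shift k x) (shift k y) a b = basis x y a b" by (simp add: basis_def)
qed

lemma basis_eq:
  assumes "x \<in> os d l" shows "basis x y (shift k x) b = (if interlace x y \<and> b = shift k y then 1 else 0)"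
  using shift_fix[OF assms] unfolding basis_def by metis

lemma conv_basis:
  "conv (basis y z) (basis x y) = (if interlace x y \<and> interlace y z then basis x z else (\<lambda>_ _. 0) :: vertex \<Rightarrow> vertex \<Rightarrow> 'k::field)"
proof (intro ext)
  fix a c
  show "conv (basis y z) (basis x y) a c = (if interlace x y \<and> interlace y z then basis x z else (\<lambda>_ _. 0 :: 'k)) a c"
  proof (cases "interlace a c \<and> interlace x y \<and> interlace y z \<and> (\<exists>k. a = shift k x)")
    case True
    then obtain k where k: "a = shift k x" by blast
    have x: "x \<in> os d l" and y: "y \<in> os d l" using True interlace_os by blast+
    have h: "interlace a c" "interlace x y" "interlace y z" using True by auto
    have eq: "basis x y a b * basis y z b c = (if b = shift k y then (if c = shift k z then 1 else 0) else (0::'k))" for b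
      using True unfolding k basis_eq[OF x] by (simp add: basis_eq[OF y])
    have "conv (basis y z) (basis x y) a c = (\<Sum>b | interlace a b \<and> interlace b c. if b = shift k y then (if c = shift k z then 1 else 0) else (0::'k))"
      using True by (simp add: conv_def eq)
    also have "\<dots> = (if interlace a (shift k y) \<and> interlace (shift k y) c then (if c = shift k z then 1 else 0) else 0)"
      by (simp add: finite_between)
    also have "\<dots> = basis x z a c" using h unfolding k basis_eq[OF x] by auto
    finally show ?thesis using True by simp
  next
    case False
    hence 0: "basis x y a b * basis y z b c = (0::'k) \<or> \<not> interlace a c" for b by (auto simp: basis_def)
    hence "conv (basis y z) (basis x y) a c = (0::'k)" unfolding conv_def by (auto intro: sum.neutral)
    moreover have "basis x z a c = (0::'k)" if "interlace x y" "interlace y z" using False that by (auto simp: basis_def)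
    ultimately show ?thesis by simp
  qed
qed

lemma conv_basis_orbits:
  assumes "\<And>k. y' \<noteq> shift k y"
  shows "conv (basis y' z) (basis x y) = (\<lambda>_ _. 0 :: 'k::field)"
proof (intro ext)
  fix a c
  have no: "\<not> ((\<exists>k. a = shift k x \<and> b = shift k y) \<and> (\<exists>m. b = shift m y' \<and> c = shift m z))" for b
  proof
    assume "(\<exists>k. a = shift k x \<and> b = shift k y) \<and> (\<exists>m. b = shift m y' \<and> c = shift m z)"
    then obtain k m where "shift m y' = shift k y" by metis
    hence "y' = shift (- m + k) y" by (simp only: shift_eq_swap[of m y'] shift_shift)
    thus False using assms by blast
  qed
  have "basis x y a b * basis y' z b c = (0::'k)" for b using no[of b] by (auto simp: basis_def)
  thus "conv (basis y' z) (basis x y) a c = (0::'k)" unfolding conv_def by (auto intro: sum.neutral)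
qed

lemma unit_coeff_sum: "unit_coeff = (\<lambda>x y. \<Sum>r\<in>reps. basis r r x y :: 'k::field)"
proof (intro ext)
  fix x y
  show "unit_coeff x y = (\<Sum>r\<in>reps. basis r r x y :: 'k)"
  proof (cases "x \<in> os d l")
    case True
    then obtain k where k: "shift k x \<in> reps" using reps_ex by blast
    have "basis r r x y = (if r = shift k x then (if x = y then 1 else 0) else (0::'k))" if r: "r \<in> reps" for r
    proof (cases "r = shift k x")
      case True
      have "basis r r x y = (basis x x x y :: 'k)" unfolding True basis_shift by simp
      also have "\<dots> = (if x = y then 1 else 0)"
        using basis_eq[OF \<open>x \<in> os d l\<close>, of x 0 y] interlace_refl[OF \<open>x \<in> os d l\<close>] by auto
      finally show ?thesis using True by simp
    next
      case False
      have "x \<noteq> shift j r" for j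
      proof
        assume "x = shift j r"
        hence "shift (k + j) r \<in> reps" using k by simp
        hence "k + j = 0" using reps_shift[OF r] by blast
        thus False using \<open>x = shift j r\<close> False by simp
      qed
      thus ?thesis using False by (simp add: basis_def)
    qed
    hence "(\<Sum>r\<in>reps. basis r r x y) = (\<Sum>r\<in>reps. if r = shift k x then (if x = y then 1 else 0) else (0::'k))" by simp
    also have "\<dots> = (if x = y then 1 else 0)" using k finite_reps by simp
    finally show ?thesis using True by (simp add: unit_coeff_def)
  next
    case False
    hence "basis r r x y = (0::'k)" if "r \<in> reps" for r using reps_os[OF that] by (auto simp: basis_def)
    thus ?thesis using False by (simp add: unit_coeff_def)
  qed
qed

text \<open>Composing with the idempotent at \<open>w\<close> cuts a coefficient function down to its row \<open>w\<close>.\<close>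

lemma conv_row:
  assumes \<gamma>: "\<gamma> \<in> Coeffs" and w: "w \<in> os d l"
  shows "conv \<gamma> (basis w w) = (\<lambda>x y. \<Sum>z\<in>above w. \<gamma> w z * basis w z x y :: 'k::field)"
proof (intro ext)
  fix x y
  show "conv \<gamma> (basis w w) x y = (\<Sum>z\<in>above w. \<gamma> w z * basis w z x y)"
  proof (cases "\<exists>k. x = shift k w")
    case True
    then obtain k where k: "x = shift k w" by blast
    have "(\<Sum>z\<in>above w. \<gamma> w z * basis w z x y) = (\<Sum>z\<in>above w. if z = shift (- k) y then \<gamma> x y else 0)"
      unfolding k basis_eq[OF w] Coeffs_shift[OF \<gamma>] by (intro sum.cong) (auto simp: above_def)
    also have "\<dots> = (if interlace w (shift (- k) y) then \<gamma> x y else 0)" using finite_above by (simp add: above_def)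
    also have "interlace w (shift (- k) y) \<longleftrightarrow> interlace x y" unfolding k using interlace_shift[of k w "shift (- k) y"] by simp
    finally have 1: "(\<Sum>z\<in>above w. \<gamma> w z * basis w z x y) = (if interlace x y then \<gamma> x y else 0)" .
    have "(\<Sum>u | interlace x u \<and> interlace u y. basis w w x u * \<gamma> u y) = (\<Sum>u | interlace x u \<and> interlace u y. if u = x then \<gamma> x y else 0)"
      unfolding k basis_eq[OF w] by (intro sum.cong) (auto simp: interlace_refl w)
    also have "\<dots> = (if interlace x y then \<gamma> x y else 0)"
      using w k by (simp add: finite_between interlace_refl)
    finally show ?thesis using 1 by (simp add: conv_def)
  next
    case False
    thus ?thesis by (auto simp: conv_def basis_def intro!: sum.neutral)
  qed
qed

end

section \<open>Modules over the orbit algebra as graded objects\<close>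

text \<open>An algebra identified by \<open>el\<close> with the coefficient functions under convolution. The
  resolution and its last kernel involve the algebra only through this identification.\<close>

locale orbit_algebra = interlacing d n l for d n l :: nat +
  fixes L :: "('k::field, 'a) module" and el :: "(vertex \<Rightarrow> vertex \<Rightarrow> 'k) \<Rightarrow> 'a"
  assumes carrier_L: "carrier L = el ` Coeffs" and inj_el: "inj_on el Coeffs"
    and el_add: "\<gamma> \<in> Coeffs \<Longrightarrow> \<delta> \<in> Coeffs \<Longrightarrow> el \<gamma> \<oplus>\<^bsub>L\<^esub> el \<delta> = el (\<lambda>x y. \<gamma> x y + \<delta> x y)"
    and el_mult: "\<gamma> \<in> Coeffs \<Longrightarrow> \<delta> \<in> Coeffs \<Longrightarrow> el \<gamma> \<otimes>\<^bsub>L\<^esub> el \<delta> = el (conv \<gamma> \<delta>)"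
    and el_smult: "\<gamma> \<in> Coeffs \<Longrightarrow> c \<odot>\<^bsub>L\<^esub> el \<gamma> = el (\<lambda>x y. c * \<gamma> x y)"
    and el_one: "\<one>\<^bsub>L\<^esub> = el unit_coeff"
begin

lemma el_carrier: "\<gamma> \<in> Coeffs \<Longrightarrow> el \<gamma> \<in> carrier L"
  using carrier_L by blast

lemma closed_L:
  "a \<in> carrier L \<Longrightarrow> b \<in> carrier L \<Longrightarrow> a \<oplus>\<^bsub>L\<^esub> b \<in> carrier L"
  "a \<in> carrier L \<Longrightarrow> b \<in> carrier L \<Longrightarrow> a \<otimes>\<^bsub>L\<^esub> b \<in> carrier L"
  "a \<in> carrier L \<Longrightarrow> c \<odot>\<^bsub>L\<^esub> a \<in> carrier L" "\<one>\<^bsub>L\<^esub> \<in> carrier L"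
proof -
  show "a \<in> carrier L \<Longrightarrow> b \<in> carrier L \<Longrightarrow> a \<oplus>\<^bsub>L\<^esub> b \<in> carrier L"
    unfolding carrier_L by (auto simp only: el_add intro!: imageI Coeffs_add)
  show "a \<in> carrier L \<Longrightarrow> b \<in> carrier L \<Longrightarrow> a \<otimes>\<^bsub>L\<^esub> b \<in> carrier L"
    unfolding carrier_L by (auto simp only: el_mult intro!: imageI Coeffs_conv)
  show "a \<in> carrier L \<Longrightarrow> c \<odot>\<^bsub>L\<^esub> a \<in> carrier L"
    unfolding carrier_L by (auto simp only: el_smult intro!: imageI Coeffs_scale)
  show "\<one>\<^bsub>L\<^esub> \<in> carrier L" unfolding el_one by (rule el_carrier[OF Coeffs_unit])
qed

text \<open>Acting by the morphism \<open>x \<rightarrow> y\<close> carries the component of a right module at \<open>y\<close> to the one at \<open>x\<close>.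
  In particular \<open>arr_act M v x x\<close> is the component of \<open>v\<close> at \<open>x\<close>. Vertices in the same orbit have the same
  component.\<close>

definition arr_act :: "('k, 'a) rmod \<Rightarrow> 'k vec \<Rightarrow> vertex \<Rightarrow> vertex \<Rightarrow> 'k vec" where
  "arr_act M v x y = act M v (el (basis x y))"

text \<open>A module is the direct sum of its components over the orbits. So a translation invariant choice of
  components is the same as a vector (\<open>arr_act_glue\<close>, \<open>comp_ext\<close>).\<close>

definition glue :: "(vertex \<Rightarrow> 'k vec) \<Rightarrow> 'k vec" where "glue u = (\<Sum>x\<in>reps. u x)"

context
  fixes M :: "('k, 'a) rmod"
  assumes M: "rmodule L M"
begin

lemma act_el_in: "v \<in> space M \<Longrightarrow> \<gamma> \<in> Coeffs \<Longrightarrow> act M v (el \<gamma>) \<in> space M"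
  using rmod_act[OF M] el_carrier by blast

lemma act_el_zero: assumes v: "v \<in> space M" shows "act M v (el (\<lambda>x y. 0)) = 0"
proof -
  have "act M v (0 \<odot>\<^bsub>L\<^esub> el (\<lambda>x y. 0)) = vscale 0 (act M v (el (\<lambda>x y. 0)))"
    by (rule rmod_act_lscale[OF M v el_carrier[OF Coeffs_zero]])
  thus ?thesis by (simp only: el_smult[OF Coeffs_zero] mult_zero_left kvec.scale_zero_left)
qed

lemma act_el_add: "v \<in> space M \<Longrightarrow> \<gamma> \<in> Coeffs \<Longrightarrow> \<delta> \<in> Coeffs \<Longrightarrow>
    act M v (el (\<lambda>x y. \<gamma> x y + \<delta> x y)) = act M v (el \<gamma>) + act M v (el \<delta>)"
  by (simp only: rmod_act_ladd[OF M _ el_carrier el_carrier, symmetric] el_add)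

lemma act_el_scale: "v \<in> space M \<Longrightarrow> \<gamma> \<in> Coeffs \<Longrightarrow> act M v (el (\<lambda>x y. c * \<gamma> x y)) = vscale c (act M v (el \<gamma>))"
  by (simp only: rmod_act_lscale[OF M _ el_carrier, symmetric] el_smult)

lemma act_el_conv: "v \<in> space M \<Longrightarrow> \<gamma> \<in> Coeffs \<Longrightarrow> \<delta> \<in> Coeffs \<Longrightarrow> act M (act M v (el \<gamma>)) (el \<delta>) = act M v (el (conv \<gamma> \<delta>))"
  by (simp only: rmod_act_mult[OF M _ el_carrier el_carrier, symmetric] el_mult)

lemma act_el_sum:
  assumes v: "v \<in> space M" and \<gamma>: "\<And>i. i \<in> F \<Longrightarrow> \<gamma> i \<in> Coeffs"
  shows "act M v (el (\<lambda>x y. \<Sum>i\<in>F. \<gamma> i x y)) = (\<Sum>i\<in>F. act M v (el (\<gamma> i)))"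
proof (cases "finite F")
  case True
  thus ?thesis using \<gamma>
  proof (induction F rule: finite_induct)
    case empty show ?case by (simp only: sum.empty act_el_zero[OF v])
  next
    case (insert i F)
    have "act M v (el (\<lambda>x y. \<gamma> i x y + (\<Sum>i\<in>F. \<gamma> i x y))) = act M v (el (\<gamma> i)) + act M v (el (\<lambda>x y. \<Sum>i\<in>F. \<gamma> i x y))"
      using insert.prems by (intro act_el_add[OF v]) (auto intro: Coeffs_sum)
    thus ?case using insert.IH insert.prems by (simp only: sum.insert[OF insert.hyps]) simp
  qed
qed (simp add: act_el_zero[OF v])

lemma arr_act_in: "v \<in> space M \<Longrightarrow> arr_act M v x y \<in> space M"
  unfolding arr_act_def by (rule act_el_in[OF _ Coeffs_basis])

lemma arr_act_lin: "lin_on (space M) (\<lambda>v. arr_act M v x y)"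
  unfolding arr_act_def by (rule rmod_act_lin[OF M el_carrier[OF Coeffs_basis]])

lemma arr_act_add: "v \<in> space M \<Longrightarrow> w \<in> space M \<Longrightarrow> arr_act M (v + w) x y = arr_act M v x y + arr_act M w x y"
  using arr_act_lin unfolding lin_on_def by blast

lemma arr_act_scale: "v \<in> space M \<Longrightarrow> arr_act M (vscale c v) x y = vscale c (arr_act M v x y)"
  using arr_act_lin unfolding lin_on_def by blast

lemma arr_act_0: "arr_act M 0 x y = 0"
  unfolding arr_act_def by (rule rmod_act_0[OF M el_carrier[OF Coeffs_basis]])

lemma arr_act_diff: "v \<in> space M \<Longrightarrow> w \<in> space M \<Longrightarrow> arr_act M (v - w) x y = arr_act M v x y - arr_act M w x y"
  unfolding arr_act_def by (rule rmod_act_diff[OF M _ _ el_carrier[OF Coeffs_basis]])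

lemma arr_act_sum: "(\<And>i. i \<in> F \<Longrightarrow> v i \<in> space M) \<Longrightarrow> arr_act M (\<Sum>i\<in>F. v i) x y = (\<Sum>i\<in>F. arr_act M (v i) x y)"
  using lin_on_sum[OF arr_act_lin rmod_subspace[OF M]] by blast

lemma arr_act_shift: "arr_act M v (shift k x) (shift k y) = arr_act M v x y"
  by (simp only: arr_act_def basis_shift)

lemma arr_act_not_interlace: "v \<in> space M \<Longrightarrow> \<not> interlace x y \<Longrightarrow> arr_act M v x y = 0"
proof -
  assume v: "v \<in> space M" and "\<not> interlace x y"
  hence "basis x y = (\<lambda>_ _. 0 :: 'k)" by (simp add: basis_def fun_eq_iff)
  thus ?thesis unfolding arr_act_def using act_el_zero[OF v] by simp
qed

text \<open>All nonzero Hom-spaces are one dimensional with compatible basis vectors, so a composite of two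
  basis morphisms is the basis morphism or zero; \<open>arr_act M v x z\<close> vanishes unless \<open>x\<close> and \<open>z\<close> interlace.\<close>

lemma arr_act_arr_act: "v \<in> space M \<Longrightarrow> arr_act M (arr_act M v y z) x y = (if interlace x y \<and> interlace y z then arr_act M v x z else 0)"
  unfolding arr_act_def act_el_conv[OF _ Coeffs_basis Coeffs_basis] conv_basis using act_el_zero by simp

lemma arr_act_arr_act': "v \<in> space M \<Longrightarrow> interlace x y \<Longrightarrow> interlace y z \<Longrightarrow> arr_act M (arr_act M v y z) x y = arr_act M v x z"
  using arr_act_arr_act by simp

lemma arr_act_idem: "v \<in> space M \<Longrightarrow> arr_act M (arr_act M v y z) y y = arr_act M v y z"
  using arr_act_arr_act[of v y z y] arr_act_not_interlace[of v y z] interlace_refl interlace_os by (cases "interlace y z") auto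

lemma arr_act_orbits: "v \<in> space M \<Longrightarrow> (\<And>k. y' \<noteq> shift k y) \<Longrightarrow> arr_act M (arr_act M v y' z) x y = 0"
proof -
  assume v: "v \<in> space M" and o: "\<And>k. y' \<noteq> shift k y"
  show ?thesis unfolding arr_act_def act_el_conv[OF v Coeffs_basis Coeffs_basis] conv_basis_orbits[OF o] by (rule act_el_zero[OF v])
qed

lemma arr_act_reps_sum: "v \<in> space M \<Longrightarrow> v = (\<Sum>x\<in>reps. arr_act M v x x)"
proof -
  assume v: "v \<in> space M"
  have "act M v (el unit_coeff) = v" using rmod_act_one[OF M v] by (simp only: el_one)
  thus ?thesis unfolding arr_act_def unit_coeff_sum act_el_sum[OF v Coeffs_basis, symmetric] by simp
qed

text \<open>The action of an arbitrary element in terms of basis morphisms, one component at a time.\<close>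

lemma arr_act_act:
  assumes v: "v \<in> space M" and \<gamma>: "\<gamma> \<in> Coeffs" and w: "w \<in> os d l"
  shows "arr_act M (act M v (el \<gamma>)) w w = (\<Sum>z\<in>above w. vscale (\<gamma> w z) (arr_act M v w z))"
proof -
  have "arr_act M (act M v (el \<gamma>)) w w = act M v (el (\<lambda>x y. \<Sum>z\<in>above w. \<gamma> w z * basis w z x y))"
    unfolding arr_act_def act_el_conv[OF v \<gamma> Coeffs_basis] conv_row[OF \<gamma> w] ..
  also have "\<dots> = (\<Sum>z\<in>above w. act M v (el (\<lambda>x y. \<gamma> w z * basis w z x y)))"
    by (rule act_el_sum[OF v]) (rule Coeffs_scale[OF Coeffs_basis])
  also have "\<dots> = (\<Sum>z\<in>above w. vscale (\<gamma> w z) (arr_act M v w z))"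
    unfolding arr_act_def act_el_scale[OF v Coeffs_basis] ..
  finally show ?thesis .
qed

lemma arr_act_act':
  assumes v: "v \<in> space M" and \<gamma>: "\<gamma> \<in> Coeffs" and xw: "interlace x w"
  shows "arr_act M (act M v (el \<gamma>)) x w = (\<Sum>z\<in>above w. vscale (\<gamma> w z) (if interlace x z then arr_act M v x z else 0))"
proof -
  have w: "w \<in> os d l" using interlace_os(2)[OF xw] .
  have "arr_act M (act M v (el \<gamma>)) x w = arr_act M (arr_act M (act M v (el \<gamma>)) w w) x w"
    using arr_act_arr_act'[OF act_el_in[OF v \<gamma>] xw interlace_refl[OF w]] by simp
  also have "\<dots> = (\<Sum>z\<in>above w. arr_act M (vscale (\<gamma> w z) (arr_act M v w z)) x w)"
    unfolding arr_act_act[OF v \<gamma> w] by (rule arr_act_sum) (rule rmod_scale[OF M arr_act_in[OF v]])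
  also have "\<dots> = (\<Sum>z\<in>above w. vscale (\<gamma> w z) (if interlace x z then arr_act M v x z else 0))"
  proof (rule sum.cong[OF refl])
    fix z assume "z \<in> above w"
    hence "interlace w z" by (simp add: above_def)
    hence "arr_act M (arr_act M v w z) x w = (if interlace x z then arr_act M v x z else 0)"
      using arr_act_arr_act'[OF v xw] arr_act_not_interlace[OF v] by simp
    thus "arr_act M (vscale (\<gamma> w z) (arr_act M v w z)) x w = vscale (\<gamma> w z) (if interlace x z then arr_act M v x z else 0)"
      by (simp only: arr_act_scale[OF arr_act_in[OF v]])
  qed
  finally show ?thesis .
qed

lemma comp_ext:
  assumes "v \<in> space M" "w \<in> space M" "\<And>x. x \<in> os d l \<Longrightarrow> arr_act M v x x = arr_act M w x x"
  shows "v = w"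
proof -
  have "v = (\<Sum>x\<in>reps. arr_act M v x x)" by (rule arr_act_reps_sum[OF assms(1)])
  also have "\<dots> = (\<Sum>x\<in>reps. arr_act M w x x)" using assms(3) reps_os by (intro sum.cong) auto
  also have "\<dots> = w" by (rule arr_act_reps_sum[OF assms(2), symmetric])
  finally show ?thesis .
qed

lemma glue_in: "(\<And>x. x \<in> os d l \<Longrightarrow> u x \<in> space M) \<Longrightarrow> glue u \<in> space M"
  unfolding glue_def using reps_os by (intro kvec.subspace_sum[OF rmod_subspace[OF M]]) auto

lemma arr_act_glue:
  assumes u: "\<And>x. x \<in> os d l \<Longrightarrow> u x \<in> space M" "\<And>x. x \<in> os d l \<Longrightarrow> arr_act M (u x) x x = u x"
    "\<And>k x. x \<in> os d l \<Longrightarrow> u (shift k x) = u x" and x: "x \<in> os d l"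
  shows "arr_act M (glue u) x x = u x"
proof -
  obtain k where k: "shift k x \<in> reps" using reps_ex[OF x] by blast
  have "arr_act M (glue u) x x = (\<Sum>r\<in>reps. arr_act M (u r) x x)"
    unfolding glue_def using u(1) reps_os by (intro arr_act_sum) auto
  also have "\<dots> = (\<Sum>r\<in>reps. if r = shift k x then u x else 0)"
  proof (rule sum.cong[OF refl])
    fix r assume r: "r \<in> reps"
    show "arr_act M (u r) x x = (if r = shift k x then u x else 0)"
    proof (cases "r = shift k x")
      case True
      thus ?thesis using u(2,3)[OF x] by simp
    next
      case False
      have "r \<noteq> shift j x" for j
      proof
        assume "r = shift j x"
        hence "shift (-k) (shift k x) = shift (- j) r" by simp
        thus False using reps_unique[OF k r] False by blast
      qed
      hence "arr_act M (arr_act M (u r) r r) x x = 0" using arr_act_orbits[OF u(1)[OF reps_os[OF r]]] by blast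
      thus ?thesis using u(2)[OF reps_os[OF r]] False by simp
    qed
  qed
  also have "\<dots> = u x" using finite_reps k by (simp add: sum.delta)
  finally show ?thesis .
qed

end

end

section \<open>Lowering a vertex along a set of coordinates\<close>

context interlacing
begin

definition lower :: "nat set \<Rightarrow> vertex \<Rightarrow> vertex" where
  "lower I y = map (\<lambda>i. y ! i - (if i \<in> I then 1 else 0)) [0..<length y]"

lemma length_lower [simp]: "length (lower I y) = length y"
  by (simp add: lower_def)

lemma nth_lower [simp]: "i < length y \<Longrightarrow> lower I y ! i = y ! i - (if i \<in> I then 1 else 0)"
  by (simp add: lower_def)

lemma lower_empty [simp]: "lower {} y = y"
  by (rule nth_equalityI) auto

lemma lower_shift [simp]: "lower I (shift k y) = shift k (lower I y)"
  by (rule nth_equalityI) auto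

lemma length_bump [simp]: "length (bump i x) = length x"
  by (simp add: bump_def)

lemma nth_bump: "j < length x \<Longrightarrow> bump i x ! j = x ! j + (if i = j then 1 else 0)"
  by (simp add: bump_def nth_list_update)

lemma bump_shift [simp]: "i < length x \<Longrightarrow> bump i (shift k x) = shift k (bump i x)"
  by (rule nth_equalityI) (auto simp: nth_bump)

lemma lower_bump: "i \<notin> I \<Longrightarrow> lower (insert i I) (bump i y) = lower I y"
  by (rule nth_equalityI) (auto simp: nth_bump)

lemma bump_swap: "i < length x \<Longrightarrow> j < length x \<Longrightarrow> bump i (bump j x) = bump j (bump i x)"
  by (rule nth_equalityI) (auto simp: nth_bump)

lemma below_lower: "length y = d + 1 \<Longrightarrow> below (lower I y) y"
  by (auto simp: below_def)

lemma below_lower_mono: "length y = d + 1 \<Longrightarrow> I \<subseteq> J \<Longrightarrow> below (lower J y) (lower I y)"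
  by (auto simp: below_def)

lemma below_bump: "length y = d + 1 \<Longrightarrow> below y (bump i y)"
  by (auto simp: below_def nth_bump)

text \<open>The positions \<open>(I, y)\<close> that contribute to the component at \<open>z\<close> of the Koszul module of degree \<open>m\<close>:
  those with \<open>Hom(z, y - e\<^sub>I) \<noteq> 0\<close>.\<close>

definition adm :: "nat \<Rightarrow> nat set \<Rightarrow> vertex \<Rightarrow> vertex \<Rightarrow> bool" where
  "adm m I y z \<longleftrightarrow> I \<subseteq> {..d} \<and> card I = m \<and> y \<in> os d l \<and> interlace z (lower I y)"

lemma adm_shift [simp]: "adm m I (shift k y) (shift k z) \<longleftrightarrow> adm m I y z"
  by (simp add: adm_def)

definition adm_at where "adm_at m z = {(I, y). adm m I y z}"

lemma finite_adm_at: "finite (adm_at m z)"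
proof (rule finite_subset)
  show "adm_at m z \<subseteq> (\<Union>I\<in>Pow {..d}. {I} \<times> {y. length y = d + 1 \<and> lower I y \<in> above z})"
    by (auto simp: adm_at_def adm_def above_def os_length)
  have "finite {y. length y = d + 1 \<and> lower I y \<in> above z}" for I
  proof (rule finite_box[of _ "\<lambda>i. z ! i" "\<lambda>i. next_entry z i + 1"])
    fix y assume "y \<in> {y. length y = d + 1 \<and> lower I y \<in> above z}"
    hence y: "length y = d + 1" "\<And>i. i \<le> d \<Longrightarrow> z ! i \<le> lower I y ! i \<and> lower I y ! i < next_entry z i"
      by (auto simp: above_def interlace_def)
    have "z ! i \<le> y ! i \<and> y ! i \<le> next_entry z i + 1" if "i \<le> d" for i
      using y(2)[OF that] y(1) that by (auto split: if_splits)
    thus "length y = d + 1 \<and> (\<forall>i\<le>d. z ! i \<le> y ! i \<and> y ! i \<le> next_entry z i + 1)" using y(1) by blast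
  qed
  thus "finite (\<Union>I\<in>Pow {..d}. {I} \<times> {y. length y = d + 1 \<and> lower I y \<in> above z})" by auto
qed

definition adm_reps where "adm_reps m = {(I, y, z). z \<in> reps \<and> adm m I y z}"

lemma finite_adm_reps: "finite (adm_reps m)"
proof (rule finite_subset)
  show "adm_reps m \<subseteq> (\<lambda>(z, I, y). (I, y, z)) ` (SIGMA z:reps. adm_at m z)"
    by (force simp: adm_reps_def adm_at_def)
  show "finite ((\<lambda>(z, I, y). (I, y, z)) ` (SIGMA z:reps. adm_at m z))"
    using finite_reps finite_adm_at by auto
qed

end

section \<open>Families and their encoding as vectors\<close>

type_synonym 'k fam = "nat set \<Rightarrow> vertex \<Rightarrow> vertex \<Rightarrow> 'k vec"

text \<open>The space of a module consists of functions \<open>nat \<Rightarrow> 'k\<close>. A family of such functions indexed by finite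
  sets and pairs of vertices becomes a single one by coding the index; \<open>dec\<close> sets the values at infinite
  sets, which have no code, to zero.\<close>

definition enc :: "'k fam \<Rightarrow> 'k::field vec" where
  "enc \<phi> k = (case prod_decode k of (a, b) \<Rightarrow> case prod_decode a of (i, j) \<Rightarrow> case prod_decode b of (y, z) \<Rightarrow>
     \<phi> (set_decode i) (from_nat y) (from_nat z) j)"

definition dec :: "'k::field vec \<Rightarrow> 'k fam" where
  "dec v I y z j = (if finite I then v (prod_encode (prod_encode (set_encode I, j), prod_encode (to_nat y, to_nat z))) else 0)"

lemma dec_enc:
  assumes "\<And>I y z. infinite I \<Longrightarrow> \<phi> I y z = 0"
  shows "dec (enc \<phi>) = \<phi>"
  using assms by (auto simp: fun_eq_iff dec_def enc_def)

lemma enc_add: "enc (\<lambda>I y z. \<phi> I y z + \<psi> I y z) = enc \<phi> + enc \<psi>"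
  by (auto simp: fun_eq_iff enc_def split: prod.split)

lemma enc_scale: "enc (\<lambda>I y z. vscale c (\<phi> I y z)) = vscale c (enc \<phi>)"
  by (auto simp: fun_eq_iff enc_def vscale_def split: prod.split)

lemma enc_zero: "enc (\<lambda>I y z. 0) = 0"
  by (auto simp: fun_eq_iff enc_def split: prod.split)

lemma enc_sum: "enc (\<lambda>I y z. \<Sum>i\<in>F. \<phi> i I y z) = (\<Sum>i\<in>F. enc (\<phi> i))"
proof (cases "finite F")
  case True
  thus ?thesis
  proof (induction F rule: finite_induct)
    case (insert i F)
    have "enc (\<lambda>I y z. \<Sum>i\<in>insert i F. \<phi> i I y z) = enc (\<lambda>I y z. \<phi> i I y z + (\<Sum>i\<in>F. \<phi> i I y z))"
      by (simp only: sum.insert[OF insert.hyps])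
    also have "\<dots> = enc (\<phi> i) + enc (\<lambda>I y z. \<Sum>i\<in>F. \<phi> i I y z)"
      by (rule enc_add)
    also have "\<dots> = (\<Sum>i\<in>insert i F. enc (\<phi> i))" by (simp only: insert.IH sum.insert[OF insert.hyps])
    finally show ?case .
  qed (simp only: sum.empty enc_zero)
qed (simp only: sum.infinite enc_zero simp_thms)

context orbit_algebra
begin

text \<open>The vectors of \<open>\<Oplus> M\<^sub>y \<otimes> e(y - e\<^sub>I)\<Lambda>\<close>. The component at \<open>z\<close> of the summand is \<open>M\<^sub>y \<otimes> Hom(z, y - e\<^sub>I)\<close>,
  which is \<open>M\<^sub>y\<close> or zero; \<open>\<phi> I y z\<close> is the entry there. Translation invariance takes the place of a sum
  over orbits of vertices \<open>y\<close>.\<close>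

definition Fam :: "nat \<Rightarrow> ('k, 'a) rmod \<Rightarrow> 'k fam set" where
  "Fam m M = {\<phi>. (\<forall>I y z. \<not> adm m I y z \<longrightarrow> \<phi> I y z = 0) \<and>
     (\<forall>I y z. \<phi> I y z \<in> space M \<and> arr_act M (\<phi> I y z) y y = \<phi> I y z) \<and>
     (\<forall>k I y z. \<phi> I (shift k y) (shift k z) = \<phi> I y z)}"

lemma FamD:
  assumes "\<phi> \<in> Fam m M"
  shows Fam_adm: "\<And>I y z. \<not> adm m I y z \<Longrightarrow> \<phi> I y z = 0"
    and Fam_in: "\<And>I y z. \<phi> I y z \<in> space M"
    and Fam_arr_act: "\<And>I y z. arr_act M (\<phi> I y z) y y = \<phi> I y z"
    and Fam_shift: "\<And>k I y z. \<phi> I (shift k y) (shift k z) = \<phi> I y z"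
  using assms unfolding Fam_def by auto

lemma FamI:
  assumes "\<And>I y z. \<not> adm m I y z \<Longrightarrow> \<phi> I y z = 0" "\<And>I y z. \<phi> I y z \<in> space M"
    "\<And>I y z. arr_act M (\<phi> I y z) y y = \<phi> I y z" "\<And>k I y z. \<phi> I (shift k y) (shift k z) = \<phi> I y z"
  shows "\<phi> \<in> Fam m M"
  using assms unfolding Fam_def by blast

lemma Fam_nonzero: "\<phi> \<in> Fam m M \<Longrightarrow> \<phi> I y z \<noteq> 0 \<Longrightarrow> adm m I y z"
  using Fam_adm by blast

lemma dec_enc_Fam: "\<phi> \<in> Fam m M \<Longrightarrow> dec (enc \<phi>) = \<phi>"
proof (rule dec_enc)
  fix I y z assume \<phi>: "\<phi> \<in> Fam m M" and "infinite (I :: nat set)"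
  hence "\<not> adm m I y z" unfolding adm_def using finite_subset[of I "{..d}"] by blast
  thus "\<phi> I y z = 0" by (rule Fam_adm[OF \<phi>])
qed

text \<open>Right multiplication on the tensor factor \<open>e(y - e\<^sub>I)\<Lambda>\<close>: the entry at \<open>w\<close> collects the entries at
  the vertices \<open>z\<close> that \<open>w\<close> maps to.\<close>

definition fam_act :: "'k fam \<Rightarrow> (vertex \<Rightarrow> vertex \<Rightarrow> 'k) \<Rightarrow> 'k fam" where
  "fam_act \<phi> \<gamma> I y w = (if interlace w (lower I y) then \<Sum>z\<in>above w. vscale (\<gamma> w z) (\<phi> I y z) else 0)"

definition coeffs :: "'a \<Rightarrow> vertex \<Rightarrow> vertex \<Rightarrow> 'k" where "coeffs = inv_into Coeffs el"

lemma coeffs_el [simp]: "\<gamma> \<in> Coeffs \<Longrightarrow> coeffs (el \<gamma>) = \<gamma>"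
  unfolding coeffs_def by (rule inv_into_f_f[OF inj_el])

text \<open>Degree \<open>m\<close> of the Koszul complex of \<open>M\<close>.\<close>

definition koszul :: "nat \<Rightarrow> ('k, 'a) rmod \<Rightarrow> ('k, 'a) rmod" where
  "koszul m M = \<lparr>space = enc ` Fam m M, act = (\<lambda>v a. enc (fam_act (dec v) (coeffs a)))\<rparr>"

lemma space_koszul: "space (koszul m M) = enc ` Fam m M"
  by (simp add: koszul_def)

lemma act_koszul: "\<phi> \<in> Fam m M \<Longrightarrow> \<gamma> \<in> Coeffs \<Longrightarrow> act (koszul m M) (enc \<phi>) (el \<gamma>) = enc (fam_act \<phi> \<gamma>)"
  by (simp add: koszul_def dec_enc_Fam)

lemma fam_act_sum:
  assumes \<gamma>: "\<gamma> \<in> Coeffs" and S: "finite S" "above w \<subseteq> S"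
  shows "fam_act \<phi> \<gamma> I y w = (if interlace w (lower I y) then \<Sum>z\<in>S. vscale (\<gamma> w z) (\<phi> I y z) else 0)"
proof -
  have "(\<Sum>z\<in>above w. vscale (\<gamma> w z) (\<phi> I y z)) = (\<Sum>z\<in>S. vscale (\<gamma> w z) (\<phi> I y z))"
  proof (rule sum.mono_neutral_left[OF S], rule ballI)
    fix z assume "z \<in> S - above w"
    hence "\<gamma> w z = 0" using CoeffsD(1)[OF \<gamma>] by (auto simp: above_def)
    thus "vscale (\<gamma> w z) (\<phi> I y z) = 0" by (simp only: kvec.scale_zero_left)
  qed
  thus ?thesis by (simp only: fam_act_def)
qed

definition orbit_fam :: "nat set \<Rightarrow> vertex \<Rightarrow> vertex \<Rightarrow> 'k vec \<Rightarrow> 'k fam" where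
  "orbit_fam J y0 z0 v I y z = (if I = J \<and> (\<exists>k. y = shift k y0 \<and> z = shift k z0) then v else 0)"

context
  fixes M :: "('k, 'a) rmod"
  assumes M: "rmodule L M"
begin

lemma Fam_zero: "(\<lambda>I y z. 0) \<in> Fam m M"
  by (rule FamI) (auto simp: rmod_0[OF M] arr_act_0[OF M])

lemma Fam_add: "\<phi> \<in> Fam m M \<Longrightarrow> \<psi> \<in> Fam m M \<Longrightarrow> (\<lambda>I y z. \<phi> I y z + \<psi> I y z) \<in> Fam m M"
  by (rule FamI) (simp_all only: simp_thms add_0_left Fam_adm Fam_shift rmod_add[OF M] Fam_in arr_act_add[OF M] Fam_arr_act)

lemma Fam_scale: "\<phi> \<in> Fam m M \<Longrightarrow> (\<lambda>I y z. vscale c (\<phi> I y z)) \<in> Fam m M"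
  by (rule FamI) (simp_all only: simp_thms kvec.scale_zero_right Fam_adm Fam_shift rmod_scale[OF M] Fam_in arr_act_scale[OF M] Fam_arr_act)

lemma Fam_diff: "\<phi> \<in> Fam m M \<Longrightarrow> \<psi> \<in> Fam m M \<Longrightarrow> (\<lambda>I y z. \<phi> I y z - \<psi> I y z) \<in> Fam m M"
  by (rule FamI) (simp_all only: simp_thms diff_self Fam_adm Fam_shift rmod_diff[OF M] Fam_in arr_act_diff[OF M] Fam_arr_act)

lemma Fam_fam_act:
  assumes \<phi>: "\<phi> \<in> Fam m M" and \<gamma>: "\<gamma> \<in> Coeffs"
  shows "fam_act \<phi> \<gamma> \<in> Fam m M"
proof (rule FamI)
  fix I y w assume ng: "\<not> adm m I y w"
  have "\<phi> I y z = 0" if "interlace w (lower I y)" for z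
    using ng that Fam_adm[OF \<phi>] unfolding adm_def by blast
  thus "fam_act \<phi> \<gamma> I y w = 0" by (simp add: fam_act_def)
next
  fix I y w
  have s: "(\<Sum>z\<in>above w. vscale (\<gamma> w z) (\<phi> I y z)) \<in> space M"
    by (intro kvec.subspace_sum[OF rmod_subspace[OF M]] rmod_scale[OF M] Fam_in[OF \<phi>])
  thus "fam_act \<phi> \<gamma> I y w \<in> space M" using rmod_0[OF M] by (simp add: fam_act_def)
  have "arr_act M (\<Sum>z\<in>above w. vscale (\<gamma> w z) (\<phi> I y z)) y y = (\<Sum>z\<in>above w. arr_act M (vscale (\<gamma> w z) (\<phi> I y z)) y y)"
    by (rule arr_act_sum[OF M]) (rule rmod_scale[OF M Fam_in[OF \<phi>]])
  also have "\<dots> = (\<Sum>z\<in>above w. vscale (\<gamma> w z) (\<phi> I y z))"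
    by (simp only: arr_act_scale[OF M Fam_in[OF \<phi>]] Fam_arr_act[OF \<phi>])
  finally show "arr_act M (fam_act \<phi> \<gamma> I y w) y y = fam_act \<phi> \<gamma> I y w"
    by (simp add: fam_act_def arr_act_0[OF M])
next
  fix k I y w
  have "(\<Sum>z\<in>above (shift k w). vscale (\<gamma> (shift k w) z) (\<phi> I (shift k y) z)) = (\<Sum>z\<in>above w. vscale (\<gamma> w z) (\<phi> I y z))"
  proof (rule sum.reindex_bij_witness[of _ "shift k" "shift (- k)"])
    fix z assume "z \<in> above (shift k w)"
    thus "shift (- k) z \<in> above w" using interlace_shift[of "- k" "shift k w" z] by (simp add: above_def)
    show "shift k (shift (- k) z) = z" by simp
    show "vscale (\<gamma> w (shift (- k) z)) (\<phi> I y (shift (- k) z)) = vscale (\<gamma> (shift k w) z) (\<phi> I (shift k y) z)"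
      using Fam_shift[OF \<phi>, of I k y "shift (- k) z"] Coeffs_shift[OF \<gamma>, of k w z] by simp
  qed (auto simp: above_def)
  thus "fam_act \<phi> \<gamma> I (shift k y) (shift k w) = fam_act \<phi> \<gamma> I y w" by (simp add: fam_act_def)
qed

lemma fam_act_unit:
  assumes \<phi>: "\<phi> \<in> Fam m M"
  shows "fam_act \<phi> unit_coeff = \<phi>"
proof (intro ext)
  fix I y w j
  have "fam_act \<phi> unit_coeff I y w = \<phi> I y w"
  proof (cases "interlace w (lower I y)")
    case True
    have w: "w \<in> os d l" using interlace_os(1)[OF True] .
    have "(\<Sum>z\<in>above w. vscale (unit_coeff w z) (\<phi> I y z)) = (\<Sum>z\<in>above w. if z = w then \<phi> I y w else 0)"
      using w by (intro sum.cong refl) (auto simp: unit_coeff_def)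
    also have "\<dots> = \<phi> I y w" using finite_above interlace_refl[OF w] by (simp add: above_def)
    finally show ?thesis using True by (simp add: fam_act_def)
  next
    case False
    thus ?thesis using Fam_adm[OF \<phi>] by (simp add: fam_act_def adm_def)
  qed
  thus "fam_act \<phi> unit_coeff I y w j = \<phi> I y w j" by simp
qed

text \<open>Both sides are sums over \<open>w \<rightarrow> u \<rightarrow> z\<close>, and a term that occurs on one side only belongs to a zero entry of
  the family.\<close>

lemma fam_act_conv:
  assumes \<phi>: "\<phi> \<in> Fam m M" and \<gamma>: "\<gamma> \<in> Coeffs" and \<delta>: "\<delta> \<in> Coeffs"
  shows "fam_act \<phi> (conv \<gamma> \<delta>) = fam_act (fam_act \<phi> \<gamma>) \<delta>"
proof -
  have "fam_act \<phi> (conv \<gamma> \<delta>) I y w = fam_act (fam_act \<phi> \<gamma>) \<delta> I y w" for I y w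
  proof (cases "interlace w (lower I y)")
    case True
    define S where "S = above w \<union> (\<Union>u\<in>above w. above u)"
    have S: "finite S" "above w \<subseteq> S" "\<And>u. u \<in> above w \<Longrightarrow> above u \<subseteq> S"
      unfolding S_def using finite_above by auto
    have conv: "conv \<gamma> \<delta> w z = (\<Sum>u\<in>above w. if interlace w z then \<delta> w u * \<gamma> u z else 0)" for z
    proof -
      have "(\<Sum>u | interlace w u \<and> interlace u z. \<delta> w u * \<gamma> u z) = (\<Sum>u\<in>above w. \<delta> w u * \<gamma> u z)"
        by (rule sum.mono_neutral_left[OF finite_above]) (auto simp: above_def CoeffsD(1)[OF \<gamma>])
      thus ?thesis by (simp add: conv_def)
    qed
    have "fam_act \<phi> (conv \<gamma> \<delta>) I y w = (\<Sum>z\<in>S. vscale (conv \<gamma> \<delta> w z) (\<phi> I y z))"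
      using True fam_act_sum[OF Coeffs_conv[OF \<gamma> \<delta>] S(1,2)] by simp
    also have "\<dots> = (\<Sum>z\<in>S. \<Sum>u\<in>above w. vscale (if interlace w z then \<delta> w u * \<gamma> u z else 0) (\<phi> I y z))"
      by (simp only: conv kvec.scale_sum_left)
    also have "\<dots> = (\<Sum>u\<in>above w. \<Sum>z\<in>S. vscale (if interlace w z then \<delta> w u * \<gamma> u z else 0) (\<phi> I y z))"
      by (rule sum.swap)
    also have "\<dots> = (\<Sum>u\<in>above w. vscale (\<delta> w u) (fam_act \<phi> \<gamma> I y u))"
    proof (rule sum.cong[OF refl])
      fix u assume u: "u \<in> above w"
      hence wu: "interlace w u" by (simp add: above_def)
      have "(\<Sum>z\<in>S. vscale (if interlace w z then \<delta> w u * \<gamma> u z else 0) (\<phi> I y z))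
          = (\<Sum>z\<in>S. vscale (\<delta> w u) (if interlace u (lower I y) then vscale (\<gamma> u z) (\<phi> I y z) else 0))"
      proof (rule sum.cong[OF refl])
        fix z
        show "vscale (if interlace w z then \<delta> w u * \<gamma> u z else 0) (\<phi> I y z)
          = vscale (\<delta> w u) (if interlace u (lower I y) then vscale (\<gamma> u z) (\<phi> I y z) else 0)"
        proof (cases "interlace u z \<and> \<phi> I y z \<noteq> 0")
          case t: True
          hence uz: "interlace u z" and zt: "interlace z (lower I y)" using Fam_nonzero[OF \<phi>] unfolding adm_def by auto
          have "below w u" "below u z" "below z (lower I y)" using wu uz zt interlace_below by auto
          hence "interlace w z" "interlace u (lower I y)"
            using interlace_convex[OF True, of z] interlace_convex[OF True, of u] below_trans by blast+
          thus ?thesis by simp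
        next
          case False
          hence "\<gamma> u z = 0 \<or> \<phi> I y z = 0" using CoeffsD(1)[OF \<gamma>] by blast
          thus ?thesis by auto
        qed
      qed
      also have "\<dots> = vscale (\<delta> w u) (fam_act \<phi> \<gamma> I y u)"
        unfolding fam_act_sum[OF \<gamma> S(1) S(3)[OF u]] by (simp add: kvec.scale_sum_right)
      finally show "(\<Sum>z\<in>S. vscale (if interlace w z then \<delta> w u * \<gamma> u z else 0) (\<phi> I y z)) = vscale (\<delta> w u) (fam_act \<phi> \<gamma> I y u)" .
    qed
    also have "\<dots> = fam_act (fam_act \<phi> \<gamma>) \<delta> I y w" using True by (simp add: fam_act_def[of "fam_act \<phi> \<gamma>"])
    finally show ?thesis .
  qed (simp add: fam_act_def)
  thus ?thesis by (intro ext) simp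
qed

lemma fam_act_add_fam: "fam_act (\<lambda>I y z. \<phi> I y z + \<psi> I y z) \<gamma> = (\<lambda>I y z. fam_act \<phi> \<gamma> I y z + fam_act \<psi> \<gamma> I y z)"
  by (intro ext) (simp add: fam_act_def kvec.scale_right_distrib sum.distrib)

lemma fam_act_add_coeff: "fam_act \<phi> (\<lambda>x y. \<gamma> x y + \<delta> x y) = (\<lambda>I y z. fam_act \<phi> \<gamma> I y z + fam_act \<phi> \<delta> I y z)"
  by (intro ext) (simp add: fam_act_def kvec.scale_left_distrib sum.distrib)

lemma fam_act_scale_fam: "fam_act (\<lambda>I y z. vscale c (\<phi> I y z)) \<gamma> = (\<lambda>I y z. vscale c (fam_act \<phi> \<gamma> I y z))"
  by (intro ext) (simp add: fam_act_def kvec.scale_sum_right mult.commute)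

lemma fam_act_scale_coeff: "fam_act \<phi> (\<lambda>x y. c * \<gamma> x y) = (\<lambda>I y z. vscale c (fam_act \<phi> \<gamma> I y z))"
  by (intro ext) (simp add: fam_act_def kvec.scale_sum_right)

lemma orbit_fam_shift: "orbit_fam J (shift k y) (shift k z) v = orbit_fam J y z v"
proof (intro ext)
  fix I y' z' j
  have "(\<exists>i. y' = shift (i + k) y \<and> z' = shift (i + k) z) \<longleftrightarrow> (\<exists>i. y' = shift i y \<and> z' = shift i z)"
    by (metis diff_add_cancel)
  thus "orbit_fam J (shift k y) (shift k z) v I y' z' j = orbit_fam J y z v I y' z' j" by (simp add: orbit_fam_def)
qed

lemma orbit_fam_Fam:
  assumes g: "adm m J y0 z0" and v: "v \<in> space M" "arr_act M v y0 y0 = v"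
  shows "orbit_fam J y0 z0 v \<in> Fam m M"
proof (rule FamI)
  fix I y z assume "\<not> adm m I y z"
  thus "orbit_fam J y0 z0 v I y z = 0" using g by (auto simp: orbit_fam_def)
next
  fix I y z
  show "orbit_fam J y0 z0 v I y z \<in> space M" using v rmod_0[OF M] by (simp add: orbit_fam_def)
  show "arr_act M (orbit_fam J y0 z0 v I y z) y y = orbit_fam J y0 z0 v I y z"
    using v by (auto simp: orbit_fam_def arr_act_0[OF M] arr_act_shift[OF M])
next
  fix k I y z
  have "(\<exists>i. shift k y = shift i y0 \<and> shift k z = shift i z0) \<longleftrightarrow> (\<exists>i. y = shift i y0 \<and> z = shift i z0)"
  proof
    assume "\<exists>i. shift k y = shift i y0 \<and> shift k z = shift i z0"
    then obtain i where "shift k y = shift i y0" "shift k z = shift i z0" by blast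
    hence "y = shift (- k + i) y0" "z = shift (- k + i) z0" by (simp_all only: simp_thms shift_eq_swap[of k] shift_shift)
    thus "\<exists>i. y = shift i y0 \<and> z = shift i z0" by blast
  next
    assume "\<exists>i. y = shift i y0 \<and> z = shift i z0"
    then obtain i where "y = shift i y0" "z = shift i z0" by blast
    thus "\<exists>i. shift k y = shift i y0 \<and> shift k z = shift i z0" by (intro exI[of _ "k + i"]) simp
  qed
  thus "orbit_fam J y0 z0 v I (shift k y) (shift k z) = orbit_fam J y0 z0 v I y z" by (simp add: orbit_fam_def)
qed

text \<open>Every orbit of positions has exactly one member with \<open>z\<close> in the fundamental domain \<open>reps\<close>. As there are
  finitely many such positions, the family module is finite dimensional.\<close>

lemma Fam_decompose:
  assumes \<phi>: "\<phi> \<in> Fam m M"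
  shows "\<phi> = (\<lambda>I' y' z'. \<Sum>(I, y, z)\<in>adm_reps m. orbit_fam I y z (\<phi> I y z) I' y' z')"
proof -
  have "\<phi> I' y' z' = (\<Sum>(I, y, z)\<in>adm_reps m. orbit_fam I y z (\<phi> I y z) I' y' z')" for I' y' z'
  proof (cases "adm m I' y' z'")
    case True
    have z': "z' \<in> os d l" using True interlace_os unfolding adm_def by blast
    then obtain k where k: "shift k z' \<in> reps" using reps_ex by blast
    have "(\<Sum>(I, y, z)\<in>adm_reps m. orbit_fam I y z (\<phi> I y z) I' y' z')
        = (\<Sum>p\<in>adm_reps m. if p = (I', shift k y', shift k z') then \<phi> I' y' z' else 0)"
    proof (rule sum.cong[OF refl])
      fix p assume p: "p \<in> adm_reps m"
      obtain I y z where pe: "p = (I, y, z)" by (cases p) auto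
      have z: "z \<in> reps" using p unfolding pe adm_reps_def by simp
      show "(case p of (I, y, z) \<Rightarrow> orbit_fam I y z (\<phi> I y z) I' y' z') = (if p = (I', shift k y', shift k z') then \<phi> I' y' z' else 0)"
      proof (cases "p = (I', shift k y', shift k z')")
        case True
        have "orbit_fam I' (shift k y') (shift k z') (\<phi> I' y' z') I' y' z' = \<phi> I' y' z'"
          unfolding orbit_fam_shift by (simp add: orbit_fam_def) (metis shift_0)
        thus ?thesis using True Fam_shift[OF \<phi>] by simp
      next
        case False
        have "\<not> (I' = I \<and> (\<exists>i. y' = shift i y \<and> z' = shift i z))"
        proof
          assume "I' = I \<and> (\<exists>i. y' = shift i y \<and> z' = shift i z)"
          then obtain i where i: "I' = I" "y' = shift i y" "z' = shift i z" by blast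
          have "shift (k + i) z \<in> reps" using k i by simp
          hence "k + i = 0" by (rule reps_shift[OF z])
          thus False using False i pe by simp
        qed
        hence z0: "orbit_fam I y z (\<phi> I y z) I' y' z' = 0" by (simp only: orbit_fam_def if_False)
        show ?thesis by (simp only: pe prod.case z0 False[unfolded pe] if_False)
      qed
    qed
    also have "\<dots> = \<phi> I' y' z'" using True k finite_adm_reps[of m] by (simp add: adm_reps_def)
    finally show ?thesis by simp
  next
    case False
    have "orbit_fam I y z (\<phi> I y z) I' y' z' = 0" if "(I, y, z) \<in> adm_reps m" for I y z
      using that False by (auto simp: orbit_fam_def adm_reps_def)
    hence "(\<Sum>(I, y, z)\<in>adm_reps m. orbit_fam I y z (\<phi> I y z) I' y' z') = 0"
      by (intro sum.neutral) (simp add: case_prod_beta)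
    thus ?thesis by (simp only: Fam_adm[OF \<phi> False])
  qed
  thus ?thesis by (rule ext[OF ext[OF ext]])
qed

lemma rmodule_koszul: "rmodule L (koszul m M)"
proof -
  have sub: "kvec.subspace (enc ` Fam m M)"
    unfolding kvec.subspace_def
  proof (intro conjI ballI allI)
    show "0 \<in> enc ` Fam m M" using Fam_zero enc_zero by (metis imageI)
    fix v assume "v \<in> enc ` Fam m M"
    then obtain \<phi> where \<phi>: "\<phi> \<in> Fam m M" "v = enc \<phi>" by blast
    show "vscale c v \<in> enc ` Fam m M" for c
      unfolding \<phi>(2) enc_scale[symmetric] by (rule imageI[OF Fam_scale[OF \<phi>(1)]])
    fix w assume "w \<in> enc ` Fam m M"
    then obtain \<psi> where \<psi>: "\<psi> \<in> Fam m M" "w = enc \<psi>" by blast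
    show "v + w \<in> enc ` Fam m M"
      unfolding \<phi>(2) \<psi>(2) enc_add[symmetric] by (rule imageI[OF Fam_add[OF \<phi>(1) \<psi>(1)]])
  qed
  obtain B where B: "finite B" "space M = kvec.span B" using rmod_fd[OF M] by blast
  define G where "G = (\<Union>(I, y, z)\<in>adm_reps m. (\<lambda>b. enc (orbit_fam I y z b)) ` B)"
  have fG: "finite G" unfolding G_def using finite_adm_reps B(1) by auto
  have orb: "enc (orbit_fam I y z v) \<in> kvec.span G" if p: "(I, y, z) \<in> adm_reps m" and v: "v \<in> kvec.span B" for I y z v
  proof -
    have a: "enc (orbit_fam I y z (v + w)) = enc (orbit_fam I y z v) + enc (orbit_fam I y z w)" for v w
      unfolding enc_add[symmetric] by (rule arg_cong[of _ _ enc]) (auto simp: fun_eq_iff orbit_fam_def)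
    have s: "enc (orbit_fam I y z (vscale c v)) = vscale c (enc (orbit_fam I y z v))" for c v
      unfolding enc_scale[symmetric] by (rule arg_cong[of _ _ enc]) (auto simp: fun_eq_iff orbit_fam_def vscale_def)
    have z: "enc (orbit_fam I y z 0) = 0"
      using s[of 0 0] by (simp only: kvec.scale_zero_left)
    have "kvec.subspace {v. enc (orbit_fam I y z v) \<in> kvec.span G}"
      unfolding kvec.subspace_def
      by (auto simp only: a s z mem_Collect_eq intro: kvec.span_zero kvec.span_add kvec.span_scale)
    moreover have "enc (orbit_fam I y z b) \<in> kvec.span G" if "b \<in> B" for b
      using p that unfolding G_def by (intro kvec.span_base) blast
    ultimately show ?thesis using kvec.span_induct[OF v, of "\<lambda>v. enc (orbit_fam I y z v) \<in> kvec.span G"] by simp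
  qed
  have "enc ` Fam m M \<subseteq> kvec.span G"
  proof
    fix v assume "v \<in> enc ` Fam m M"
    then obtain \<phi> where \<phi>: "\<phi> \<in> Fam m M" "v = enc \<phi>" by blast
    have "enc (\<lambda>I' y' z'. \<Sum>p\<in>adm_reps m. (\<lambda>(I, y, z). orbit_fam I y z (\<phi> I y z)) p I' y' z')
       = (\<Sum>p\<in>adm_reps m. enc ((\<lambda>(I, y, z). orbit_fam I y z (\<phi> I y z)) p))" by (rule enc_sum)
    also have "\<dots> \<in> kvec.span G"
      using orb Fam_in[OF \<phi>(1)] B(2) by (intro kvec.span_sum) auto
    finally show "v \<in> kvec.span G"
      unfolding \<phi>(2) using Fam_decompose[OF \<phi>(1)] by (simp add: case_prod_beta)
  qed
  hence fd: "\<exists>C. finite C \<and> enc ` Fam m M = kvec.span C" using fd_subspace[OF sub _ fG] by blast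
  note cl = Fam_fam_act Fam_add Fam_scale
  have e: "\<And>v. v \<in> space (koszul m M) \<longleftrightarrow> (\<exists>\<phi>\<in>Fam m M. v = enc \<phi>)" unfolding space_koszul by blast
  show ?thesis
    unfolding rmodule_def
  proof (intro conjI ballI allI)
    show "kvec.subspace (space (koszul m M))" "\<exists>C. finite C \<and> space (koszul m M) = kvec.span C"
      unfolding space_koszul using sub fd by auto
    fix v assume "v \<in> space (koszul m M)"
    then obtain \<phi> where \<phi>: "\<phi> \<in> Fam m M" "v = enc \<phi>" unfolding e by blast
    show "act (koszul m M) v \<one>\<^bsub>L\<^esub> = v"
      by (simp only: \<phi>(2) el_one act_koszul[OF \<phi>(1) Coeffs_unit] fam_act_unit[OF \<phi>(1)])
    fix a assume "a \<in> carrier L"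
    then obtain \<gamma> where \<gamma>: "\<gamma> \<in> Coeffs" "a = el \<gamma>" unfolding carrier_L by blast
    show "act (koszul m M) v a \<in> space (koszul m M)"
      unfolding \<phi>(2) \<gamma>(2) act_koszul[OF \<phi>(1) \<gamma>(1)] space_koszul by (rule imageI[OF Fam_fam_act[OF \<phi>(1) \<gamma>(1)]])
    show "act (koszul m M) (vscale c v) a = vscale c (act (koszul m M) v a)" for c
      unfolding \<phi>(2) \<gamma>(2) enc_scale[symmetric] act_koszul[OF \<phi>(1) \<gamma>(1)] act_koszul[OF Fam_scale[OF \<phi>(1)] \<gamma>(1)] fam_act_scale_fam ..
    show "act (koszul m M) v (c \<odot>\<^bsub>L\<^esub> a) = vscale c (act (koszul m M) v a)" for c
      unfolding \<phi>(2) \<gamma>(2) el_smult[OF \<gamma>(1)] act_koszul[OF \<phi>(1) \<gamma>(1)] act_koszul[OF \<phi>(1) Coeffs_scale[OF \<gamma>(1)]]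
        fam_act_scale_coeff enc_scale ..
    show "act (koszul m M) (v + w) a = act (koszul m M) v a + act (koszul m M) w a" if w: "w \<in> space (koszul m M)" for w
    proof -
      obtain \<psi> where \<psi>: "\<psi> \<in> Fam m M" "w = enc \<psi>" using w unfolding e by blast
      show ?thesis
        unfolding \<phi>(2) \<gamma>(2) \<psi>(2) enc_add[symmetric] act_koszul[OF \<phi>(1) \<gamma>(1)] act_koszul[OF \<psi>(1) \<gamma>(1)]
          act_koszul[OF Fam_add[OF \<phi>(1) \<psi>(1)] \<gamma>(1)] fam_act_add_fam ..
    qed
    fix b assume "b \<in> carrier L"
    then obtain \<delta> where \<delta>: "\<delta> \<in> Coeffs" "b = el \<delta>" unfolding carrier_L by blast
    show "act (koszul m M) v (a \<oplus>\<^bsub>L\<^esub> b) = act (koszul m M) v a + act (koszul m M) v b"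
      unfolding \<phi>(2) \<gamma>(2) \<delta>(2) el_add[OF \<gamma>(1) \<delta>(1)] act_koszul[OF \<phi>(1) \<gamma>(1)] act_koszul[OF \<phi>(1) \<delta>(1)]
        act_koszul[OF \<phi>(1) Coeffs_add[OF \<gamma>(1) \<delta>(1)]] fam_act_add_coeff enc_add ..
    show "act (koszul m M) v (a \<otimes>\<^bsub>L\<^esub> b) = act (koszul m M) (act (koszul m M) v a) b"
      unfolding \<phi>(2) \<gamma>(2) \<delta>(2) el_mult[OF \<gamma>(1) \<delta>(1)] act_koszul[OF \<phi>(1) \<gamma>(1)]
        act_koszul[OF Fam_fam_act[OF \<phi>(1) \<gamma>(1)] \<delta>(1)]
        act_koszul[OF \<phi>(1) Coeffs_conv[OF \<gamma>(1) \<delta>(1)]] fam_act_conv[OF \<phi>(1) \<gamma>(1) \<delta>(1)] ..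
  qed
qed

end

end

section \<open>Projectivity of the family modules\<close>

context orbit_algebra
begin

definition component :: "('k, 'a) rmod \<Rightarrow> vertex \<Rightarrow> 'k vec set" where
  "component M y = {v \<in> space M. arr_act M v y y = v}"

lemma component_subspace: "rmodule L M \<Longrightarrow> kvec.subspace (component M y)"
  unfolding kvec.subspace_def component_def
  by (simp add: rmod_0 rmod_add rmod_scale arr_act_0 arr_act_add arr_act_scale)

lemma Fam_component: "\<phi> \<in> Fam m M \<Longrightarrow> \<phi> I y z \<in> component M y"
  by (simp add: component_def Fam_in Fam_arr_act)

lemma rhom_arr_act: "f \<in> rhom L M X \<Longrightarrow> v \<in> space M \<Longrightarrow> f (arr_act M v x y) = arr_act X (f v) x y"
  unfolding arr_act_def by (rule rhom_act[OF _ _ el_carrier[OF Coeffs_basis]])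

text \<open>Linear maps \<open>M\<^sub>y \<rightarrow> X\<close> that depend only on the orbit of \<open>y\<close>. Composed with the projection to the component
  of \<open>X\<close> at \<open>y - e\<^sub>I\<close>, such a map \<open>s\<close> extends to \<open>M\<^sub>y \<otimes> e(y - e\<^sub>I)\<Lambda>\<close> by \<open>v \<otimes> \<lambda> \<mapsto> s(v)\<lambda>\<close>; the extension
  is \<open>induced\<close>.\<close>

definition equivariant_maps :: "('k, 'a) rmod \<Rightarrow> ('k, 'a) rmod \<Rightarrow> (nat set \<Rightarrow> vertex \<Rightarrow> 'k vec \<Rightarrow> 'k vec) \<Rightarrow> bool" where
  "equivariant_maps M X s \<longleftrightarrow> (\<forall>I y. lin_on (component M y) (s I y) \<and> (\<forall>v\<in>component M y. s I y v \<in> space X) \<and>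
     (\<forall>k. \<forall>v\<in>component M y. s I (shift k y) v = s I y v))"

definition induced_at where
  "induced_at m X s \<phi> z = (\<Sum>(I, y)\<in>adm_at m z. arr_act X (s I y (\<phi> I y z)) z (lower I y))"

definition induced where "induced m X s \<phi> = glue (induced_at m X s \<phi>)"

context
  fixes M X :: "('k, 'a) rmod" and s
  assumes M: "rmodule L M" and X: "rmodule L X" and s: "equivariant_maps M X s"
begin

lemma equivariant_mapsD: "lin_on (component M y) (s I y)" "v \<in> component M y \<Longrightarrow> s I y v \<in> space X"
  "v \<in> component M y \<Longrightarrow> s I (shift k y) v = s I y v"
  using s unfolding equivariant_maps_def by blast+

lemma equivariant_maps_0: "s I y 0 = 0"
  using lin_on_sum[OF equivariant_mapsD(1)[of y I] component_subspace[OF M], of "{} :: nat set" "\<lambda>_. 0"] by simp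

lemma induced_at_props:
  assumes \<phi>: "\<phi> \<in> Fam m M"
  shows induced_at_in: "induced_at m X s \<phi> z \<in> space X"
    and induced_at_arr_act: "arr_act X (induced_at m X s \<phi> z) z z = induced_at m X s \<phi> z"
    and induced_at_shift: "induced_at m X s \<phi> (shift k z) = induced_at m X s \<phi> z"
proof -
  have sX: "s I y (\<phi> I y z) \<in> space X" for I y z by (rule equivariant_mapsD(2)[OF Fam_component[OF \<phi>]])
  show "induced_at m X s \<phi> z \<in> space X"
    unfolding induced_at_def using arr_act_in[OF X sX] by (intro kvec.subspace_sum[OF rmod_subspace[OF X]]) (simp add: case_prod_beta)
  have "arr_act X (induced_at m X s \<phi> z) z z = (\<Sum>p\<in>adm_at m z. arr_act X ((\<lambda>(I, y). arr_act X (s I y (\<phi> I y z)) z (lower I y)) p) z z)"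
    unfolding induced_at_def using arr_act_in[OF X sX] by (intro arr_act_sum[OF X]) (simp add: case_prod_beta)
  also have "\<dots> = induced_at m X s \<phi> z"
    unfolding induced_at_def by (intro sum.cong refl) (simp add: case_prod_beta arr_act_idem[OF X sX])
  finally show "arr_act X (induced_at m X s \<phi> z) z z = induced_at m X s \<phi> z" .
  show "induced_at m X s \<phi> (shift k z) = induced_at m X s \<phi> z"
    unfolding induced_at_def
  proof (rule sum.reindex_bij_witness[of _ "\<lambda>(I, y). (I, shift k y)" "\<lambda>(I, y). (I, shift (- k) y)"])
    fix p assume "p \<in> adm_at m (shift k z)"
    then obtain I y where p: "p = (I, y)" "adm m I y (shift k z)" by (auto simp: adm_at_def)
    have "adm m I (shift k (shift (- k) y)) (shift k z)" using p(2) by simp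
    hence "adm m I (shift (- k) y) z" unfolding adm_shift .
    thus "(case p of (I, y) \<Rightarrow> (I, shift (- k) y)) \<in> adm_at m z" using p(1) by (simp add: adm_at_def)
    show "(case (case p of (I, y) \<Rightarrow> (I, shift (- k) y)) of (I, y) \<Rightarrow> (I, shift k y)) = p" using p(1) by simp
    have a: "\<phi> I y (shift k z) = \<phi> I (shift (- k) y) z" using Fam_shift[OF \<phi>, of I k "shift (- k) y" z] by simp
    have b: "s I y v = s I (shift (- k) y) v" if "v \<in> component M (shift (- k) y)" for v
      using equivariant_mapsD(3)[OF that, of I k] by simp
    have c: "arr_act X u (shift k z) (lower I y) = arr_act X u z (lower I (shift (- k) y))" for u
      using arr_act_shift[OF X, of u k z "lower I (shift (- k) y)"] by simp
    show "(case (case p of (I, y) \<Rightarrow> (I, shift (- k) y)) of (I, y) \<Rightarrow> arr_act X (s I y (\<phi> I y z)) z (lower I y)) =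
       (case p of (I, y) \<Rightarrow> arr_act X (s I y (\<phi> I y (shift k z))) (shift k z) (lower I y))"
      unfolding p(1) prod.case a c b[OF Fam_component[OF \<phi>]] ..
  qed (auto simp: adm_at_def)
qed

lemma induced_in: "\<phi> \<in> Fam m M \<Longrightarrow> induced m X s \<phi> \<in> space X"
  unfolding induced_def by (rule glue_in[OF X induced_at_in])

lemma arr_act_induced:
  assumes \<phi>: "\<phi> \<in> Fam m M" and z: "z \<in> os d l"
  shows "arr_act X (induced m X s \<phi>) z z = induced_at m X s \<phi> z"
  unfolding induced_def by (rule arr_act_glue[OF X induced_at_props[OF \<phi>] z])

lemma induced_add:
  assumes \<phi>: "\<phi> \<in> Fam m M" and \<psi>: "\<psi> \<in> Fam m M"
  shows "induced m X s (\<lambda>I y z. \<phi> I y z + \<psi> I y z) = induced m X s \<phi> + induced m X s \<psi>"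
proof -
  have eq: "induced_at m X s (\<lambda>I y z. \<phi> I y z + \<psi> I y z) z = induced_at m X s \<phi> z + induced_at m X s \<psi> z" for z
  proof -
    have "s I y (\<phi> I y z + \<psi> I y z) = s I y (\<phi> I y z) + s I y (\<psi> I y z)" for I y
      using equivariant_mapsD(1)[of y I] Fam_component[OF \<phi>] Fam_component[OF \<psi>] unfolding lin_on_def by blast
    hence "arr_act X (s I y (\<phi> I y z + \<psi> I y z)) z t = arr_act X (s I y (\<phi> I y z)) z t + arr_act X (s I y (\<psi> I y z)) z t" for I y t
      by (simp only: arr_act_add[OF X equivariant_mapsD(2)[OF Fam_component[OF \<phi>]] equivariant_mapsD(2)[OF Fam_component[OF \<psi>]]])
    thus ?thesis unfolding induced_at_def sum.distrib[symmetric] by (intro sum.cong refl) auto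
  qed
  show ?thesis unfolding induced_def glue_def sum.distrib[symmetric] by (rule sum.cong[OF refl eq])
qed

lemma induced_scale:
  assumes \<phi>: "\<phi> \<in> Fam m M"
  shows "induced m X s (\<lambda>I y z. vscale c (\<phi> I y z)) = vscale c (induced m X s \<phi>)"
proof -
  have eq: "induced_at m X s (\<lambda>I y z. vscale c (\<phi> I y z)) z = vscale c (induced_at m X s \<phi> z)" for z
  proof -
    have "s I y (vscale c (\<phi> I y z)) = vscale c (s I y (\<phi> I y z))" for I y
      using equivariant_mapsD(1)[of y I] Fam_component[OF \<phi>] unfolding lin_on_def by blast
    hence "arr_act X (s I y (vscale c (\<phi> I y z))) z t = vscale c (arr_act X (s I y (\<phi> I y z)) z t)" for I y t
      by (simp only: arr_act_scale[OF X equivariant_mapsD(2)[OF Fam_component[OF \<phi>]]])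
    thus ?thesis unfolding induced_at_def kvec.scale_sum_right by (intro sum.cong refl) auto
  qed
  show ?thesis unfolding induced_def glue_def kvec.scale_sum_right by (rule sum.cong[OF refl eq])
qed

text \<open>Acting by \<open>w \<rightarrow> z\<close> after \<open>z \<rightarrow> y - e\<^sub>I\<close> is acting by \<open>w \<rightarrow> y - e\<^sub>I\<close>. The positions \<open>(I, y)\<close> seen from \<open>w\<close> and
  from \<open>z\<close> differ, but those seen from only one of them contribute nothing.\<close>

lemma induced_fam_act:
  assumes \<phi>: "\<phi> \<in> Fam m M" and \<gamma>: "\<gamma> \<in> Coeffs"
  shows "induced m X s (fam_act \<phi> \<gamma>) = act X (induced m X s \<phi>) (el \<gamma>)"
proof (rule comp_ext[OF X induced_in[OF Fam_fam_act[OF M \<phi> \<gamma>]] act_el_in[OF X induced_in[OF \<phi>] \<gamma>]])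
  fix w assume w: "w \<in> os d l"
  have sX: "s I y (\<phi> I y z) \<in> space X" for I y z by (rule equivariant_mapsD(2)[OF Fam_component[OF \<phi>]])
  have vX: "vscale c (s I y (\<phi> I y z)) \<in> space X" for c I y z by (rule rmod_scale[OF X sX])
  let ?F = "\<lambda>z (I, y). arr_act X (s I y (\<phi> I y z)) w (lower I y)"
  have "arr_act X (induced m X s (fam_act \<phi> \<gamma>)) w w = induced_at m X s (fam_act \<phi> \<gamma>) w"
    by (rule arr_act_induced[OF Fam_fam_act[OF M \<phi> \<gamma>] w])
  also have "\<dots> = (\<Sum>p\<in>adm_at m w. \<Sum>z\<in>above w. vscale (\<gamma> w z) (?F z p))"
    unfolding induced_at_def
  proof (rule sum.cong[OF refl])
    fix p assume "p \<in> adm_at m w"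
    then obtain I y where p: "p = (I, y)" "interlace w (lower I y)" by (auto simp: adm_at_def adm_def)
    have "s I y (fam_act \<phi> \<gamma> I y w) = (\<Sum>z\<in>above w. s I y (vscale (\<gamma> w z) (\<phi> I y z)))"
      unfolding fam_act_def if_P[OF p(2)]
      by (rule lin_on_sum[OF equivariant_mapsD(1) component_subspace[OF M]])
        (rule kvec.subspace_scale[OF component_subspace[OF M] Fam_component[OF \<phi>]])
    also have "\<dots> = (\<Sum>z\<in>above w. vscale (\<gamma> w z) (s I y (\<phi> I y z)))"
      using equivariant_mapsD(1)[of y I] Fam_component[OF \<phi>] unfolding lin_on_def by (intro sum.cong refl) blast
    finally have "arr_act X (s I y (fam_act \<phi> \<gamma> I y w)) w (lower I y) = (\<Sum>z\<in>above w. arr_act X (vscale (\<gamma> w z) (s I y (\<phi> I y z))) w (lower I y))"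
      using arr_act_sum[OF X vX] by simp
    also have "\<dots> = (\<Sum>z\<in>above w. vscale (\<gamma> w z) (arr_act X (s I y (\<phi> I y z)) w (lower I y)))"
      by (simp only: arr_act_scale[OF X sX])
    finally show "(case p of (I, y) \<Rightarrow> arr_act X (s I y (fam_act \<phi> \<gamma> I y w)) w (lower I y)) = (\<Sum>z\<in>above w. vscale (\<gamma> w z) (?F z p))"
      by (simp only: p(1) prod.case)
  qed
  also have "\<dots> = (\<Sum>z\<in>above w. \<Sum>p\<in>adm_at m w. vscale (\<gamma> w z) (?F z p))" by (rule sum.swap)
  also have "\<dots> = (\<Sum>z\<in>above w. vscale (\<gamma> w z) (arr_act X (induced m X s \<phi>) w z))"
  proof (rule sum.cong[OF refl])
    fix z assume "z \<in> above w"
    hence wz: "interlace w z" by (simp add: above_def)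
    have z: "z \<in> os d l" using interlace_os(2)[OF wz] .
    have F0: "?F z p = 0" if "p \<notin> adm_at m z \<or> p \<notin> adm_at m w \<and> p \<in> adm_at m z" for p
    proof -
      obtain I y where p: "p = (I, y)" by (cases p)
      show ?thesis
      proof (cases "p \<in> adm_at m z")
        case True
        hence "\<not> interlace w (lower I y)" using that unfolding p by (auto simp: adm_at_def adm_def)
        thus ?thesis unfolding p prod.case by (rule arr_act_not_interlace[OF X sX])
      next
        case False
        hence "\<phi> I y z = 0" using Fam_adm[OF \<phi>] unfolding p by (simp add: adm_at_def)
        thus ?thesis unfolding p prod.case by (simp only: equivariant_maps_0 arr_act_0[OF X])
      qed
    qed
    have "arr_act X (induced m X s \<phi>) w z = arr_act X (induced_at m X s \<phi> z) w z"
      unfolding arr_act_induced[OF \<phi> z, symmetric] using arr_act_arr_act'[OF X induced_in[OF \<phi>] wz interlace_refl[OF z]] by simp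
    also have "\<dots> = (\<Sum>p\<in>adm_at m z. arr_act X ((\<lambda>(I, y). arr_act X (s I y (\<phi> I y z)) z (lower I y)) p) w z)"
      unfolding induced_at_def using arr_act_in[OF X sX] by (intro arr_act_sum[OF X]) (simp add: case_prod_beta)
    also have "\<dots> = (\<Sum>p\<in>adm_at m z. ?F z p)"
    proof (rule sum.cong[OF refl])
      fix p assume "p \<in> adm_at m z"
      then obtain I y where p: "p = (I, y)" "interlace z (lower I y)" by (auto simp: adm_at_def adm_def)
      show "arr_act X ((\<lambda>(I, y). arr_act X (s I y (\<phi> I y z)) z (lower I y)) p) w z = ?F z p"
        unfolding p(1) prod.case by (rule arr_act_arr_act'[OF X sX wz p(2)])
    qed
    also have "\<dots> = (\<Sum>p\<in>adm_at m z \<inter> adm_at m w. ?F z p)"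
      using F0 by (intro sum.mono_neutral_right finite_adm_at) auto
    also have "\<dots> = (\<Sum>p\<in>adm_at m w. ?F z p)"
      using F0 by (intro sum.mono_neutral_left finite_adm_at) auto
    finally show "(\<Sum>p\<in>adm_at m w. vscale (\<gamma> w z) (?F z p)) = vscale (\<gamma> w z) (arr_act X (induced m X s \<phi>) w z)"
      by (simp only: kvec.scale_sum_right)
  qed
  also have "\<dots> = arr_act X (act X (induced m X s \<phi>) (el \<gamma>)) w w"
    by (rule arr_act_act[OF X induced_in[OF \<phi>] \<gamma> w, symmetric])
  finally show "arr_act X (induced m X s (fam_act \<phi> \<gamma>)) w w = arr_act X (act X (induced m X s \<phi>) (el \<gamma>)) w w" .
qed

end

lemma koszul_rhomI:
  assumes M: "rmodule L M"
    and "\<And>\<phi>. \<phi> \<in> Fam m M \<Longrightarrow> F \<phi> \<in> space X"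
    "\<And>\<phi> \<psi>. \<phi> \<in> Fam m M \<Longrightarrow> \<psi> \<in> Fam m M \<Longrightarrow> F (\<lambda>I y z. \<phi> I y z + \<psi> I y z) = F \<phi> + F \<psi>"
    "\<And>c \<phi>. \<phi> \<in> Fam m M \<Longrightarrow> F (\<lambda>I y z. vscale c (\<phi> I y z)) = vscale c (F \<phi>)"
    "\<And>\<phi> \<gamma>. \<phi> \<in> Fam m M \<Longrightarrow> \<gamma> \<in> Coeffs \<Longrightarrow> F (fam_act \<phi> \<gamma>) = act X (F \<phi>) (el \<gamma>)"
  shows "(\<lambda>v. F (dec v)) \<in> rhom L (koszul m M) X"
proof (rule rhomI)
  fix v assume "v \<in> space (koszul m M)"
  then obtain \<phi> where \<phi>: "\<phi> \<in> Fam m M" "v = enc \<phi>" unfolding space_koszul by blast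
  note de = dec_enc_Fam
  show "F (dec v) \<in> space X" unfolding \<phi>(2) de[OF \<phi>(1)] by (rule assms(2)[OF \<phi>(1)])
  show "F (dec (vscale c v)) = vscale c (F (dec v))" for c
    unfolding \<phi>(2) enc_scale[symmetric] de[OF \<phi>(1)] de[OF Fam_scale[OF M \<phi>(1)]] by (rule assms(4)[OF \<phi>(1)])
  show "F (dec (v + w)) = F (dec v) + F (dec w)" if w: "w \<in> space (koszul m M)" for w
  proof -
    obtain \<psi> where \<psi>: "\<psi> \<in> Fam m M" "w = enc \<psi>" using w unfolding space_koszul by blast
    show ?thesis
      unfolding \<phi>(2) \<psi>(2) enc_add[symmetric] de[OF \<phi>(1)] de[OF \<psi>(1)] de[OF Fam_add[OF M \<phi>(1) \<psi>(1)]]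
      by (rule assms(3)[OF \<phi>(1) \<psi>(1)])
  qed
  show "F (dec (act (koszul m M) v a)) = act X (F (dec v)) a" if a: "a \<in> carrier L" for a
  proof -
    obtain \<gamma> where \<gamma>: "\<gamma> \<in> Coeffs" "a = el \<gamma>" using a unfolding carrier_L by blast
    show ?thesis
      unfolding \<phi>(2) \<gamma>(2) act_koszul[OF \<phi>(1) \<gamma>(1)] de[OF \<phi>(1)] de[OF Fam_fam_act[OF M \<phi>(1) \<gamma>(1)]]
      by (rule assms(5)[OF \<phi>(1) \<gamma>(1)])
  qed
qed

lemma induced_rhom:
  assumes M: "rmodule L M" and X: "rmodule L X" and s: "equivariant_maps M X s"
  shows "(\<lambda>v. induced m X s (dec v)) \<in> rhom L (koszul m M) X"
  by (rule koszul_rhomI[OF M, where F = "induced m X s"])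
    (fact induced_in[OF M X s] induced_add[OF M X s] induced_scale[OF M X s] induced_fam_act[OF M X s])+

text \<open>The vector \<open>v \<otimes> 1\<close> of \<open>M\<^sub>y \<otimes> e(y - e\<^sub>I)\<Lambda>\<close>; these generate the module.\<close>

definition generator where "generator I y v = orbit_fam I y (lower I y) v"

lemma fam_act_generator:
  assumes M: "rmodule L M" and g: "adm m I y z"
  shows "fam_act (generator I y v) (basis z (lower I y)) = orbit_fam I y z v"
proof -
  have z: "z \<in> os d l" and zl: "interlace z (lower I y)" and y: "y \<in> os d l" and lo: "lower I y \<in> os d l"
    using g interlace_os unfolding adm_def by auto
  have "fam_act (generator I y v) (basis z (lower I y)) I' y' w = orbit_fam I y z v I' y' w" for I' y' w
  proof (cases "\<exists>k. w = shift k z")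
    case True
    then obtain k where k: "w = shift k z" by blast
    have "(\<Sum>u\<in>above w. vscale (basis z (lower I y) w u) (generator I y v I' y' u))
        = (\<Sum>u\<in>above w. if u = shift k (lower I y) then generator I y v I' y' u else 0)"
      unfolding k basis_eq[OF z] using zl by (intro sum.cong refl) auto
    also have "\<dots> = generator I y v I' y' (shift k (lower I y))"
      using zl finite_above unfolding k by (simp add: above_def)
    also have "\<dots> = (if I' = I \<and> y' = shift k y then v else 0)"
    proof -
      have "(\<exists>j. y' = shift j y \<and> shift k (lower I y) = shift j (lower I y)) \<longleftrightarrow> y' = shift k y"
        using shift_fix[OF lo] by metis
      thus ?thesis by (simp add: generator_def orbit_fam_def)
    qed
    finally have "fam_act (generator I y v) (basis z (lower I y)) I' y' w
        = (if interlace w (lower I' y') then if I' = I \<and> y' = shift k y then v else 0 else 0)"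
      by (simp add: fam_act_def)
    also have "\<dots> = (if I' = I \<and> y' = shift k y then v else 0)"
      using zl unfolding k by auto
    also have "\<dots> = orbit_fam I y z v I' y' w"
    proof -
      have "(\<exists>j. y' = shift j y \<and> w = shift j z) \<longleftrightarrow> y' = shift k y"
        unfolding k using shift_fix[OF z] by metis
      thus ?thesis by (simp add: orbit_fam_def)
    qed
    finally show ?thesis .
  next
    case False
    hence "basis z (lower I y) w u = (0::'k)" for u by (simp add: basis_def)
    hence "(\<Sum>u\<in>above w. vscale (basis z (lower I y) w u) (generator I y v I' y' u)) = 0"
      by (simp only: kvec.scale_zero_left sum.neutral_const)
    moreover have "orbit_fam I y z v I' y' w = 0" using False by (simp add: orbit_fam_def)
    ultimately show ?thesis by (simp add: fam_act_def)
  qed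
  thus ?thesis by (rule ext[OF ext[OF ext]])
qed


end

context orbit_algebra
begin

text \<open>A homomorphism \<open>f\<close> to \<open>Y\<close> is determined by the linear maps \<open>v \<mapsto> f(v \<otimes> 1)\<close>, and any linear maps induce
  a homomorphism. So \<open>f\<close> lifts along an epimorphism \<open>g : X \<rightarrow> Y\<close> as soon as the linear maps do, and they
  lift by composing with a linear section of \<open>g\<close>.\<close>

theorem projective_koszul:
  assumes M: "rmodule L M"
  shows "projective L (koszul m M)"
  unfolding projective_def
proof (intro conjI allI impI rmodule_koszul[OF M])
  fix X Y f g
  assume "rmodule L X \<and> rmodule L Y \<and> g \<in> rhom L X Y \<and> g ` space X = space Y \<and> f \<in> rhom L (koszul m M) Y"
  hence X: "rmodule L X" and Y: "rmodule L Y" and g: "g \<in> rhom L X Y" and gs: "g ` space X = space Y"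
    and f: "f \<in> rhom L (koszul m M) Y" by auto
  obtain t where t: "lin_on (space Y) t" "\<And>y. y \<in> space Y \<Longrightarrow> t y \<in> space X \<and> g (t y) = y"
    using lin_on_section[OF rhom_lin[OF g] rmod_subspace[OF X] rmod_subspace[OF Y] gs] by blast
  \<comment> \<open>For inadmissible \<open>(I, y)\<close> the family \<open>v \<otimes> 1\<close> would not belong to the module, so zero is used.\<close>
  define G where "G I y v = (if adm m I y (lower I y) then enc (generator I y v) else 0)" for I y and v :: "'k vec"
  have G_in: "G I y v \<in> space (koszul m M)" if "v \<in> component M y" for I y v
    using that rmod_0[OF rmodule_koszul[OF M]] unfolding G_def generator_def space_koszul component_def
    by (auto intro: imageI orbit_fam_Fam[OF M])
  have G_add: "G I y (v + w) = G I y v + G I y w" for I y v w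
  proof -
    have "generator I y (v + w) = (\<lambda>I' y' z'. generator I y v I' y' z' + generator I y w I' y' z')"
      by (auto simp: fun_eq_iff generator_def orbit_fam_def)
    thus ?thesis by (simp add: G_def enc_add)
  qed
  have G_scale: "G I y (vscale c v) = vscale c (G I y v)" for I y v c
  proof -
    have "generator I y (vscale c v) = (\<lambda>I' y' z'. vscale c (generator I y v I' y' z'))"
      by (auto simp: fun_eq_iff generator_def orbit_fam_def vscale_def)
    thus ?thesis by (simp add: G_def enc_scale)
  qed
  have G_shift: "G I (shift k y) v = G I y v" for I k y v
    unfolding G_def generator_def lower_shift adm_shift orbit_fam_shift[OF M] ..
  define s where "s I y v = t (f (G I y v))" for I y v
  have equivariant_maps: "equivariant_maps M X s"
    unfolding equivariant_maps_def
  proof (intro allI conjI ballI)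
    fix I y
    show "lin_on (component M y) (s I y)"
      unfolding lin_on_def s_def
      using G_in rhom_in[OF f] t(1)
      by (simp add: G_add G_scale rhom_add[OF f] rhom_scale[OF f] lin_on_def)
    fix v assume v: "v \<in> component M y"
    show "s I y v \<in> space X" unfolding s_def using t(2)[OF rhom_in[OF f G_in[OF v]]] by blast
    show "s I (shift k y) v = s I y v" for k by (simp add: s_def G_shift)
  qed
  define h where "h = (\<lambda>v. induced m X s (dec v))"
  have h: "h \<in> rhom L (koszul m M) X" unfolding h_def by (rule induced_rhom[OF M X equivariant_maps])
  have "g (h v) = f v" if v: "v \<in> space (koszul m M)" for v
  proof -
    obtain \<phi> where \<phi>: "\<phi> \<in> Fam m M" "v = enc \<phi>" using v unfolding space_koszul by blast
    have sX: "s I y (\<phi> I y z) \<in> space X" for I y z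
      using equivariant_maps Fam_component[OF \<phi>(1)] unfolding equivariant_maps_def by blast
    have gs: "g (s I y (\<phi> I y z)) = f (G I y (\<phi> I y z))" for I y z
      unfolding s_def using t(2)[OF rhom_in[OF f G_in[OF Fam_component[OF \<phi>(1)]]]] by blast
    have "h v = (\<Sum>z\<in>reps. \<Sum>(I, y)\<in>adm_at m z. arr_act X (s I y (\<phi> I y z)) z (lower I y))"
      unfolding h_def \<phi>(2) dec_enc_Fam[OF \<phi>(1)] induced_def glue_def induced_at_def ..
    also have "\<dots> = (\<Sum>q\<in>(SIGMA z:reps. adm_at m z). (\<lambda>(z, I, y). arr_act X (s I y (\<phi> I y z)) z (lower I y)) q)"
      by (simp add: sum.Sigma[OF finite_reps] finite_adm_at case_prod_beta)
    also have "\<dots> = (\<Sum>(I, y, z)\<in>adm_reps m. arr_act X (s I y (\<phi> I y z)) z (lower I y))"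
      by (rule sum.reindex_bij_witness[of _ "\<lambda>(I, y, z). (z, I, y)" "\<lambda>(z, I, y). (I, y, z)"])
        (auto simp: adm_reps_def adm_at_def)
    finally have "g (h v) = g (\<Sum>p\<in>adm_reps m. (\<lambda>(I, y, z). arr_act X (s I y (\<phi> I y z)) z (lower I y)) p)" by simp
    also have "\<dots> = (\<Sum>p\<in>adm_reps m. g ((\<lambda>(I, y, z). arr_act X (s I y (\<phi> I y z)) z (lower I y)) p))"
      by (rule lin_on_sum[OF rhom_lin[OF g] rmod_subspace[OF X]]) (auto intro: arr_act_in[OF X sX])
    also have "\<dots> = (\<Sum>p\<in>adm_reps m. f ((\<lambda>(I, y, z). enc (orbit_fam I y z (\<phi> I y z))) p))"
    proof (rule sum.cong[OF refl])
      fix p assume "p \<in> adm_reps m"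
      then obtain I y z where p: "p = (I, y, z)" "adm m I y z" by (auto simp: adm_reps_def)
      have gg: "adm m I y (lower I y)" using p(2) interlace_os(2) interlace_refl unfolding adm_def by blast
      have c: "\<phi> I y z \<in> component M y" by (rule Fam_component[OF \<phi>(1)])
      have gF: "generator I y (\<phi> I y z) \<in> Fam m M"
        unfolding generator_def using orbit_fam_Fam[OF M gg] c unfolding component_def by blast
      have "g (arr_act X (s I y (\<phi> I y z)) z (lower I y)) = arr_act Y (f (G I y (\<phi> I y z))) z (lower I y)"
        unfolding rhom_arr_act[OF g sX] gs ..
      also have "\<dots> = f (arr_act (koszul m M) (enc (generator I y (\<phi> I y z))) z (lower I y))"
        unfolding rhom_arr_act[OF f G_in[OF c], symmetric] unfolding G_def if_P[OF gg] ..
      also have "\<dots> = f (enc (orbit_fam I y z (\<phi> I y z)))"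
        unfolding arr_act_def act_koszul[OF gF Coeffs_basis] fam_act_generator[OF M p(2)] ..
      finally show "g ((\<lambda>(I, y, z). arr_act X (s I y (\<phi> I y z)) z (lower I y)) p) = f ((\<lambda>(I, y, z). enc (orbit_fam I y z (\<phi> I y z))) p)"
        unfolding p(1) prod.case .
    qed
    also have "\<dots> = f (\<Sum>p\<in>adm_reps m. (\<lambda>(I, y, z). enc (orbit_fam I y z (\<phi> I y z))) p)"
    proof (rule lin_on_sum[OF rhom_lin[OF f] rmod_subspace[OF rmodule_koszul[OF M]], symmetric])
      fix p assume "p \<in> adm_reps m"
      then obtain I y z where p: "p = (I, y, z)" "adm m I y z" by (auto simp: adm_reps_def)
      show "(\<lambda>(I, y, z). enc (orbit_fam I y z (\<phi> I y z))) p \<in> space (koszul m M)"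
        unfolding p(1) prod.case space_koszul
        by (rule imageI[OF orbit_fam_Fam[OF M p(2) Fam_in[OF \<phi>(1)] Fam_arr_act[OF \<phi>(1)]]])
    qed
    also have "(\<Sum>p\<in>adm_reps m. (\<lambda>(I, y, z). enc (orbit_fam I y z (\<phi> I y z))) p)
        = enc (\<lambda>I' y' z'. \<Sum>p\<in>adm_reps m. (\<lambda>(I, y, z). orbit_fam I y z (\<phi> I y z)) p I' y' z')"
      unfolding enc_sum by (rule sum.cong[OF refl]) (simp add: case_prod_beta)
    also have "(\<lambda>I' y' z'. \<Sum>p\<in>adm_reps m. (\<lambda>(I, y, z). orbit_fam I y z (\<phi> I y z)) p I' y' z') = \<phi>"
      by (subst (2) Fam_decompose[OF M \<phi>(1)]) (simp add: case_prod_beta)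
    finally show ?thesis unfolding \<phi>(2) .
  qed
  thus "\<exists>h\<in>rhom L (koszul m M) X. \<forall>v\<in>space (koszul m M). g (h v) = f v" using h by blast
qed

section \<open>The augmentation\<close>

text \<open>The action map \<open>M\<^sub>y \<otimes> e(y)\<Lambda> \<rightarrow> M\<close>.\<close>

definition augment :: "('k, 'a) rmod \<Rightarrow> 'k vec \<Rightarrow> 'k vec" where
  "augment M v = induced 0 M (\<lambda>I y u. u) (dec v)"

lemma equivariant_maps_id: "rmodule L M \<Longrightarrow> equivariant_maps M M (\<lambda>I y u. u)"
  unfolding equivariant_maps_def lin_on_def component_def by simp

lemma adm_at_0: "adm_at 0 z = (\<lambda>y. ({}, y)) ` above z"
  using interlace_os finite_subset[of _ "{..d}"] by (force simp: adm_at_def adm_def above_def)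

lemma induced_at_0: "induced_at 0 M (\<lambda>I y u. u) \<phi> z = (\<Sum>y\<in>above z. arr_act M (\<phi> {} y z) z y)"
  unfolding induced_at_def adm_at_0 by (subst sum.reindex) (auto simp: inj_on_def)

lemma augment_rhom: "rmodule L M \<Longrightarrow> augment M \<in> rhom L (koszul 0 M) M"
  using induced_rhom[OF _ _ equivariant_maps_id, of M 0] unfolding augment_def[abs_def] by simp

lemma arr_act_augment:
  assumes M: "rmodule L M" and \<phi>: "\<phi> \<in> Fam 0 M" and z: "z \<in> os d l"
  shows "arr_act M (augment M (enc \<phi>)) z z = (\<Sum>y\<in>above z. arr_act M (\<phi> {} y z) z y)"
  unfolding augment_def dec_enc_Fam[OF \<phi>] arr_act_induced[OF M M equivariant_maps_id[OF M] \<phi> z] induced_at_0 ..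

lemma augment_zero_iff:
  assumes M: "rmodule L M" and \<phi>: "\<phi> \<in> Fam 0 M"
  shows "augment M (enc \<phi>) = 0 \<longleftrightarrow> (\<forall>z\<in>os d l. (\<Sum>y\<in>above z. arr_act M (\<phi> {} y z) z y) = 0)"
proof
  assume a: "augment M (enc \<phi>) = 0"
  show "\<forall>z\<in>os d l. (\<Sum>y\<in>above z. arr_act M (\<phi> {} y z) z y) = 0"
    by (intro ballI) (simp only: arr_act_augment[OF M \<phi>, symmetric] a arr_act_0[OF M])
next
  assume a: "\<forall>z\<in>os d l. (\<Sum>y\<in>above z. arr_act M (\<phi> {} y z) z y) = 0"
  have "augment M (enc \<phi>) \<in> space M" using rhom_in[OF augment_rhom[OF M]] \<phi> unfolding space_koszul by blast
  thus "augment M (enc \<phi>) = 0"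
    by (rule comp_ext[OF M _ rmod_0[OF M]]) (simp only: arr_act_augment[OF M \<phi>] arr_act_0[OF M] a[rule_format])
qed

text \<open>A vector is the sum of its components \<open>v\<^sub>z\<close>, hence the image of the sum of the \<open>v\<^sub>z \<otimes> 1\<close>.\<close>

lemma augment_surj:
  assumes M: "rmodule L M"
  shows "augment M ` space (koszul 0 M) = space M"
proof
  show "augment M ` space (koszul 0 M) \<subseteq> space M" using rhom_in[OF augment_rhom[OF M]] by blast
  show "space M \<subseteq> augment M ` space (koszul 0 M)"
  proof
    fix v assume v: "v \<in> space M"
    define \<phi> where "\<phi> I y z = (if I = {} \<and> y = z \<and> z \<in> os d l then arr_act M v z z else 0)" for I :: "nat set" and y z
    have \<phi>: "\<phi> \<in> Fam 0 M"
      by (rule FamI) (auto simp: \<phi>_def adm_def interlace_refl rmod_0[OF M] arr_act_0[OF M] arr_act_in[OF M v] arr_act_idem[OF M v] arr_act_shift[OF M] shift_eq_iff)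
    have "augment M (enc \<phi>) = v"
    proof (rule comp_ext[OF M _ v])
      show "augment M (enc \<phi>) \<in> space M" using rhom_in[OF augment_rhom[OF M]] \<phi> unfolding space_koszul by blast
      fix z assume z: "z \<in> os d l"
      have "arr_act M (augment M (enc \<phi>)) z z = (\<Sum>y\<in>above z. if y = z then arr_act M v z z else 0)"
        unfolding arr_act_augment[OF M \<phi> z]
        by (rule sum.cong[OF refl]) (simp add: \<phi>_def z arr_act_0[OF M] arr_act_idem[OF M v])
      also have "\<dots> = arr_act M v z z" using finite_above interlace_refl[OF z] by (simp add: above_def)
      finally show "arr_act M (augment M (enc \<phi>)) z z = arr_act M v z z" .
    qed
    thus "v \<in> augment M ` space (koszul 0 M)" using \<phi> unfolding space_koszul by (metis imageI)
  qed
qed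

lemma enough_projectives_L: "enough_projectives L"
  by unfold_locales (use projective_koszul augment_rhom augment_surj in blast)

section \<open>Functoriality of the family modules\<close>

text \<open>\<open>f \<otimes> id\<close>, entry by entry.\<close>

definition koszul_map :: "('k vec \<Rightarrow> 'k vec) \<Rightarrow> 'k vec \<Rightarrow> 'k vec" where
  "koszul_map f v = enc (\<lambda>I y z. f (dec v I y z))"

context
  fixes M X f
  assumes M: "rmodule L M" and X: "rmodule L X" and f: "f \<in> rhom L M X"
begin

lemma Fam_map:
  assumes \<phi>: "\<phi> \<in> Fam m M" shows "(\<lambda>I y z. f (\<phi> I y z)) \<in> Fam m X"
proof (rule FamI)
  fix I y z
  show "\<not> adm m I y z \<Longrightarrow> f (\<phi> I y z) = 0" by (simp only: simp_thms Fam_adm[OF \<phi>] rhom_0[OF M f])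
  show "f (\<phi> I y z) \<in> space X" by (rule rhom_in[OF f Fam_in[OF \<phi>]])
  show "arr_act X (f (\<phi> I y z)) y y = f (\<phi> I y z)"
    unfolding rhom_arr_act[OF f Fam_in[OF \<phi>], symmetric] Fam_arr_act[OF \<phi>] ..
  show "f (\<phi> I (shift k y) (shift k z)) = f (\<phi> I y z)" for k by (simp only: Fam_shift[OF \<phi>])
qed

lemma koszul_map_enc: "\<phi> \<in> Fam m M \<Longrightarrow> koszul_map f (enc \<phi>) = enc (\<lambda>I y z. f (\<phi> I y z))"
  unfolding koszul_map_def by (simp only: dec_enc_Fam)

lemma koszul_map_rhom: "koszul_map f \<in> rhom L (koszul m M) (koszul m X)"
proof -
  have "(\<lambda>v. enc (\<lambda>I y z. f (dec v I y z))) \<in> rhom L (koszul m M) (koszul m X)"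
  proof (rule koszul_rhomI[OF M, where F = "\<lambda>\<phi>. enc (\<lambda>I y z. f (\<phi> I y z))"])
    fix \<phi> assume \<phi>: "\<phi> \<in> Fam m M"
    show "enc (\<lambda>I y z. f (\<phi> I y z)) \<in> space (koszul m X)" unfolding space_koszul by (rule imageI[OF Fam_map[OF \<phi>]])
    show "enc (\<lambda>I y z. f (vscale c (\<phi> I y z))) = vscale c (enc (\<lambda>I y z. f (\<phi> I y z)))" for c
      unfolding rhom_scale[OF f Fam_in[OF \<phi>]] enc_scale ..
    show "enc (\<lambda>I y z. f (\<phi> I y z + \<psi> I y z)) = enc (\<lambda>I y z. f (\<phi> I y z)) + enc (\<lambda>I y z. f (\<psi> I y z))"
      if \<psi>: "\<psi> \<in> Fam m M" for \<psi>
      unfolding rhom_add[OF f Fam_in[OF \<phi>] Fam_in[OF \<psi>]] enc_add ..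
    show "enc (\<lambda>I y z. f (fam_act \<phi> \<gamma> I y z)) = act (koszul m X) (enc (\<lambda>I y z. f (\<phi> I y z))) (el \<gamma>)" if \<gamma>: "\<gamma> \<in> Coeffs" for \<gamma>
    proof -
      have "f (fam_act \<phi> \<gamma> I y w) = fam_act (\<lambda>I y z. f (\<phi> I y z)) \<gamma> I y w" for I y w
      proof (cases "interlace w (lower I y)")
        case True
        have "f (\<Sum>z\<in>above w. vscale (\<gamma> w z) (\<phi> I y z)) = (\<Sum>z\<in>above w. f (vscale (\<gamma> w z) (\<phi> I y z)))"
          by (rule lin_on_sum[OF rhom_lin[OF f] rmod_subspace[OF M]]) (rule rmod_scale[OF M Fam_in[OF \<phi>]])
        thus ?thesis using True by (simp only: fam_act_def if_True rhom_scale[OF f Fam_in[OF \<phi>]])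
      next
        case False
        thus ?thesis by (simp only: fam_act_def if_False rhom_0[OF M f])
      qed
      thus ?thesis unfolding act_koszul[OF Fam_map[OF \<phi>] \<gamma>] by simp
    qed
  qed
  thus ?thesis unfolding koszul_map_def[abs_def] .
qed

lemma augment_natural:
  assumes v: "v \<in> space (koszul 0 M)"
  shows "augment X (koszul_map f v) = f (augment M v)"
proof -
  obtain \<phi> where \<phi>: "\<phi> \<in> Fam 0 M" "v = enc \<phi>" using v unfolding space_koszul by blast
  have aM: "augment M v \<in> space M" by (rule rhom_in[OF augment_rhom[OF M] v])
  show ?thesis
  proof (rule comp_ext[OF X rhom_in[OF augment_rhom[OF X] rhom_in[OF koszul_map_rhom v]] rhom_in[OF f aM]])
    fix z assume z: "z \<in> os d l"
    have "arr_act X (f (augment M v)) z z = f (\<Sum>y\<in>above z. arr_act M (\<phi> {} y z) z y)"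
      unfolding rhom_arr_act[OF f aM, symmetric] unfolding \<phi>(2) arr_act_augment[OF M \<phi>(1) z] ..
    also have "\<dots> = (\<Sum>y\<in>above z. f (arr_act M (\<phi> {} y z) z y))"
      by (rule lin_on_sum[OF rhom_lin[OF f] rmod_subspace[OF M]]) (rule arr_act_in[OF M Fam_in[OF \<phi>(1)]])
    also have "\<dots> = (\<Sum>y\<in>above z. arr_act X (f (\<phi> {} y z)) z y)" by (simp only: rhom_arr_act[OF f Fam_in[OF \<phi>(1)]])
    also have "\<dots> = arr_act X (augment X (koszul_map f v)) z z"
      unfolding \<phi>(2) koszul_map_enc[OF \<phi>(1)] arr_act_augment[OF X Fam_map[OF \<phi>(1)] z] ..
    finally show "arr_act X (augment X (koszul_map f v)) z z = arr_act X (f (augment M v)) z z" ..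
  qed
qed

end

end

section \<open>The Koszul differential\<close>

text \<open>The Koszul sign of removing \<open>i\<close> from \<open>J \<union> {i}\<close>.\<close>

definition sgn_at :: "nat \<Rightarrow> nat set \<Rightarrow> 'k::field" where
  "sgn_at i J = (- 1) ^ card {j \<in> J. j < i}"

lemma sgn_at_square: "sgn_at i J * sgn_at i J = (1 :: 'k::field)"
  by (simp add: sgn_at_def power_mult_distrib[symmetric])

lemma sgn_at_insert:
  assumes "finite J" "j \<notin> J"
  shows "sgn_at i (insert j J) = (if j < i then - sgn_at i J else (sgn_at i J :: 'k::field))"
proof (cases "j < i")
  case True
  have "{k \<in> insert j J. k < i} = insert j {k \<in> J. k < i}" using True by auto
  thus ?thesis using assms True by (simp add: sgn_at_def)
next
  case False
  have "{k \<in> insert j J. k < i} = {k \<in> J. k < i}" using False by auto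
  thus ?thesis using False by (simp add: sgn_at_def)
qed

lemma sgn_at_antisym:
  assumes "finite J" "i \<notin> J" "j \<notin> J" "i \<noteq> j"
  shows "sgn_at i (insert j J) * sgn_at j (insert i J) = - (sgn_at i J * sgn_at j J :: 'k::field)"
    and "sgn_at i J * sgn_at j (insert i J) = - (sgn_at j J * sgn_at i (insert j J) :: 'k::field)"
  using assms by (cases "i < j"; simp add: sgn_at_insert)+

text \<open>The terms cancel in pairs. Swapping the indices would only show that the sum equals its own negative,
  which is not enough in characteristic two.\<close>

lemma sum_antisym_zero:
  fixes a :: "nat \<Rightarrow> nat \<Rightarrow> 'b::ab_group_add"
  assumes "\<And>i. i \<in> S \<Longrightarrow> a i i = 0" "\<And>i j. i \<in> S \<Longrightarrow> j \<in> S \<Longrightarrow> i \<noteq> j \<Longrightarrow> a i j = - a j i"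
  shows "(\<Sum>i\<in>S. \<Sum>j\<in>S. a i j) = 0"
proof -
  have sw: "(if j < i then a j i else 0) = - (if j < i then a i j else 0)" if "i \<in> S" "j \<in> S" for i j
    using assms(2)[OF that(2,1)] by (cases "j < i") (simp_all del: minus_equation_iff)
  have split: "a i j = (if j < i then a i j else 0) + (if i < j then a i j else 0)" if "i \<in> S" for i j
    using assms(1)[OF that] by (cases i j rule: linorder_cases) auto
  have "(\<Sum>i\<in>S. \<Sum>j\<in>S. a i j) = (\<Sum>i\<in>S. \<Sum>j\<in>S. (if j < i then a i j else 0) + (if i < j then a i j else 0))"
    by (intro sum.cong refl split)
  also have "\<dots> = (\<Sum>i\<in>S. \<Sum>j\<in>S. if j < i then a i j else 0) + (\<Sum>i\<in>S. \<Sum>j\<in>S. if i < j then a i j else 0)"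
    by (simp add: sum.distrib)
  also have "(\<Sum>i\<in>S. \<Sum>j\<in>S. if i < j then a i j else 0) = (\<Sum>j\<in>S. \<Sum>i\<in>S. if i < j then a i j else 0)"
    by (rule sum.swap)
  also have "\<dots> = (\<Sum>i\<in>S. \<Sum>j\<in>S. - (if j < i then a i j else 0))"
    by (intro sum.cong refl sw)
  also have "\<dots> = - (\<Sum>i\<in>S. \<Sum>j\<in>S. if j < i then a i j else 0)"
    by (simp only: sum_negf)
  finally show ?thesis by simp
qed

context orbit_algebra
begin

lemma lower_insert_below: "length y = d + 1 \<Longrightarrow> below (lower (insert i J) y) (lower J y)"
  by (rule below_lower_mono) auto

lemma bump_notin_lower: "length y = d + 1 \<Longrightarrow> i \<notin> J \<Longrightarrow> lower (insert i J) (bump i y) = lower J y"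
  by (rule lower_bump)

text \<open>The operator that removes \<open>i\<close> from the index set. A vector \<open>v \<otimes> \<lambda>\<close> at \<open>(J \<union> {i}, y)\<close> goes to
  \<open>v a\<^sub>i \<otimes> \<lambda>\<close> at \<open>(J, y - e\<^sub>i)\<close> minus \<open>v \<otimes> a\<^sub>i \<lambda>\<close> at \<open>(J, y)\<close>. Read off at a fixed position \<open>(J, y)\<close>, the first
  term comes from \<open>y + e\<^sub>i\<close>, and the scalar of \<open>\<lambda>\<close> does not change.\<close>

definition side_diff :: "('k, 'a) rmod \<Rightarrow> nat \<Rightarrow> 'k fam \<Rightarrow> 'k fam" where
  "side_diff M i \<phi> J y z = (if i \<notin> J \<and> y \<in> os d l \<and> interlace z (lower J y)
     then arr_act M (\<phi> (insert i J) (bump i y) z) y (bump i y) - \<phi> (insert i J) y z else 0)"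

lemma side_diff_zero: "\<not> (i \<notin> J \<and> y \<in> os d l \<and> interlace z (lower J y)) \<Longrightarrow> side_diff M i \<phi> J y z = 0"
  unfolding side_diff_def by (rule if_not_P)

definition bdry :: "('k, 'a) rmod \<Rightarrow> 'k fam \<Rightarrow> 'k fam" where
  "bdry M \<phi> J y z = (\<Sum>i\<le>d. vscale (sgn_at i J) (side_diff M i \<phi> J y z))"

text \<open>The composite \<open>w \<rightarrow> z \<rightarrow> y - e\<^sub>J\<^sub>\<union>\<^sub>i \<rightarrow> y - e\<^sub>J\<close> is nonzero, hence so are all its segments.\<close>

lemma interlace_lower:
  assumes "interlace w z" "interlace z (lower (insert i J) y)" "interlace w (lower J y)" "length y = d + 1"
  shows "interlace w (lower (insert i J) y)" "interlace z (lower J y)"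
proof -
  have v: "below w z" "below z (lower (insert i J) y)" "below (lower (insert i J) y) (lower J y)"
    using assms interlace_below lower_insert_below by auto
  show "interlace w (lower (insert i J) y)" using interlace_convex(1)[OF assms(3) below_trans[OF v(1,2)] v(3)] .
  show "interlace z (lower J y)" using interlace_convex(2)[OF assms(3) v(1) below_trans[OF v(2,3)]] .
qed

context
  fixes M :: "('k, 'a) rmod"
  assumes M: "rmodule L M"
begin

lemma side_diff_in: "\<phi> \<in> Fam m M \<Longrightarrow> side_diff M i \<phi> J y z \<in> space M"
  unfolding side_diff_def by (simp add: rmod_0[OF M] rmod_diff[OF M] arr_act_in[OF M] Fam_in)

lemma side_diff_cmp: "\<phi> \<in> Fam m M \<Longrightarrow> arr_act M (side_diff M i \<phi> J y z) y y = side_diff M i \<phi> J y z"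
  unfolding side_diff_def by (simp add: arr_act_0[OF M] arr_act_diff[OF M] arr_act_in[OF M] Fam_in Fam_arr_act arr_act_idem[OF M])

lemma side_diff_adm:
  assumes \<phi>: "\<phi> \<in> Fam (Suc m) M" and n: "\<not> adm m J y z"
  shows "side_diff M i \<phi> J y z = 0"
proof (cases "i \<notin> J \<and> y \<in> os d l \<and> interlace z (lower J y)")
  case True
  have "\<not> (insert i J \<subseteq> {..d} \<and> card (insert i J) = Suc m)"
  proof
    assume a: "insert i J \<subseteq> {..d} \<and> card (insert i J) = Suc m"
    hence "finite J" "card J = m" using True finite_subset[of J "{..d}"] by auto
    thus False using a n True unfolding adm_def by auto
  qed
  hence "\<phi> (insert i J) y' z = 0" for y' using Fam_adm[OF \<phi>] unfolding adm_def by blast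
  thus ?thesis by (simp only: side_diff_def arr_act_0[OF M] diff_self if_cancel)
qed (simp only: side_diff_def if_False)

lemma side_diff_shift:
  assumes \<phi>: "\<phi> \<in> Fam m M" and i: "i \<le> d"
  shows "side_diff M i \<phi> J (shift k y) (shift k z) = side_diff M i \<phi> J y z"
proof (cases "y \<in> os d l")
  case True
  hence b: "bump i (shift k y) = shift k (bump i y)" using i os_length by (intro bump_shift) simp
  show ?thesis unfolding side_diff_def b by (simp add: Fam_shift[OF \<phi>] arr_act_shift[OF M])
qed (simp add: side_diff_def)

lemma bdry_in: "\<phi> \<in> Fam m M \<Longrightarrow> bdry M \<phi> J y z \<in> space M"
  unfolding bdry_def by (intro kvec.subspace_sum[OF rmod_subspace[OF M]] rmod_scale[OF M] side_diff_in)

lemma bdry_Fam: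
  assumes \<phi>: "\<phi> \<in> Fam (Suc m) M"
  shows "bdry M \<phi> \<in> Fam m M"
proof (rule FamI)
  fix J y z
  show "bdry M \<phi> J y z \<in> space M" by (rule bdry_in[OF \<phi>])
  show "bdry M \<phi> J y z = 0" if "\<not> adm m J y z"
    by (simp only: bdry_def side_diff_adm[OF \<phi> that] kvec.scale_zero_right sum.neutral_const)
  have "arr_act M (bdry M \<phi> J y z) y y = (\<Sum>i\<le>d. arr_act M (vscale (sgn_at i J) (side_diff M i \<phi> J y z)) y y)"
    unfolding bdry_def by (rule arr_act_sum[OF M]) (rule rmod_scale[OF M side_diff_in[OF \<phi>]])
  also have "\<dots> = bdry M \<phi> J y z"
    unfolding bdry_def by (simp only: arr_act_scale[OF M side_diff_in[OF \<phi>]] side_diff_cmp[OF \<phi>])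
  finally show "arr_act M (bdry M \<phi> J y z) y y = bdry M \<phi> J y z" .
  show "bdry M \<phi> J (shift k y) (shift k z) = bdry M \<phi> J y z" for k
    unfolding bdry_def by (intro sum.cong refl) (simp add: side_diff_shift[OF \<phi>])
qed

lemma side_diff_add:
  assumes "\<phi> \<in> Fam m M" "\<psi> \<in> Fam m M"
  shows "side_diff M i (\<lambda>I y z. \<phi> I y z + \<psi> I y z) J y z = side_diff M i \<phi> J y z + side_diff M i \<psi> J y z"
  unfolding side_diff_def by (simp add: arr_act_add[OF M Fam_in[OF assms(1)] Fam_in[OF assms(2)]])

lemma side_diff_diff:
  assumes "\<phi> \<in> Fam m M" "\<psi> \<in> Fam m M"
  shows "side_diff M i (\<lambda>I y z. \<phi> I y z - \<psi> I y z) J y z = side_diff M i \<phi> J y z - side_diff M i \<psi> J y z"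
  unfolding side_diff_def by (simp add: arr_act_diff[OF M Fam_in[OF assms(1)] Fam_in[OF assms(2)]])

lemma side_diff_scale:
  assumes "\<phi> \<in> Fam m M"
  shows "side_diff M i (\<lambda>I y z. vscale c (\<phi> I y z)) J y z = vscale c (side_diff M i \<phi> J y z)"
  unfolding side_diff_def by (simp add: arr_act_scale[OF M Fam_in[OF assms]] kvec.scale_right_diff_distrib)

lemma bdry_add:
  assumes "\<phi> \<in> Fam m M" "\<psi> \<in> Fam m M"
  shows "bdry M (\<lambda>I y z. \<phi> I y z + \<psi> I y z) = (\<lambda>J y z. bdry M \<phi> J y z + bdry M \<psi> J y z)"
  unfolding bdry_def[abs_def] side_diff_add[OF assms] kvec.scale_right_distrib sum.distrib ..

lemma bdry_diff:
  assumes "\<phi> \<in> Fam m M" "\<psi> \<in> Fam m M"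
  shows "bdry M (\<lambda>I y z. \<phi> I y z - \<psi> I y z) = (\<lambda>J y z. bdry M \<phi> J y z - bdry M \<psi> J y z)"
  unfolding bdry_def[abs_def] side_diff_diff[OF assms] kvec.scale_right_diff_distrib sum_subtractf ..

lemma bdry_scale:
  assumes "\<phi> \<in> Fam m M"
  shows "bdry M (\<lambda>I y z. vscale c (\<phi> I y z)) = (\<lambda>J y z. vscale c (bdry M \<phi> J y z))"
  unfolding bdry_def[abs_def] side_diff_scale[OF assms] kvec.scale_sum_right by (simp add: mult.commute)

text \<open>Both parts of the operator commute with right multiplication because neither touches the scalars. What
  has to be compared is where the entries are cut off to zero.\<close>

lemma side_diff_fam_act:
  assumes \<phi>: "\<phi> \<in> Fam m M" and \<gamma>: "\<gamma> \<in> Coeffs"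
  shows "side_diff M i (fam_act \<phi> \<gamma>) J y w = fam_act (side_diff M i \<phi>) \<gamma> J y w"
proof (cases "i \<notin> J \<and> y \<in> os d l \<and> interlace w (lower J y)")
  case True
  hence i: "i \<notin> J" and y: "y \<in> os d l" and wy: "interlace w (lower J y)" by auto
  have len: "length y = d + 1" by (rule os_length[OF y])
  note lb = bump_notin_lower[OF len i]
  let ?b = "bump i y" and ?I = "insert i J"
  have 1: "arr_act M (fam_act \<phi> \<gamma> ?I ?b w) y ?b = (\<Sum>z\<in>above w. vscale (\<gamma> w z) (arr_act M (\<phi> ?I ?b z) y ?b))"
  proof -
    have "arr_act M (fam_act \<phi> \<gamma> ?I ?b w) y ?b = (\<Sum>z\<in>above w. arr_act M (vscale (\<gamma> w z) (\<phi> ?I ?b z)) y ?b)"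
      unfolding fam_act_def lb if_P[OF wy] by (rule arr_act_sum[OF M]) (rule rmod_scale[OF M Fam_in[OF \<phi>]])
    thus ?thesis by (simp only: arr_act_scale[OF M Fam_in[OF \<phi>]])
  qed
  have 2: "fam_act \<phi> \<gamma> ?I y w = (\<Sum>z\<in>above w. vscale (\<gamma> w z) (\<phi> ?I y z))"
  proof (cases "interlace w (lower ?I y)")
    case False
    have "\<phi> ?I y z = 0" if "z \<in> above w" for z
    proof (rule ccontr)
      assume "\<phi> ?I y z \<noteq> 0"
      hence "interlace z (lower ?I y)" using Fam_nonzero[OF \<phi>] unfolding adm_def by blast
      thus False using interlace_lower(1)[OF _ _ wy len, of z i] that False by (simp add: above_def)
    qed
    hence "(\<Sum>z\<in>above w. vscale (\<gamma> w z) (\<phi> ?I y z)) = 0"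
      by (intro sum.neutral) (simp add: kvec.scale_zero_right)
    thus ?thesis using False by (simp add: fam_act_def)
  qed (simp only: fam_act_def if_True)
  have "side_diff M i (fam_act \<phi> \<gamma>) J y w = (\<Sum>z\<in>above w. vscale (\<gamma> w z) (arr_act M (\<phi> ?I ?b z) y ?b - \<phi> ?I y z))"
    using True by (simp only: side_diff_def if_True simp_thms 1 2 kvec.scale_right_diff_distrib sum_subtractf)
  also have "\<dots> = (\<Sum>z\<in>above w. vscale (\<gamma> w z) (side_diff M i \<phi> J y z))"
  proof (rule sum.cong[OF refl])
    fix z assume "z \<in> above w"
    hence wz: "interlace w z" by (simp add: above_def)
    show "vscale (\<gamma> w z) (arr_act M (\<phi> ?I ?b z) y ?b - \<phi> ?I y z) = vscale (\<gamma> w z) (side_diff M i \<phi> J y z)"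
    proof (cases "interlace z (lower J y)")
      case True
      thus ?thesis using i y by (simp only: side_diff_def if_True simp_thms)
    next
      case False
      have a: "\<phi> ?I ?b z = 0"
        using False Fam_nonzero[OF \<phi>, of ?I ?b z] lb unfolding adm_def by auto
      have b: "\<phi> ?I y z = 0"
      proof (rule ccontr)
        assume "\<phi> ?I y z \<noteq> 0"
        hence "interlace z (lower ?I y)" using Fam_nonzero[OF \<phi>] unfolding adm_def by blast
        thus False using interlace_lower(2)[OF wz _ wy len] False by blast
      qed
      show ?thesis using False by (simp only: side_diff_def if_False simp_thms a b arr_act_0[OF M] diff_self)
    qed
  qed
  also have "\<dots> = fam_act (side_diff M i \<phi>) \<gamma> J y w" using wy by (simp only: fam_act_def if_True)
  finally show ?thesis .
next
  case False
  have "fam_act (side_diff M i \<phi>) \<gamma> J y w = 0"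
  proof (cases "interlace w (lower J y)")
    case True
    hence "side_diff M i \<phi> J y z = 0" for z using False by (intro side_diff_zero) blast
    thus ?thesis by (simp add: fam_act_def)
  qed (simp add: fam_act_def)
  thus ?thesis using False unfolding side_diff_def by (simp only: simp_thms if_False)
qed

lemma bdry_fam_act:
  assumes \<phi>: "\<phi> \<in> Fam m M" and \<gamma>: "\<gamma> \<in> Coeffs"
  shows "bdry M (fam_act \<phi> \<gamma>) = fam_act (bdry M \<phi>) \<gamma>"
proof -
  have "bdry M (fam_act \<phi> \<gamma>) J y w = fam_act (bdry M \<phi>) \<gamma> J y w" for J y w
  proof -
    have a: "bdry M (fam_act \<phi> \<gamma>) J y w = (\<Sum>i\<le>d. vscale (sgn_at i J) (fam_act (side_diff M i \<phi>) \<gamma> J y w))"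
      unfolding bdry_def side_diff_fam_act[OF assms] ..
    show ?thesis
    proof (cases "interlace w (lower J y)")
      case True
      have "bdry M (fam_act \<phi> \<gamma>) J y w = (\<Sum>i\<le>d. \<Sum>z\<in>above w. vscale (sgn_at i J) (vscale (\<gamma> w z) (side_diff M i \<phi> J y z)))"
        unfolding a using True by (simp only: fam_act_def if_True kvec.scale_sum_right)
      also have "\<dots> = (\<Sum>z\<in>above w. \<Sum>i\<le>d. vscale (sgn_at i J) (vscale (\<gamma> w z) (side_diff M i \<phi> J y z)))" by (rule sum.swap)
      also have "\<dots> = (\<Sum>z\<in>above w. vscale (\<gamma> w z) (bdry M \<phi> J y z))"
        unfolding bdry_def kvec.scale_sum_right kvec.scale_scale by (simp only: mult.commute)
      finally show ?thesis using True by (simp only: fam_act_def if_True)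
    next
      case False
      thus ?thesis unfolding a by (simp add: fam_act_def)
    qed
  qed
  thus ?thesis by (rule ext[OF ext[OF ext]])
qed

lemma side_diff2_same: "side_diff M i (side_diff M i \<phi>) J y z = 0"
proof -
  have "side_diff M i \<phi> (insert i J) y' z = 0" for y' by (simp add: side_diff_def)
  thus ?thesis by (simp only: side_diff_def[of M i "side_diff M i \<phi>"] arr_act_0[OF M] diff_self if_cancel)
qed

text \<open>The four terms of the composite, in a form that is visibly symmetric in \<open>i\<close> and \<open>j\<close>. An intermediate
  vertex that is missing makes the corresponding composite arrow zero.\<close>

lemma side_diff2_eq:
  assumes \<phi>: "\<phi> \<in> Fam m M" and i: "i \<le> d" "i \<notin> J" and j: "j \<le> d" "j \<notin> J" and ij: "i \<noteq> j"
    and y: "y \<in> os d l" and zy: "interlace z (lower J y)"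
  shows "side_diff M i (side_diff M j \<phi>) J y z =
     arr_act M (\<phi> (insert i (insert j J)) (bump i (bump j y)) z) y (bump i (bump j y))
     - arr_act M (\<phi> (insert i (insert j J)) (bump i y) z) y (bump i y)
     - arr_act M (\<phi> (insert i (insert j J)) (bump j y) z) y (bump j y)
     + \<phi> (insert i (insert j J)) y z"
proof -
  let ?I = "insert i (insert j J)"
  have I: "insert j (insert i J) = ?I" by (rule insert_commute)
  have len: "length y = d + 1" by (rule os_length[OF y])
  have bb: "bump j (bump i y) = bump i (bump j y)" using len i j by (intro bump_swap) auto
  have lowi: "lower (insert i J) (bump i y) = lower J y" by (rule bump_notin_lower[OF len i(2)])
  have lowij: "lower ?I (bump j y) = lower (insert i J) y"
    unfolding I[symmetric] using j ij by (intro bump_notin_lower[OF len]) auto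
  let ?u = "\<phi> ?I (bump i (bump j y)) z"
  have u: "?u \<in> space M" by (rule Fam_in[OF \<phi>])
  have 1: "arr_act M (side_diff M j \<phi> (insert i J) (bump i y) z) y (bump i y)
     = arr_act M ?u y (bump i (bump j y)) - arr_act M (\<phi> ?I (bump i y) z) y (bump i y)"
  proof (cases "bump i y \<in> os d l")
    case True
    have "side_diff M j \<phi> (insert i J) (bump i y) z = arr_act M ?u (bump i y) (bump i (bump j y)) - \<phi> ?I (bump i y) z"
      unfolding side_diff_def lowi bb I using True j ij zy by simp
    hence "arr_act M (side_diff M j \<phi> (insert i J) (bump i y) z) y (bump i y)
       = arr_act M (arr_act M ?u (bump i y) (bump i (bump j y))) y (bump i y) - arr_act M (\<phi> ?I (bump i y) z) y (bump i y)"
      by (simp only: arr_act_diff[OF M arr_act_in[OF M u] Fam_in[OF \<phi>]])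
    also have "arr_act M (arr_act M ?u (bump i y) (bump i (bump j y))) y (bump i y) = arr_act M ?u y (bump i (bump j y))"
    proof (cases "interlace y (bump i (bump j y))")
      case t: True
      have "below y (bump i y)" "below (bump i y) (bump i (bump j y))"
        using below_bump[OF len] below_bump[of "bump i y" j] len bb by auto
      thus ?thesis using arr_act_arr_act'[OF M u] interlace_convex[OF t] by blast
    next
      case False
      thus ?thesis by (simp only: arr_act_arr_act[OF M u] arr_act_not_interlace[OF M u False] if_cancel)
    qed
    finally show ?thesis .
  next
    case False
    have a: "\<phi> ?I (bump i y) z = 0" using False Fam_nonzero[OF \<phi>] unfolding adm_def by blast
    have "\<not> interlace y (bump i (bump j y))"
    proof
      assume t: "interlace y (bump i (bump j y))"
      have "below y (bump i y)" "below (bump i y) (bump i (bump j y))"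
        using below_bump[OF len] below_bump[of "bump i y" j] len bb by auto
      thus False using interlace_os(2)[OF interlace_convex(1)[OF t]] False by blast
    qed
    hence b: "arr_act M ?u y (bump i (bump j y)) = 0" by (rule arr_act_not_interlace[OF M u])
    have c: "side_diff M j \<phi> (insert i J) (bump i y) z = 0" using False by (simp add: side_diff_def)
    show ?thesis by (simp only: a b c arr_act_0[OF M] diff_self)
  qed
  have 2: "side_diff M j \<phi> (insert i J) y z = arr_act M (\<phi> ?I (bump j y) z) y (bump j y) - \<phi> ?I y z"
  proof (cases "interlace z (lower (insert i J) y)")
    case True
    thus ?thesis unfolding side_diff_def I using y j ij by simp
  next
    case False
    have a: "\<phi> ?I (bump j y) z = 0"
      using False Fam_nonzero[OF \<phi>, of ?I "bump j y" z] lowij unfolding adm_def by auto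
    have b: "\<phi> ?I y z = 0"
    proof (rule ccontr)
      assume "\<phi> ?I y z \<noteq> 0"
      hence "interlace z (lower ?I y)" using Fam_nonzero[OF \<phi>] unfolding adm_def by blast
      hence "below z (lower (insert i J) y)"
        using interlace_below below_trans lower_insert_below[OF len, of j "insert i J"] unfolding I by blast
      thus False using interlace_convex(1)[OF zy _ lower_insert_below[OF len]] False by blast
    qed
    have c: "side_diff M j \<phi> (insert i J) y z = 0" using False by (simp add: side_diff_def)
    show ?thesis by (simp only: a b c arr_act_0[OF M] diff_self)
  qed
  have "side_diff M i (side_diff M j \<phi>) J y z = arr_act M (side_diff M j \<phi> (insert i J) (bump i y) z) y (bump i y) - side_diff M j \<phi> (insert i J) y z"
    using i y zy by (simp only: side_diff_def[of M i "side_diff M j \<phi>"] simp_thms if_True)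
  thus ?thesis unfolding 1 2 by (simp only: diff_diff_eq2 algebra_simps)
qed

text \<open>Multiplications by arrows in different directions commute, on either side of the tensor sign, and
  operations on different sides commute. So the operators for different directions commute, and the
  signs make the square of the differential vanish.\<close>

lemma side_diff2_commute:
  assumes \<phi>: "\<phi> \<in> Fam m M" and i: "i \<le> d" "i \<notin> J" and j: "j \<le> d" "j \<notin> J" and ij: "i \<noteq> j"
  shows "side_diff M i (side_diff M j \<phi>) J y z = side_diff M j (side_diff M i \<phi>) J y z"
proof (cases "y \<in> os d l \<and> interlace z (lower J y)")
  case True
  hence y: "y \<in> os d l" and zy: "interlace z (lower J y)" by auto
  have len: "length y = d + 1" by (rule os_length[OF y])
  have bb: "bump j (bump i y) = bump i (bump j y)" using len i j by (intro bump_swap) auto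
  have I: "insert j (insert i J) = insert i (insert j J)" by (rule insert_commute)
  show ?thesis
    unfolding side_diff2_eq[OF \<phi> i j ij y zy] side_diff2_eq[OF \<phi> j i ij[symmetric] y zy] I bb by (simp only: algebra_simps)
qed (auto simp: side_diff_def)

lemma side_diff_bdry:
  assumes \<phi>: "\<phi> \<in> Fam m M"
  shows "side_diff M i (bdry M \<phi>) J y z = (\<Sum>j\<le>d. vscale (sgn_at j (insert i J)) (side_diff M i (side_diff M j \<phi>) J y z))"
proof (cases "i \<notin> J \<and> y \<in> os d l \<and> interlace z (lower J y)")
  case True
  have "arr_act M (bdry M \<phi> (insert i J) (bump i y) z) y (bump i y)
      = (\<Sum>j\<le>d. vscale (sgn_at j (insert i J)) (arr_act M (side_diff M j \<phi> (insert i J) (bump i y) z) y (bump i y)))"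
    unfolding bdry_def by (subst arr_act_sum[OF M]) (simp_all only: arr_act_scale[OF M side_diff_in[OF \<phi>]] rmod_scale[OF M side_diff_in[OF \<phi>]])
  moreover have "bdry M \<phi> (insert i J) y z = (\<Sum>j\<le>d. vscale (sgn_at j (insert i J)) (side_diff M j \<phi> (insert i J) y z))"
    by (rule bdry_def)
  ultimately show ?thesis
    using True by (simp only: side_diff_def[of M i] simp_thms if_True kvec.scale_right_diff_distrib sum_subtractf)
next
  case False
  show ?thesis by (simp only: side_diff_zero[OF False] kvec.scale_zero_right sum.neutral_const)
qed

lemma bdry_bdry:
  assumes \<phi>: "\<phi> \<in> Fam m M"
  shows "bdry M (bdry M \<phi>) = (\<lambda>J y z. 0)"
proof -
  have "bdry M (bdry M \<phi>) J y z = 0" for J y z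
  proof -
    let ?S = "{..d} - J"
    let ?a = "\<lambda>i j. vscale (sgn_at i J * sgn_at j (insert i J)) (side_diff M i (side_diff M j \<phi>) J y z)"
    have z1: "side_diff M i (side_diff M j \<phi>) J y z = 0" if "i \<in> J \<or> j \<in> J" for i j
    proof -
      have "side_diff M j \<phi> (insert i J) y' z = 0" if "j \<in> J" for y' using that by (simp add: side_diff_def)
      thus ?thesis using that by (cases "i \<in> J") (simp_all add: side_diff_def[of M i] arr_act_0[OF M])
    qed
    have "bdry M (bdry M \<phi>) J y z = (\<Sum>i\<le>d. \<Sum>j\<le>d. ?a i j)"
      unfolding bdry_def[of M "bdry M \<phi>"] side_diff_bdry[OF \<phi>] kvec.scale_sum_right kvec.scale_scale ..
    also have "\<dots> = (\<Sum>i\<in>?S. \<Sum>j\<le>d. ?a i j)"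
      using z1 by (intro sum.mono_neutral_right) auto
    also have "\<dots> = (\<Sum>i\<in>?S. \<Sum>j\<in>?S. ?a i j)"
      using z1 by (intro sum.cong refl sum.mono_neutral_right) auto
    also have "\<dots> = 0"
    proof (cases "finite J")
      case fin: True
      show ?thesis
      proof (rule sum_antisym_zero)
        fix i show "?a i i = 0" by (simp only: side_diff2_same kvec.scale_zero_right)
      next
        fix i j assume "i \<in> ?S" "j \<in> ?S" "i \<noteq> j"
        hence ij: "i \<le> d" "i \<notin> J" "j \<le> d" "j \<notin> J" "i \<noteq> j" by auto
        show "?a i j = - ?a j i"
          unfolding side_diff2_commute[OF \<phi> ij] sgn_at_antisym(2)[OF fin ij(2,4,5)] kvec.scale_minus_left ..
      qed
    next
      case False
      have "side_diff M i (side_diff M j \<phi>) J y z = 0" for i j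
      proof -
        have n: "\<phi> (insert j (insert i J)) y' z = 0" for y'
          using False Fam_adm[OF \<phi>] finite_subset[of _ "{..d}"] unfolding adm_def by (metis finite_atMost finite_insert)
        hence "side_diff M j \<phi> (insert i J) y' z = 0" for y' by (simp only: side_diff_def n arr_act_0[OF M] diff_self if_cancel)
        thus ?thesis by (simp only: side_diff_def[of M i "side_diff M j \<phi>"] arr_act_0[OF M] diff_self if_cancel)
      qed
      thus ?thesis by (simp only: kvec.scale_zero_right sum.neutral_const)
    qed
    finally show ?thesis .
  qed
  thus ?thesis by (rule ext[OF ext[OF ext]])
qed

text \<open>For each direction \<open>i\<close> the images of \<open>v a\<^sub>i \<otimes> \<lambda>\<close> and \<open>v \<otimes> a\<^sub>i \<lambda>\<close> in \<open>M\<close> are the same vector \<open>v a\<^sub>i \<lambda>\<close>. In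
  terms of families, the two sums agree after shifting \<open>y\<close> by \<open>e\<^sub>i\<close>; the index sets \<open>?A\<close> and \<open>?B\<close> record the
  nonzero terms.\<close>

lemma augment_bdry:
  assumes \<phi>: "\<phi> \<in> Fam (Suc 0) M"
  shows "augment M (enc (bdry M \<phi>)) = 0"
  unfolding augment_zero_iff[OF M bdry_Fam[OF \<phi>]]
proof
  fix z assume z: "z \<in> os d l"
  have step: "(\<Sum>y\<in>above z. arr_act M (side_diff M i \<phi> {} y z) z y) = 0" if i: "i \<le> d" for i
  proof -
    let ?A = "{y. interlace z y \<and> interlace y (bump i y) \<and> interlace z (bump i y) \<and> \<phi> {i} (bump i y) z \<noteq> 0}"
    let ?B = "{y. interlace z y \<and> \<phi> {i} y z \<noteq> 0}"
    have inup: "?A \<subseteq> above z" "?B \<subseteq> above z" by (auto simp: above_def)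
    have t: "arr_act M (side_diff M i \<phi> {} y z) z y = (if y \<in> ?A then arr_act M (\<phi> {i} (bump i y) z) z (bump i y) else 0)
       - (if y \<in> ?B then arr_act M (\<phi> {i} y z) z y else 0)" if y: "y \<in> above z" for y
    proof -
      have zy: "interlace z y" using y by (simp add: above_def)
      have "side_diff M i \<phi> {} y z = arr_act M (\<phi> {i} (bump i y) z) y (bump i y) - \<phi> {i} y z"
        using zy interlace_os(2)[OF zy] by (simp add: side_diff_def)
      hence "arr_act M (side_diff M i \<phi> {} y z) z y = arr_act M (arr_act M (\<phi> {i} (bump i y) z) y (bump i y)) z y - arr_act M (\<phi> {i} y z) z y"
        by (simp only: arr_act_diff[OF M arr_act_in[OF M Fam_in[OF \<phi>]] Fam_in[OF \<phi>]])
      moreover have "arr_act M (arr_act M (\<phi> {i} (bump i y) z) y (bump i y)) z y =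
          (if y \<in> ?A then arr_act M (\<phi> {i} (bump i y) z) z (bump i y) else 0)"
        unfolding arr_act_arr_act[OF M Fam_in[OF \<phi>]] using zy arr_act_not_interlace[OF M Fam_in[OF \<phi>], of z "bump i y"]
        by (auto simp: arr_act_0[OF M])
      moreover have "arr_act M (\<phi> {i} y z) z y = (if y \<in> ?B then arr_act M (\<phi> {i} y z) z y else 0)"
        using zy by (auto simp: arr_act_0[OF M])
      ultimately show ?thesis by simp
    qed
    have "(\<Sum>y\<in>above z. arr_act M (side_diff M i \<phi> {} y z) z y)
       = (\<Sum>y\<in>above z. if y \<in> ?A then arr_act M (\<phi> {i} (bump i y) z) z (bump i y) else 0)
         - (\<Sum>y\<in>above z. if y \<in> ?B then arr_act M (\<phi> {i} y z) z y else 0)"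
      unfolding sum_subtractf[symmetric] by (rule sum.cong[OF refl t])
    also have "(\<Sum>y\<in>above z. if y \<in> ?A then arr_act M (\<phi> {i} (bump i y) z) z (bump i y) else 0)
       = (\<Sum>y\<in>?A. arr_act M (\<phi> {i} (bump i y) z) z (bump i y))"
      unfolding sum.inter_restrict[OF finite_above, symmetric] using inup(1) by (simp add: Int_absorb1)
    also have "(\<Sum>y\<in>above z. if y \<in> ?B then arr_act M (\<phi> {i} y z) z y else 0) = (\<Sum>y\<in>?B. arr_act M (\<phi> {i} y z) z y)"
      unfolding sum.inter_restrict[OF finite_above, symmetric] using inup(2) by (simp add: Int_absorb1)
    also have "(\<Sum>y\<in>?A. arr_act M (\<phi> {i} (bump i y) z) z (bump i y)) = (\<Sum>y\<in>?B. arr_act M (\<phi> {i} y z) z y)"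
    proof (rule sum.reindex_bij_witness[of _ "lower {i}" "bump i"])
      fix y assume y: "y \<in> ?A"
      hence len: "length y = d + 1" by (auto simp: interlace_def)
      show "lower {i} (bump i y) = y" using lower_bump[of i "{}" y] by simp
      show "bump i y \<in> ?B" using y by auto
    next
      fix y assume y: "y \<in> ?B"
      hence len: "length y = d + 1" by (auto simp: interlace_def)
      show b: "bump i (lower {i} y) = y" by (rule nth_equalityI) (use len in \<open>auto simp: nth_bump\<close>)
      have g: "adm (Suc 0) {i} y z" using y Fam_nonzero[OF \<phi>] by auto
      hence l: "interlace z (lower {i} y)" by (simp add: adm_def)
      have "interlace (lower {i} y) y" using interlace_convex(2)[of z y "lower {i} y"] y interlace_below[OF l] below_lower[OF len] by auto
      thus "lower {i} y \<in> ?A" using y b l by simp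
    qed simp
    finally show ?thesis by (simp only: diff_self)
  qed
  have "(\<Sum>y\<in>above z. arr_act M (bdry M \<phi> {} y z) z y) = (\<Sum>y\<in>above z. \<Sum>i\<le>d. vscale (sgn_at i {}) (arr_act M (side_diff M i \<phi> {} y z) z y))"
  proof (rule sum.cong[OF refl])
    fix y
    show "arr_act M (bdry M \<phi> {} y z) z y = (\<Sum>i\<le>d. vscale (sgn_at i {}) (arr_act M (side_diff M i \<phi> {} y z) z y))"
      unfolding bdry_def by (subst arr_act_sum[OF M]) (simp_all only: arr_act_scale[OF M side_diff_in[OF \<phi>]] rmod_scale[OF M side_diff_in[OF \<phi>]])
  qed
  also have "\<dots> = (\<Sum>i\<le>d. \<Sum>y\<in>above z. vscale (sgn_at i {}) (arr_act M (side_diff M i \<phi> {} y z) z y))" by (rule sum.swap)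
  also have "\<dots> = (\<Sum>i\<le>d. vscale (sgn_at i {}) 0)"
    unfolding kvec.scale_sum_right[symmetric] by (rule sum.cong[OF refl]) (simp add: step)
  also have "\<dots> = 0" by (simp only: kvec.scale_zero_right sum.neutral_const)
  finally show "(\<Sum>y\<in>above z. arr_act M (bdry M \<phi> {} y z) z y) = 0" .
qed

end

end

section \<open>Exactness of the Koszul complex\<close>

context interlacing
begin

text \<open>The difference of the weights of \<open>y\<close> and \<open>z\<close> filters the Koszul complex: multiplication by an arrow on
  the side of \<open>M\<close> lowers it, multiplication on the other side preserves it.\<close>

definition weight :: "vertex \<Rightarrow> int" where "weight y = (\<Sum>i\<le>d. y ! i)"

text \<open>The coordinates \<open>i\<close> for which \<open>i \<in> I\<close> and \<open>i \<notin> I\<close> are both compatible with \<open>Hom(z, y - e\<^sub>I) \<noteq> 0\<close>. At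
  the other coordinates \<open>y\<^sub>i\<close> is one of the two extreme values, and \<open>I\<close> is determined.\<close>

definition free_coords :: "vertex \<Rightarrow> vertex \<Rightarrow> nat set" where
  "free_coords y z = {i. i \<le> d \<and> z ! i < y ! i \<and> y ! i < next_entry z i}"

text \<open>The inverse of \<open>\<Phi>\<close> has the entries \<open>next_entry z i\<close>; interlacing says \<open>z \<le> w < \<Phi>\<inverse>(z)\<close> in every coordinate.\<close>

definition Phi_inv :: "vertex \<Rightarrow> vertex" where "Phi_inv z = tl z @ [z ! 0 + width]"

definition Phi_fun :: "vertex \<Rightarrow> vertex" where "Phi_fun z = (last z - width) # butlast z"

lemma length_Phi_inv: "length (Phi_inv z) = d + 1 \<longleftrightarrow> length z = d + 1"
  using d1 by (cases z) (auto simp: Phi_inv_def)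

lemma length_Phi_fun: "length (Phi_fun z) = d + 1 \<longleftrightarrow> length z = d + 1"
  using d1 by (cases z) (auto simp: Phi_fun_def)

lemma nth_Phi_inv: "length z = d + 1 \<Longrightarrow> i \<le> d \<Longrightarrow> Phi_inv z ! i = next_entry z i"
  by (auto simp: Phi_inv_def next_entry_def nth_append nth_tl)

lemma Phi_fun_Phi_inv: "length z = d + 1 \<Longrightarrow> Phi_fun (Phi_inv z) = z"
  by (cases z) (auto simp: Phi_inv_def Phi_fun_def)

lemma Phi_inv_Phi_fun: assumes "length z = d + 1" shows "Phi_inv (Phi_fun z) = z"
proof -
  have "z \<noteq> []" using assms by auto
  thus ?thesis by (simp add: Phi_inv_def Phi_fun_def)
qed

lemma Phi_inv_shift: "length z = d + 1 \<Longrightarrow> Phi_inv (shift k z) = shift k (Phi_inv z)"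
  by (rule nth_equalityI) (use length_Phi_inv[of z] length_Phi_inv[of "shift k z"] in \<open>auto simp: nth_Phi_inv less_Suc_eq_le\<close>)

lemma Phi_fun_shift: "length z = d + 1 \<Longrightarrow> Phi_fun (shift k z) = shift k (Phi_fun z)"
  by (metis Phi_fun_Phi_inv length_Phi_fun length_shift Phi_inv_Phi_fun Phi_inv_shift)

lemma interlace_Phi_inv_Phi_inv: "interlace (Phi_inv x) (Phi_inv y) \<longleftrightarrow> interlace x y"
proof (cases "length x = d + 1 \<and> length y = d + 1")
  case True
  hence lx: "length x = d + 1" and ly: "length y = d + 1" by auto
  have lsx: "length (Phi_inv x) = d + 1" "length (Phi_inv y) = d + 1" using lx ly length_Phi_inv by blast+
  have nxs: "next_entry (Phi_inv x) i = (if i = d then next_entry x 0 + width else next_entry x (Suc i))" if "i \<le> d" for i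
    using that lx by (auto simp: next_entry_def[of "Phi_inv x"] nth_Phi_inv)
  show ?thesis
  proof
    assume a: "interlace x y"
    have "Phi_inv x ! i \<le> Phi_inv y ! i \<and> Phi_inv y ! i < next_entry (Phi_inv x) i" if i: "i \<le> d" for i
    proof (cases "i = d")
      case True
      thus ?thesis using a lx ly by (simp add: nth_Phi_inv nxs interlace_def next_entry_def[of x d] next_entry_def[of y d])
    next
      case False
      hence "Suc i \<le> d" using i by simp
      thus ?thesis using a lx ly False by (simp add: nth_Phi_inv nxs interlace_def next_entry_def[of x i] next_entry_def[of y i])
    qed
    thus "interlace (Phi_inv x) (Phi_inv y)" using lsx unfolding interlace_def by blast
  next
    assume a: "interlace (Phi_inv x) (Phi_inv y)"
    have b: "next_entry x i \<le> next_entry y i \<and> next_entry y i < (if i = d then next_entry x 0 + width else next_entry x (Suc i))" if "i \<le> d" for i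
    proof -
      have "Phi_inv x ! i \<le> Phi_inv y ! i \<and> Phi_inv y ! i < next_entry (Phi_inv x) i" using a that unfolding interlace_def by blast
      thus ?thesis using that lx ly unfolding nxs[OF that] by (simp add: nth_Phi_inv)
    qed
    have "x ! j \<le> y ! j \<and> y ! j < next_entry x j" if j: "j \<le> d" for j
    proof (cases j)
      case 0
      thus ?thesis using b[of d] by (simp add: next_entry_def[of x d] next_entry_def[of y d])
    next
      case (Suc i)
      thus ?thesis using b[of i] j by (simp add: next_entry_def[of x i] next_entry_def[of y i])
    qed
    thus "interlace x y" using lx ly unfolding interlace_def by blast
  qed
next
  case False
  thus ?thesis using length_Phi_inv unfolding interlace_def by blast
qed

lemma interlace_Phi_fun_Phi_fun: "interlace (Phi_fun x) (Phi_fun y) \<longleftrightarrow> interlace x y"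
proof (cases "length x = d + 1 \<and> length y = d + 1")
  case True
  thus ?thesis using interlace_Phi_inv_Phi_inv[of "Phi_fun x" "Phi_fun y"] Phi_inv_Phi_fun by simp
next
  case False
  thus ?thesis using length_Phi_fun unfolding interlace_def by blast
qed

lemma os_Phi_inv: "Phi_inv z \<in> os d l \<longleftrightarrow> z \<in> os d l"
  using interlace_Phi_inv_Phi_inv[of z z] interlace_refl interlace_os(1) by blast

text \<open>The inequalities \<open>z\<^sub>i < y\<^sub>i \<le> z\<^sub>i\<^sub>+\<^sub>1\<close> for all \<open>i\<close> read \<open>y\<^sub>i \<le> z\<^sub>i\<^sub>+\<^sub>1 < y\<^sub>i\<^sub>+\<^sub>1\<close> after a cyclic regrouping. So the
  entries of the top Koszul module lie at the pairs with \<open>Hom(y, \<Phi>\<inverse>(z)) \<noteq> 0\<close>, the morphisms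
  through which the twisted module embeds in it.\<close>

lemma interlace_lower_full:
  assumes y: "length y = d + 1"
  shows "interlace z (lower {..d} y) \<longleftrightarrow> interlace y (Phi_inv z)"
proof (cases "length z = d + 1")
  case True
  hence lz: "length z = d + 1" "length (Phi_inv z) = d + 1" using length_Phi_inv by blast+
  have lower: "lower {..d} y ! i = y ! i - 1" if "i \<le> d" for i using that y by simp
  show ?thesis
  proof
    assume a: "interlace z (lower {..d} y)"
    hence b: "z ! i \<le> y ! i - 1 \<and> y ! i - 1 < next_entry z i" if "i \<le> d" for i
      using that lower[OF that] unfolding interlace_def by auto
    have "y ! i \<le> Phi_inv z ! i \<and> Phi_inv z ! i < next_entry y i" if i: "i \<le> d" for i
    proof (cases "i = d")
      case True
      thus ?thesis using b[of 0] b[of d] lz by (simp add: nth_Phi_inv next_entry_def)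
    next
      case False
      thus ?thesis using b[of i] b[of "Suc i"] lz i by (simp add: nth_Phi_inv next_entry_def)
    qed
    thus "interlace y (Phi_inv z)" using y lz unfolding interlace_def by blast
  next
    assume a: "interlace y (Phi_inv z)"
    hence b: "y ! i \<le> next_entry z i \<and> next_entry z i < next_entry y i" if "i \<le> d" for i
      using that nth_Phi_inv[OF lz(1) that] unfolding interlace_def by auto
    have "z ! j \<le> y ! j - 1 \<and> y ! j - 1 < next_entry z j" if j: "j \<le> d" for j
    proof (cases j)
      case 0
      thus ?thesis using b[of d] b[of 0] by (simp add: next_entry_def[of z d] next_entry_def[of y d])
    next
      case (Suc i)
      thus ?thesis using b[of i] b[of j] j by (simp add: next_entry_def[of z i] next_entry_def[of y i])
    qed
    thus "interlace z (lower {..d} y)" using y lz lower unfolding interlace_def by simp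
  qed
next
  case False
  thus ?thesis using length_Phi_inv unfolding interlace_def by blast
qed

lemma interlace_lower_more:
  assumes "interlace z (lower J y)" "length y = d + 1" "i \<le> d" "z ! i < y ! i"
  shows "interlace z (lower (insert i J) y)"
  using assms unfolding interlace_def by (auto split: if_splits)

lemma interlace_lower_less:
  assumes "interlace z (lower I y)" "length y = d + 1" "i \<le> d" "y ! i < next_entry z i"
  shows "interlace z (lower (I - {i}) y)"
proof -
  have "z ! j \<le> lower (I - {i}) y ! j \<and> lower (I - {i}) y ! j < next_entry z j" if j: "j \<le> d" for j
  proof -
    have "z ! j \<le> lower I y ! j \<and> lower I y ! j < next_entry z j" using assms(1) j unfolding interlace_def by blast
    thus ?thesis using j assms(2,4) by (cases "j = i") (auto split: if_splits)
  qed
  thus ?thesis using assms(1,2) unfolding interlace_def by simp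
qed

text \<open>The only positions without a free coordinate are \<open>y = z\<close> and \<open>y = \<Phi>\<inverse>(z)\<close>: if one coordinate
  of \<open>y\<close> reaches the next coordinate of \<open>z\<close>, then strict monotonicity pushes all others up as well,
  cyclically.\<close>

lemma no_free_coordinate:
  assumes g: "adm m I y z" and f: "free_coords y z = {}"
  shows "I = {} \<and> y = z \<or> I = {..d} \<and> y = Phi_inv z"
proof -
  have y: "y \<in> os d l" and zI: "interlace z (lower I y)" and I: "I \<subseteq> {..d}" using g unfolding adm_def by auto
  have ly: "length y = d + 1" and lz: "length z = d + 1" using os_length y interlace_os(1)[OF zI] by auto
  have b: "z ! i \<le> y ! i - (if i \<in> I then 1 else 0) \<and> y ! i - (if i \<in> I then 1 else 0) < next_entry z i" if "i \<le> d" for i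
    using zI that ly unfolding interlace_def by auto
  have alt: "(i \<notin> I \<and> y ! i = z ! i) \<or> (i \<in> I \<and> y ! i = next_entry z i)" if i: "i \<le> d" for i
  proof -
    have "y ! i \<le> z ! i \<or> next_entry z i \<le> y ! i" using f i unfolding free_coords_def by force
    thus ?thesis using b[OF i] by (cases "i \<in> I") auto
  qed
  have inc: "y ! i < next_entry y i" if "i \<le> d" for i using y that unfolding os_iff by blast
  have step: "Suc i \<in> I" if "i \<in> I" "Suc i \<le> d" for i
  proof -
    have "y ! i = z ! Suc i" using alt[of i] that by (auto simp: next_entry_def)
    moreover have "y ! i < y ! Suc i" using inc[of i] that by (auto simp: next_entry_def)
    ultimately show ?thesis using alt[OF that(2)] by auto
  qed
  have wrap: "0 \<in> I" if "d \<in> I"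
  proof -
    have "y ! d = z ! 0 + width" using alt[of d] that by (auto simp: next_entry_def)
    moreover have "y ! d < y ! 0 + width" using inc[of d] by (auto simp: next_entry_def)
    ultimately show ?thesis using alt[of 0] by auto
  qed
  have above: "j \<in> I" if "i \<in> I" "i \<le> j" "j \<le> d" for i j
    using that(2,1,3) by (induction j rule: dec_induct) (auto intro: step)
  show ?thesis
  proof (cases "I = {}")
    case True
    hence "y = z" using alt ly lz by (intro nth_equalityI) auto
    thus ?thesis using True by simp
  next
    case False
    then obtain i where i: "i \<in> I" "i \<le> d" using I by auto
    hence "d \<in> I" using above by blast
    hence "0 \<in> I" by (rule wrap)
    hence all: "j \<in> I" if "j \<le> d" for j using above that by blast
    hence "I = {..d}" using I by auto
    moreover have "y = Phi_inv z"
      using alt all ly length_Phi_inv[of z] lz by (intro nth_equalityI) (auto simp: nth_Phi_inv less_Suc_eq_le)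
    ultimately show ?thesis by simp
  qed
qed

lemma finite_free_coords: "finite (free_coords y z)"
  by (rule finite_subset[of _ "{..d}"]) (auto simp: free_coords_def)

lemma free_coords_shift: "length y = d + 1 \<Longrightarrow> length z = d + 1 \<Longrightarrow> free_coords (shift k y) (shift k z) = free_coords y z"
  by (auto simp: free_coords_def)

lemma weight_bump: "length y = d + 1 \<Longrightarrow> i \<le> d \<Longrightarrow> weight (bump i y) = weight y + 1"
  unfolding weight_def by (simp add: nth_bump sum.distrib)

lemma weight_mono: "below z y \<Longrightarrow> weight z \<le> weight y"
  unfolding weight_def below_def by (intro sum_mono) auto

lemma weight_strict: assumes "below z y" "z \<noteq> y" shows "weight z < weight y"
proof (rule ccontr)
  assume "\<not> weight z < weight y"
  hence e: "(\<Sum>i\<le>d. z ! i) = (\<Sum>i\<le>d. y ! i)" using weight_mono[OF assms(1)] unfolding weight_def by simp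
  have "z ! i = y ! i" if i: "i \<le> d" for i
    using sum_mono_inv[OF e, of i] assms(1) i unfolding below_def by auto
  hence "z = y" using assms(1) unfolding below_def by (intro nth_equalityI) auto
  thus False using assms(2) by simp
qed

lemma sum_next_entry: "(\<Sum>i\<le>d. next_entry z i) = weight z + width"
proof -
  have "(\<Sum>i\<le>d. next_entry z i) = (\<Sum>i<d. z ! Suc i) + (z ! 0 + width)"
    by (simp add: lessThan_Suc_atMost[symmetric] next_entry_def)
  also have "(\<Sum>i<d. z ! Suc i) = weight z - z ! 0"
    unfolding weight_def lessThan_Suc_atMost[symmetric] by (simp only: sum.lessThan_Suc_shift)
  finally show ?thesis by simp
qed

lemma weight_adm: assumes "adm m I y z" shows "0 \<le> weight y - weight z" "weight y - weight z \<le> width"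
proof -
  have y: "length y = d + 1" and zI: "interlace z (lower I y)" using assms os_length unfolding adm_def by auto
  show "0 \<le> weight y - weight z" using weight_mono[OF below_trans[OF interlace_below[OF zI] below_lower[OF y]]] by simp
  have "y ! i \<le> next_entry z i" if "i \<le> d" for i
    using zI that y unfolding interlace_def by (auto split: if_splits)
  hence "weight y \<le> (\<Sum>i\<le>d. next_entry z i)" unfolding weight_def by (intro sum_mono) simp
  thus "weight y - weight z \<le> width" unfolding sum_next_entry by simp
qed

end

context orbit_algebra
begin

text \<open>The contraction of the graded complex at \<open>(y, z)\<close> in the direction of the least free coordinate. Any
  free coordinate would do, but the choice may depend only on \<open>y\<close> and \<open>z\<close>, not on \<open>I\<close>. The sign undoes that
  of the second term of the differential.\<close>

definition homotopy :: "'k fam \<Rightarrow> 'k fam" where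
  "homotopy \<phi> I y z = (if free_coords y z \<noteq> {} \<and> Min (free_coords y z) \<in> I
     then vscale (- sgn_at (Min (free_coords y z)) (I - {Min (free_coords y z)})) (\<phi> (I - {Min (free_coords y z)}) y z) else 0)"

context
  fixes M :: "('k, 'a) rmod"
  assumes M: "rmodule L M"
begin

lemma homotopy_zero: "(\<And>J. \<phi> J y z = 0) \<Longrightarrow> homotopy \<phi> I y z = 0"
  unfolding homotopy_def by (simp only: kvec.scale_zero_right if_cancel)

lemma homotopy_Fam:
  assumes \<phi>: "\<phi> \<in> Fam m M"
  shows "homotopy \<phi> \<in> Fam (Suc m) M"
proof (rule FamI)
  fix I y z
  let ?i = "Min (free_coords y z)"
  show "homotopy \<phi> I y z \<in> space M"
    unfolding homotopy_def by (simp add: rmod_0[OF M] rmod_minus[OF M] rmod_scale[OF M Fam_in[OF \<phi>]])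
  show "arr_act M (homotopy \<phi> I y z) y y = homotopy \<phi> I y z"
    unfolding homotopy_def by (simp add: arr_act_0[OF M] arr_act_scale[OF M Fam_in[OF \<phi>]] Fam_arr_act[OF \<phi>] del: kvec.scale_minus_left)
  show "homotopy \<phi> I y z = 0" if n: "\<not> adm (Suc m) I y z"
  proof (cases "free_coords y z \<noteq> {} \<and> ?i \<in> I")
    case True
    have i: "?i \<in> free_coords y z" "?i \<in> I" using True Min_in[OF finite_free_coords] by auto
    have "\<phi> (I - {?i}) y z = 0"
    proof (rule ccontr)
      assume "\<phi> (I - {?i}) y z \<noteq> 0"
      hence g: "adm m (I - {?i}) y z" by (rule Fam_nonzero[OF \<phi>])
      have I: "I \<subseteq> {..d}" using g i unfolding adm_def free_coords_def by auto
      hence fin: "finite I" using finite_subset by blast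
      have "card I = Suc m" using g card_Suc_Diff1[OF fin i(2)] unfolding adm_def by simp
      moreover have "interlace z (lower (insert ?i (I - {?i})) y)"
        using g i os_length unfolding adm_def free_coords_def by (intro interlace_lower_more) auto
      ultimately show False using n g I i(2) unfolding adm_def by (simp add: insert_absorb)
    qed
    thus ?thesis unfolding homotopy_def by (simp only: kvec.scale_zero_right if_cancel)
  qed (simp only: homotopy_def if_False)
  show "homotopy \<phi> I (shift k y) (shift k z) = homotopy \<phi> I y z" for k
  proof (cases "length y = d + 1 \<and> length z = d + 1")
    case True
    thus ?thesis unfolding homotopy_def by (simp add: free_coords_shift Fam_shift[OF \<phi>])
  next
    case False
    have "\<not> adm m J y z" for J
      using False os_length interlace_os(1) unfolding adm_def by blast
    hence "\<phi> J y z = 0" "\<phi> J (shift k y) (shift k z) = 0" for J using Fam_adm[OF \<phi>] Fam_shift[OF \<phi>] by auto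
    thus ?thesis by (simp only: homotopy_zero)
  qed
qed

text \<open>In the highest weight only the part of the operator that preserves the weight is left.\<close>

lemma side_diff_top:
  assumes b: "\<And>J. \<phi> J (bump i y) z = 0" and y: "y \<in> os d l" and zJ: "interlace z (lower J y)"
  shows "side_diff M i \<phi> J y z = (if i \<in> J then 0 else - \<phi> (insert i J) y z)"
  unfolding side_diff_def using y zJ by (simp add: b arr_act_0[OF M])

text \<open>Subtracting a boundary removes the part of a cycle of highest weight \<open>K\<close>, provided that it vanishes where
  there is no free coordinate.\<close>

lemma homotopy_step:
  assumes \<phi>: "\<phi> \<in> Fam m M" and cyc: "bdry M \<phi> = (\<lambda>J y z. 0)"
    and bound: "\<And>I y z. K < weight y - weight z \<Longrightarrow> \<phi> I y z = 0"
    and crit: "\<And>I y z. free_coords y z = {} \<Longrightarrow> weight y - weight z = K \<Longrightarrow> \<phi> I y z = 0"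
    and w: "K \<le> weight y - weight z"
  shows "\<phi> I y z - bdry M (homotopy \<phi>) I y z = 0"
proof (cases "adm m I y z")
  case g: True
  have y: "y \<in> os d l" and zI: "interlace z (lower I y)" and I: "I \<subseteq> {..d}" using g unfolding adm_def by auto
  have ly: "length y = d + 1" by (rule os_length[OF y])
  have fin: "finite I" using I finite_subset by blast
  have b0: "\<phi> J (bump i y) z = 0" if "i \<le> d" for i J
    using bound[of "bump i y" z J] weight_bump[OF ly that] w by simp
  have bh: "homotopy \<phi> J (bump i y) z = 0" if "i \<le> d" for i J
    by (rule homotopy_zero) (rule b0[OF that])
  have Dh: "bdry M (homotopy \<phi>) I y z = (\<Sum>i\<le>d. vscale (sgn_at i I) (if i \<in> I then 0 else - homotopy \<phi> (insert i I) y z))"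
    unfolding bdry_def by (intro sum.cong refl) (simp add: side_diff_top[where \<phi> = "homotopy \<phi>", OF bh y zI])
  show ?thesis
  proof (cases "free_coords y z = {}")
    case True
    have 0: "\<phi> J y z = 0" for J using crit[OF True] bound w by (cases "weight y - weight z = K") auto
    hence "homotopy \<phi> J y z = 0" for J by (rule homotopy_zero)
    hence "bdry M (homotopy \<phi>) I y z = 0" unfolding Dh by (simp only: minus_zero if_cancel kvec.scale_zero_right sum.neutral_const)
    thus ?thesis by (simp only: 0 diff_self)
  next
    case ne: False
    define i0 where "i0 = Min (free_coords y z)"
    have i0: "i0 \<in> free_coords y z" unfolding i0_def by (rule Min_in[OF finite_free_coords ne])
    hence i0d: "i0 \<le> d" "z ! i0 < y ! i0" "y ! i0 < next_entry z i0" unfolding free_coords_def by auto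
    have homotopy: "homotopy \<phi> J y z = (if i0 \<in> J then vscale (- sgn_at i0 (J - {i0})) (\<phi> (J - {i0}) y z) else 0)" for J
      unfolding homotopy_def i0_def using ne by simp
    have "bdry M (homotopy \<phi>) I y z = \<phi> I y z"
    proof (cases "i0 \<in> I")
      case False
      have "bdry M (homotopy \<phi>) I y z = (\<Sum>i\<le>d. if i = i0 then \<phi> I y z else 0)"
        unfolding Dh
      proof (rule sum.cong[OF refl])
        fix i assume "i \<in> {..d}"
        show "vscale (sgn_at i I) (if i \<in> I then 0 else - homotopy \<phi> (insert i I) y z) = (if i = i0 then \<phi> I y z else 0)"
        proof (cases "i = i0")
          case True
          have "insert i0 I - {i0} = I" using False by auto
          thus ?thesis using True False unfolding homotopy by (simp add: sgn_at_square)
        next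
          case ii: False
          thus ?thesis using False unfolding homotopy by simp
        qed
      qed
      thus ?thesis using i0d(1) by simp
    next
      case True
      define J where "J = I - {i0}"
      have IJ: "I = insert i0 J" "i0 \<notin> J" "finite J" using True fin unfolding J_def by auto
      \<comment> \<open>As \<open>i0\<close> is free, the position \<open>J\<close> without it is admissible too, and the cycle condition there
        expresses \<open>\<phi> I\<close> by the other entries of highest weight.\<close>
      have zJ: "interlace z (lower J y)" unfolding J_def by (rule interlace_lower_less[OF zI ly i0d(1,3)])
      let ?R = "\<Sum>i\<in>{..d} - {i0}. vscale (sgn_at i J) (if i \<in> J then 0 else - \<phi> (insert i J) y z)"
      have "0 = bdry M \<phi> J y z" unfolding cyc ..
      also have "\<dots> = (\<Sum>i\<le>d. vscale (sgn_at i J) (if i \<in> J then 0 else - \<phi> (insert i J) y z))"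
        unfolding bdry_def by (intro sum.cong refl) (simp add: side_diff_top[where \<phi> = \<phi>, OF b0 y zJ])
      also have "\<dots> = vscale (sgn_at i0 J) (- \<phi> I y z) + ?R"
        using i0d(1) IJ by (subst sum.remove[of _ i0]) auto
      finally have "0 = - vscale (sgn_at i0 J) (\<phi> I y z) + ?R" by (simp only: kvec.scale_minus_right)
      moreover have "a = b" if "0 = - a + b" for a b :: "'k vec"
        using that by (metis add.right_neutral add_minus_cancel)
      ultimately have "vscale (sgn_at i0 J) (\<phi> I y z) = ?R" by blast
      hence "vscale (sgn_at i0 J) ?R = vscale (sgn_at i0 J) (vscale (sgn_at i0 J) (\<phi> I y z))" by simp
      also have "\<dots> = \<phi> I y z" by (simp only: kvec.scale_scale sgn_at_square kvec.scale_one)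
      finally have \<phi>I: "\<phi> I y z = vscale (sgn_at i0 J) ?R" ..
      have "bdry M (homotopy \<phi>) I y z = (\<Sum>i\<in>{..d} - {i0}. vscale (sgn_at i I) (if i \<in> I then 0 else - homotopy \<phi> (insert i I) y z))"
        unfolding Dh using i0d(1) True by (subst sum.remove[of _ i0]) auto
      also have "\<dots> = (\<Sum>i\<in>{..d} - {i0}. vscale (sgn_at i0 J) (vscale (sgn_at i J) (if i \<in> J then 0 else - \<phi> (insert i J) y z)))"
      proof (rule sum.cong[OF refl])
        fix i assume "i \<in> {..d} - {i0}"
        hence ii: "i \<noteq> i0" by simp
        show "vscale (sgn_at i I) (if i \<in> I then 0 else - homotopy \<phi> (insert i I) y z)
          = vscale (sgn_at i0 J) (vscale (sgn_at i J) (if i \<in> J then 0 else - \<phi> (insert i J) y z))"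
        proof (cases "i \<in> J")
          case iJ: True
          hence "i \<in> I" using IJ by simp
          thus ?thesis using iJ by simp
        next
          case iJ: False
          hence iI: "i \<notin> I" using IJ ii by simp
          have e: "insert i I - {i0} = insert i J" using IJ ii by auto
          have "homotopy \<phi> (insert i I) y z = vscale (- sgn_at i0 (insert i J)) (\<phi> (insert i J) y z)"
            unfolding homotopy e using True by simp
          hence "vscale (sgn_at i I) (- homotopy \<phi> (insert i I) y z) = vscale (sgn_at i (insert i0 J) * sgn_at i0 (insert i J)) (\<phi> (insert i J) y z)"
            unfolding IJ(1) by simp
          also have "\<dots> = vscale (sgn_at i0 J) (vscale (sgn_at i J) (- \<phi> (insert i J) y z))"
            unfolding sgn_at_antisym(1)[OF IJ(3) iJ IJ(2) ii] by (simp add: mult.commute)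
          finally show ?thesis using iI iJ by simp
        qed
      qed
      also have "\<dots> = \<phi> I y z" unfolding \<phi>I kvec.scale_sum_right ..
      finally show ?thesis .
    qed
    thus ?thesis by (simp only: diff_self)
  qed
next
  case False
  have "bdry M (homotopy \<phi>) I y z = 0" by (rule Fam_adm[OF bdry_Fam[OF M homotopy_Fam[OF \<phi>]] False])
  thus ?thesis by (simp only: Fam_adm[OF \<phi> False] diff_self)
qed

lemma Fam_large: "Suc d < m \<Longrightarrow> \<phi> \<in> Fam m M \<Longrightarrow> \<phi> = (\<lambda>I y z. 0)"
proof -
  assume m: "Suc d < m" and \<phi>: "\<phi> \<in> Fam m M"
  have n: "\<not> adm m I y z" for I y z
    using m card_mono[of "{..d}" I] unfolding adm_def by auto
  show ?thesis by (rule ext[OF ext[OF ext]]) (rule Fam_adm[OF \<phi> n])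
qed

lemma bdry_zero: "bdry M (\<lambda>I y z. 0) = (\<lambda>I y z. 0)"
proof -
  have "side_diff M i (\<lambda>I y z. 0) J y z = 0" for i J y z by (simp only: side_diff_def arr_act_0[OF M] diff_self if_cancel)
  thus ?thesis by (intro ext[OF ext[OF ext]]) (simp only: bdry_def kvec.scale_zero_right sum.neutral_const)
qed

text \<open>In degree \<open>0\<close> a cycle has to be killed by the augmentation. In degree \<open>d + 1\<close> the homology is \<open>M\<^sub>\<Phi>\<close>, read
  off at the positions without free coordinates, and the cycles considered are those with trivial class.\<close>

definition cycle :: "nat \<Rightarrow> 'k fam \<Rightarrow> bool" where
  "cycle m \<phi> \<longleftrightarrow> \<phi> \<in> Fam m M \<and> bdry M \<phi> = (\<lambda>J y z. 0) \<and> (m = 0 \<longrightarrow> augment M (enc \<phi>) = 0) \<and>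
     (m = Suc d \<longrightarrow> (\<forall>I y z. free_coords y z = {} \<longrightarrow> \<phi> I y z = 0))"

text \<open>Induction on a bound for the weights. A position of highest weight without free coordinate is either
  \<open>y = z\<close>, where the augmentation shows that the entry is zero, or in degree \<open>d + 1\<close>, where this is part
  of the assumption on the cycle.\<close>

lemma cycle_boundary_bounded:
  assumes "cycle m \<phi>" "m \<le> Suc d" "\<And>I y z. int K \<le> weight y - weight z \<Longrightarrow> \<phi> I y z = 0"
  shows "\<exists>\<chi>\<in>Fam (Suc m) M. bdry M \<chi> = \<phi>"
  using assms
proof (induction K arbitrary: \<phi>)
  case 0
  have \<phi>: "\<phi> \<in> Fam m M" using 0(1) unfolding cycle_def by blast
  have "\<phi> I y z = 0" for I y z
  proof (cases "adm m I y z")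
    case True
    hence "int 0 \<le> weight y - weight z" using weight_adm(1) by fastforce
    thus ?thesis by (rule 0(3))
  qed (rule Fam_adm[OF \<phi>])
  hence "\<phi> = (\<lambda>I y z. 0)" by (intro ext[OF ext[OF ext]])
  thus ?case using Fam_zero[OF M] bdry_zero by blast
next
  case (Suc K)
  have \<phi>: "\<phi> \<in> Fam m M" and bdry\<phi>: "bdry M \<phi> = (\<lambda>J y z. 0)" and a\<phi>: "m = 0 \<Longrightarrow> augment M (enc \<phi>) = 0"
    and top: "\<And>I y z. m = Suc d \<Longrightarrow> free_coords y z = {} \<Longrightarrow> \<phi> I y z = 0"
    using Suc.prems(1) unfolding cycle_def by blast+
  have bound: "\<phi> I y z = 0" if "int K < weight y - weight z" for I y z
    by (rule Suc.prems(3)) (use that in simp)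
  have crit: "\<phi> I y z = 0" if f: "free_coords y z = {}" and w: "weight y - weight z = int K" for I y z
  proof (rule ccontr)
    assume ne: "\<phi> I y z \<noteq> 0"
    hence g: "adm m I y z" by (rule Fam_nonzero[OF \<phi>])
    consider "I = {}" "y = z" | "I = {..d}" using no_free_coordinate[OF g f] by blast
    thus False
    proof cases
      case 1
      have m: "m = 0" using g 1 unfolding adm_def by simp
      have K: "K = 0" using w 1 by simp
      have z: "z \<in> os d l" using g 1 unfolding adm_def by blast
      \<comment> \<open>Here the highest weight is \<open>0\<close>, so the augmentation has a single summand.\<close>
      have "(\<Sum>y\<in>above z. arr_act M (\<phi> {} y z) z y) = (\<Sum>y\<in>above z. if y = z then \<phi> {} z z else 0)"
      proof (rule sum.cong[OF refl])
        fix y' assume "y' \<in> above z"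
        hence zy: "interlace z y'" by (simp add: above_def)
        show "arr_act M (\<phi> {} y' z) z y' = (if y' = z then \<phi> {} z z else 0)"
        proof (cases "y' = z")
          case True
          thus ?thesis using Fam_arr_act[OF \<phi>, of "{}" z z] by simp
        next
          case False
          hence "\<phi> {} y' z = 0" using weight_strict[OF interlace_below[OF zy]] bound[of y' z "{}"] K by auto
          thus ?thesis using False by (simp add: arr_act_0[OF M])
        qed
      qed
      also have "\<dots> = \<phi> {} z z" using finite_above interlace_refl[OF z] by (simp add: above_def)
      also have "(\<Sum>y\<in>above z. arr_act M (\<phi> {} y z) z y) = 0"
        using augment_zero_iff[OF M] \<phi> a\<phi>[OF m] z unfolding m by blast
      finally have "0 = \<phi> {} z z" .
      thus False using ne unfolding 1 by metis
    next
      case 2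
      hence "m = Suc d" using g unfolding adm_def by simp
      thus False using top f ne by blast
    qed
  qed
  define \<psi> where "\<psi> = (\<lambda>I y z. \<phi> I y z - bdry M (homotopy \<phi>) I y z)"
  have hF: "homotopy \<phi> \<in> Fam (Suc m) M" by (rule homotopy_Fam[OF \<phi>])
  have DhF: "bdry M (homotopy \<phi>) \<in> Fam m M" by (rule bdry_Fam[OF M hF])
  have \<psi>F: "\<psi> \<in> Fam m M" unfolding \<psi>_def by (rule Fam_diff[OF M \<phi> DhF])
  have "cycle m \<psi>"
    unfolding cycle_def
  proof (intro conjI impI allI)
    show "\<psi> \<in> Fam m M" by (rule \<psi>F)
    show "bdry M \<psi> = (\<lambda>J y z. 0)" unfolding \<psi>_def bdry_diff[OF M \<phi> DhF] bdry\<phi> bdry_bdry[OF M hF] by (simp only: diff_self)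
    show "augment M (enc \<psi>) = 0" if m: "m = 0"
    proof -
      have "enc \<psi> = enc \<phi> - enc (bdry M (homotopy \<phi>))"
        unfolding \<psi>_def by (auto simp: fun_eq_iff enc_def split: prod.split)
      moreover have "augment M (enc \<phi> - enc (bdry M (homotopy \<phi>))) = augment M (enc \<phi>) - augment M (enc (bdry M (homotopy \<phi>)))"
        using \<phi> DhF unfolding m by (intro rhom_minus_val[OF rmodule_koszul[OF M] augment_rhom[OF M]]) (auto simp: space_koszul)
      ultimately show ?thesis using a\<phi>[OF m] augment_bdry[OF M hF[unfolded m]] by simp
    qed
    show "\<psi> I y z = 0" if m: "m = Suc d" and f: "free_coords y z = {}" for I y z
    proof -
      have h0: "homotopy \<phi> = (\<lambda>I y z. 0)" using Fam_large[OF _ hF] m by simp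
      show ?thesis unfolding \<psi>_def h0 bdry_zero using top[OF m f] by simp
    qed
  qed
  moreover have "\<psi> I y z = 0" if "int K \<le> weight y - weight z" for I y z
    unfolding \<psi>_def by (rule homotopy_step[OF \<phi> bdry\<phi> bound crit that])
  ultimately obtain \<chi> where \<chi>: "\<chi> \<in> Fam (Suc m) M" "bdry M \<chi> = \<psi>" using Suc.IH[OF _ Suc.prems(2)] by blast
  have "bdry M (\<lambda>I y z. \<chi> I y z + homotopy \<phi> I y z) = \<phi>"
    unfolding bdry_add[OF M \<chi>(1) hF] \<chi>(2) \<psi>_def by (intro ext[OF ext[OF ext]]) (simp only: diff_add_cancel)
  thus ?case using Fam_add[OF M \<chi>(1) hF] by blast
qed

theorem cycle_boundary:
  assumes "cycle m \<phi>" "m \<le> Suc d"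
  shows "\<exists>\<chi>\<in>Fam (Suc m) M. bdry M \<chi> = \<phi>"
proof (rule cycle_boundary_bounded[OF assms])
  \<comment> \<open>Weights of admissible positions are at most \<open>width\<close>.\<close>
  fix I y z assume w: "int (nat (width + 1)) \<le> weight y - weight z"
  have \<phi>: "\<phi> \<in> Fam m M" using assms(1) unfolding cycle_def by blast
  have "width < weight y - weight z" using w by simp
  hence "\<not> adm m I y z" using weight_adm(2) by fastforce
  thus "\<phi> I y z = 0" by (rule Fam_adm[OF \<phi>])
qed

lemma bdry_Fam_0: assumes \<phi>: "\<phi> \<in> Fam 0 M" shows "bdry M \<phi> = (\<lambda>J y z. 0)"
proof -
  have n: "\<not> adm 0 (insert i J) y z" for i J y z
    unfolding adm_def using finite_subset[of "insert i J" "{..d}"] by auto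
  have "side_diff M i \<phi> J y z = 0" for i J y z by (simp only: side_diff_def Fam_adm[OF \<phi> n] arr_act_0[OF M] diff_self if_cancel)
  thus ?thesis by (intro ext[OF ext[OF ext]]) (simp only: bdry_def kvec.scale_zero_right sum.neutral_const)
qed

end

end

section \<open>The Koszul resolution of a module\<close>

lemma rhom_inverse:
  assumes A: "rmodule L A" and s: "s \<in> rhom L A B"
    and t: "\<And>w. w \<in> space B \<Longrightarrow> t w \<in> space A" "\<And>w. w \<in> space B \<Longrightarrow> s (t w) = w"
    and ts: "\<And>v. v \<in> space A \<Longrightarrow> t (s v) = v"
  shows "t \<in> rhom L B A"
proof (rule rhomI)
  fix v assume v: "v \<in> space B"
  show "t v \<in> space A" by (rule t(1)[OF v])
  show "t (v + w) = t v + t w" if w: "w \<in> space B" for w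
  proof -
    have "s (t v + t w) = v + w" by (simp only: rhom_add[OF s t(1)[OF v] t(1)[OF w]] t(2) v w)
    thus ?thesis using ts[OF rmod_add[OF A t(1)[OF v] t(1)[OF w]]] by simp
  qed
  show "t (vscale c v) = vscale c (t v)" for c
  proof -
    have "s (vscale c (t v)) = vscale c v" by (simp only: rhom_scale[OF s t(1)[OF v]] t(2) v)
    thus ?thesis using ts[OF rmod_scale[OF A t(1)[OF v]]] by metis
  qed
  show "t (act B v a) = act A (t v) a" if a: "a \<in> carrier L" for a
  proof -
    have "s (act A (t v) a) = act B v a" by (simp only: rhom_act[OF s t(1)[OF v] a] t(2) v)
    thus ?thesis using ts[OF rmod_act[OF A t(1)[OF v] a]] by metis
  qed
qed

context orbit_algebra
begin

text \<open>The maps of the augmented complex, starting with the augmentation; \<open>kernel_mod m\<close> is the module that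
  the map with index \<open>m\<close> covers.\<close>

definition resol :: "nat \<Rightarrow> ('k, 'a) rmod \<Rightarrow> 'k vec \<Rightarrow> 'k vec" where
  "resol m M = (case m of 0 \<Rightarrow> augment M | Suc i \<Rightarrow> (\<lambda>v. enc (bdry M (dec v))))"

definition kernel_mod :: "nat \<Rightarrow> ('k, 'a) rmod \<Rightarrow> ('k, 'a) rmod" where
  "kernel_mod m M = (case m of 0 \<Rightarrow> M | Suc i \<Rightarrow> ker_mod (koszul i M) (resol i M))"

lemma resol_simps: "resol 0 M = augment M" "resol (Suc i) M = (\<lambda>v. enc (bdry M (dec v)))"
  by (simp_all add: resol_def)

lemma kernel_mod_simps: "kernel_mod 0 M = M" "kernel_mod (Suc i) M = ker_mod (koszul i M) (resol i M)"
  by (simp_all add: kernel_mod_def)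

lemma enc_eq_0_iff: "\<phi> \<in> Fam m M \<Longrightarrow> enc \<phi> = 0 \<longleftrightarrow> \<phi> = (\<lambda>I y z. 0)"
proof
  assume \<phi>: "\<phi> \<in> Fam m M" and e: "enc \<phi> = 0"
  have "dec (enc \<phi>) = dec 0" by (simp only: e)
  also have "dec 0 = (\<lambda>I y z. 0 :: 'k vec)" by (auto simp: dec_def fun_eq_iff)
  finally show "\<phi> = (\<lambda>I y z. 0)" unfolding dec_enc_Fam[OF \<phi>] .
qed (simp only: enc_zero)

context
  fixes M :: "('k, 'a) rmod"
  assumes M: "rmodule L M"
begin

lemma bdry_rhom: "(\<lambda>v. enc (bdry M (dec v))) \<in> rhom L (koszul (Suc m) M) (koszul m M)"
proof (rule koszul_rhomI[OF M, where F = "\<lambda>\<phi>. enc (bdry M \<phi>)"])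
  fix \<phi> assume \<phi>: "\<phi> \<in> Fam (Suc m) M"
  show "enc (bdry M \<phi>) \<in> space (koszul m M)" unfolding space_koszul by (rule imageI[OF bdry_Fam[OF M \<phi>]])
  show "enc (bdry M (\<lambda>I y z. vscale c (\<phi> I y z))) = vscale c (enc (bdry M \<phi>))" for c
    unfolding bdry_scale[OF M \<phi>] enc_scale ..
  show "enc (bdry M (\<lambda>I y z. \<phi> I y z + \<psi> I y z)) = enc (bdry M \<phi>) + enc (bdry M \<psi>)" if "\<psi> \<in> Fam (Suc m) M" for \<psi>
    unfolding bdry_add[OF M \<phi> that] enc_add ..
  show "enc (bdry M (fam_act \<phi> \<gamma>)) = act (koszul m M) (enc (bdry M \<phi>)) (el \<gamma>)" if "\<gamma> \<in> Coeffs" for \<gamma>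
    unfolding bdry_fam_act[OF M \<phi> that] act_koszul[OF bdry_Fam[OF M \<phi>] that] ..
qed

lemma resol_bdry_zero: "\<chi> \<in> Fam (Suc i) M \<Longrightarrow> resol i M (enc (bdry M \<chi>)) = 0"
proof (cases i)
  case 0
  assume "\<chi> \<in> Fam (Suc i) M"
  thus ?thesis using augment_bdry[OF M] 0 by (simp add: resol_simps)
next
  case (Suc j)
  assume \<chi>: "\<chi> \<in> Fam (Suc i) M"
  show ?thesis unfolding Suc resol_simps dec_enc_Fam[OF bdry_Fam[OF M \<chi>]] bdry_bdry[OF M \<chi>] by (rule enc_zero)
qed

lemma ker_cycle:
  assumes \<phi>: "\<phi> \<in> Fam m M" and k: "resol m M (enc \<phi>) = 0"
  shows "bdry M \<phi> = (\<lambda>J y z. 0)" "m = 0 \<Longrightarrow> augment M (enc \<phi>) = 0"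
proof -
  show "bdry M \<phi> = (\<lambda>J y z. 0)"
  proof (cases m)
    case 0
    thus ?thesis using bdry_Fam_0[OF M] \<phi> by simp
  next
    case (Suc j)
    have "enc (bdry M \<phi>) = 0" using k unfolding Suc resol_simps dec_enc_Fam[OF \<phi>] .
    thus ?thesis using enc_eq_0_iff[OF bdry_Fam[OF M \<phi>[unfolded Suc]]] by simp
  qed
  show "m = 0 \<Longrightarrow> augment M (enc \<phi>) = 0" using k by (simp add: resol_simps)
qed

lemma resol_onto:
  assumes m: "m \<le> Suc d"
  shows "resol m M \<in> rhom L (koszul m M) (kernel_mod m M)" "resol m M ` space (koszul m M) = space (kernel_mod m M)"
proof -
  show r: "resol m M \<in> rhom L (koszul m M) (kernel_mod m M)"
  proof (cases m)
    case 0
    thus ?thesis using augment_rhom[OF M] by (simp add: resol_simps kernel_mod_simps)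
  next
    case (Suc i)
    have "(\<lambda>v. enc (bdry M (dec v))) \<in> rhom L (koszul (Suc i) M) (ker_mod (koszul i M) (resol i M))"
    proof (rule rhom_to_ker[OF bdry_rhom])
      fix v assume "v \<in> space (koszul (Suc i) M)"
      then obtain \<chi> where \<chi>: "\<chi> \<in> Fam (Suc i) M" "v = enc \<chi>" unfolding space_koszul by blast
      show "resol i M (enc (bdry M (dec v))) = 0" unfolding \<chi>(2) dec_enc_Fam[OF \<chi>(1)] by (rule resol_bdry_zero[OF \<chi>(1)])
    qed
    thus ?thesis unfolding Suc resol_simps kernel_mod_simps .
  qed
  show "resol m M ` space (koszul m M) = space (kernel_mod m M)"
  proof
    show "resol m M ` space (koszul m M) \<subseteq> space (kernel_mod m M)" using rhom_in[OF r] by blast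
    show "space (kernel_mod m M) \<subseteq> resol m M ` space (koszul m M)"
    proof (cases m)
      case 0
      thus ?thesis using augment_surj[OF M] by (simp add: resol_simps kernel_mod_simps)
    next
      case (Suc i)
      show ?thesis
      proof
        fix v assume "v \<in> space (kernel_mod m M)"
        then obtain \<phi> where \<phi>: "\<phi> \<in> Fam i M" "v = enc \<phi>" and k: "resol i M (enc \<phi>) = 0"
          unfolding Suc kernel_mod_simps by (auto simp: space_koszul)
        have "cycle M i \<phi>"
          unfolding cycle_def[OF M] using \<phi>(1) ker_cycle[OF \<phi>(1) k] m Suc by simp
        then obtain \<chi> where \<chi>: "\<chi> \<in> Fam (Suc i) M" "bdry M \<chi> = \<phi>"
          using cycle_boundary[OF M, of i \<phi>] m Suc by auto
        have "v = resol m M (enc \<chi>)"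
          unfolding Suc resol_simps dec_enc_Fam[OF \<chi>(1)] \<chi>(2) \<phi>(2) ..
        thus "v \<in> resol m M ` space (koszul m M)" using \<chi>(1) unfolding Suc space_koszul by blast
      qed
    qed
  qed
qed

end

lemma koszul_map_bdry:
  assumes M: "rmodule L M" and X: "rmodule L X" and f: "f \<in> rhom L M X" and \<phi>: "\<phi> \<in> Fam m M"
  shows "bdry X (\<lambda>I y z. f (\<phi> I y z)) = (\<lambda>J y z. f (bdry M \<phi> J y z))"
proof -
  have t: "side_diff X i (\<lambda>I y z. f (\<phi> I y z)) J y z = f (side_diff M i \<phi> J y z)" for i J y z
    unfolding side_diff_def
    by (simp add: rhom_0[OF M f] rhom_minus_val[OF M f arr_act_in[OF M Fam_in[OF \<phi>]] Fam_in[OF \<phi>]]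
        rhom_arr_act[OF f Fam_in[OF \<phi>]])
  have "f (bdry M \<phi> J y z) = (\<Sum>i\<le>d. f (vscale (sgn_at i J) (side_diff M i \<phi> J y z)))" for J y z
    unfolding bdry_def by (rule lin_on_sum[OF rhom_lin[OF f] rmod_subspace[OF M]]) (rule rmod_scale[OF M side_diff_in[OF M \<phi>]])
  hence "f (bdry M \<phi> J y z) = bdry X (\<lambda>I y z. f (\<phi> I y z)) J y z" for J y z
    unfolding bdry_def t by (simp only: rhom_scale[OF f side_diff_in[OF M \<phi>]])
  thus ?thesis by (intro ext[OF ext[OF ext]]) (rule sym)
qed

lemma resolves_L:
  "enough_projectives.resolves L (Suc (Suc d)) kernel_mod koszul resol (\<lambda>m. koszul_map)"
  unfolding enough_projectives.resolves_def[OF enough_projectives_L]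
proof (intro conjI allI impI)
  fix M assume M: "rmodule L M"
  show "kernel_mod 0 M = M" by (rule kernel_mod_simps)
  fix m assume "m < Suc (Suc d)"
  hence m: "m \<le> Suc d" by simp
  show "projective L (koszul m M)" by (rule projective_koszul[OF M])
  show "resol m M \<in> rhom L (koszul m M) (kernel_mod m M)" "resol m M ` space (koszul m M) = space (kernel_mod m M)"
    by (rule resol_onto[OF M m])+
  show "kernel_mod (Suc m) M = ker_mod (koszul m M) (resol m M)" by (rule kernel_mod_simps)
next
  fix M X f m assume M: "rmodule L M" and X: "rmodule L X" and f: "f \<in> rhom L M X"
  show "koszul_map f \<in> rhom L (koszul m M) (koszul m X)" by (rule koszul_map_rhom[OF M X f])
  show "\<forall>v\<in>space (koszul m M). resol m X (koszul_map f v) = (case m of 0 \<Rightarrow> f | Suc i \<Rightarrow> koszul_map f) (resol m M v)"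
  proof
    fix v assume v: "v \<in> space (koszul m M)"
    show "resol m X (koszul_map f v) = (case m of 0 \<Rightarrow> f | Suc i \<Rightarrow> koszul_map f) (resol m M v)"
    proof (cases m)
      case 0
      thus ?thesis using augment_natural[OF M X f] v by (simp add: resol_simps)
    next
      case (Suc i)
      obtain \<phi> where \<phi>: "\<phi> \<in> Fam (Suc i) M" "v = enc \<phi>" using v unfolding Suc space_koszul by blast
      show ?thesis
        unfolding Suc nat.case resol_simps \<phi>(2) koszul_map_enc[OF M X f \<phi>(1)] dec_enc_Fam[OF \<phi>(1)]
          dec_enc_Fam[OF Fam_map[OF M X f \<phi>(1)]] koszul_map_bdry[OF M X f \<phi>(1)] koszul_map_enc[OF M X f bdry_Fam[OF M \<phi>(1)]] ..
    qed
  qed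
qed

end

section \<open>The last kernel is the twisted module\<close>

text \<open>An automorphism that relabels the vertices of basis morphisms by \<open>\<Phi>\<close>.\<close>

locale orbit_twist = orbit_algebra d n l L el for d n l :: nat
    and L :: "('k::field, 'a) module" and el :: "(vertex \<Rightarrow> vertex \<Rightarrow> 'k) \<Rightarrow> 'a" +
  fixes \<phi>\<^sub>L :: "'a \<Rightarrow> 'a"
  assumes \<phi>_el: "\<gamma> \<in> Coeffs \<Longrightarrow> \<phi>\<^sub>L (el \<gamma>) = el (\<lambda>x y. \<gamma> (Phi_inv x) (Phi_inv y))"
begin

lemma Coeffs_Phi_inv: "\<gamma> \<in> Coeffs \<Longrightarrow> (\<lambda>x y. \<gamma> (Phi_inv x) (Phi_inv y)) \<in> Coeffs"
proof (rule CoeffsI)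
  assume \<gamma>: "\<gamma> \<in> Coeffs"
  fix x y
  show "\<gamma> (Phi_inv x) (Phi_inv y) = 0" if "\<not> interlace x y" using CoeffsD(1)[OF \<gamma>] that by (simp add: interlace_Phi_inv_Phi_inv)
  show "\<gamma> (Phi_inv (shift k x)) (Phi_inv (shift k y)) = \<gamma> (Phi_inv x) (Phi_inv y)" for k
  proof (cases "length x = d + 1 \<and> length y = d + 1")
    case True
    thus ?thesis by (simp add: Phi_inv_shift CoeffsD(2)[OF \<gamma>])
  next
    case False
    hence "\<not> interlace x y" by (auto simp: interlace_def)
    hence "\<not> interlace (Phi_inv x) (Phi_inv y)" "\<not> interlace (Phi_inv (shift k x)) (Phi_inv (shift k y))" by (simp_all only: interlace_Phi_inv_Phi_inv interlace_shift simp_thms)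
    thus ?thesis using CoeffsD(1)[OF \<gamma>] by simp
  qed
qed

lemma Coeffs_Phi_fun: "\<gamma> \<in> Coeffs \<Longrightarrow> (\<lambda>x y. \<gamma> (Phi_fun x) (Phi_fun y)) \<in> Coeffs"
proof (rule CoeffsI)
  assume \<gamma>: "\<gamma> \<in> Coeffs"
  fix x y
  show "\<gamma> (Phi_fun x) (Phi_fun y) = 0" if "\<not> interlace x y" using CoeffsD(1)[OF \<gamma>] that by (simp add: interlace_Phi_fun_Phi_fun)
  show "\<gamma> (Phi_fun (shift k x)) (Phi_fun (shift k y)) = \<gamma> (Phi_fun x) (Phi_fun y)" for k
  proof (cases "length x = d + 1 \<and> length y = d + 1")
    case True
    thus ?thesis by (simp add: Phi_fun_shift CoeffsD(2)[OF \<gamma>])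
  next
    case False
    hence "\<not> interlace x y" by (auto simp: interlace_def)
    hence "\<not> interlace (Phi_fun x) (Phi_fun y)" "\<not> interlace (Phi_fun (shift k x)) (Phi_fun (shift k y))" by (simp_all only: interlace_Phi_fun_Phi_fun interlace_shift simp_thms)
    thus ?thesis using CoeffsD(1)[OF \<gamma>] by simp
  qed
qed

lemma Coeffs_Phi_inv_Phi_fun:
  assumes \<gamma>: "\<gamma> \<in> Coeffs"
  shows "(\<lambda>x y. \<gamma> (Phi_inv (Phi_fun x)) (Phi_inv (Phi_fun y))) = \<gamma>" "(\<lambda>x y. \<gamma> (Phi_fun (Phi_inv x)) (Phi_fun (Phi_inv y))) = \<gamma>"
proof -
  have "\<gamma> (Phi_inv (Phi_fun x)) (Phi_inv (Phi_fun y)) = \<gamma> x y \<and> \<gamma> (Phi_fun (Phi_inv x)) (Phi_fun (Phi_inv y)) = \<gamma> x y" for x y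
  proof (cases "interlace x y")
    case True
    hence "length x = d + 1" "length y = d + 1" by (simp_all add: interlace_def)
    thus ?thesis by (simp add: Phi_inv_Phi_fun Phi_fun_Phi_inv)
  next
    case False
    thus ?thesis using CoeffsD(1)[OF \<gamma>] by (simp add: interlace_Phi_inv_Phi_inv interlace_Phi_fun_Phi_fun)
  qed
  thus "(\<lambda>x y. \<gamma> (Phi_inv (Phi_fun x)) (Phi_inv (Phi_fun y))) = \<gamma>" "(\<lambda>x y. \<gamma> (Phi_fun (Phi_inv x)) (Phi_fun (Phi_inv y))) = \<gamma>" by auto
qed

text \<open>Relabelling by a bijection that preserves interlacing reindexes the sum over intermediate vertices.\<close>

lemma conv_Phi_inv: "(\<lambda>x y. conv \<gamma> \<delta> (Phi_inv x) (Phi_inv y)) = conv (\<lambda>x y. \<gamma> (Phi_inv x) (Phi_inv y)) (\<lambda>x y. \<delta> (Phi_inv x) (Phi_inv y) :: 'k)"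
proof (intro ext)
  fix x z
  have "(\<Sum>y | interlace (Phi_inv x) y \<and> interlace y (Phi_inv z). \<delta> (Phi_inv x) y * \<gamma> y (Phi_inv z))
      = (\<Sum>y | interlace x y \<and> interlace y z. \<delta> (Phi_inv x) (Phi_inv y) * \<gamma> (Phi_inv y) (Phi_inv z))"
  proof (rule sum.reindex_bij_witness[of _ Phi_inv Phi_fun])
    fix y assume y: "y \<in> {y. interlace (Phi_inv x) y \<and> interlace y (Phi_inv z)}"
    hence ly: "length y = d + 1" by (simp add: interlace_def)
    show "Phi_inv (Phi_fun y) = y" by (rule Phi_inv_Phi_fun[OF ly])
    thus "Phi_fun y \<in> {y. interlace x y \<and> interlace y z}" using y interlace_Phi_inv_Phi_inv[of x "Phi_fun y"] interlace_Phi_inv_Phi_inv[of "Phi_fun y" z] by simp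
    show "\<delta> (Phi_inv x) (Phi_inv (Phi_fun y)) * \<gamma> (Phi_inv (Phi_fun y)) (Phi_inv z) = \<delta> (Phi_inv x) y * \<gamma> y (Phi_inv z)" using Phi_inv_Phi_fun[OF ly] by simp
  next
    fix y assume y: "y \<in> {y. interlace x y \<and> interlace y z}"
    thus "Phi_fun (Phi_inv y) = y" by (intro Phi_fun_Phi_inv) (simp add: interlace_def)
    show "Phi_inv y \<in> {y. interlace (Phi_inv x) y \<and> interlace y (Phi_inv z)}" using y by (simp add: interlace_Phi_inv_Phi_inv)
  qed
  thus "conv \<gamma> \<delta> (Phi_inv x) (Phi_inv z) = conv (\<lambda>x y. \<gamma> (Phi_inv x) (Phi_inv y)) (\<lambda>x y. \<delta> (Phi_inv x) (Phi_inv y)) x z"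
    by (simp add: conv_def interlace_Phi_inv_Phi_inv)
qed

lemma unit_Phi_inv: "(\<lambda>x y. unit_coeff (Phi_inv x) (Phi_inv y)) = (unit_coeff :: vertex \<Rightarrow> vertex \<Rightarrow> 'k)"
proof (intro ext)
  fix x y
  have "Phi_inv x = Phi_inv y \<and> Phi_inv x \<in> os d l \<longleftrightarrow> x = y \<and> x \<in> os d l"
  proof
    assume a: "Phi_inv x = Phi_inv y \<and> Phi_inv x \<in> os d l"
    hence "Phi_inv x \<in> os d l" "Phi_inv y \<in> os d l" by metis+
    hence "x \<in> os d l" "y \<in> os d l" by (simp_all only: os_Phi_inv)
    thus "x = y \<and> x \<in> os d l" using a Phi_fun_Phi_inv os_length by metis
  qed (auto simp: os_Phi_inv)
  thus "unit_coeff (Phi_inv x) (Phi_inv y) = (unit_coeff x y :: 'k)" by (simp add: unit_coeff_def)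
qed

lemma twisting_L: "twisting L \<phi>\<^sub>L"
proof -
  interpret enough_projectives L by (rule enough_projectives_L)
  have inj: "inj_on \<phi>\<^sub>L (carrier L)"
  proof (rule inj_onI)
    fix a b assume "a \<in> carrier L" "b \<in> carrier L" "\<phi>\<^sub>L a = \<phi>\<^sub>L b"
    then obtain \<gamma> \<delta> where g: "\<gamma> \<in> Coeffs" "a = el \<gamma>" "\<delta> \<in> Coeffs" "b = el \<delta>" "\<phi>\<^sub>L (el \<gamma>) = \<phi>\<^sub>L (el \<delta>)"
      unfolding carrier_L by blast
    have e: "(\<lambda>x y. \<gamma> (Phi_inv x) (Phi_inv y)) = (\<lambda>x y. \<delta> (Phi_inv x) (Phi_inv y))"
      using inj_onD[OF inj_el _ Coeffs_Phi_inv[OF g(1)] Coeffs_Phi_inv[OF g(3)]] g(5) unfolding \<phi>_el[OF g(1)] \<phi>_el[OF g(3)] by blast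
    have "(\<lambda>x y. \<gamma> (Phi_inv (Phi_fun x)) (Phi_inv (Phi_fun y))) = (\<lambda>x y. \<delta> (Phi_inv (Phi_fun x)) (Phi_inv (Phi_fun y)))"
      by (intro ext) (rule fun_cong[OF fun_cong[OF e]])
    thus "a = b" using g(2,4) unfolding Coeffs_Phi_inv_Phi_fun(1)[OF g(1)] Coeffs_Phi_inv_Phi_fun(1)[OF g(3)] by simp
  qed
  have surj: "\<phi>\<^sub>L ` carrier L = carrier L"
  proof
    show "\<phi>\<^sub>L ` carrier L \<subseteq> carrier L" unfolding carrier_L using \<phi>_el Coeffs_Phi_inv by auto
    show "carrier L \<subseteq> \<phi>\<^sub>L ` carrier L"
    proof
      fix a assume "a \<in> carrier L"
      then obtain \<gamma> where g: "\<gamma> \<in> Coeffs" "a = el \<gamma>" unfolding carrier_L by blast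
      have "\<phi>\<^sub>L (el (\<lambda>x y. \<gamma> (Phi_fun x) (Phi_fun y))) = a"
        unfolding \<phi>_el[OF Coeffs_Phi_fun[OF g(1)]] Coeffs_Phi_inv_Phi_fun(2)[OF g(1)] g(2) ..
      thus "a \<in> \<phi>\<^sub>L ` carrier L" using el_carrier[OF Coeffs_Phi_fun[OF g(1)]] by blast
    qed
  qed
  show ?thesis
  proof unfold_locales
    show "bij_betw \<phi>\<^sub>L (carrier L) (carrier L)" using inj surj by (rule bij_betw_imageI)
    fix a b assume "a \<in> carrier L" "b \<in> carrier L"
    then obtain \<gamma> \<delta> where g: "\<gamma> \<in> Coeffs" "a = el \<gamma>" and h: "\<delta> \<in> Coeffs" "b = el \<delta>" unfolding carrier_L by blast
    show "\<phi>\<^sub>L (a \<oplus>\<^bsub>L\<^esub> b) = \<phi>\<^sub>L a \<oplus>\<^bsub>L\<^esub> \<phi>\<^sub>L b"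
      unfolding g(2) h(2) el_add[OF g(1) h(1)] \<phi>_el[OF g(1)] \<phi>_el[OF h(1)] \<phi>_el[OF Coeffs_add[OF g(1) h(1)]]
        el_add[OF Coeffs_Phi_inv[OF g(1)] Coeffs_Phi_inv[OF h(1)]] ..
    show "\<phi>\<^sub>L (a \<otimes>\<^bsub>L\<^esub> b) = \<phi>\<^sub>L a \<otimes>\<^bsub>L\<^esub> \<phi>\<^sub>L b"
      unfolding g(2) h(2) el_mult[OF g(1) h(1)] \<phi>_el[OF g(1)] \<phi>_el[OF h(1)] \<phi>_el[OF Coeffs_conv[OF g(1) h(1)]]
        el_mult[OF Coeffs_Phi_inv[OF g(1)] Coeffs_Phi_inv[OF h(1)]] conv_Phi_inv ..
  next
    fix a c assume "a \<in> carrier L"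
    then obtain \<gamma> where g: "\<gamma> \<in> Coeffs" "a = el \<gamma>" unfolding carrier_L by blast
    show "\<phi>\<^sub>L (c \<odot>\<^bsub>L\<^esub> a) = c \<odot>\<^bsub>L\<^esub> \<phi>\<^sub>L a"
      unfolding g(2) el_smult[OF g(1)] \<phi>_el[OF g(1)] \<phi>_el[OF Coeffs_scale[OF g(1)]] el_smult[OF Coeffs_Phi_inv[OF g(1)]] ..
  next
    show "\<phi>\<^sub>L \<one>\<^bsub>L\<^esub> = \<one>\<^bsub>L\<^esub>" unfolding el_one \<phi>_el[OF Coeffs_unit] unit_Phi_inv ..
  qed (use closed_L in auto)
qed

sublocale tw: twisting L \<phi>\<^sub>L by (rule twisting_L)

text \<open>An element acts on the twisted module through the inverse automorphism, that is, with coefficients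
  relabelled in the opposite direction.\<close>

lemma act_tw:
  assumes \<gamma>: "\<gamma> \<in> Coeffs"
  shows "act (twist L \<phi>\<^sub>L M) v (el \<gamma>) = act M v (el (\<lambda>x y. \<gamma> (Phi_fun x) (Phi_fun y)))"
proof -
  have "\<phi>\<^sub>L (el (\<lambda>x y. \<gamma> (Phi_fun x) (Phi_fun y))) = el \<gamma>" unfolding \<phi>_el[OF Coeffs_Phi_fun[OF \<gamma>]] Coeffs_Phi_inv_Phi_fun(2)[OF \<gamma>] ..
  hence "inv_into (carrier L) \<phi>\<^sub>L (el \<gamma>) = el (\<lambda>x y. \<gamma> (Phi_fun x) (Phi_fun y))"
    using tw.\<phi>\<psi>(3)[OF el_carrier[OF Coeffs_Phi_fun[OF \<gamma>]]] by simp
  thus ?thesis by simp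
qed

text \<open>The embedding of \<open>M\<^sub>\<Phi>\<close> in the top Koszul module. The component of \<open>M\<^sub>\<Phi>\<close> at \<open>z\<close> is \<open>M\<close> at \<open>\<Phi>\<inverse>(z)\<close>. A vector \<open>v\<close>
  there goes to the sum, over all \<open>y\<close> that map to \<open>\<Phi>\<inverse>(z)\<close>, of \<open>v\<close> acted on by \<open>y \<rightarrow> \<Phi>\<inverse>(z)\<close>, tensored with the
  morphism \<open>z \<rightarrow> y - (1, \<dots>, 1)\<close>; the term with \<open>y = \<Phi>\<inverse>(z)\<close> is \<open>v\<close> itself, and the inverse reads it off.\<close>

definition omega :: "('k, 'a) rmod \<Rightarrow> 'k vec \<Rightarrow> 'k fam" where
  "omega M v I y z = (if I = {..d} then arr_act M v y (Phi_inv z) else 0)"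

definition omega_inv :: "('k, 'a) rmod \<Rightarrow> 'k vec \<Rightarrow> 'k vec" where
  "omega_inv M w = glue (\<lambda>x. dec w {..d} x (Phi_fun x))"

context
  fixes M :: "('k, 'a) rmod"
  assumes M: "rmodule L M"
begin

lemma omega_Fam: assumes v: "v \<in> space M" shows "omega M v \<in> Fam (Suc d) M"
proof (rule FamI)
  fix I y z
  show "omega M v I y z \<in> space M" by (simp add: omega_def rmod_0[OF M] arr_act_in[OF M v])
  show "arr_act M (omega M v I y z) y y = omega M v I y z" by (simp add: omega_def arr_act_0[OF M] arr_act_idem[OF M v])
  show "omega M v I y z = 0" if n: "\<not> adm (Suc d) I y z"
  proof (cases "I = {..d}")
    case True
    have "\<not> interlace y (Phi_inv z)"
    proof
      assume a: "interlace y (Phi_inv z)"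
      hence "length y = d + 1" "y \<in> os d l" using interlace_os by (auto simp: interlace_def)
      hence "adm (Suc d) I y z" using a interlace_lower_full True unfolding adm_def by simp
      thus False using n by blast
    qed
    thus ?thesis using True arr_act_not_interlace[OF M v] by (simp add: omega_def)
  qed (simp add: omega_def)
  show "omega M v I (shift k y) (shift k z) = omega M v I y z" for k
  proof (cases "length z = d + 1")
    case True
    thus ?thesis by (simp add: omega_def Phi_inv_shift arr_act_shift[OF M])
  next
    case False
    hence "\<not> interlace y (Phi_inv z)" "\<not> interlace (shift k y) (Phi_inv (shift k z))" using length_Phi_inv unfolding interlace_def by auto
    thus ?thesis using arr_act_not_interlace[OF M v] by (simp add: omega_def)
  qed
qed

text \<open>Both sides sum over the morphisms from \<open>y\<close> through \<open>\<Phi>\<inverse>(w)\<close> to \<open>\<Phi>\<inverse>(z)\<close>, since \<open>\<Phi>\<inverse>\<close> preserves interlacing.\<close>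

lemma omega_fam_act:
  assumes v: "v \<in> space M" and \<gamma>: "\<gamma> \<in> Coeffs"
  shows "omega M (act M v (el (\<lambda>x y. \<gamma> (Phi_fun x) (Phi_fun y)))) = fam_act (omega M v) \<gamma>"
proof -
  have "omega M (act M v (el (\<lambda>x y. \<gamma> (Phi_fun x) (Phi_fun y)))) I y w = fam_act (omega M v) \<gamma> I y w" for I y w
  proof (cases "I = {..d} \<and> interlace y (Phi_inv w)")
    case True
    hence I: "I = {..d}" and yw: "interlace y (Phi_inv w)" by auto
    have ly: "length y = d + 1" and lw: "length w = d + 1" using yw length_Phi_inv by (auto simp: interlace_def)
    have wy: "interlace w (lower {..d} y)" using yw interlace_lower_full[OF ly] by simp
    have "omega M (act M v (el (\<lambda>x y. \<gamma> (Phi_fun x) (Phi_fun y)))) I y w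
        = (\<Sum>x\<in>above (Phi_inv w). vscale (\<gamma> (Phi_fun (Phi_inv w)) (Phi_fun x)) (if interlace y x then arr_act M v y x else 0))"
      unfolding omega_def if_P[OF I] by (rule arr_act_act'[OF M v Coeffs_Phi_fun[OF \<gamma>] yw])
    also have "\<dots> = (\<Sum>z\<in>above w. vscale (\<gamma> w z) (arr_act M v y (Phi_inv z)))"
    proof (rule sum.reindex_bij_witness[of _ Phi_inv Phi_fun])
      fix x assume x: "x \<in> above (Phi_inv w)"
      hence lx: "length x = d + 1" by (simp add: above_def interlace_def)
      show e: "Phi_inv (Phi_fun x) = x" by (rule Phi_inv_Phi_fun[OF lx])
      show "Phi_fun x \<in> above w" using x interlace_Phi_inv_Phi_inv[of w "Phi_fun x"] by (simp add: above_def e)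
      have "(if interlace y x then arr_act M v y x else 0) = arr_act M v y x" using arr_act_not_interlace[OF M v] by simp
      thus "vscale (\<gamma> w (Phi_fun x)) (arr_act M v y (Phi_inv (Phi_fun x)))
         = vscale (\<gamma> (Phi_fun (Phi_inv w)) (Phi_fun x)) (if interlace y x then arr_act M v y x else 0)"
        by (simp only: e Phi_fun_Phi_inv[OF lw])
    next
      fix z assume z: "z \<in> above w"
      thus "Phi_fun (Phi_inv z) = z" by (intro Phi_fun_Phi_inv) (simp add: above_def interlace_def)
      show "Phi_inv z \<in> above (Phi_inv w)" using z by (simp add: above_def interlace_Phi_inv_Phi_inv)
    qed
    also have "\<dots> = fam_act (omega M v) \<gamma> I y w" using wy by (simp add: fam_act_def omega_def I)
    finally show ?thesis .
  next
    case False
    have "\<not> adm (Suc d) I y w"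
    proof
      assume g: "adm (Suc d) I y w"
      hence "I = {..d}" using card_subset_eq[of "{..d}" I] unfolding adm_def by simp
      moreover have "length y = d + 1" using g os_length unfolding adm_def by blast
      ultimately show False using False g interlace_lower_full unfolding adm_def by blast
    qed
    hence "omega M u I y w = 0" "fam_act (omega M v) \<gamma> I y w = 0" if "u \<in> space M" for u
      using Fam_adm[OF omega_Fam[OF that]] Fam_adm[OF Fam_fam_act[OF M omega_Fam[OF v] \<gamma>]] by blast+
    thus ?thesis using act_el_in[OF M v Coeffs_Phi_fun[OF \<gamma>]] by simp
  qed
  thus ?thesis by (rule ext[OF ext[OF ext]])
qed

text \<open>The two terms of every \<open>side_diff\<close> cancel: acting by \<open>y + e\<^sub>i \<rightarrow> \<Phi>\<inverse>(z)\<close> and then by \<open>a\<^sub>i\<close> is the same as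
  acting by \<open>y \<rightarrow> \<Phi>\<inverse>(z)\<close>. If that morphism is zero, both terms are zero.\<close>

lemma bdry_omega: assumes v: "v \<in> space M" shows "bdry M (omega M v) = (\<lambda>J y z. 0)"
proof -
  have "side_diff M i (omega M v) J y z = 0" for i J y z
  proof (cases "i \<notin> J \<and> y \<in> os d l \<and> interlace z (lower J y) \<and> insert i J = {..d}")
    case True
    hence i: "i \<notin> J" and y: "y \<in> os d l" and zJ: "interlace z (lower J y)" and I: "insert i J = {..d}" by auto
    have ly: "length y = d + 1" "length (bump i y) = d + 1" using os_length[OF y] by auto
    have "interlace z (lower {..d} (bump i y))" using zJ bump_notin_lower[OF ly(1) i] I by simp
    hence b: "interlace (bump i y) (Phi_inv z)" using interlace_lower_full[OF ly(2)] by simp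
    have "arr_act M (arr_act M v (bump i y) (Phi_inv z)) y (bump i y) = arr_act M v y (Phi_inv z)"
    proof (cases "interlace y (Phi_inv z)")
      case True
      hence "interlace y (bump i y)" using interlace_convex(1)[OF True below_bump[OF ly(1)] interlace_below[OF b]] by blast
      thus ?thesis using arr_act_arr_act'[OF M v _ b] by blast
    next
      case False
      thus ?thesis by (simp only: arr_act_arr_act[OF M v] arr_act_not_interlace[OF M v False] if_cancel)
    qed
    thus ?thesis using i y zJ by (simp add: side_diff_def omega_def I)
  next
    case False
    show ?thesis
    proof (cases "insert i J = {..d}")
      case True
      thus ?thesis using False by (intro side_diff_zero) blast
    next
      case I: False
      thus ?thesis by (simp add: side_diff_def omega_def arr_act_0[OF M])
    qed
  qed
  thus ?thesis by (intro ext[OF ext[OF ext]]) (simp only: bdry_def kvec.scale_zero_right sum.neutral_const)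
qed

lemma omega_rhom: "(\<lambda>v. enc (omega M v)) \<in> rhom L (twist L \<phi>\<^sub>L M) (kernel_mod (Suc (Suc d)) M)"
  unfolding kernel_mod_simps
proof (rule rhom_to_ker)
  show "(\<lambda>v. enc (omega M v)) \<in> rhom L (twist L \<phi>\<^sub>L M) (koszul (Suc d) M)"
  proof (rule rhomI)
    fix v assume "v \<in> space (twist L \<phi>\<^sub>L M)"
    hence v: "v \<in> space M" by simp
    show "enc (omega M v) \<in> space (koszul (Suc d) M)" unfolding space_koszul by (rule imageI[OF omega_Fam[OF v]])
    have "omega M (vscale c v) = (\<lambda>I y z. vscale c (omega M v I y z))" for c
      by (intro ext[OF ext[OF ext]]) (simp add: omega_def arr_act_scale[OF M v])
    thus "enc (omega M (vscale c v)) = vscale c (enc (omega M v))" for c by (simp only: enc_scale)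
    show "enc (omega M (v + w)) = enc (omega M v) + enc (omega M w)" if "w \<in> space (twist L \<phi>\<^sub>L M)" for w
    proof -
      have w: "w \<in> space M" using that by simp
      have "omega M (v + w) = (\<lambda>I y z. omega M v I y z + omega M w I y z)"
        by (intro ext[OF ext[OF ext]]) (simp add: omega_def arr_act_add[OF M v w])
      thus ?thesis by (simp only: enc_add)
    qed
    show "enc (omega M (act (twist L \<phi>\<^sub>L M) v a)) = act (koszul (Suc d) M) (enc (omega M v)) a" if a: "a \<in> carrier L" for a
    proof -
      obtain \<gamma> where g: "\<gamma> \<in> Coeffs" "a = el \<gamma>" using a unfolding carrier_L by blast
      show ?thesis unfolding g(2) act_tw[OF g(1)] act_koszul[OF omega_Fam[OF v] g(1)] omega_fam_act[OF v g(1)] ..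
    qed
  qed
  fix v assume "v \<in> space (twist L \<phi>\<^sub>L M)"
  hence v: "v \<in> space M" by simp
  show "resol (Suc d) M (enc (omega M v)) = 0"
    unfolding resol_simps dec_enc_Fam[OF omega_Fam[OF v]] bdry_omega[OF v] by (rule enc_zero)
qed

lemma glue_Fam:
  assumes \<phi>: "\<phi> \<in> Fam m M"
  shows "omega_inv M (enc \<phi>) \<in> space M" and "x \<in> os d l \<Longrightarrow> arr_act M (omega_inv M (enc \<phi>)) x x = \<phi> {..d} x (Phi_fun x)"
proof -
  let ?u = "\<lambda>x. \<phi> {..d} x (Phi_fun x)"
  have t: "?u (shift k x) = ?u x" if "x \<in> os d l" for k x
    unfolding Phi_fun_shift[OF os_length[OF that]] by (rule Fam_shift[OF \<phi>])
  show "omega_inv M (enc \<phi>) \<in> space M" unfolding omega_inv_def dec_enc_Fam[OF \<phi>] by (rule glue_in[OF M Fam_in[OF \<phi>]])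
  show "arr_act M (omega_inv M (enc \<phi>)) x x = ?u x" if "x \<in> os d l"
    unfolding omega_inv_def dec_enc_Fam[OF \<phi>] by (rule arr_act_glue[OF M Fam_in[OF \<phi>] Fam_arr_act[OF \<phi>] t that])
qed

lemma omega_inv_omega: assumes v: "v \<in> space M" shows "omega_inv M (enc (omega M v)) = v"
proof (rule comp_ext[OF M glue_Fam(1)[OF omega_Fam[OF v]] v])
  fix x assume x: "x \<in> os d l"
  show "arr_act M (omega_inv M (enc (omega M v))) x x = arr_act M v x x"
    unfolding glue_Fam(2)[OF omega_Fam[OF v] x] by (simp add: omega_def Phi_inv_Phi_fun[OF os_length[OF x]])
qed

text \<open>A vector of the last kernel and the image of its entries at \<open>y = \<Phi>\<inverse>(z)\<close> differ by a cycle with trivial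
  class. It is the boundary of an element of degree \<open>d + 2\<close>, and there the complex is zero.\<close>

lemma omega_omega_inv:
  assumes w: "w \<in> space (kernel_mod (Suc (Suc d)) M)"
  shows "omega_inv M w \<in> space M" "enc (omega M (omega_inv M w)) = w"
proof -
  obtain \<phi> where \<phi>: "\<phi> \<in> Fam (Suc d) M" "w = enc \<phi>" and k: "resol (Suc d) M (enc \<phi>) = 0"
    using w unfolding kernel_mod_simps by (auto simp: space_koszul)
  show v: "omega_inv M w \<in> space M" unfolding \<phi>(2) by (rule glue_Fam(1)[OF \<phi>(1)])
  let ?\<psi> = "\<lambda>I y z. \<phi> I y z - omega M (omega_inv M w) I y z"
  have \<psi>F: "?\<psi> \<in> Fam (Suc d) M" by (rule Fam_diff[OF M \<phi>(1) omega_Fam[OF v]])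
  have "cycle M (Suc d) ?\<psi>"
    unfolding cycle_def[OF M]
  proof (intro conjI impI allI)
    show "?\<psi> \<in> Fam (Suc d) M" by (rule \<psi>F)
    show "bdry M ?\<psi> = (\<lambda>J y z. 0)"
      unfolding bdry_diff[OF M \<phi>(1) omega_Fam[OF v]] ker_cycle(1)[OF M \<phi>(1) k] bdry_omega[OF v] by (simp only: diff_self)
    fix I y z assume f: "free_coords y z = {}"
    show "?\<psi> I y z = 0"
    proof (rule ccontr)
      assume "?\<psi> I y z \<noteq> 0"
      hence g: "adm (Suc d) I y z" by (rule Fam_nonzero[OF \<psi>F])
      have "I \<noteq> {}" using g unfolding adm_def by auto
      hence I: "I = {..d}" and y: "y = Phi_inv z" using no_free_coordinate[OF g f] by auto
      have yos: "y \<in> os d l" using g unfolding adm_def by blast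
      have lz: "length z = d + 1" using os_length[OF yos] unfolding y length_Phi_inv .
      have "omega M (omega_inv M w) I y z = \<phi> I y z"
        unfolding omega_def if_P[OF I] y[symmetric] \<phi>(2) glue_Fam(2)[OF \<phi>(1) yos] unfolding I y Phi_fun_Phi_inv[OF lz] ..
      thus False using \<open>?\<psi> I y z \<noteq> 0\<close> by simp
    qed
  qed simp
  then obtain \<chi> where \<chi>: "\<chi> \<in> Fam (Suc (Suc d)) M" "bdry M \<chi> = ?\<psi>"
    using cycle_boundary[OF M, of "Suc d" ?\<psi>] by auto
  have "\<chi> = (\<lambda>I y z. 0)" using Fam_large[OF M _ \<chi>(1)] by simp
  hence "?\<psi> = (\<lambda>I y z. 0)" using \<chi>(2) bdry_zero[OF M] by simp
  hence "\<phi> I y z - omega M (omega_inv M w) I y z = 0" for I y z by meson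
  hence "omega M (omega_inv M w) I y z = \<phi> I y z" for I y z by (metis eq_iff_diff_eq_0)
  hence "omega M (omega_inv M w) = \<phi>" by (rule ext[OF ext[OF ext]])
  thus "enc (omega M (omega_inv M w)) = w" by (simp only: \<phi>(2))
qed

end

text \<open>The last kernel of the Koszul resolution is naturally the twisted module; dimension shifting does the
  rest.\<close>

theorem twisted_periodic:
  "naturally_isomorphic (stmod L) (stmod L) (func_pow (syzygy_functor L) (d + 2)) (twist_functor L \<phi>\<^sub>L)"
proof -
  have "naturally_isomorphic (stmod L) (stmod L) (func_pow (syzygy_functor L) (Suc (Suc d))) (twist_functor L \<phi>\<^sub>L)"
  proof (rule tw.syzygy_power_iso[OF resolves_L tw.is_functor_twist, where \<tau> = omega_inv and \<sigma> = "\<lambda>M v. enc (omega M v)"];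
      (unfold tw.on_obj_twist)?)
    fix M assume M: "rmodule L M"
    show "(\<lambda>v. enc (omega M v)) \<in> rhom L (twist L \<phi>\<^sub>L M) (kernel_mod (Suc (Suc d)) M)" by (rule omega_rhom[OF M])
    show "omega_inv M \<in> rhom L (kernel_mod (Suc (Suc d)) M) (twist L \<phi>\<^sub>L M)"
      using omega_omega_inv[OF M] omega_inv_omega[OF M] by (intro rhom_inverse[OF tw.rmodule_twist[OF M] omega_rhom[OF M]]) auto
    show "enc (omega M (omega_inv M v)) = v" if "v \<in> space (kernel_mod (Suc (Suc d)) M)" for v by (rule omega_omega_inv(2)[OF M that])
    show "omega_inv M (enc (omega M v)) = v" if "v \<in> space (twist L \<phi>\<^sub>L M)" for v using omega_inv_omega[OF M] that by simp
  next
    fix M X f assume M: "rmodule L M" and X: "rmodule L X" and f: "f \<in> rhom L M X"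
    show "f \<in> rhom L (twist L \<phi>\<^sub>L M) (twist L \<phi>\<^sub>L X) \<and>
       on_arr (twist_functor L \<phi>\<^sub>L) M X (stable_class L M X f) = stable_class L (twist L \<phi>\<^sub>L M) (twist L \<phi>\<^sub>L X) f"
      using tw.rhom_twist[OF f] tw.twist_on_class[OF M X f] by blast
    fix v assume "v \<in> space (kernel_mod (Suc (Suc d)) M)"
    then obtain \<phi> where \<phi>: "\<phi> \<in> Fam (Suc d) M" "v = enc \<phi>" unfolding kernel_mod_simps by (auto simp: space_koszul)
    have "f (\<Sum>x\<in>reps. \<phi> {..d} x (Phi_fun x)) = (\<Sum>x\<in>reps. f (\<phi> {..d} x (Phi_fun x)))"
      by (rule lin_on_sum[OF rhom_lin[OF f] rmod_subspace[OF M] Fam_in[OF \<phi>(1)]])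
    thus "omega_inv X ((case Suc (Suc d) of 0 \<Rightarrow> f | Suc i \<Rightarrow> koszul_map f) v) = f (omega_inv M v)"
      unfolding nat.case \<phi>(2) koszul_map_enc[OF M X f \<phi>(1)] omega_inv_def glue_def dec_enc_Fam[OF \<phi>(1)]
        dec_enc_Fam[OF Fam_map[OF M X f \<phi>(1)]] by simp
  qed
  thus ?thesis by simp
qed

end

section \<open>Paths and words\<close>

context interlacing
begin

lemma target_append: "target (x, u @ v) = target (target (x, u), v)"
  by (induction u arbitrary: x) auto

lemma is_path_os: "is_path d l (x, u) \<Longrightarrow> x \<in> os d l"
  by (cases u) auto

lemma is_path_append: "is_path d l (x, u @ v) \<longleftrightarrow> is_path d l (x, u) \<and> is_path d l (target (x, u), v)"
  by (induction u arbitrary: x) (auto dest: is_path_os)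

lemma is_path_set: "is_path d l (x, u) \<Longrightarrow> set u \<subseteq> {..d}"
  by (induction u arbitrary: x) auto

lemma target_os: "is_path d l (x, u) \<Longrightarrow> target (x, u) \<in> os d l"
  by (induction u arbitrary: x) auto

lemma length_target [simp]: "length (target (x, u)) = length x"
  by (induction u arbitrary: x) auto

lemma nth_target:
  "length x = d + 1 \<Longrightarrow> j \<le> d \<Longrightarrow> target (x, u) ! j = x ! j + int (count_list u j)"
  by (induction u arbitrary: x) (auto simp: nth_bump)

lemma below_target: "length x = d + 1 \<Longrightarrow> below x (target (x, u))"
  unfolding below_def by (auto simp: nth_target)

lemma weight_target: "length x = d + 1 \<Longrightarrow> set u \<subseteq> {..d} \<Longrightarrow> weight (target (x, u)) = weight x + int (length u)"
  by (induction u arbitrary: x) (auto simp: weight_bump)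

definition words :: "vertex \<Rightarrow> vertex \<Rightarrow> nat list set" where
  "words x y = {u. is_path d l (x, u) \<and> target (x, u) = y}"

lemma finite_words: "finite (words x y)"
proof (rule finite_subset)
  show "finite {u. set u \<subseteq> {..d} \<and> length u = nat (weight y - weight x)}"
    by (rule finite_lists_length_eq) simp
  show "words x y \<subseteq> {u. set u \<subseteq> {..d} \<and> length u = nat (weight y - weight x)}"
    unfolding words_def using is_path_set is_path_os os_length weight_target by fastforce
qed

text \<open>Every partial target lies between \<open>x\<close> and \<open>y\<close> and therefore is a vertex.\<close>

lemma word_is_path:
  assumes "interlace x y" "set u \<subseteq> {..d}" "target (x, u) = y"
  shows "is_path d l (x, u)"
  using assms
proof (induction u arbitrary: x)
  case Nil
  thus ?case using interlace_os by auto
next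
  case (Cons i u)
  have x: "x \<in> os d l" using interlace_os(1)[OF Cons.prems(1)] .
  have lx: "length x = d + 1" by (rule os_length[OF x])
  have "below (bump i x) y" using below_target[of "bump i x" u] lx Cons.prems(3) by simp
  hence "interlace (bump i x) y" using interlace_convex(2)[OF Cons.prems(1) below_bump[OF lx]] by blast
  thus ?case using Cons x by simp
qed

lemma word_exists: "interlace x y \<Longrightarrow> \<exists>u. u \<in> words x y"
proof (induction "nat (weight y - weight x)" arbitrary: x)
  case 0
  hence "weight y \<le> weight x" by simp
  hence "x = y" using weight_strict[OF interlace_below[OF 0(2)]] by fastforce
  hence "[] \<in> words x y" using interlace_os(1)[OF 0(2)] by (simp add: words_def)
  thus ?case by blast
next
  case (Suc k)
  have x: "x \<in> os d l" using interlace_os(1)[OF Suc(3)] .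
  have lx: "length x = d + 1" by (rule os_length[OF x])
  have v: "below x y" by (rule interlace_below[OF Suc(3)])
  have "x \<noteq> y" using Suc(2) by auto
  then obtain i where i: "i \<le> d" "x ! i \<noteq> y ! i"
    using v unfolding below_def by (metis less_Suc_eq_le nth_equalityI Suc_eq_plus1)
  hence "below (bump i x) y" using v unfolding below_def by (auto simp: nth_bump order.not_eq_order_implies_strict)
  hence interlace: "interlace (bump i x) y" using interlace_convex(2)[OF Suc(3) below_bump[OF lx]] by blast
  have "k = nat (weight y - weight (bump i x))" using Suc(2) weight_bump[OF lx i(1)] by simp
  then obtain u where "u \<in> words (bump i x) y" using Suc(1) interlace by blast
  hence "i # u \<in> words x y" using x i by (simp add: words_def)
  thus ?case by blast
qed

text \<open>The scalar of the class of a linear combination of paths from \<open>x\<close> to \<open>y\<close>: in the quotient all these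
  paths are the same morphism, or zero if the vertices do not interlace.\<close>

definition path_sum :: "(path \<Rightarrow> 'k::field) \<Rightarrow> vertex \<Rightarrow> vertex \<Rightarrow> 'k" where
  "path_sum c x y = (if interlace x y then \<Sum>u\<in>words x y. c (x, u) else 0)"

section \<open>The ideal of relations\<close>

lemma kQ_iff: "c \<in> kQ d l x y \<longleftrightarrow> (\<forall>p. c p \<noteq> 0 \<longrightarrow> is_path d l p \<and> fst p = x \<and> target p = y)"
proof
  assume a: "\<forall>p. c p \<noteq> 0 \<longrightarrow> is_path d l p \<and> fst p = x \<and> target p = y"
  have "{p. c p \<noteq> 0} \<subseteq> Pair x ` words x y"
  proof
    fix p assume "p \<in> {p. c p \<noteq> 0}"
    hence "is_path d l p \<and> fst p = x \<and> target p = y" using a by blast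
    thus "p \<in> Pair x ` words x y" by (cases p) (auto simp: words_def)
  qed
  hence "finite {p. c p \<noteq> 0}" using finite_words finite_subset by blast
  thus "c \<in> kQ d l x y" using a unfolding kQ_def by blast
qed (auto simp: kQ_def)

lemma path_comp_nonzero:
  assumes "path_comp b c p \<noteq> 0"
  obtains m where "b (target (fst p, take m (snd p)), drop m (snd p)) \<noteq> 0" "c (fst p, take m (snd p)) \<noteq> 0"
proof -
  obtain x u where p: "p = (x, u)" by (cases p)
  have "(\<Sum>m\<le>length u. b (target (x, take m u), drop m u) * c (x, take m u)) \<noteq> 0"
    using assms unfolding p path_comp_def by simp
  then obtain m where "b (target (x, take m u), drop m u) * c (x, take m u) \<noteq> 0"
    using sum.not_neutral_contains_not_neutral by blast
  thus thesis using that[of m] unfolding p by auto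
qed

lemma path_comp_path:
  assumes "path_comp b c p \<noteq> 0" "\<And>p. b p \<noteq> 0 \<Longrightarrow> is_path d l p" "\<And>p. c p \<noteq> 0 \<Longrightarrow> is_path d l p"
  shows "is_path d l p"
proof -
  obtain x u where p: "p = (x, u)" by (cases p)
  obtain m where m: "b (target (x, take m u), drop m u) \<noteq> 0" "c (x, take m u) \<noteq> 0"
    using path_comp_nonzero[OF assms(1)] unfolding p by auto
  thus ?thesis using assms(2)[OF m(1)] assms(3)[OF m(2)] is_path_append[of x "take m u" "drop m u"] unfolding p by simp
qed

lemma path_comp_kQ:
  assumes b: "b \<in> kQ d l y z" and c: "c \<in> kQ d l x y"
  shows "path_comp b c \<in> kQ d l x z"
  unfolding kQ_iff
proof (intro allI impI)
  fix p assume nz: "path_comp b c p \<noteq> 0"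
  obtain x' u where p: "p = (x', u)" by (cases p)
  obtain m where m: "b (target (x', take m u), drop m u) \<noteq> 0" "c (x', take m u) \<noteq> 0"
    using path_comp_nonzero[OF nz] unfolding p by auto
  have "is_path d l p" by (rule path_comp_path[OF nz]) (use b c in \<open>auto simp: kQ_iff\<close>)
  moreover have "x' = x" using c m(2) unfolding kQ_iff by force
  moreover have "target (target (x', take m u), drop m u) = z" using b m(1) unfolding kQ_iff by blast
  ultimately show "is_path d l p \<and> fst p = x \<and> target p = z"
    unfolding p target_append[symmetric] by simp
qed

text \<open>A path from \<open>x\<close> to \<open>z\<close> with a marked intermediate point is a pair of composable paths. If \<open>x\<close> and \<open>z\<close>
  interlace, then all intermediate vertices interlace with both ends, so that the condition in \<open>conv\<close> on
  the summation index loses nothing.\<close>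

lemma path_sum_comp:
  shows "path_sum (path_comp b c) = conv (path_sum b) (path_sum c :: vertex \<Rightarrow> vertex \<Rightarrow> 'k::field)"
proof (intro ext)
  fix x z
  show "path_sum (path_comp b c) x z = conv (path_sum b) (path_sum c) x z"
  proof (cases "interlace x z")
    case True
    have lx: "length x = d + 1" using True by (simp add: interlace_def)
    let ?Y = "{y. interlace x y \<and> interlace y z}"
    let ?S = "SIGMA u:words x z. {..length u}"
    let ?T = "SIGMA y:?Y. words x y \<times> words y z"
    have "path_sum (path_comp b c) x z = (\<Sum>u\<in>words x z. \<Sum>m\<le>length u. b (target (x, take m u), drop m u) * c (x, take m u))"
      using True by (simp add: path_sum_def path_comp_def)
    also have "\<dots> = (\<Sum>(u, m)\<in>?S. b (target (x, take m u), drop m u) * c (x, take m u))"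
      by (rule sum.Sigma) (auto simp: finite_words)
    also have "\<dots> = (\<Sum>(y, u, v)\<in>?T. c (x, u) * b (y, v))"
    proof (rule sum.reindex_bij_witness[of _ "\<lambda>(y, u, v). (u @ v, length u)"
          "\<lambda>(u, m). (target (x, take m u), take m u, drop m u)"])
      fix s assume "s \<in> ?S"
      then obtain u m where s: "s = (u, m)" "u \<in> words x z" "m \<le> length u" by auto
      let ?y = "target (x, take m u)"
      have p: "is_path d l (x, take m u)" "is_path d l (?y, drop m u)" "target (?y, drop m u) = z"
        using s(2) is_path_append[of x "take m u" "drop m u"] target_append[of x "take m u" "drop m u"]
        unfolding words_def by auto
      have "below x ?y" "below ?y z" using below_target[OF lx] below_target[of ?y "drop m u"] lx p(3) by auto
      hence "interlace x ?y" "interlace ?y z" using interlace_convex[OF True] by blast+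
      thus "(case s of (u, m) \<Rightarrow> (target (x, take m u), take m u, drop m u)) \<in> ?T"
        using p by (simp add: s(1) words_def)
    qed (auto simp: words_def target_append is_path_append)
    also have "\<dots> = (\<Sum>y\<in>?Y. \<Sum>(u, v)\<in>words x y \<times> words y z. c (x, u) * b (y, v))"
      by (rule sum.Sigma[symmetric]) (auto simp: finite_words finite_between)
    also have "\<dots> = (\<Sum>y\<in>?Y. path_sum c x y * path_sum b y z)"
    proof (rule sum.cong[OF refl])
      fix y assume "y \<in> ?Y"
      thus "(\<Sum>(u, v)\<in>words x y \<times> words y z. c (x, u) * b (y, v)) = path_sum c x y * path_sum b y z"
        by (simp add: path_sum_def sum_product sum.cartesian_product)
    qed
    also have "\<dots> = conv (path_sum b) (path_sum c) x z" using True by (simp add: conv_def)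
    finally show ?thesis .
  qed (simp add: path_sum_def conv_def)
qed

lemma path_sum_add: "path_sum (\<lambda>p. b p + c p) x y = path_sum b x y + (path_sum c x y :: 'k::field)"
  by (simp add: path_sum_def sum.distrib)

lemma path_sum_diff: "path_sum (\<lambda>p. b p - c p) x y = path_sum b x y - (path_sum c x y :: 'k::field)"
  by (simp add: path_sum_def sum_subtractf)

lemma path_sum_scale: "path_sum (\<lambda>p. s * c p) x y = s * (path_sum c x y :: 'k::field)"
  by (simp add: path_sum_def sum_distrib_left)

lemma path_sum_kQ:
  assumes "c \<in> kQ d l x y" "y' \<noteq> y \<or> x' \<noteq> x"
  shows "path_sum c x' y' = (0 :: 'k::field)"
proof -
  have "c (x', u) = 0" if "u \<in> words x' y'" for u
    using assms that unfolding kQ_iff words_def by (metis (mono_tags, lifting) fst_conv mem_Collect_eq)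
  thus ?thesis by (simp add: path_sum_def)
qed

lemma path_sum_elt:
  assumes "is_path d l (x, u)" "target (x, u) = y" "interlace x y"
  shows "path_sum (path_elt d l (x, u)) x y = (1 :: 'k::field)"
proof -
  have "(\<Sum>v\<in>words x y. path_elt d l (x, u) (x, v)) = (\<Sum>v\<in>words x y. if v = u then 1 else (0 :: 'k))"
    using assms by (intro sum.cong refl) (auto simp: path_elt_def)
  thus ?thesis using assms finite_words by (simp add: path_sum_def words_def)
qed

text \<open>The two paths of a commutativity relation have coefficients \<open>1\<close> and \<open>-1\<close>. A zero relation has its ends
  not interlacing, for otherwise its missing vertex would exist. Products are handled by \<open>path_sum_comp\<close>.\<close>

lemma rel_ideal_path_sum:
  assumes "rel_ideal d l x y c"
  shows "c \<in> kQ d l x y" "path_sum c x y = (0 :: 'k::field)"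
proof -
  have "c \<in> kQ d l x y \<and> path_sum c x y = 0"
    using assms
  proof induction
    case (zero x y)
    show ?case by (simp add: kQ_iff path_sum_def)
  next
    case (gen x i j)
    have lx: "length x = d + 1" using os_length[OF gen(1)] .
    have sw: "bump j (bump i x) = bump i (bump j x)" using gen lx by (intro bump_swap) auto
    let ?y = "bump i (bump j x)"
    have k: "path_elt d l (x, [j, i]) - path_elt d l (x, [i, j]) \<in> (kQ d l x ?y :: (path \<Rightarrow> 'k) set)"
      unfolding kQ_iff
    proof (intro allI impI)
      fix p assume nz: "(path_elt d l (x, [j, i]) - path_elt d l (x, [i, j])) p \<noteq> (0 :: 'k)"
      have e: "path_elt d l q p = (0 :: 'k)" if "\<not> (is_path d l p \<and> p = q)" for q
        unfolding path_elt_def using that by (intro if_not_P) blast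
      have "is_path d l p \<and> (p = (x, [j, i]) \<or> p = (x, [i, j]))"
      proof (rule ccontr)
        assume "\<not> ?thesis"
        hence "path_elt d l (x, [j, i]) p = (0 :: 'k)" "path_elt d l (x, [i, j]) p = (0 :: 'k)"
          by (intro e, blast)+
        thus False using nz by (simp only: minus_apply diff_self simp_thms)
      qed
      thus "is_path d l p \<and> fst p = x \<and> target p = ?y" using sw by auto
    qed
    show ?case
    proof (cases "interlace x ?y")
      case True
      have p: "is_path d l (x, [j, i])" "is_path d l (x, [i, j])"
        using gen by (auto intro!: word_is_path[OF True] simp: sw simp del: is_path.simps)
      have "path_sum (\<lambda>p. path_elt d l (x, [j, i]) p - path_elt d l (x, [i, j]) p) x ?y = (0 :: 'k)"
      proof -
        have "path_sum (path_elt d l (x, [j, i])) x ?y = (1 :: 'k)" "path_sum (path_elt d l (x, [i, j])) x ?y = (1 :: 'k)"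
          using sw by (auto intro!: path_sum_elt[OF p(1) _ True] path_sum_elt[OF p(2) _ True])
        thus ?thesis by (simp only: path_sum_diff diff_self)
      qed
      thus ?thesis using k by (simp add: fun_diff_def)
    next
      case False
      thus ?thesis using k unfolding path_sum_def by (simp only: simp_thms if_False)
    qed
  next
    case (add x y c c')
    have "c + c' \<in> kQ d l x y" using add by (auto simp: kQ_iff) (metis add.left_neutral)+
    moreover have "path_sum (\<lambda>p. c p + c' p) x y = 0" using add by (simp add: path_sum_add)
    ultimately show ?case by (simp add: plus_fun_def)
  next
    case (comp_left b y z x c)
    have "path_sum c x y' * path_sum b y' z = 0" for y'
      using comp_left path_sum_kQ[of c x y y' x] by (cases "y' = y") auto
    hence "conv (path_sum b) (path_sum c) x z = 0" unfolding conv_def by (auto intro: sum.neutral)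
    moreover have "path_comp b c \<in> kQ d l x z" using comp_left by (blast intro: path_comp_kQ)
    ultimately show ?case by (simp only: path_sum_comp simp_thms)
  next
    case (comp_right y z c b x)
    have "path_sum b x y' * path_sum c y' z = 0" for y'
      using comp_right path_sum_kQ[of b x y y' x] by (cases "y' = y") auto
    hence "conv (path_sum c) (path_sum b) x z = 0" unfolding conv_def by (auto intro: sum.neutral)
    moreover have "path_comp c b \<in> kQ d l x z" using comp_right by (blast intro: path_comp_kQ)
    ultimately show ?case by (simp only: path_sum_comp simp_thms)
  qed
  thus "c \<in> kQ d l x y" "path_sum c x y = 0" by auto
qed

lemma path_comp_const:
  assumes "\<And>p. c p \<noteq> 0 \<Longrightarrow> target p = y"
  shows "path_comp (\<lambda>p. if p = (y, []) then s else 0) c = (\<lambda>p. s * (c p :: 'k::field))"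
proof
  fix p :: path obtain x u where p: "p = (x, u)" by (cases p)
  have "path_comp (\<lambda>p. if p = (y, []) then s else 0) c (x, u)
      = (\<Sum>m\<le>length u. if m = length u then s * c (x, u) else 0)"
    unfolding path_comp_def prod.case
  proof (rule sum.cong[OF refl])
    fix m assume m: "m \<in> {..length u}"
    show "(if (target (x, take m u), drop m u) = (y, []) then s else 0) * c (x, take m u)
       = (if m = length u then s * c (x, u) else 0)"
      using assms[of "(x, u)"] m by (cases "m = length u") auto
  qed
  thus "path_comp (\<lambda>p. if p = (y, []) then s else 0) c p = s * c p" unfolding p by simp
qed

text \<open>The ideal is closed under composition with the scalar multiple of a trivial path.\<close>

lemma rel_ideal_scale:
  assumes "rel_ideal d l x y c"
  shows "rel_ideal d l x y (\<lambda>p. s * (c p :: 'k::field))"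
proof (cases "y \<in> os d l")
  case True
  have c: "\<And>p. c p \<noteq> 0 \<Longrightarrow> target p = y" using rel_ideal_path_sum(1)[OF assms] unfolding kQ_iff by blast
  have "(\<lambda>p. if p = (y, []) then s else 0) \<in> kQ d l y y" using True by (simp add: kQ_iff)
  from rel_ideal.comp_left[OF this assms]
  have "rel_ideal d l x y (path_comp (\<lambda>p. if p = (y, []) then s else 0) c)" .
  moreover have "path_comp (\<lambda>p. if p = (y, []) then s else 0) c = (\<lambda>p. s * c p)"
    by (rule path_comp_const) (rule c)
  ultimately show ?thesis by (simp only:)
next
  case False
  have "c p = 0" for p
  proof (rule ccontr)
    assume "c p \<noteq> 0"
    hence "is_path d l p" "target p = y" using rel_ideal_path_sum(1)[OF assms] unfolding kQ_iff by blast+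
    thus False using target_os False by (cases p) auto
  qed
  hence "(\<lambda>p. s * c p) = 0" by (simp add: fun_eq_iff)
  thus ?thesis by (simp add: rel_ideal.zero)
qed

lemma rel_ideal_sum:
  "finite F \<Longrightarrow> (\<And>i. i \<in> F \<Longrightarrow> rel_ideal d l x y (c i)) \<Longrightarrow> rel_ideal d l x y (\<lambda>p. \<Sum>i\<in>F. (c i p :: 'k::field))"
proof (induction F rule: finite_induct)
  case empty
  show ?case using rel_ideal.zero by (simp add: zero_fun_def)
next
  case (insert i F)
  hence "rel_ideal d l x y (c i + (\<lambda>p. \<Sum>i\<in>F. c i p))" by (intro rel_ideal.add) auto
  thus ?case using insert.hyps by (simp add: plus_fun_def)
qed

definition word_diff :: "vertex \<Rightarrow> nat list \<Rightarrow> nat list \<Rightarrow> path \<Rightarrow> 'k::field" where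
  "word_diff x u v = (\<lambda>p. path_elt d l (x, u) p - path_elt d l (x, v) p)"

lemma rel_ideal_trans:
  assumes "rel_ideal d l x y (word_diff x u v :: path \<Rightarrow> 'k::field)" "rel_ideal d l x y (word_diff x v w :: path \<Rightarrow> 'k)"
  shows "rel_ideal d l x y (word_diff x u w :: path \<Rightarrow> 'k)"
proof -
  have "word_diff x u w = word_diff x u v + (word_diff x v w :: path \<Rightarrow> 'k)" by (auto simp: word_diff_def fun_eq_iff)
  thus ?thesis using rel_ideal.add[OF assms] by simp
qed

lemma path_comp_prefix:
  assumes x: "x \<in> os d l" "i \<le> d" "bump i x \<in> os d l"
  shows "path_comp c (path_elt d l (x, [i])) (x', u) =
    (if x' = x \<and> u \<noteq> [] \<and> hd u = i then c (bump i x, tl u) else (0 :: 'k::field))"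
proof -
  have p: "is_path d l (x, [i])" using x by simp
  have e: "path_elt d l (x, [i]) (x', take m u) = (if x' = x \<and> u \<noteq> [] \<and> hd u = i \<and> m = 1 then 1 else (0 :: 'k))"
    if "m \<le> length u" for m
    using p that by (cases u; cases m) (auto simp: path_elt_def simp del: is_path.simps)
  have "path_comp c (path_elt d l (x, [i])) (x', u)
      = (\<Sum>m\<le>length u. if m = 1 then (if x' = x \<and> u \<noteq> [] \<and> hd u = i then c (bump i x, tl u) else 0) else 0)"
    unfolding path_comp_def prod.case
  proof (rule sum.cong[OF refl])
    fix m assume m: "m \<in> {..length u}"
    show "c (target (x', take m u), drop m u) * path_elt d l (x, [i]) (x', take m u) =
      (if m = 1 then (if x' = x \<and> u \<noteq> [] \<and> hd u = i then c (bump i x, tl u) else 0) else 0)"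
      using m e[of m] by (cases u) auto
  qed
  also have "\<dots> = (if x' = x \<and> u \<noteq> [] \<and> hd u = i then c (bump i x, tl u) else 0)"
    by (cases u) (auto simp: Suc_le_eq)
  finally show ?thesis .
qed

lemma path_comp_elt_prefix:
  assumes x: "x \<in> os d l" "i \<le> d" "bump i x \<in> os d l"
  shows "path_comp (path_elt d l (bump i x, u)) (path_elt d l (x, [i])) = (path_elt d l (x, i # u) :: path \<Rightarrow> 'k::field)"
proof
  fix p :: path obtain x' v where p: "p = (x', v)" by (cases p)
  show "path_comp (path_elt d l (bump i x, u)) (path_elt d l (x, [i])) p = (path_elt d l (x, i # u) p :: 'k)"
    unfolding p path_comp_prefix[OF x] using x by (cases v) (auto simp: path_elt_def)
qed

lemma prefix_kQ:
  assumes x: "x \<in> os d l" "i \<le> d" "bump i x \<in> os d l"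
  shows "path_elt d l (x, [i]) \<in> kQ d l x (bump i x)"
  unfolding kQ_iff using x by (auto simp: path_elt_def split: if_splits)

lemma rel_ideal_prefix:
  assumes x: "x \<in> os d l" "i \<le> d" "bump i x \<in> os d l"
    and r: "rel_ideal d l (bump i x) y (path_elt d l (bump i x, u) :: path \<Rightarrow> 'k::field)"
  shows "rel_ideal d l x y (path_elt d l (x, i # u) :: path \<Rightarrow> 'k)"
  using rel_ideal.comp_right[OF r prefix_kQ[OF x]] unfolding path_comp_elt_prefix[OF x] .

lemma rel_ideal_prefix_word_diff:
  assumes x: "x \<in> os d l" "i \<le> d" "bump i x \<in> os d l"
    and r: "rel_ideal d l (bump i x) y (word_diff (bump i x) u v :: path \<Rightarrow> 'k::field)"
  shows "rel_ideal d l x y (word_diff x (i # u) (i # v) :: path \<Rightarrow> 'k)"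
proof -
  have "path_comp (word_diff (bump i x) u v) (path_elt d l (x, [i])) = (word_diff x (i # u) (i # v) :: path \<Rightarrow> 'k)"
  proof
    fix p
    have "path_comp (word_diff (bump i x) u v) (path_elt d l (x, [i])) p =
        path_comp (path_elt d l (bump i x, u)) (path_elt d l (x, [i])) p
        - (path_comp (path_elt d l (bump i x, v)) (path_elt d l (x, [i])) p :: 'k)"
      unfolding path_comp_def word_diff_def by (cases p) (simp add: left_diff_distrib sum_subtractf)
    thus "path_comp (word_diff (bump i x) u v) (path_elt d l (x, [i])) p = (word_diff x (i # u) (i # v) p :: 'k)"
      unfolding path_comp_elt_prefix[OF x] by (simp add: word_diff_def)
  qed
  thus ?thesis using rel_ideal.comp_right[OF r prefix_kQ[OF x]] by simp
qed

text \<open>A generating relation, continued by the path \<open>w\<close>. Either of the two words may fail to be a path, and then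
  its \<open>path_elt\<close> is zero.\<close>

lemma rel_ideal_swap:
  assumes x: "x \<in> os d l" "i \<le> d" "j \<le> d" and w: "is_path d l (bump i (bump j x), w)" "target (bump i (bump j x), w) = y"
  shows "rel_ideal d l x y (word_diff x (j # i # w) (i # j # w) :: path \<Rightarrow> 'k::field)"
proof -
  let ?z = "bump i (bump j x)"
  have lx: "length x = d + 1" using os_length[OF x(1)] .
  have sw: "bump j (bump i x) = ?z" using x lx by (intro bump_swap) auto
  have g: "rel_ideal d l x ?z (path_elt d l (x, [j, i]) - path_elt d l (x, [i, j]) :: path \<Rightarrow> 'k)"
    using x by (intro rel_ideal.gen) auto
  have k: "path_elt d l (?z, w) \<in> kQ d l ?z y" unfolding kQ_iff using w by (auto simp: path_elt_def split: if_splits)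
  have zos: "?z \<in> os d l" by (rule is_path_os[OF w(1)])
  have "path_comp (path_elt d l (?z, w)) (path_elt d l (x, [j, i]) - path_elt d l (x, [i, j]))
      = (word_diff x (j # i # w) (i # j # w) :: path \<Rightarrow> 'k)"
  proof
    fix p :: path obtain x' v where p: "p = (x', v)" by (cases p)
    have s: "(\<Sum>m\<le>length v. path_elt d l (?z, w) (target (x', take m v), drop m v) * path_elt d l (x, [a, b]) (x', take m v))
        = (path_elt d l (x, a # b # w) (x', v) :: 'k)" if ab: "a \<le> d" "b \<le> d" "bump b (bump a x) = ?z" for a b
    proof -
      have "(\<Sum>m\<le>length v. path_elt d l (?z, w) (target (x', take m v), drop m v) * path_elt d l (x, [a, b]) (x', take m v))
         = (\<Sum>m\<le>length v. if m = 2 then (path_elt d l (x, a # b # w) (x', v) :: 'k) else 0)"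
      proof (rule sum.cong[OF refl])
        fix m assume m: "m \<in> {..length v}"
        show "path_elt d l (?z, w) (target (x', take m v), drop m v) * path_elt d l (x, [a, b]) (x', take m v)
           = (if m = 2 then (path_elt d l (x, a # b # w) (x', v) :: 'k) else 0)"
        proof (cases "m = 2")
          case True
          have "v = take 2 v @ drop 2 v" by simp
          hence v: "v = a # b # w \<longleftrightarrow> take 2 v = [a, b] \<and> drop 2 v = w"
            by (metis append_Cons append_Nil append_eq_conv_conj drop_Suc_Cons drop_0 numeral_2_eq_2 take_Suc_Cons take_0)
          show ?thesis using True ab x w zos by (auto simp: path_elt_def v)
        next
          case False
          have "take m v \<noteq> [a, b]" using False m by (metis atMost_iff length_Cons length_take list.size(3) min.absorb2 numeral_2_eq_2)
          thus ?thesis using False by (simp add: path_elt_def)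
        qed
      qed
      also have "\<dots> = path_elt d l (x, a # b # w) (x', v)"
      proof (cases "2 \<le> length v")
        case False
        hence "v \<noteq> a # b # w" by auto
        thus ?thesis by (simp add: path_elt_def)
      qed simp
      finally show ?thesis .
    qed
    show "path_comp (path_elt d l (?z, w)) (path_elt d l (x, [j, i]) - path_elt d l (x, [i, j])) p
      = (word_diff x (j # i # w) (i # j # w) p :: 'k)"
      unfolding p path_comp_def prod.case word_diff_def minus_apply right_diff_distrib sum_subtractf
      using s[OF x(3,2) refl] s[OF x(2,3) sw] by simp
  qed
  thus ?thesis using rel_ideal.comp_left[OF k g] by simp
qed

text \<open>If the Hom-space does not vanish, then any two words with the same letters are congruent: move
  the first letter of one to the front of the other by commutativity relations; every word that
  occurs is a path.\<close>

lemma words_congruent: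
  assumes "interlace x y" "set u \<subseteq> {..d}" "target (x, u) = y" "mset u = mset v"
  shows "rel_ideal d l x y (word_diff x u v :: path \<Rightarrow> 'k::field)"
  using assms
proof (induction "length u" arbitrary: x u v rule: less_induct)
  case less
  have x: "x \<in> os d l" using interlace_os(1)[OF less.prems(1)] .
  have lx: "length x = d + 1" by (rule os_length[OF x])
  show ?case
  proof (cases u)
    case Nil
    hence "v = []" using less.prems(4) by (cases v) auto
    hence "word_diff x u v = (0 :: path \<Rightarrow> 'k)" using Nil by (simp add: word_diff_def fun_eq_iff)
    thus ?thesis by (simp add: rel_ideal.zero)
  next
    case (Cons i u')
    then obtain j v' where v: "v = j # v'" using less.prems(4) by (cases v) auto
    have sv: "set v \<subseteq> {..d}" using less.prems(2,4) by (metis set_mset_mset)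
    have tv: "target (x, v) = y"
    proof (rule nth_equalityI)
      show "length (target (x, v)) = length y" using lx less.prems(1) by (simp add: interlace_def)
      fix a assume "a < length (target (x, v))"
      thus "target (x, v) ! a = y ! a"
        using lx less.prems(3,4) nth_target[OF lx, of a u] nth_target[OF lx, of a v]
        by (metis Suc_eq_plus1 count_mset length_target less_Suc_eq_le)
    qed
    have pu: "is_path d l (x, u)" by (rule word_is_path[OF less.prems(1-3)])
    have pv: "is_path d l (x, v)" by (rule word_is_path[OF less.prems(1) sv tv])
    have i: "i \<le> d" "bump i x \<in> os d l" using pu is_path_os unfolding Cons by auto
    have j: "j \<le> d" "bump j x \<in> os d l" using pv is_path_os unfolding v by auto
    have ilb: "interlace (bump a x) y" if "target (bump a x, w) = y" for a w
    proof -
      have "below (bump a x) y" using below_target[of "bump a x" w] lx that by simp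
      thus ?thesis using interlace_convex(2)[OF less.prems(1) below_bump[OF lx]] by blast
    qed
    have ti: "target (bump i x, u') = y" using less.prems(3) unfolding Cons by simp
    have tj: "target (bump j x, v') = y" using tv unfolding v by simp
    show ?thesis
    proof (cases "i = j")
      case True
      have "rel_ideal d l (bump i x) y (word_diff (bump i x) u' v' :: path \<Rightarrow> 'k)"
        using less.prems(2,4) Cons v True by (intro less.hyps ilb[OF ti] ti) auto
      thus ?thesis unfolding Cons v True[symmetric] by (rule rel_ideal_prefix_word_diff[OF x i])
    next
      case False
      \<comment> \<open>Pass through \<open>i j w\<close> and \<open>j i w\<close>: equal first letters reduce to shorter words, and the middle step
        is a commutativity relation.\<close>
      define w where "w = remove1 i v'"
      have iv: "i \<in> set v'" using less.prems(4) False unfolding Cons v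
        by (metis list.set_intros(1) set_ConsD set_mset_mset)
      have mv: "mset v' = mset (i # w)" using iv unfolding w_def by simp
      have mu: "mset u' = mset (j # w)" using less.prems(4) mv unfolding Cons v by (simp add: add_mset_commute)
      have A: "rel_ideal d l x y (word_diff x (i # u') (i # j # w) :: path \<Rightarrow> 'k)"
        using less.prems(2) mu Cons by (intro rel_ideal_prefix_word_diff[OF x i] less.hyps ilb[OF ti] ti) auto
      have C: "rel_ideal d l x y (word_diff x (j # v') (j # i # w) :: path \<Rightarrow> 'k)"
      proof -
        have "length v' < length u" using less.prems(4) v by (metis length_Cons lessI mset_eq_length)
        thus ?thesis using sv mv v by (intro rel_ideal_prefix_word_diff[OF x j] less.hyps ilb[OF tj] tj) auto
      qed
      have C': "rel_ideal d l x y (word_diff x (j # i # w) (j # v') :: path \<Rightarrow> 'k)"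
      proof -
        have "(\<lambda>p. (- 1) * word_diff x (j # v') (j # i # w) p) = (word_diff x (j # i # w) (j # v') :: path \<Rightarrow> 'k)"
          by (auto simp: word_diff_def)
        thus ?thesis using rel_ideal_scale[OF C, of "- 1"] by simp
      qed
      have sw: "set (i # j # w) \<subseteq> {..d}"
        using less.prems(2) mu unfolding Cons by (metis list.set(2) mset.simps(2) set_mset_mset)
      have tw: "target (x, i # j # w) = y"
      proof (rule nth_equalityI)
        show "length (target (x, i # j # w)) = length y" using lx less.prems(1) by (simp add: interlace_def)
        fix a assume "a < length (target (x, i # j # w))"
        hence a: "a \<le> d" using lx by (simp del: target.simps)
        have "mset (i # j # w) = mset u" using mu unfolding Cons by simp
        hence "count_list (i # j # w) a = count_list u a" by (metis count_mset)
        thus "target (x, i # j # w) ! a = y ! a"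
          using nth_target[OF lx a, of u] nth_target[OF lx a, of "i # j # w"] less.prems(3) by simp
      qed
      have "is_path d l (x, i # j # w)" by (rule word_is_path[OF less.prems(1) sw tw])
      hence "is_path d l (bump j (bump i x), w)" "target (bump j (bump i x), w) = y" using tw by auto
      hence B: "rel_ideal d l x y (word_diff x (i # j # w) (j # i # w) :: path \<Rightarrow> 'k)"
        using rel_ideal_swap[OF x j(1) i(1)] by blast
      show ?thesis unfolding Cons v by (rule rel_ideal_trans[OF A rel_ideal_trans[OF B C']])
    qed
  qed
qed

end

context interlacing
begin

lemma words_mset: assumes "u \<in> words x y" "v \<in> words x y" shows "mset u = mset v"
proof (rule multiset_eqI)
  fix a
  have p: "is_path d l (x, u)" "is_path d l (x, v)" "target (x, u) = target (x, v)" using assms by (auto simp: words_def)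
  have lx: "length x = d + 1" using os_length is_path_os p(1) by blast
  have "count_list u a = count_list v a"
  proof (cases "a \<le> d")
    case True
    thus ?thesis using nth_target[OF lx True, of u] nth_target[OF lx True, of v] p(3) by simp
  next
    case False
    hence "a \<notin> set u" "a \<notin> set v" using is_path_set p by fastforce+
    thus ?thesis by (simp add: count_list_0_iff)
  qed
  thus "count (mset u) a = count (mset v) a" by (simp add: count_mset)
qed

text \<open>A path whose end does not interlace with its start lies in the ideal. Suppose that the first
  letter \<open>i\<close> is what destroys interlacing; then a letter \<open>j = i - 1\<close> (cyclically) must occur later,
  and it can be moved directly behind \<open>i\<close>. Either \<open>j\<close> cannot be applied before \<open>i\<close>, and the two letters
  form a zero relation, or they can be swapped, and the shorter remaining path is not interlacing.\<close>

lemma path_not_interlace_rel_ideal: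
  assumes "is_path d l (x, u)" "target (x, u) = y" "\<not> interlace x y"
  shows "rel_ideal d l x y (path_elt d l (x, u) :: path \<Rightarrow> 'k::field)"
  using assms
proof (induction "length u" arbitrary: x u rule: less_induct)
  case less
  have x: "x \<in> os d l" using is_path_os less.prems(1) by blast
  have lx: "length x = d + 1" by (rule os_length[OF x])
  obtain i u' where u: "u = i # u'"
    using less.prems interlace_refl[OF x] by (cases u) auto
  have i: "i \<le> d" using less.prems(1) unfolding u by auto
  let ?x = "bump i x"
  have p': "is_path d l (?x, u')" "target (?x, u') = y" using less.prems(1,2) unfolding u by auto
  have x': "?x \<in> os d l" by (rule is_path_os[OF p'(1)])
  show ?case
  proof (cases "interlace ?x y")
    case False
    show ?thesis unfolding u
      by (rule rel_ideal_prefix[OF x i x' less.hyps[OF _ p' False]]) (simp add: u)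
  next
    case True
    have ly: "length y = d + 1" using True by (simp add: interlace_def)
    have vxy: "below x y" using below_trans[OF below_bump[OF lx] interlace_below[OF True]] .
    obtain j where j: "j \<le> d" "next_entry x j \<le> y ! j"
      using less.prems(3) vxy lx ly unfolding interlace_def below_def by (meson not_le)
    have jx: "y ! j < next_entry ?x j" using True j(1) unfolding interlace_def by blast
    \<comment> \<open>Applying \<open>i\<close> changes \<open>next_entry\<close> only at the cyclic predecessor of \<open>i\<close>.\<close>
    have ji: "i = (if j = d then 0 else Suc j)"
      using j jx lx i by (auto simp: next_entry_def nth_bump split: if_splits)
    have jni: "j \<noteq> i" using ji d1 by (auto split: if_splits)
    have yj: "y ! j = next_entry x j" using j jx ji lx i by (auto simp: next_entry_def nth_bump split: if_splits)
    have "x ! j < y ! j" using x j(1) yj unfolding os_iff by auto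
    moreover have "?x ! j = x ! j" using jni lx j(1) by (simp add: nth_bump)
    ultimately have "count_list u' j \<noteq> 0" using nth_target[of ?x j u'] lx j(1) p'(2) by auto
    hence ju: "j \<in> set u'" by (simp add: count_list_0_iff)
    define w where "w = remove1 j u'"
    have mu: "mset u' = mset (j # w)" using ju unfolding w_def by simp
    have A: "rel_ideal d l x y (word_diff x (i # u') (i # j # w) :: path \<Rightarrow> 'k)"
      by (rule rel_ideal_prefix_word_diff[OF x i x' words_congruent[OF True is_path_set[OF p'(1)] p'(2) mu]])
    have sjw: "set (j # w) \<subseteq> {..d}" using is_path_set[OF p'(1)] mu by (metis set_mset_mset)
    have tjw: "target (?x, j # w) = y"
    proof (rule nth_equalityI)
      show "length (target (?x, j # w)) = length y" using lx ly by simp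
      fix a assume "a < length (target (?x, j # w))"
      hence a: "a \<le> d" using lx by (simp del: target.simps)
      have "count_list (j # w) a = count_list u' a" using mu by (metis count_mset)
      thus "target (?x, j # w) ! a = y ! a"
        using nth_target[of ?x a u'] nth_target[of ?x a "j # w"] lx a p'(2) by simp
    qed
    have pjw: "is_path d l (?x, j # w)" by (rule word_is_path[OF True sjw tjw])
    have pw: "is_path d l (bump j ?x, w)" "target (bump j ?x, w) = y" using pjw tjw by auto
    have B: "rel_ideal d l x y (word_diff x (i # j # w) (j # i # w) :: path \<Rightarrow> 'k)"
      by (rule rel_ideal_swap[OF x j(1) i pw])
    have AB: "rel_ideal d l x y (word_diff x (i # u') (j # i # w) :: path \<Rightarrow> 'k)" by (rule rel_ideal_trans[OF A B])
    have C: "rel_ideal d l x y (path_elt d l (x, j # i # w) :: path \<Rightarrow> 'k)"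
    proof (cases "bump j x \<in> os d l")
      case False
      hence "\<not> is_path d l (x, j # i # w)" by auto
      hence "path_elt d l (x, j # i # w) = (0 :: path \<Rightarrow> 'k)" unfolding path_elt_def by (intro ext) auto
      thus ?thesis by (simp only: rel_ideal.zero)
    next
      case os2: True
      have sw: "bump i (bump j x) = bump j ?x" using lx i j by (intro bump_swap) auto
      have p2: "is_path d l (bump j x, i # w)" "target (bump j x, i # w) = y" using os2 pw i sw by auto
      have "next_entry (bump j x) j = next_entry x j" using jni lx ji d1 j(1) by (auto simp: next_entry_def nth_bump split: if_splits)
      hence "\<not> interlace (bump j x) y" using yj j(1) unfolding interlace_def by force
      moreover have "length (i # w) < length u" using mset_eq_length[OF mu] unfolding u by simp
      ultimately have "rel_ideal d l (bump j x) y (path_elt d l (bump j x, i # w) :: path \<Rightarrow> 'k)"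
        using less.hyps p2 by blast
      thus ?thesis by (rule rel_ideal_prefix[OF x j(1) os2])
    qed
    have "path_elt d l (x, i # u') = word_diff x (i # u') (j # i # w) + (path_elt d l (x, j # i # w) :: path \<Rightarrow> 'k)"
      by (auto simp: word_diff_def fun_eq_iff simp del: split_paired_All)
    thus ?thesis using rel_ideal.add[OF AB C] unfolding u by simp
  qed
qed

text \<open>If the ends interlace, then every combination of paths is congruent to a multiple of one fixed path,
  the factor being the sum of the coefficients. Otherwise every path lies in the ideal, and the sum is
  zero by definition.\<close>

theorem rel_ideal_iff:
  assumes c: "c \<in> kQ d l x y"
  shows "rel_ideal d l x y c \<longleftrightarrow> path_sum c x y = (0 :: 'k::field)"
proof
  assume s: "path_sum c x y = 0"
  have nz: "c (x', u) = 0" if "\<not> (x' = x \<and> u \<in> words x y)" for x' u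
    using c that unfolding kQ_iff words_def by force
  have pe: "path_elt d l (x, v) (x', u) = (if x' = x \<and> u = v then 1 else (0 :: 'k))" if "v \<in> words x y" for v u x'
    using that by (auto simp: path_elt_def words_def)
  show "rel_ideal d l x y c"
  proof (cases "interlace x y")
    case True
    then obtain u0 where u0: "u0 \<in> words x y" using word_exists by blast
    have "c = (\<lambda>p. \<Sum>u\<in>words x y. c (x, u) * word_diff x u u0 p)"
    proof
      fix p :: path obtain x' v where p: "p = (x', v)" by (cases p)
      have "(\<Sum>u\<in>words x y. c (x, u) * word_diff x u u0 p)
          = (\<Sum>u\<in>words x y. c (x, u) * path_elt d l (x, u) p) - (\<Sum>u\<in>words x y. c (x, u)) * path_elt d l (x, u0) p"
        by (simp add: word_diff_def right_diff_distrib sum_subtractf sum_distrib_right)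
      also have "(\<Sum>u\<in>words x y. c (x, u)) = 0" using s True by (simp add: path_sum_def)
      also have "(\<Sum>u\<in>words x y. c (x, u) * path_elt d l (x, u) p) = (\<Sum>u\<in>words x y. if u = v then (if x' = x then c (x, v) else 0) else 0)"
        unfolding p by (intro sum.cong refl) (auto simp: pe)
      also have "\<dots> = c p" using nz finite_words unfolding p by auto
      finally show "c p = (\<Sum>u\<in>words x y. c (x, u) * word_diff x u u0 p)" by simp
    qed
    moreover have "rel_ideal d l x y (\<lambda>p. \<Sum>u\<in>words x y. c (x, u) * word_diff x u u0 p)"
    proof (rule rel_ideal_sum[OF finite_words], rule rel_ideal_scale)
      fix u assume u: "u \<in> words x y"
      show "rel_ideal d l x y (word_diff x u u0 :: path \<Rightarrow> 'k)"
        using u is_path_set words_mset[OF u u0] by (intro words_congruent[OF True]) (auto simp: words_def)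
    qed
    ultimately show ?thesis by metis
  next
    case False
    have "c = (\<lambda>p. \<Sum>u\<in>words x y. c (x, u) * path_elt d l (x, u) p)"
    proof
      fix p :: path obtain x' v where p: "p = (x', v)" by (cases p)
      have "(\<Sum>u\<in>words x y. c (x, u) * path_elt d l (x, u) p) = (\<Sum>u\<in>words x y. if u = v then (if x' = x then c (x, v) else 0) else 0)"
        unfolding p by (intro sum.cong refl) (auto simp: pe)
      also have "\<dots> = c p" using nz finite_words unfolding p by auto
      finally show "c p = (\<Sum>u\<in>words x y. c (x, u) * path_elt d l (x, u) p)" by simp
    qed
    moreover have "rel_ideal d l x y (\<lambda>p. \<Sum>u\<in>words x y. c (x, u) * path_elt d l (x, u) p)"
    proof (rule rel_ideal_sum[OF finite_words], rule rel_ideal_scale)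
      fix u assume "u \<in> words x y"
      thus "rel_ideal d l x y (path_elt d l (x, u) :: path \<Rightarrow> 'k)"
        using False by (intro path_not_interlace_rel_ideal) (auto simp: words_def)
    qed
    ultimately show ?thesis by metis
  qed
qed (rule rel_ideal_path_sum(2))

section \<open>The orbit algebra in coordinates\<close>

definition on_paths :: "(path \<Rightarrow> 'k::field) \<Rightarrow> bool" where
  "on_paths c \<longleftrightarrow> (\<forall>p. c p \<noteq> 0 \<longrightarrow> is_path d l p)"

text \<open>The coset of the ideal of relations that corresponds to a coefficient function.\<close>

definition fibre :: "(vertex \<Rightarrow> vertex \<Rightarrow> 'k::field) \<Rightarrow> (path \<Rightarrow> 'k) set" where
  "fibre \<gamma> = {c. on_paths c \<and> path_sum c = \<gamma>}"

lemma part_kQ: "on_paths c \<Longrightarrow> Defs.part x y c \<in> kQ d l x y"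
  by (auto simp: kQ_iff Defs.part_def on_paths_def split: if_splits)

lemma carrier_path_matrices: "carrier (path_matrices d l) = {c :: path \<Rightarrow> 'k::field. on_paths c}"
proof -
  have "on_paths c" if "\<forall>x y. Defs.part x y c \<in> kQ d l x y" for c :: "path \<Rightarrow> 'k"
    unfolding on_paths_def
  proof (intro allI impI)
    fix p assume "c p \<noteq> 0"
    hence "Defs.part (fst p) (target p) c p \<noteq> 0" by (simp add: Defs.part_def)
    moreover have "Defs.part (fst p) (target p) c \<in> kQ d l (fst p) (target p)" using that by blast
    ultimately show "is_path d l p" unfolding kQ_iff by blast
  qed
  thus ?thesis unfolding path_matrices_def using part_kQ by auto
qed

lemma path_sum_part: "path_sum (Defs.part x y c) x y = path_sum c x y"
  by (auto simp: path_sum_def Defs.part_def words_def intro!: sum.cong)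

lemma rel_ideal_part: "on_paths c \<Longrightarrow> rel_ideal d l x y (Defs.part x y c) \<longleftrightarrow> path_sum c x y = 0"
  unfolding rel_ideal_iff[OF part_kQ] path_sum_part ..

lemma rel_matrices_fibre: "rel_matrices d l = fibre (\<lambda>_ _. 0)"
  by (auto simp: rel_matrices_def carrier_path_matrices rel_ideal_part fibre_def fun_eq_iff)

lemma on_paths_add: "on_paths b \<Longrightarrow> on_paths c \<Longrightarrow> on_paths (\<lambda>p. b p + c p)"
  unfolding on_paths_def by (metis add.left_neutral)

lemma on_paths_diff: "on_paths b \<Longrightarrow> on_paths c \<Longrightarrow> on_paths (\<lambda>p. b p - c p)"
  unfolding on_paths_def by (metis diff_self)

lemma on_paths_scale: "on_paths c \<Longrightarrow> on_paths (\<lambda>p. s * c p)"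
  unfolding on_paths_def by auto

lemma on_paths_comp: "on_paths b \<Longrightarrow> on_paths c \<Longrightarrow> on_paths (path_comp b c)"
  unfolding on_paths_def by (blast intro: path_comp_path)

lemma coset_fibre:
  assumes a: "on_paths a"
  shows "rel_matrices d l +>\<^bsub>path_matrices d l\<^esub> a = fibre (path_sum a)"
proof
  show "rel_matrices d l +>\<^bsub>path_matrices d l\<^esub> a \<subseteq> fibre (path_sum a)"
  proof
    fix c assume "c \<in> rel_matrices d l +>\<^bsub>path_matrices d l\<^esub> a"
    then obtain h where h: "h \<in> fibre (\<lambda>_ _. 0)" "c = h + a"
      unfolding rel_matrices_fibre by (auto simp: a_r_coset_def r_coset_def path_matrices_def)
    have c: "c = (\<lambda>p. h p + a p)" using h(2) by auto
    have "on_paths c" unfolding c using h(1) a by (intro on_paths_add) (simp_all add: fibre_def)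
    moreover have "path_sum c = path_sum a"
      unfolding c using h(1) by (intro ext) (simp add: path_sum_add fibre_def)
    ultimately show "c \<in> fibre (path_sum a)" by (simp add: fibre_def)
  qed
  show "fibre (path_sum a) \<subseteq> rel_matrices d l +>\<^bsub>path_matrices d l\<^esub> a"
  proof
    fix c assume c: "c \<in> fibre (path_sum a)"
    let ?h = "\<lambda>p. c p - a p"
    have "?h \<in> fibre (\<lambda>_ _. 0)"
      using c on_paths_diff[OF _ a, of c] by (auto simp: fibre_def path_sum_diff fun_eq_iff simp del: split_paired_All)
    moreover have "c = ?h + a" by auto
    ultimately show "c \<in> rel_matrices d l +>\<^bsub>path_matrices d l\<^esub> a"
      unfolding rel_matrices_fibre by (auto simp: a_r_coset_def r_coset_def path_matrices_def)
  qed
qed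

text \<open>A member of the fibre: put the whole coefficient on one chosen path.\<close>

definition lift_coeffs :: "(vertex \<Rightarrow> vertex \<Rightarrow> 'k::field) \<Rightarrow> path \<Rightarrow> 'k" where
  "lift_coeffs \<gamma> = (\<lambda>(x, u). if is_path d l (x, u) \<and> interlace x (target (x, u)) \<and> u = (SOME v. v \<in> words x (target (x, u)))
     then \<gamma> x (target (x, u)) else 0)"

lemma lift_coeffs_fibre:
  assumes \<gamma>: "\<And>x y. \<not> interlace x y \<Longrightarrow> \<gamma> x y = (0 :: 'k::field)"
  shows "lift_coeffs \<gamma> \<in> fibre \<gamma>"
proof -
  have "path_sum (lift_coeffs \<gamma>) x y = \<gamma> x y" for x y
  proof (cases "interlace x y")
    case True
    have w: "(SOME v. v \<in> words x y) \<in> words x y" using word_exists[OF True] by (rule someI_ex)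
    have "(\<Sum>u\<in>words x y. lift_coeffs \<gamma> (x, u)) = (\<Sum>u\<in>words x y. if u = (SOME v. v \<in> words x y) then \<gamma> x y else 0)"
      using True by (intro sum.cong refl) (auto simp: lift_coeffs_def words_def)
    thus ?thesis using True w finite_words by (simp add: path_sum_def)
  qed (simp add: path_sum_def \<gamma>)
  moreover have "on_paths (lift_coeffs \<gamma>)" by (auto simp: on_paths_def lift_coeffs_def split: if_splits)
  ultimately show ?thesis by (auto simp: fibre_def)
qed

lemma fibre_coset:
  assumes \<gamma>: "\<And>x y. \<not> interlace x y \<Longrightarrow> \<gamma> x y = (0 :: 'k::field)" and c: "c \<in> fibre \<gamma>"
  shows "rel_matrices d l +>\<^bsub>path_matrices d l\<^esub> c = fibre \<gamma>"
  using coset_fibre[of c] c by (simp add: fibre_def)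

lemma fibre_eq_iff:
  assumes "\<And>x y. \<not> interlace x y \<Longrightarrow> \<gamma> x y = (0 :: 'k::field)" and "fibre \<gamma> = fibre \<delta>"
  shows "\<gamma> = \<delta>"
proof -
  have "lift_coeffs \<gamma> \<in> fibre \<gamma>" by (rule lift_coeffs_fibre[OF assms(1)])
  moreover have "lift_coeffs \<gamma> \<in> fibre \<delta>" unfolding assms(2)[symmetric] by (rule lift_coeffs_fibre[OF assms(1)])
  ultimately show ?thesis by (simp add: fibre_def)
qed

lemma path_sum_not_interlace: "\<not> interlace x y \<Longrightarrow> path_sum c x y = 0"
  by (simp add: path_sum_def)

text \<open>A bijection of the set of paths that lies over a bijection of the vertices carries the set of paths
  between two vertices to the set of paths between their images, so it preserves sums over such sets.
  Here \<open>\<tau>\<close> is the inverse of \<open>\<sigma>\<close>, and \<open>s\<close> is the map on vertices below \<open>\<tau>\<close>.\<close>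

lemma push_fibre:
  fixes \<gamma> :: "vertex \<Rightarrow> vertex \<Rightarrow> 'k::field"
  assumes \<sigma>: "\<And>p. is_path d l p \<Longrightarrow> is_path d l (\<sigma> p) \<and> \<tau> (\<sigma> p) = p"
    and \<tau>: "\<And>p. is_path d l p \<Longrightarrow> is_path d l (\<tau> p) \<and> \<sigma> (\<tau> p) = p"
    and s: "\<And>p. is_path d l p \<Longrightarrow> fst (\<tau> p) = s (fst p) \<and> target (\<tau> p) = s (target p)"
    and s_interlace: "\<And>x y. interlace (s x) (s y) \<longleftrightarrow> interlace x y" and s_inj: "inj_on s (os d l)" and s_surj: "os d l \<subseteq> s ` os d l"
    and \<gamma>: "\<And>x y. \<not> interlace x y \<Longrightarrow> \<gamma> x y = 0"
  shows "push d l \<sigma> ` fibre \<gamma> = fibre (\<lambda>x y. \<gamma> (s x) (s y))"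
proof -
  have inv: "inv_into {p. is_path d l p} \<sigma> q = \<tau> q" if q: "is_path d l q" for q
  proof (rule inv_into_f_eq)
    show "inj_on \<sigma> {p. is_path d l p}" by (rule inj_onI) (metis \<sigma> mem_Collect_eq)
  qed (use \<tau>[OF q] in auto)
  have push: "push d l \<sigma> c q = (if is_path d l q then c (\<tau> q) else 0)" for c :: "path \<Rightarrow> 'k" and q
    by (simp add: push_def inv)
  have sum: "path_sum (push d l \<sigma> c) x y = path_sum c (s x) (s y)" for c :: "path \<Rightarrow> 'k" and x y
  proof (cases "interlace x y")
    case True
    have xy: "x \<in> os d l" "y \<in> os d l" using interlace_os[OF True] by auto
    have "(\<Sum>u\<in>words x y. push d l \<sigma> c (x, u)) = (\<Sum>v\<in>words (s x) (s y). c (s x, v))"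
    proof (rule sum.reindex_bij_witness[of _ "\<lambda>v. snd (\<sigma> (s x, v))" "\<lambda>u. snd (\<tau> (x, u))"])
      fix u assume "u \<in> words x y"
      hence u: "is_path d l (x, u)" "target (x, u) = y" by (auto simp: words_def)
      have t: "\<tau> (x, u) = (s x, snd (\<tau> (x, u)))" using s[OF u(1)] by (simp add: prod_eq_iff)
      show "snd (\<sigma> (s x, snd (\<tau> (x, u)))) = u" unfolding t[symmetric] using \<tau>[OF u(1)] by simp
      show "snd (\<tau> (x, u)) \<in> words (s x) (s y)"
        unfolding words_def mem_Collect_eq t[symmetric] using \<tau>[OF u(1)] s[OF u(1)] u(2) by simp
      show "c (s x, snd (\<tau> (x, u))) = push d l \<sigma> c (x, u)"
        unfolding push t[symmetric] using u(1) by simp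
    next
      fix v assume "v \<in> words (s x) (s y)"
      hence v: "is_path d l (s x, v)" "target (s x, v) = s y" by (auto simp: words_def)
      let ?q = "\<sigma> (s x, v)"
      have q: "is_path d l ?q" "\<tau> ?q = (s x, v)" using \<sigma>[OF v(1)] by auto
      obtain x' u where qe: "?q = (x', u)" by (cases ?q)
      have os': "x' \<in> os d l" "target (x', u) \<in> os d l" using q(1) is_path_os target_os unfolding qe by auto
      have "s x' = s x" "s (target (x', u)) = s y" using s[OF q(1)] v(2) unfolding q(2) unfolding qe by auto
      hence e: "x' = x" "target (x', u) = y" using inj_onD[OF s_inj _ os'(1) xy(1)] inj_onD[OF s_inj _ os'(2) xy(2)] by auto
      have q': "?q = (x, snd ?q)" using qe e by simp
      show "snd (\<tau> (x, snd ?q)) = v" unfolding q'[symmetric] q(2) by simp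
      show "snd ?q \<in> words x y" unfolding words_def mem_Collect_eq q'[symmetric] using q(1) e unfolding qe by simp
    qed
    thus ?thesis using True by (simp add: path_sum_def s_interlace)
  qed (simp add: path_sum_def s_interlace)
  have sp: "on_paths (push d l \<sigma> c)" for c :: "path \<Rightarrow> 'k" by (auto simp: on_paths_def push)
  show ?thesis
  proof
    show "push d l \<sigma> ` fibre \<gamma> \<subseteq> fibre (\<lambda>x y. \<gamma> (s x) (s y))"
    proof
      fix c' assume "c' \<in> push d l \<sigma> ` fibre \<gamma>"
      then obtain c where c: "path_sum c = \<gamma>" "c' = push d l \<sigma> c" by (auto simp: fibre_def)
      have "path_sum c' = (\<lambda>x y. \<gamma> (s x) (s y))" unfolding c(2) by (intro ext) (simp only: sum c(1))
      thus "c' \<in> fibre (\<lambda>x y. \<gamma> (s x) (s y))" using sp unfolding fibre_def c(2) by blast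
    qed
    show "fibre (\<lambda>x y. \<gamma> (s x) (s y)) \<subseteq> push d l \<sigma> ` fibre \<gamma>"
    proof
      fix c assume "c \<in> fibre (\<lambda>x y. \<gamma> (s x) (s y))"
      hence c: "on_paths c" "path_sum c = (\<lambda>x y. \<gamma> (s x) (s y))" by (auto simp: fibre_def)
      define b where "b q = (if is_path d l q then c (\<sigma> q) else 0)" for q
      have pb: "push d l \<sigma> b = c"
      proof
        fix q show "push d l \<sigma> b q = c q"
        proof (cases "is_path d l q")
          case True
          thus ?thesis using \<tau>[OF True] by (simp add: push b_def)
        next
          case False
          hence "c q = 0" using c(1) unfolding on_paths_def by blast
          thus ?thesis using False by (simp add: push)
        qed
      qed
      have "path_sum b x y = \<gamma> x y" for x y
      proof (cases "interlace x y")
        case True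
        then obtain x' y' where xy: "x = s x'" "y = s y'" using interlace_os[OF True] s_surj by blast
        have "path_sum b x y = path_sum c x' y'" unfolding xy pb[symmetric] sum ..
        thus ?thesis using c(2) xy by simp
      qed (simp add: path_sum_not_interlace \<gamma>)
      hence "b \<in> fibre \<gamma>" by (auto simp: fibre_def on_paths_def b_def)
      thus "c \<in> push d l \<sigma> ` fibre \<gamma>" using pb by blast
    qed
  qed
qed

lemma is_path_relabel:
  assumes "\<And>x. length x = d + 1 \<Longrightarrow> s x \<in> os d l \<longleftrightarrow> x \<in> os d l"
    and "\<And>x i. length x = d + 1 \<Longrightarrow> i \<le> d \<Longrightarrow> r i \<le> d \<and> bump (r i) (s x) = s (bump i x)"
  shows "is_path d l (x, u) \<Longrightarrow> is_path d l (s x, map r u) \<and> target (s x, map r u) = s (target (x, u))"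
proof (induction u arbitrary: x)
  case Nil
  thus ?case using assms(1) os_length by auto
next
  case (Cons i u)
  have x: "x \<in> os d l" and i: "i \<le> d" and p: "is_path d l (bump i x, u)" using Cons.prems by auto
  have lx: "length x = d + 1" by (rule os_length[OF x])
  show ?case using Cons.IH[OF p] assms(1)[OF lx] assms(2)[OF lx i] x by simp
qed

lemma push_translate_fibre:
  fixes \<gamma> :: "vertex \<Rightarrow> vertex \<Rightarrow> 'k::field"
  assumes \<gamma>: "\<And>x y. \<not> interlace x y \<Longrightarrow> \<gamma> x y = 0"
  shows "push d l (translate n) ` fibre \<gamma> = fibre (\<lambda>x y. \<gamma> (shift 1 x) (shift 1 y))"
proof (rule push_fibre[where \<tau> = "\<lambda>(x, u). (shift 1 x, u)"])
  have t: "translate n p = (shift (- 1) (fst p), snd p)" for p by (simp add: translate_def shift_def case_prod_beta)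
  have r: "is_path d l (x, u) \<Longrightarrow> is_path d l (shift k x, u) \<and> target (shift k x, u) = shift k (target (x, u))" for k x u
    using is_path_relabel[of "shift k" "\<lambda>i. i" x u] by simp
  fix p assume p: "is_path d l p"
  obtain x u where pe: "p = (x, u)" by (cases p)
  show "is_path d l (translate n p) \<and> (\<lambda>(x, u). (shift 1 x, u)) (translate n p) = p"
    "is_path d l ((\<lambda>(x, u). (shift 1 x, u)) p) \<and> translate n ((\<lambda>(x, u). (shift 1 x, u)) p) = p"
    "fst ((\<lambda>(x, u). (shift 1 x, u)) p) = shift 1 (fst p) \<and> target ((\<lambda>(x, u). (shift 1 x, u)) p) = shift 1 (target p)"
    using r[OF p[unfolded pe]] unfolding t pe by auto
next
  show "inj_on (shift 1) (os d l)" by (rule inj_onI) (simp add: shift_eq_iff)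
  show "os d l \<subseteq> shift 1 ` os d l"
  proof
    fix x assume "x \<in> os d l"
    moreover have "x = shift 1 (shift (- 1) x)" by simp
    ultimately show "x \<in> shift 1 ` os d l" by (metis imageI os_shift)
  qed
qed (use \<gamma> in auto)

lemma push_Phi_fibre:
  fixes \<gamma> :: "vertex \<Rightarrow> vertex \<Rightarrow> 'k::field"
  assumes \<gamma>: "\<And>x y. \<not> interlace x y \<Longrightarrow> \<gamma> x y = 0"
  shows "push d l (Phi_path d l) ` fibre \<gamma> = fibre (\<lambda>x y. \<gamma> (Phi_inv x) (Phi_inv y))"
proof -
  define r where "r i = (if i = 0 then d else i - 1)" for i
  define q where "q i = (i + 1) mod (d + 1)" for i
  have rq: "q i \<le> d" "r (q i) = i" "r i \<le> d" "q (r i) = i" if "i \<le> d" for i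
    using that by (cases "i = d"; auto simp: r_def q_def)+
  have bsh: "bump (r i) (Phi_inv x) = Phi_inv (bump i x)" if lx: "length x = d + 1" and i: "i \<le> d" for x i
  proof (rule nth_equalityI)
    have ls: "length (Phi_inv x) = d + 1" "length (Phi_inv (bump i x)) = d + 1" using lx length_Phi_inv[of x] length_Phi_inv[of "bump i x"] by auto
    thus "length (bump (r i) (Phi_inv x)) = length (Phi_inv (bump i x))" by simp
    fix a assume "a < length (bump (r i) (Phi_inv x))"
    hence a: "a \<le> d" using ls by simp
    have "next_entry (bump i x) a = next_entry x a + (if r i = a then 1 else 0)"
      using a i lx by (auto simp: next_entry_def nth_bump r_def)
    thus "bump (r i) (Phi_inv x) ! a = Phi_inv (bump i x) ! a" using a ls lx by (simp add: nth_bump nth_Phi_inv)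
  qed
  have bPh: "bump (q i) (Phi_fun x) = Phi_fun (bump i x)" if lx: "length x = d + 1" and i: "i \<le> d" for x i
  proof -
    have "Phi_inv (bump (q i) (Phi_fun x)) = bump i x"
      using bsh[of "Phi_fun x" "q i"] lx length_Phi_fun[of x] rq[OF i] Phi_inv_Phi_fun[OF lx] by simp
    thus ?thesis using Phi_fun_Phi_inv[of "bump (q i) (Phi_fun x)"] lx length_Phi_fun[of x] by simp
  qed
  have os_Phi_fun: "Phi_fun x \<in> os d l \<longleftrightarrow> x \<in> os d l" if "length x = d + 1" for x
    using os_Phi_inv[of "Phi_fun x"] Phi_inv_Phi_fun[OF that] by simp
  have ps: "is_path d l (Phi_inv x, map r u) \<and> target (Phi_inv x, map r u) = Phi_inv (target (x, u))" if "is_path d l (x, u)" for x u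
    using that by (rule is_path_relabel[rotated 2]) (use os_Phi_inv rq bsh in auto)
  have pP: "is_path d l (Phi_fun x, map q u) \<and> target (Phi_fun x, map q u) = Phi_fun (target (x, u))" if "is_path d l (x, u)" for x u
    using that by (rule is_path_relabel[rotated 2]) (use os_Phi_fun rq bPh in auto)
  have Phi: "Phi_path d l (x, u) = (Phi_fun x, map q u)" for x u
    by (simp add: Phi_path_def Phi_vertex_def Phi_fun_def q_def algebra_simps)
  have mqr: "map q (map r u) = u" "map r (map q u) = u" if "set u \<subseteq> {..d}" for u
    using that rq by (auto intro!: map_idI)
  show ?thesis
  proof (rule push_fibre[where \<tau> = "\<lambda>(x, u). (Phi_inv x, map r u)"])
    fix p assume p: "is_path d l p"
    obtain x u where pe: "p = (x, u)" by (cases p)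
    have lx: "length x = d + 1" using p is_path_os os_length unfolding pe by blast
    have su: "set u \<subseteq> {..d}" using p is_path_set unfolding pe by blast
    show "is_path d l (Phi_path d l p) \<and> (\<lambda>(x, u). (Phi_inv x, map r u)) (Phi_path d l p) = p"
      using pP[OF p[unfolded pe]] mqr[OF su] Phi_inv_Phi_fun[OF lx] unfolding pe Phi by simp
    show "is_path d l ((\<lambda>(x, u). (Phi_inv x, map r u)) p) \<and> Phi_path d l ((\<lambda>(x, u). (Phi_inv x, map r u)) p) = p"
      using ps[OF p[unfolded pe]] mqr[OF su] Phi_fun_Phi_inv[OF lx] unfolding pe by (simp add: Phi)
    show "fst ((\<lambda>(x, u). (Phi_inv x, map r u)) p) = Phi_inv (fst p) \<and> target ((\<lambda>(x, u). (Phi_inv x, map r u)) p) = Phi_inv (target p)"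
      using ps[OF p[unfolded pe]] unfolding pe by simp
  next
    show "inj_on Phi_inv (os d l)" by (rule inj_onI) (metis Phi_fun_Phi_inv os_length)
    show "os d l \<subseteq> Phi_inv ` os d l"
    proof
      fix x assume x: "x \<in> os d l"
      have lx: "length x = d + 1" by (rule os_length[OF x])
      show "x \<in> Phi_inv ` os d l" using Phi_inv_Phi_fun[OF lx] os_Phi_fun[OF lx] x by (metis imageI)
    qed
  qed (use \<gamma> interlace_Phi_inv_Phi_inv in auto)
qed

lemma translation_invariant:
  assumes "\<And>x y. \<gamma> (shift 1 x) (shift 1 y) = \<gamma> x y"
  shows "\<gamma> (shift k x) (shift k y) = \<gamma> x y"
proof (induction k rule: int_induct[of _ 0])
  case (step1 i)
  thus ?case using assms[of "shift i x" "shift i y"] by (simp add: add.commute)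
next
  case (step2 i)
  thus ?case using assms[of "shift (i - 1) x" "shift (i - 1) y"] by simp
qed simp

end

locale coordinates = interlacing d n l for d n l :: nat +
  fixes L :: "('k::field, (path \<Rightarrow> 'k) set) module"
  assumes L: "L = nakayama_algebra d n l"
begin

lemma L_simps:
  "carrier L = {C \<in> carrier (path_matrices d l Quot rel_matrices d l). push d l (translate n) ` C = C \<and>
         (\<forall>c\<in>C. (\<forall>x. finite {y. \<not> rel_ideal d l x y (Defs.part x y c)}) \<and>
                 (\<forall>y. finite {x. \<not> rel_ideal d l x y (Defs.part x y c)}))}"
  "A \<otimes>\<^bsub>L\<^esub> B = rcoset_mult (path_matrices d l) (rel_matrices d l) A B"
  "A \<oplus>\<^bsub>L\<^esub> B = set_add (path_matrices d l) A B"
  "\<one>\<^bsub>L\<^esub> = rel_matrices d l +>\<^bsub>path_matrices d l\<^esub> \<one>\<^bsub>path_matrices d l\<^esub>"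
  "s \<odot>\<^bsub>L\<^esub> A = (\<Union>c\<in>A. rel_matrices d l +>\<^bsub>path_matrices d l\<^esub> (\<lambda>p. s * c p))"
  by (simp_all add: L nakayama_algebra_def Let_def FactRing_def)

lemma Coeffs_0: "\<gamma> \<in> Coeffs \<Longrightarrow> \<not> interlace x y \<Longrightarrow> \<gamma> x y = (0 :: 'k)"
  by (rule CoeffsD(1))

text \<open>Invariance under the generating translation is invariance under all of them. The finiteness of rows
  and columns holds for every element, as a vertex interlaces with finitely many others.\<close>

lemma carrier_L_fibre: "carrier L = fibre ` Coeffs"
proof
  show "carrier L \<subseteq> fibre ` Coeffs"
  proof
    fix C assume C: "C \<in> carrier L"
    hence "C \<in> carrier (path_matrices d l Quot rel_matrices d l)" and inv: "push d l (translate n) ` C = C"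
      by (auto simp: L_simps)
    then obtain a where a: "on_paths a" "C = rel_matrices d l +>\<^bsub>path_matrices d l\<^esub> a"
      by (auto simp: FactRing_def A_RCOSETS_def RCOSETS_def a_r_coset_def carrier_path_matrices)
    let ?\<gamma> = "path_sum a"
    have Cf: "C = fibre ?\<gamma>" unfolding a(2) by (rule coset_fibre[OF a(1)])
    have n0: "\<And>x y. \<not> interlace x y \<Longrightarrow> ?\<gamma> x y = 0" by (rule path_sum_not_interlace)
    have "fibre ?\<gamma> = fibre (\<lambda>x y. ?\<gamma> (shift 1 x) (shift 1 y))"
      using inv push_translate_fibre[OF n0] unfolding Cf by simp
    hence "?\<gamma> = (\<lambda>x y. ?\<gamma> (shift 1 x) (shift 1 y))" using fibre_eq_iff[of ?\<gamma>] n0 by blast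
    hence "?\<gamma> (shift 1 x) (shift 1 y) = ?\<gamma> x y" for x y by metis
    hence "?\<gamma> (shift k x) (shift k y) = ?\<gamma> x y" for k x y by (rule translation_invariant)
    hence "?\<gamma> \<in> Coeffs" using n0 by (intro CoeffsI)
    thus "C \<in> fibre ` Coeffs" using Cf by blast
  qed
  show "fibre ` Coeffs \<subseteq> carrier L"
  proof
    fix C :: "(path \<Rightarrow> 'k) set" assume "C \<in> fibre ` Coeffs"
    then obtain \<gamma> where \<gamma>: "\<gamma> \<in> Coeffs" "C = fibre \<gamma>" by blast
    note n0 = Coeffs_0[OF \<gamma>(1)]
    have lf: "lift_coeffs \<gamma> \<in> fibre \<gamma>" by (rule lift_coeffs_fibre[OF n0])
    have "C = rel_matrices d l +>\<^bsub>path_matrices d l\<^esub> lift_coeffs \<gamma>" unfolding \<gamma>(2) by (rule fibre_coset[OF n0 lf, symmetric])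
    moreover have "on_paths (lift_coeffs \<gamma>)" using lf by (simp add: fibre_def)
    ultimately have "C \<in> carrier (path_matrices d l Quot rel_matrices d l)"
      by (auto simp: FactRing_def A_RCOSETS_def RCOSETS_def a_r_coset_def carrier_path_matrices)
    moreover have "push d l (translate n) ` C = C"
    proof -
      have "push d l (translate n) ` fibre \<gamma> = fibre (\<lambda>x y. \<gamma> (shift 1 x) (shift 1 y))"
        by (rule push_translate_fibre) (rule n0)
      thus ?thesis by (simp only: \<gamma>(2) CoeffsD(2)[OF \<gamma>(1)])
    qed
    moreover have "finite {y. \<not> rel_ideal d l x y (Defs.part x y c)}" "finite {y. \<not> rel_ideal d l y x (Defs.part y x c)}"
      if "c \<in> C" for c x
    proof -
      have c: "on_paths c" "path_sum c = \<gamma>" using that unfolding \<gamma>(2) fibre_def by auto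
      have "{y. \<not> rel_ideal d l x y (Defs.part x y c)} \<subseteq> above x" "{y. \<not> rel_ideal d l y x (Defs.part y x c)} \<subseteq> beneath x"
        unfolding rel_ideal_part[OF c(1)] c(2) using n0 by (auto simp: above_def beneath_def)
      thus "finite {y. \<not> rel_ideal d l x y (Defs.part x y c)}" "finite {y. \<not> rel_ideal d l y x (Defs.part y x c)}"
        using finite_above finite_beneath finite_subset by blast+
    qed
    ultimately show "C \<in> carrier L" by (simp add: L_simps)
  qed
qed

lemma fibre_nonempty: "\<gamma> \<in> Coeffs \<Longrightarrow> lift_coeffs \<gamma> \<in> (fibre \<gamma> :: (path \<Rightarrow> 'k) set)"
  using lift_coeffs_fibre Coeffs_0 by blast

lemma fibre_mult:
  assumes \<gamma>: "\<gamma> \<in> Coeffs" and \<delta>: "\<delta> \<in> Coeffs"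
  shows "fibre \<gamma> \<otimes>\<^bsub>L\<^esub> fibre \<delta> = fibre (conv \<gamma> \<delta> :: vertex \<Rightarrow> vertex \<Rightarrow> 'k)"
proof -
  have m: "b \<otimes>\<^bsub>path_matrices d l\<^esub> c = path_comp b c" for b c :: "path \<Rightarrow> 'k" by (simp add: path_matrices_def)
  have "rel_matrices d l +>\<^bsub>path_matrices d l\<^esub> path_comp b c = fibre (conv \<gamma> \<delta>)" if "b \<in> fibre \<gamma>" "c \<in> fibre \<delta>" for b c
    using that coset_fibre[OF on_paths_comp, of b c] unfolding path_sum_comp by (simp add: fibre_def)
  thus ?thesis
    using fibre_nonempty[OF \<gamma>] fibre_nonempty[OF \<delta>] unfolding L_simps rcoset_mult_def m by blast
qed

lemma fibre_add:
  assumes \<gamma>: "\<gamma> \<in> Coeffs" and \<delta>: "\<delta> \<in> Coeffs"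
  shows "fibre \<gamma> \<oplus>\<^bsub>L\<^esub> fibre \<delta> = fibre (\<lambda>x y. \<gamma> x y + (\<delta> x y :: 'k))"
proof -
  have "fibre \<gamma> \<oplus>\<^bsub>L\<^esub> fibre \<delta> = (\<Union>b\<in>fibre \<gamma>. \<Union>c\<in>fibre \<delta>. {\<lambda>p. b p + c p})"
    unfolding L_simps set_add_def set_mult_def by (simp add: path_matrices_def plus_fun_def)
  also have "\<dots> = fibre (\<lambda>x y. \<gamma> x y + \<delta> x y)"
  proof
    show "(\<Union>b\<in>fibre \<gamma>. \<Union>c\<in>fibre \<delta>. {\<lambda>p. b p + c p}) \<subseteq> fibre (\<lambda>x y. \<gamma> x y + \<delta> x y)"
      using on_paths_add by (auto simp: fibre_def path_sum_add fun_eq_iff simp del: split_paired_All)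
    show "fibre (\<lambda>x y. \<gamma> x y + \<delta> x y) \<subseteq> (\<Union>b\<in>fibre \<gamma>. \<Union>c\<in>fibre \<delta>. {\<lambda>p. b p + c p})"
    proof
      fix a assume a: "a \<in> fibre (\<lambda>x y. \<gamma> x y + \<delta> x y)"
      let ?b = "lift_coeffs \<gamma>"
      have b: "?b \<in> fibre \<gamma>" by (rule fibre_nonempty[OF \<gamma>])
      have "(\<lambda>p. a p - ?b p) \<in> fibre \<delta>"
        using a b on_paths_diff[of a ?b] by (auto simp: fibre_def path_sum_diff fun_eq_iff simp del: split_paired_All)
      moreover have "a = (\<lambda>p. ?b p + (a p - ?b p))" by simp
      ultimately show "a \<in> (\<Union>b\<in>fibre \<gamma>. \<Union>c\<in>fibre \<delta>. {\<lambda>p. b p + c p})" using b by blast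
    qed
  qed
  finally show ?thesis .
qed

lemma fibre_smult:
  assumes \<gamma>: "\<gamma> \<in> Coeffs"
  shows "s \<odot>\<^bsub>L\<^esub> fibre \<gamma> = fibre (\<lambda>x y. s * (\<gamma> x y :: 'k))"
proof -
  have "rel_matrices d l +>\<^bsub>path_matrices d l\<^esub> (\<lambda>p. s * c p) = fibre (\<lambda>x y. s * \<gamma> x y)" if "c \<in> fibre \<gamma>" for c
  proof -
    have c: "on_paths c" "path_sum c = \<gamma>" using that by (auto simp: fibre_def)
    have "path_sum (\<lambda>p. s * c p) = (\<lambda>x y. s * \<gamma> x y)" by (intro ext) (simp only: path_sum_scale c(2))
    thus ?thesis using coset_fibre[OF on_paths_scale[OF c(1)], of s] by simp
  qed
  thus ?thesis using fibre_nonempty[OF \<gamma>] unfolding L_simps by blast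
qed

lemma fibre_one: "\<one>\<^bsub>L\<^esub> = fibre (unit_coeff :: vertex \<Rightarrow> vertex \<Rightarrow> 'k)"
proof -
  let ?o = "\<lambda>p. if snd p = [] \<and> fst p \<in> os d l then 1 else (0 :: 'k)"
  have s: "on_paths ?o" unfolding on_paths_def by auto
  have "path_sum ?o x y = unit_coeff x y" for x y
  proof (cases "interlace x y")
    case True
    have "(\<Sum>u\<in>words x y. ?o (x, u)) = (\<Sum>u\<in>words x y. if u = [] then 1 else 0)"
      using interlace_os(1)[OF True] by (intro sum.cong refl) simp
    also have "\<dots> = (if [] \<in> words x y then 1 else 0)" using finite_words by simp
    finally show ?thesis using True interlace_os(1)[OF True] by (auto simp: path_sum_def words_def unit_coeff_def)
  next
    case False
    thus ?thesis using interlace_refl by (auto simp: path_sum_def unit_coeff_def)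
  qed
  hence "path_sum ?o = unit_coeff" by (intro ext)
  moreover have "\<one>\<^bsub>path_matrices d l\<^esub> = ?o" by (simp add: path_matrices_def)
  ultimately show ?thesis unfolding L_simps using coset_fibre[OF s] by simp
qed

lemma orbit_twist_L: "orbit_twist d n l L fibre (nakayama_Phi d l)"
proof unfold_locales
  show "carrier L = fibre ` Coeffs" by (rule carrier_L_fibre)
  show "inj_on (fibre :: (vertex \<Rightarrow> vertex \<Rightarrow> 'k) \<Rightarrow> _) Coeffs"
    by (rule inj_onI) (use fibre_eq_iff Coeffs_0 in blast)
  show "\<one>\<^bsub>L\<^esub> = fibre unit_coeff" by (rule fibre_one)
  fix \<gamma> \<delta> :: "vertex \<Rightarrow> vertex \<Rightarrow> 'k" assume \<gamma>: "\<gamma> \<in> Coeffs"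
  show "s \<odot>\<^bsub>L\<^esub> fibre \<gamma> = fibre (\<lambda>x y. s * \<gamma> x y)" for s by (rule fibre_smult[OF \<gamma>])
  show "nakayama_Phi d l (fibre \<gamma>) = fibre (\<lambda>x y. \<gamma> (Phi_inv x) (Phi_inv y))"
    unfolding nakayama_Phi_def by (rule push_Phi_fibre[OF Coeffs_0[OF \<gamma>]])
  assume \<delta>: "\<delta> \<in> Coeffs"
  show "fibre \<gamma> \<oplus>\<^bsub>L\<^esub> fibre \<delta> = fibre (\<lambda>x y. \<gamma> x y + \<delta> x y)" by (rule fibre_add[OF \<gamma> \<delta>])
  show "fibre \<gamma> \<otimes>\<^bsub>L\<^esub> fibre \<delta> = fibre (conv \<gamma> \<delta>)" by (rule fibre_mult[OF \<gamma> \<delta>])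
qed

end

theorem proposition3p22:
  fixes d n l :: nat
    and \<Lambda> :: "('k::field, (path \<Rightarrow> 'k) set) module"
  assumes "d \<ge> 1" and "n \<ge> 1" and "l \<ge> 2"
    and "\<Lambda> = nakayama_algebra d n l"
  shows "naturally_isomorphic (stmod \<Lambda>) (stmod \<Lambda>)
           (func_pow (syzygy_functor \<Lambda>) (d + 2))
           (twist_functor \<Lambda> (nakayama_Phi d l))"
proof -
  interpret coordinates d n l \<Lambda> by unfold_locales (use assms in auto)
  show ?thesis by (rule orbit_twist.twisted_periodic[OF orbit_twist_L])
qed

end
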